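(* Let $\alpha$ be a smooth function of involutive and generic type, and let $F_1\colon I_1\times J_1\to\mathbb R^3$ be the map associated with the integral manifold $S_1$ determined by smooth functions $\xi(t),\mu(t)$ as described in the context. Write $G=\widetilde{\overline{x(\alpha_q+\alpha\alpha_p)}}\colon I_1\times J_1\to\mathbb R$. Assume that the singular point $(s_0,t_0)\in S(F_1)$ satisfies $G_s(s_0,t_0)\neq0$. Then: (1) $F_1$ is a cuspidal edge at $(s_0,t_0)$ if and only if $\xi'''(t_0)+G_t(s_0,t_0)\ne0$. (2) $F_1$ is a swallowtail at $(s_0,t_0)$ if and only if $\xi'''(t_0)+G_t(s_0,t_0)=0$ and $\xi^{(4)}(t_0)+G_{tt}(s_0,t_0)\neq0$. (3) $F_1$ is a butterfly at $(s_0,t_0)$ if and only if $\xi'''(t_0)+G_t(s_0,t_0)=0$, $\xi^{(4)}(t_0)+G_{tt}(s_0,t_0)=0$ and $\xi^{(5)}(t_0)+G_{ttt}(s_0,t_0)\neq0$.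
   Context: All objects are $C^\infty$ and all considerations are local. $(x,y,z,p,q)$ are canonical coordinates on $J^1(2,1)=PT^*J^0(2,1)$, $\dim J^0(2,1)=3$, in which the contact form is $dz-p\,dx-q\,dy$; $J^0(2,1)$ is locally identified with $\mathbb R^3$ via $(x,y,z)$. The function $\alpha=\alpha(x,y,z,p,q)$ is of involutive type if $\alpha_x+p\alpha_z-\alpha(\alpha_y+q\alpha_z)=0$ on its domain, and of generic type if $1+x(\alpha_y+q\alpha_z)\ne0$. Define the local diffeomorphism $\Phi_1(x,y,z,p,q)=(x_0,\dots,x_4)=(x,\ y+\alpha x,\ z-px-qy,\ p,\ q)$, with a local inverse $\Phi_1^{-1}$ on an open set $V_1\subset\mathbb R\times U_1$ (product of an open interval and an open $U_1\subset\mathbb R^4$); let $\varphi_1,\psi_1$ be its second ($y$) and third ($z$) components. The function $\overline\alpha=\alpha\circ\Phi_1^{-1}$ does not depend on $x_0$ and is regarded as a function of $(x_1,x_2,x_3,x_4)$. Let $\xi(t)$ be a smooth function and $\mu(t)$ a solution of $\mu'(t)=\overline\alpha(-\xi'(t),\xi(t),\mu(t),t)$. For open intervals $I_1,J_1$ with $(s,-\xi'(t),\xi(t),\mu(t),t)\in V_1$ for $(s,t)\in I_1\times J_1$, put $\Theta_1(s,t)=\Phi_1^{-1}(s,-\xi'(t),\xi(t),\mu(t),t)$; its image $S_1$ is a two-dimensional integral manifold of the ideal generated by $dz-p\,dx-q\,dy$, $dp-\alpha\,dq$ and their exterior derivatives. For a function $g$ of $(x,y,z,p,q)$ write $\widetilde{\overline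 g}=g\circ\Theta_1\colon I_1\times J_1\to\mathbb R$. The map associated with $S_1$ is $$F_1(s,t)=(s,\ \varphi_1(s,-\xi'(t),\xi(t),\mu(t),t),\ \psi_1(s,-\xi'(t),\xi(t),\mu(t),t)),$$ and $S(F_1)$ is the set of its singular points (where $\mathrm{rank}\,dF_1<2$). Two map germs $f\colon(\mathbb R^2,a)\to(\mathbb R^3,f(a))$, $g\colon(\mathbb R^2,b)\to(\mathbb R^3,g(b))$ are right-left equivalent if $\psi\circ f=g\circ\varphi$ for some diffeomorphism germs $\varphi\colon(\mathbb R^2,a)\to(\mathbb R^2,b)$ and $\psi\colon(\mathbb R^3,f(a))\to(\mathbb R^3,g(b))$. A map is, at a point, a cuspidal edge, swallowtail or butterfly if its germ there is right-left equivalent to the germ at the origin of, respectively, $(u,v)\mapsto(u,v^2,v^3)$, $(u,v)\mapsto(u,3v^4+uv^2,4v^3+2uv)$, $(u,v)\mapsto(u,5v^4+2uv,uv^2+4v^5)$. *)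

theory Defs
  imports "HOL-Analysis.Analysis"
begin

type_synonym R4 = "real \<times> real \<times> real \<times> real"
type_synonym R5 = "real \<times> real \<times> real \<times> real \<times> real"

definition dir_deriv :: "'a::real_normed_vector \<Rightarrow> ('a \<Rightarrow> 'b::real_normed_vector) \<Rightarrow> 'a \<Rightarrow> 'b"
  where "dir_deriv v f = (\<lambda>x. frechet_derivative f (at x) v)"

text \<open>These notions are meant for open sets only: derivatives are taken in full neighbourhoods.\<close>

primrec C_on :: "nat \<Rightarrow> 'a::real_normed_vector set \<Rightarrow> ('a \<Rightarrow> 'b::real_normed_vector) \<Rightarrow> bool"
  where
    "C_on 0 S f \<longleftrightarrow> continuous_on S f"
  | "C_on (Suc k) S f \<longleftrightarrow> (\<forall>x\<in>S. f differentiable (at x)) \<and> (\<forall>v. C_on k S (dir_deriv v f))"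

definition smooth_on :: "'a::real_normed_vector set \<Rightarrow> ('a \<Rightarrow> 'b::real_normed_vector) \<Rightarrow> bool"
  where "smooth_on S f \<longleftrightarrow> (\<forall>k. C_on k S f)"

definition diffeo_inverse ::
    "'a::real_normed_vector set \<Rightarrow> 'b::real_normed_vector set \<Rightarrow> ('a \<Rightarrow> 'b) \<Rightarrow> ('b \<Rightarrow> 'a) \<Rightarrow> bool"
  where "diffeo_inverse W V f g \<longleftrightarrow>
    open W \<and> open V \<and> smooth_on W f \<and> smooth_on V g \<and> f ` W = V \<and> g ` V = W \<and>
    (\<forall>w\<in>W. g (f w) = w) \<and> (\<forall>v\<in>V. f (g v) = v)"

definition diffeo_germ :: "('a::real_normed_vector \<Rightarrow> 'b::real_normed_vector) \<Rightarrow> 'a \<Rightarrow> 'b \<Rightarrow> bool"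
  where "diffeo_germ h a b \<longleftrightarrow> h a = b \<and> (\<exists>U V k. a \<in> U \<and> diffeo_inverse U V h k)"

definition right_left_equivalent ::
    "('a::real_normed_vector \<Rightarrow> 'b::real_normed_vector) \<Rightarrow> 'a \<Rightarrow> ('a \<Rightarrow> 'b) \<Rightarrow> 'a \<Rightarrow> bool"
  where "right_left_equivalent f a g b \<longleftrightarrow>
    (\<exists>\<phi> \<psi>. diffeo_germ \<phi> a b \<and> diffeo_germ \<psi> (f a) (g b) \<and>
       (\<forall>\<^sub>F x in nhds a. \<psi> (f x) = g (\<phi> x)))"

definition is_cuspidal_edge :: "(real \<times> real \<Rightarrow> real \<times> real \<times> real) \<Rightarrow> real \<times> real \<Rightarrow> bool"
  where "is_cuspidal_edge f a \<longleftrightarrow>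
    right_left_equivalent f a (\<lambda>(u, v). (u, v^2, v^3)) (0, 0)"

definition is_swallowtail :: "(real \<times> real \<Rightarrow> real \<times> real \<times> real) \<Rightarrow> real \<times> real \<Rightarrow> bool"
  where "is_swallowtail f a \<longleftrightarrow>
    right_left_equivalent f a (\<lambda>(u, v). (u, 3 * v^4 + u * v^2, 4 * v^3 + 2 * u * v)) (0, 0)"

definition is_butterfly :: "(real \<times> real \<Rightarrow> real \<times> real \<times> real) \<Rightarrow> real \<times> real \<Rightarrow> bool"
  where "is_butterfly f a \<longleftrightarrow>
    right_left_equivalent f a (\<lambda>(u, v). (u, 5 * v^4 + 2 * u * v, u * v^2 + 4 * v^5)) (0, 0)"

definition singular_points ::
    "(real \<times> real) set \<Rightarrow> (real \<times> real \<Rightarrow> real \<times> real \<times> real) \<Rightarrow> (real \<times> real) set"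
  where "singular_points M f = {a \<in> M. dim (range (frechet_derivative f (at a))) < 2}"

abbreviation D_x :: "(R5 \<Rightarrow> real) \<Rightarrow> R5 \<Rightarrow> real" where "D_x \<equiv> dir_deriv (1, 0, 0, 0, 0)"
abbreviation D_y :: "(R5 \<Rightarrow> real) \<Rightarrow> R5 \<Rightarrow> real" where "D_y \<equiv> dir_deriv (0, 1, 0, 0, 0)"
abbreviation D_z :: "(R5 \<Rightarrow> real) \<Rightarrow> R5 \<Rightarrow> real" where "D_z \<equiv> dir_deriv (0, 0, 1, 0, 0)"
abbreviation D_p :: "(R5 \<Rightarrow> real) \<Rightarrow> R5 \<Rightarrow> real" where "D_p \<equiv> dir_deriv (0, 0, 0, 1, 0)"
abbreviation D_q :: "(R5 \<Rightarrow> real) \<Rightarrow> R5 \<Rightarrow> real" where "D_q \<equiv> dir_deriv (0, 0, 0, 0, 1)"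

abbreviation D_s :: "(real \<times> real \<Rightarrow> real) \<Rightarrow> real \<times> real \<Rightarrow> real" where "D_s \<equiv> dir_deriv (1, 0)"
abbreviation D_t :: "(real \<times> real \<Rightarrow> real) \<Rightarrow> real \<times> real \<Rightarrow> real" where "D_t \<equiv> dir_deriv (0, 1)"

definition involutive_type :: "R5 set \<Rightarrow> (R5 \<Rightarrow> real) \<Rightarrow> bool"
  where "involutive_type D \<alpha> \<longleftrightarrow>
    (\<forall>(x, y, z, p, q) \<in> D. let w = (x, y, z, p, q) in
       D_x \<alpha> w + p * D_z \<alpha> w - \<alpha> w * (D_y \<alpha> w + q * D_z \<alpha> w) = 0)"

definition generic_type :: "R5 set \<Rightarrow> (R5 \<Rightarrow> real) \<Rightarrow> bool"
  where "generic_type D \<alpha> \<longleftrightarrow>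
    (\<forall>(x, y, z, p, q) \<in> D. let w = (x, y, z, p, q) in
       1 + x * (D_y \<alpha> w + q * D_z \<alpha> w) \<noteq> 0)"

definition Phi1 :: "(R5 \<Rightarrow> real) \<Rightarrow> R5 \<Rightarrow> R5"
  where "Phi1 \<alpha> = (\<lambda>(x, y, z, p, q).
    (x, y + \<alpha> (x, y, z, p, q) * x, z - p * x - q * y, p, q))"

text \<open>
  \<open>\<Psi>\<close> stands for a local inverse of \<open>Phi1 \<alpha>\<close> on \<open>K \<times> U\<close> with \<open>K\<close> an interval. For \<open>\<alpha>\<close> of
  involutive and generic type, \<open>\<alpha> \<circ> \<Psi>\<close> does not depend on the coordinate \<open>x\<^sub>0 \<in> K\<close>;
  \<open>alpha_bar\<close> is this common value. That it exists is a consequence, not part of the definition.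
\<close>

definition alpha_bar :: "(R5 \<Rightarrow> real) \<Rightarrow> (R5 \<Rightarrow> R5) \<Rightarrow> real set \<Rightarrow> R4 \<Rightarrow> real"
  where "alpha_bar \<alpha> \<Psi> K = (\<lambda>(x1, x2, x3, x4). THE a. \<forall>x0\<in>K. \<alpha> (\<Psi> (x0, x1, x2, x3, x4)) = a)"

definition Theta1 :: "(R5 \<Rightarrow> R5) \<Rightarrow> (real \<Rightarrow> real) \<Rightarrow> (real \<Rightarrow> real) \<Rightarrow> real \<times> real \<Rightarrow> R5"
  where "Theta1 \<Psi> \<xi> \<mu> = (\<lambda>(s, t). \<Psi> (s, - deriv \<xi> t, \<xi> t, \<mu> t, t))"

definition F1 :: "(R5 \<Rightarrow> R5) \<Rightarrow> (real \<Rightarrow> real) \<Rightarrow> (real \<Rightarrow> real) \<Rightarrow> real \<times> real \<Rightarrow> real \<times> real \<times> real"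
  where "F1 \<Psi> \<xi> \<mu> = (\<lambda>(s, t).
    let \<phi>1 = (\<lambda>w. fst (snd (\<Psi> w))); \<psi>1 = (\<lambda>w. fst (snd (snd (\<Psi> w))));
        w = (s, - deriv \<xi> t, \<xi> t, \<mu> t, t)
    in (s, \<phi>1 w, \<psi>1 w))"

end

theory Submission
  imports Defs
begin

text \<open>
  Involutivity and genericity make \<open>\<alpha>\<close> constant along the \<open>x\<^sub>0\<close>-curves, so \<open>\<alpha> (\<Theta>\<^sub>1 (s, t)) = \<mu>' t\<close>. With
  \<open>h = \<xi> + s \<mu>\<close> this gives \<open>F\<^sub>1 = (s, - h\<^sub>t, h - t h\<^sub>t)\<close>: the map \<open>F\<^sub>1\<close> runs through the \<open>(s, Y, Z)\<close> for which
  \<open>h (s, x) + x Y - Z\<close> has a double zero, at \<open>x = t\<close>. Moreover \<open>\<xi>'' + G = (1 + s (\<alpha>\<^sub>y + q \<alpha>\<^sub>z)) h\<^sub>t\<^sub>t\<close> with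
  a nonvanishing factor, so the point is singular iff \<open>h\<^sub>t\<^sub>t = 0\<close> there, \<open>G\<^sub>s \<noteq> 0\<close> means \<open>\<mu>'' \<noteq> 0\<close>, and
  the conditions of the theorem compare the order of the zero of \<open>h\<^sub>t\<^sub>t\<close> with \<open>1, 2, 3\<close>.

  For these orders the family, divided by a unit, is a three-parameter unfolding of \<open>x ^ n\<close> with
  \<open>n = 3, 4, 5\<close>. Malgrange division (obtained from Nirenberg's almost analytic extensions and
  the Cauchy-Pompeiu formula) and the implicit function theorem identify it with the model
  polynomial whose double roots are parametrized by the cuspidal edge, swallowtail or butterfly. That no other case
  yields one of these germs follows from the Lojasiewicz exponents \<open>2, 3, 4\<close> of the models.
\<close>

section \<open>Smooth maps\<close>

text \<open>The obstacle is the order 5. Modulo \<open>x^5\<close> and \<open>x^4\<close> the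
  functions \<open>1, x, x^2, x^3\<close> stay independent, so an unfolding with three parameters is
  not versal. The three parameters and a translation of x are used up by the coefficients of
  \<open>1, x, x^2, x^4\<close>; the parameters multiply functions that agree with
  \<open>1, x, x^2\<close> only up to order 3, so an \<open>x^3\<close> term is left over. The
  freedom that remains is the coordinate on the line: replacing x by x/\<omega> and multiplying by
  \<omega>^5 preserves \<open>x^5\<close>, and three coefficients of \<omega> absorb the leftover.
  For the orders 3 and 4 a translation is enough; order 3 carries one parameter along trivially. The
  data are only smooth, and quotient and remainder must be smooth jointly in x and the coefficients
  of the divisor, whose roots may leave the real line; hence division needs almost analytic
  extensions. The conditions on G form a cascade. Since \<xi>'' + G is a unit times h_tt, its k-th
  t-derivative is that unit times the corresponding derivative of h once the lower ones vanish,
  which is exactly the situation in which each part of the theorem evaluates it.\<close>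

lemma dir_deriv_eq: "(f has_derivative f') (at x) \<Longrightarrow> dir_deriv v f x = f' v"
  by (simp add: dir_deriv_def frechet_derivative_at[symmetric])

lemma has_derivative_dir_deriv:
  "f differentiable (at x) \<Longrightarrow> (f has_derivative (\<lambda>v. dir_deriv v f x)) (at x)"
  by (simp add: dir_deriv_def frechet_derivative_works[symmetric])

lemma dir_deriv_cong_open:
  assumes "open S" "x \<in> S" "\<And>y. y \<in> S \<Longrightarrow> f y = g y"
  shows "dir_deriv v f x = dir_deriv v g x"
proof -
  have "(f has_derivative D) (at x) = (g has_derivative D) (at x)" for D
    using has_derivative_transform_within_open[OF _ assms(1,2), of f D UNIV g]
      has_derivative_transform_within_open[OF _ assms(1,2), of g D UNIV f] assms(3) by auto
  then show ?thesis by (simp add: dir_deriv_def frechet_derivative_def)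
qed

lemma C_on_cong:
  assumes "open S" "\<And>x. x \<in> S \<Longrightarrow> f x = g x" "C_on k S f"
  shows "C_on k S g"
  using assms(2,3)
proof (induction k arbitrary: f g)
  case 0
  then show ?case by (auto cong: continuous_on_cong)
next
  case (Suc k)
  have "g differentiable (at x)" if "x \<in> S" for x
    using Suc.prems that assms(1) unfolding differentiable_def
    by (metis C_on.simps(2) differentiable_def has_derivative_transform_within_open)
  moreover have "C_on k S (dir_deriv v g)" for v
    using Suc.IH[of "dir_deriv v f" "dir_deriv v g"] Suc.prems
      dir_deriv_cong_open[OF assms(1), of _ f g] by auto
  ultimately show ?case by simp
qed

lemma C_on_Suc_D: "C_on (Suc k) S f \<Longrightarrow> C_on k S f"
proof (induction k arbitrary: f)
  case 0
  then show ?case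
    by (auto intro!: continuous_at_imp_continuous_on differentiable_imp_continuous_within)
next
  case (Suc k)
  then show ?case by (metis C_on.simps(2))
qed

lemma C_on_subset: "C_on k S f \<Longrightarrow> T \<subseteq> S \<Longrightarrow> C_on k T f"
  by (induction k arbitrary: f) (auto intro: continuous_on_subset)

text \<open>Differentiability is demanded at each point in a full neighbourhood, so it passes to
  unions by itself; openness enters through the continuity at the bottom of the induction.\<close>

lemma C_on_Un:
  assumes "open S" "open T" "C_on k S f" "C_on k T f"
  shows "C_on k (S \<union> T) f"
  using assms(3,4) by (induction k arbitrary: f) (auto intro: continuous_on_open_Un assms(1,2))

lemma C_on_const:
  fixes S :: "'a::real_normed_vector set"
  shows "C_on k S (\<lambda>_. c)"
proof (induction k arbitrary: c)
  case (Suc k)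
  have "dir_deriv v (\<lambda>_::'a. c) = (\<lambda>_. 0)" for v
    by (rule ext) (rule dir_deriv_eq, rule has_derivative_const)
  with Suc show ?case by simp
qed simp

lemma dir_deriv_blin:
  assumes "bounded_linear L" "f differentiable (at x)"
  shows "dir_deriv v (\<lambda>x. L (f x)) x = L (dir_deriv v f x)"
  by (rule dir_deriv_eq bounded_linear.has_derivative assms has_derivative_dir_deriv)+

lemma C_on_blin:
  assumes "bounded_linear L" "open S" "C_on k S f"
  shows "C_on k S (\<lambda>x. L (f x))"
  using assms(3)
proof (induction k arbitrary: f)
  case 0
  then show ?case using bounded_linear.continuous_on[OF assms(1)] by auto
next
  case (Suc k)
  have *: "C_on k S (\<lambda>x. L (dir_deriv v f x))" for v
    using Suc by simp
  have "C_on k S (dir_deriv v (\<lambda>x. L (f x)))" for v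
    by (rule C_on_cong[OF assms(2) _ *])
       (rule dir_deriv_blin[OF assms(1), symmetric]; use Suc.prems in simp)
  moreover have "(\<lambda>x. L (f x)) differentiable (at x)" if "x \<in> S" for x
    by (rule differentiableI[OF bounded_linear.has_derivative[OF assms(1)]], rule has_derivative_dir_deriv)
      (use Suc.prems that in auto)
  ultimately show ?case by simp
qed

lemma dir_deriv_add:
  assumes "f differentiable (at x)" "g differentiable (at x)"
  shows "dir_deriv v (\<lambda>x. f x + g x) x = dir_deriv v f x + dir_deriv v g x"
  by (rule dir_deriv_eq has_derivative_add has_derivative_dir_deriv assms)+

lemma C_on_add:
  assumes "open S" "C_on k S f" "C_on k S g"
  shows "C_on k S (\<lambda>x. f x + g x)"
  using assms(2,3)
proof (induction k arbitrary: f g)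
  case 0
  then show ?case by (auto intro: continuous_on_add)
next
  case (Suc k)
  have *: "C_on k S (\<lambda>x. dir_deriv v f x + dir_deriv v g x)" for v
    using Suc by simp
  have "C_on k S (dir_deriv v (\<lambda>x. f x + g x))" for v
    by (rule C_on_cong[OF assms(1) _ *])
       (rule dir_deriv_add[symmetric]; use Suc.prems in simp)
  then show ?case using Suc.prems by auto
qed

lemma dir_deriv_bilinear:
  assumes "bounded_bilinear B" "f differentiable (at x)" "g differentiable (at x)"
  shows "dir_deriv v (\<lambda>x. B (f x) (g x)) x = B (f x) (dir_deriv v g x) + B (dir_deriv v f x) (g x)"
  by (rule dir_deriv_eq bounded_bilinear.FDERIV assms has_derivative_dir_deriv)+

lemma C_on_bilinear:
  assumes "bounded_bilinear B" "open S" "C_on k S f" "C_on k S g"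
  shows "C_on k S (\<lambda>x. B (f x) (g x))"
  using assms(3,4)
proof (induction k arbitrary: f g)
  case 0
  then show ?case by (auto intro: bounded_bilinear.continuous_on[OF assms(1)])
next
  case (Suc k)
  have *: "C_on k S (\<lambda>x. B (f x) (dir_deriv v g x) + B (dir_deriv v f x) (g x))" for v
    using Suc.prems C_on_Suc_D[OF Suc.prems(1)] C_on_Suc_D[OF Suc.prems(2)]
    by (intro C_on_add assms(2) Suc.IH) simp_all
  have "C_on k S (dir_deriv v (\<lambda>x. B (f x) (g x)))" for v
    by (rule C_on_cong[OF assms(2) _ *[of v]])
       (rule dir_deriv_bilinear[OF assms(1), symmetric]; use Suc.prems in simp)
  moreover have "(\<lambda>x. B (f x) (g x)) differentiable (at x)" if "x \<in> S" for x
    by (rule differentiableI[OF bounded_bilinear.FDERIV[OF assms(1)]]; rule has_derivative_dir_deriv)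
      (use Suc.prems that in auto)
  ultimately show ?case by simp
qed

lemma C_on_sum:
  assumes "open S" "\<And>i. i \<in> I \<Longrightarrow> C_on k S (f i)"
  shows "C_on k S (\<lambda>x. \<Sum>i\<in>I. f i x)"
  using assms(2)
  by (induction I rule: infinite_finite_induct) (auto intro: C_on_const C_on_add[OF assms(1)])

lemma dir_deriv_compose:
  fixes f :: "'a::real_normed_vector \<Rightarrow> 'b::euclidean_space"
  assumes "f differentiable (at x)" "g differentiable (at (f x))"
  shows "dir_deriv v (\<lambda>x. g (f x)) x = (\<Sum>b\<in>Basis. (dir_deriv v f x \<bullet> b) *\<^sub>R dir_deriv b g (f x))"
proof -
  let ?G = "\<lambda>w. dir_deriv w g (f x)"
  have G: "(g has_derivative ?G) (at (f x))"
    using assms(2) by (rule has_derivative_dir_deriv)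
  then have lin: "linear ?G" by (rule has_derivative_linear)
  have "dir_deriv v (\<lambda>x. g (f x)) x = ?G (dir_deriv v f x)"
    by (rule dir_deriv_eq[OF has_derivative_compose[OF has_derivative_dir_deriv[OF assms(1)] G]])
  also have "\<dots> = ?G (\<Sum>b\<in>Basis. (dir_deriv v f x \<bullet> b) *\<^sub>R b)"
    by (simp add: euclidean_representation)
  also have "\<dots> = (\<Sum>b\<in>Basis. (dir_deriv v f x \<bullet> b) *\<^sub>R ?G b)"
    by (simp add: linear_sum[OF lin] linear_cmul[OF lin])
  finally show ?thesis .
qed

text \<open>Expanding the chain rule over \<open>Basis\<close> makes the derivative a finite sum of
  products in which g is differentiated in fixed directions. The induction hypothesis covers those;
  it would not cover the direction \<open>dir_deriv v f x\<close>, which varies with x.\<close>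

lemma C_on_compose:
  fixes f :: "'a::real_normed_vector \<Rightarrow> 'b::euclidean_space"
  assumes "open S" "open T" "f ` S \<subseteq> T" "C_on k T g" "C_on k S f"
  shows "C_on k S (\<lambda>x. g (f x))"
  using assms(4,5)
proof (induction k arbitrary: g)
  case 0
  then show ?case using assms(3) by (auto intro: continuous_on_compose2)
next
  case (Suc k)
  note * = C_on_bilinear[OF bounded_bilinear_scaleR assms(1)] 
     C_on_blin[OF bounded_linear_inner_left assms(1)]
  have "C_on k S (\<lambda>x. \<Sum>b\<in>Basis. (dir_deriv v f x \<bullet> b) *\<^sub>R dir_deriv b g (f x))" for v
  proof (intro C_on_sum * assms(1))
    show "C_on k S (\<lambda>x. dir_deriv b g (f x))" for b
      using Suc.prems C_on_Suc_D[OF Suc.prems(2)] by (intro Suc.IH) simp_all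
    show "C_on k S (dir_deriv v f)"
      using Suc.prems by simp
  qed
  then have "C_on k S (dir_deriv v (\<lambda>x. g (f x)))" for v
    by (rule C_on_cong[OF assms(1), rotated])
      (rule dir_deriv_compose[symmetric]; use Suc.prems assms(3) in \<open>auto simp: image_subset_iff\<close>)
  moreover have "(\<lambda>x. g (f x)) differentiable (at x)" if "x \<in> S" for x
    by (rule differentiable_compose[of g f x UNIV]) (use Suc.prems that assms(3) in auto)
  ultimately show ?case by simp
qed

lemma smooth_on_C: "smooth_on S f \<Longrightarrow> C_on k S f"
  by (simp add: smooth_on_def)

lemma smooth_on_differentiable: "smooth_on S f \<Longrightarrow> x \<in> S \<Longrightarrow> f differentiable (at x)"
  using smooth_on_C[of S f 1] by simp

lemma smooth_on_has_derivative:
  "smooth_on S f \<Longrightarrow> x \<in> S \<Longrightarrow> (f has_derivative (\<lambda>v. dir_deriv v f x)) (at x)"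
  by (simp add: smooth_on_differentiable has_derivative_dir_deriv)

lemma smooth_on_continuous_on: "smooth_on S f \<Longrightarrow> continuous_on S f"
  using smooth_on_C[of S f 0] by simp

lemma smooth_on_isCont: "smooth_on S f \<Longrightarrow> x \<in> S \<Longrightarrow> isCont f x"
  using differentiable_imp_continuous_within smooth_on_differentiable by blast

lemma smooth_on_dir_deriv: "smooth_on S f \<Longrightarrow> smooth_on S (dir_deriv v f)"
  unfolding smooth_on_def using C_on.simps(2) by blast

lemma smooth_on_subset: "smooth_on S f \<Longrightarrow> T \<subseteq> S \<Longrightarrow> smooth_on T f"
  unfolding smooth_on_def using C_on_subset by blast

lemma smooth_on_cong:
  "open S \<Longrightarrow> (\<And>x. x \<in> S \<Longrightarrow> f x = g x) \<Longrightarrow> smooth_on S f \<Longrightarrow> smooth_on S g"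
  using C_on_cong unfolding smooth_on_def by blast

lemma smooth_on_Un:
  "open S \<Longrightarrow> open T \<Longrightarrow> smooth_on S f \<Longrightarrow> smooth_on T f \<Longrightarrow> smooth_on (S \<union> T) f"
  using C_on_Un unfolding smooth_on_def by blast

lemma smooth_on_const: "smooth_on S (\<lambda>_. c)"
  by (simp add: smooth_on_def C_on_const)

lemma smooth_on_blin:
  "bounded_linear L \<Longrightarrow> open S \<Longrightarrow> smooth_on S f \<Longrightarrow> smooth_on S (\<lambda>x. L (f x))"
  by (simp add: smooth_on_def C_on_blin)

lemma smooth_on_add:
  "open S \<Longrightarrow> smooth_on S f \<Longrightarrow> smooth_on S g \<Longrightarrow> smooth_on S (\<lambda>x. f x + g x)"
  by (simp add: smooth_on_def C_on_add)

lemma smooth_on_minus: "open S \<Longrightarrow> smooth_on S f \<Longrightarrow> smooth_on S (\<lambda>x. - f x)"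
  by (rule smooth_on_blin[of uminus]) (auto intro: bounded_linear_minus bounded_linear_ident)

lemma smooth_on_diff:
  "open S \<Longrightarrow> smooth_on S f \<Longrightarrow> smooth_on S g \<Longrightarrow> smooth_on S (\<lambda>x. f x - g x)"
  using smooth_on_add[of S f "\<lambda>x. - g x"] smooth_on_minus[of S g] by simp

lemma smooth_on_bilinear:
  "bounded_bilinear B \<Longrightarrow> open S \<Longrightarrow> smooth_on S f \<Longrightarrow> smooth_on S g \<Longrightarrow>
    smooth_on S (\<lambda>x. B (f x) (g x))"
  by (simp add: smooth_on_def C_on_bilinear)

lemma smooth_on_mult:
  fixes f g :: "'a::real_normed_vector \<Rightarrow> 'b::real_normed_algebra"
  shows "open S \<Longrightarrow> smooth_on S f \<Longrightarrow> smooth_on S g \<Longrightarrow> smooth_on S (\<lambda>x. f x * g x)"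
  by (rule smooth_on_bilinear[OF bounded_bilinear_mult])

lemma smooth_on_scaleR:
  "open S \<Longrightarrow> smooth_on S f \<Longrightarrow> smooth_on S g \<Longrightarrow> smooth_on S (\<lambda>x. f x *\<^sub>R g x)"
  by (rule smooth_on_bilinear[OF bounded_bilinear_scaleR])

lemma smooth_on_power:
  fixes f :: "'a::real_normed_vector \<Rightarrow> 'b::real_normed_algebra_1"
  shows "open S \<Longrightarrow> smooth_on S f \<Longrightarrow> smooth_on S (\<lambda>x. f x ^ n)"
  by (induction n) (auto intro: smooth_on_const smooth_on_mult)

lemma smooth_on_sum:
  "open S \<Longrightarrow> (\<And>i. i \<in> I \<Longrightarrow> smooth_on S (f i)) \<Longrightarrow> smooth_on S (\<lambda>x. \<Sum>i\<in>I. f i x)"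
  by (simp add: smooth_on_def C_on_sum)

lemma smooth_on_id: "open S \<Longrightarrow> smooth_on S (\<lambda>x. x)"
proof -
  assume S: "open S"
  have "dir_deriv v (\<lambda>x::'a. x) = (\<lambda>_. v)" for v
    by (rule ext) (rule dir_deriv_eq, rule has_derivative_ident)
  then have "C_on k S (\<lambda>x. x)" for k
    by (cases k) (auto intro: C_on_const)
  then show ?thesis by (simp add: smooth_on_def)
qed

lemma smooth_on_linear: "bounded_linear L \<Longrightarrow> open S \<Longrightarrow> smooth_on S L"
  by (rule smooth_on_blin[OF _ _ smooth_on_id])

lemma smooth_on_Pair:
  assumes "open S" "smooth_on S f" "smooth_on S g"
  shows "smooth_on S (\<lambda>x. (f x, g x))"
proof -
  have "smooth_on S (\<lambda>x. (f x, 0) + (0, g x))"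
    by (intro smooth_on_add smooth_on_blin[where L="\<lambda>u. (u, 0)"] smooth_on_blin[where L="\<lambda>u. (0, u)"]
         bounded_linear_Pair bounded_linear_ident bounded_linear_zero assms)
  then show ?thesis by simp
qed

lemma smooth_on_fst: "open S \<Longrightarrow> smooth_on S f \<Longrightarrow> smooth_on S (\<lambda>x. fst (f x))"
  by (rule smooth_on_blin[OF bounded_linear_fst])

lemma smooth_on_snd: "open S \<Longrightarrow> smooth_on S f \<Longrightarrow> smooth_on S (\<lambda>x. snd (f x))"
  by (rule smooth_on_blin[OF bounded_linear_snd])

lemma smooth_on_compose:
  fixes f :: "'a::real_normed_vector \<Rightarrow> 'b::euclidean_space"
  shows "open S \<Longrightarrow> open T \<Longrightarrow> f ` S \<subseteq> T \<Longrightarrow> smooth_on T g \<Longrightarrow> smooth_on S f \<Longrightarrow>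
    smooth_on S (\<lambda>x. g (f x))"
  by (simp add: smooth_on_def C_on_compose)

lemma smooth_on_compose_UNIV:
  fixes f :: "'a::real_normed_vector \<Rightarrow> 'b::euclidean_space"
  shows "open S \<Longrightarrow> smooth_on UNIV g \<Longrightarrow> smooth_on S f \<Longrightarrow> smooth_on S (\<lambda>x. g (f x))"
  by (rule smooth_on_compose[of S UNIV]) auto

text \<open>Coinduction for smoothness, meant for functions given by a formula that differentiation
  reproduces, such as integrals depending on parameters.\<close>

lemma smooth_on_coinduct:
  assumes "P f" and "\<And>g x. P g \<Longrightarrow> x \<in> S \<Longrightarrow> g differentiable (at x)"
    and "\<And>g v. P g \<Longrightarrow> P (dir_deriv v g)"
  shows "smooth_on S f"
proof -
  have "C_on k S g" if "P g" for k g
    using that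
  proof (induction k arbitrary: g)
    case 0
    then show ?case
      using assms(2) by (auto intro!: continuous_at_imp_continuous_on differentiable_imp_continuous_within)
  qed (use assms in auto)
  then show ?thesis using assms(1) by (simp add: smooth_on_def)
qed

lemma C_on_inverse:
  fixes f :: "'a::real_normed_vector \<Rightarrow> 'b::real_normed_field"
  assumes "open S" "C_on k S f" "\<And>x. x \<in> S \<Longrightarrow> f x \<noteq> 0"
  shows "C_on k S (\<lambda>x. inverse (f x))"
  using assms(2)
proof (induction k)
  case 0
  then show ?case using assms(3) by (auto intro: continuous_on_inverse)
next
  case (Suc k)
  have 1: "((\<lambda>x. inverse (f x)) has_derivative (\<lambda>v. - (inverse (f x) * dir_deriv v f x * inverse (f x)))) (at x)"
    if "x \<in> S" for x
    using that Suc.prems assms(3) by (intro Deriv.has_derivative_inverse has_derivative_dir_deriv) auto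
  note * = C_on_bilinear[OF bounded_bilinear_mult assms(1)]
    C_on_blin[OF bounded_linear_minus[OF bounded_linear_ident] assms(1)]
  have "C_on k S (\<lambda>x. - (inverse (f x) * dir_deriv v f x * inverse (f x)))" for v
    using Suc.IH[OF C_on_Suc_D[OF Suc.prems]] Suc.prems by (intro *) simp_all
  then have "C_on k S (dir_deriv v (\<lambda>x. inverse (f x)))" for v
    by (rule C_on_cong[OF assms(1), rotated]) (use dir_deriv_eq[OF 1] in auto)
  then show ?case using differentiableI[OF 1] by simp
qed

lemma smooth_on_inverse:
  fixes f :: "'a::real_normed_vector \<Rightarrow> 'b::real_normed_field"
  shows "open S \<Longrightarrow> smooth_on S f \<Longrightarrow> (\<And>x. x \<in> S \<Longrightarrow> f x \<noteq> 0) \<Longrightarrow> smooth_on S (\<lambda>x. inverse (f x))"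
  by (simp add: smooth_on_def C_on_inverse)

lemma smooth_on_divide:
  fixes f g :: "'a::real_normed_vector \<Rightarrow> 'b::real_normed_field"
  shows "open S \<Longrightarrow> smooth_on S f \<Longrightarrow> smooth_on S g \<Longrightarrow> (\<And>x. x \<in> S \<Longrightarrow> g x \<noteq> 0) \<Longrightarrow>
    smooth_on S (\<lambda>x. f x / g x)"
  unfolding divide_inverse by (intro smooth_on_mult smooth_on_inverse)

lemma dir_deriv_linear:
  assumes "f differentiable (at x)"
  shows "linear (\<lambda>v. dir_deriv v f x)"
  using has_derivative_dir_deriv[OF assms] by (rule has_derivative_linear)

lemma dir_deriv_Basis:
  fixes f :: "'a::euclidean_space \<Rightarrow> 'b::real_normed_vector"
  assumes "f differentiable (at x)"
  shows "dir_deriv v f x = (\<Sum>b\<in>Basis. (v \<bullet> b) *\<^sub>R dir_deriv b f x)"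
proof -
  note lin = dir_deriv_linear[OF assms]
  have "dir_deriv v f x = dir_deriv (\<Sum>b\<in>Basis. (v \<bullet> b) *\<^sub>R b) f x"
    by (simp add: euclidean_representation)
  also have "\<dots> = (\<Sum>b\<in>Basis. (v \<bullet> b) *\<^sub>R dir_deriv b f x)"
    using linear_sum[OF lin, of "\<lambda>b. (v \<bullet> b) *\<^sub>R b" Basis] linear_cmul[OF lin] by simp
  finally show ?thesis .
qed

lemma C_on_SucI_Basis:
  fixes f :: "'a::euclidean_space \<Rightarrow> 'b::real_normed_vector"
  assumes "open S" "\<And>x. x \<in> S \<Longrightarrow> f differentiable (at x)"
    "\<And>b. b \<in> Basis \<Longrightarrow> C_on k S (dir_deriv b f)"
  shows "C_on (Suc k) S f"
proof -
  have "C_on k S (\<lambda>x. \<Sum>b\<in>Basis. (v \<bullet> b) *\<^sub>R dir_deriv b f x)" for v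
    using assms by (intro C_on_sum C_on_blin[OF bounded_linear_scaleR_right]) auto
  then have "C_on k S (dir_deriv v f)" for v
    by (rule C_on_cong[OF assms(1), rotated]) (rule dir_deriv_Basis[symmetric], rule assms(2))
  then show ?thesis using assms by simp
qed

section \<open>Inverse and implicit functions\<close>

lemma differentiable_Lipschitz_at:
  assumes "f differentiable (at a)"
  obtains K where "K > 0" "\<forall>\<^sub>F x in nhds a. norm (f x - f a) \<le> K * norm (x - a)"
proof -
  obtain D where D: "(f has_derivative D) (at a)"
    using assms differentiable_def by blast
  then have "bounded_linear D" and *: "\<And>e. 0 < e \<Longrightarrow> \<exists>d>0. \<forall>y. norm (y - a) < d \<longrightarrow> norm (f y - f a - D (y - a)) \<le> e * norm (y - a)"
    by (auto simp: has_derivative_at_alt)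
  then obtain K where K: "K > 0" "\<And>x. norm (D x) \<le> norm x * K"
    using bounded_linear.pos_bounded by blast
  obtain d where d: "d > 0" "\<And>y. norm (y - a) < d \<Longrightarrow> norm (f y - f a - D (y - a)) \<le> 1 * norm (y - a)"
    using *[of 1] by auto
  have "norm (f x - f a) \<le> (1 + K) * norm (x - a)" if "dist x a < d" for x
  proof -
    have "norm (f x - f a) \<le> norm (f x - f a - D (x - a)) + norm (D (x - a))"
      by (metis add.commute diff_add_cancel norm_triangle_ineq)
    also have "\<dots> \<le> 1 * norm (x - a) + norm (x - a) * K"
      by (intro add_mono d K) (use that in \<open>simp add: dist_norm\<close>)
    finally show ?thesis by (simp add: algebra_simps)
  qed
  then have "\<forall>\<^sub>F x in nhds a. norm (f x - f a) \<le> (1 + K) * norm (x - a)"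
    unfolding eventually_nhds_metric using d(1) by blast
  then show ?thesis using that[of "1 + K"] K(1) by auto
qed

text \<open>As f vanishes at a, it is O(|x - a|) there and \<open>(g x - g a) *\<^sub>R f x\<close>
  is o(|x - a|), so continuity of g suffices. Inverses of linear maps are differentiated this way,
  when only their continuity is known.\<close>

lemma has_derivative_cont_scaleR:
  fixes g :: "'a::real_normed_vector \<Rightarrow> real"
  assumes "isCont g a" "(f has_derivative D) (at a)" "f a = 0"
  shows "((\<lambda>x. g x *\<^sub>R f x) has_derivative (\<lambda>h. g a *\<^sub>R D h)) (at a)"
proof -
  obtain K where K: "K > 0" "\<forall>\<^sub>F x in nhds a. norm (f x - f a) \<le> K * norm (x - a)"
    using differentiable_Lipschitz_at[of f a] assms(2) differentiable_def by blast
  have "((\<lambda>x. (g x - g a) *\<^sub>R f x) has_derivative (\<lambda>h. 0)) (at a)"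
    unfolding has_derivative_at_alt
  proof (intro conjI allI impI)
    show "bounded_linear (\<lambda>h::'a. 0::'b)" by (rule bounded_linear_zero)
    fix e :: real assume "e > 0"
    have "\<forall>\<^sub>F x in nhds a. dist (g x) (g a) < e / K"
      using assms(1) \<open>e > 0\<close> K(1) by (intro tendstoD) (auto simp: continuous_at tendsto_at_iff_tendsto_nhds)
    with K(2) have "\<forall>\<^sub>F y in nhds a. norm ((g y - g a) *\<^sub>R f y - (g a - g a) *\<^sub>R f a - 0) \<le> e * norm (y - a)"
    proof eventually_elim
      case (elim x)
      have "norm ((g x - g a) *\<^sub>R f x) = dist (g x) (g a) * norm (f x)"
        by (simp add: dist_norm)
      also have "\<dots> \<le> e / K * (K * norm (x - a))"
        using elim assms(3) K(1) \<open>e > 0\<close> by (intro mult_mono) auto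
      finally show ?case using K(1) by simp
    qed
    then show "\<exists>d>0. \<forall>y. norm (y - a) < d \<longrightarrow> norm ((g y - g a) *\<^sub>R f y - (g a - g a) *\<^sub>R f a - 0) \<le> e * norm (y - a)"
      unfolding eventually_nhds_metric by (simp add: dist_norm)
  qed
  from has_derivative_add[OF bounded_linear.has_derivative[OF bounded_linear_scaleR_right[of "g a"] assms(2)] this]
  show ?thesis by (simp add: algebra_simps)
qed

lemma linear_Basis_expand:
  fixes L :: "'a::euclidean_space \<Rightarrow> 'b::real_vector"
  assumes "linear L"
  shows "L w = (\<Sum>b\<in>Basis. (w \<bullet> b) *\<^sub>R L b)"
proof -
  have "L w = L (\<Sum>b\<in>Basis. (w \<bullet> b) *\<^sub>R b)" by (simp add: euclidean_representation)
  also have "\<dots> = (\<Sum>b\<in>Basis. (w \<bullet> b) *\<^sub>R L b)"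
    by (simp only: linear_sum[OF assms] linear_cmul[OF assms])
  finally show ?thesis .
qed

text \<open>A bound for \<open>inv (A x) v\<close> near a comes from absorbing the perturbation of
  \<open>A a\<close>. Inserted into the resolvent identity \<open>rep\<close> it gives continuity at
  a; continuity inserted into the same identity gives the derivative.\<close>

lemma inverse_family_has_derivative:
  fixes A :: "'a::real_normed_vector \<Rightarrow> 'b::euclidean_space \<Rightarrow> 'b"
  assumes S: "open S" "a \<in> S" and lin: "\<And>x. x \<in> S \<Longrightarrow> linear (A x)"
    and bij: "\<And>x. x \<in> S \<Longrightarrow> bij (A x)"
    and diff: "\<And>w. (\<lambda>x. A x w) differentiable (at a)"
  shows "((\<lambda>x. inv (A x) v) has_derivative
    (\<lambda>u. - inv (A a) (\<Sum>b\<in>Basis. (inv (A a) v \<bullet> b) *\<^sub>R dir_deriv u (\<lambda>x. A x b) a))) (at a)"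
proof -
  let ?I = "inv (A a)" and ?W = "\<lambda>x. inv (A x) v"
  have AW: "A x (?W x) = v" if "x \<in> S" for x
    using bij[OF that] by (simp add: bij_is_surj surj_f_inv_f)
  have IA: "?I (A a w) = w" for w
    using bij[OF S(2)] by (simp add: bij_is_inj)
  have linI: "linear ?I"
    using lin[OF S(2)] bij[OF S(2)] by (metis bij_betw_def inj_linear_imp_inv_linear)
  then have blinI: "bounded_linear ?I" by (rule linear_conv_bounded_linear[THEN iffD1])
  obtain C where C: "C > 0" "\<And>x. norm (?I x) \<le> norm x * C"
    using bounded_linear.pos_bounded[OF blinI] by blast
  have expand: "A x w - A a w = (\<Sum>b\<in>Basis. (w \<bullet> b) *\<^sub>R (A x b - A a b))" if "x \<in> S" for x w
  proof -
    have "A y w = (\<Sum>b\<in>Basis. (w \<bullet> b) *\<^sub>R A y b)" if "y \<in> S" for y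
      by (rule linear_Basis_expand[OF lin[OF that]])
    from this[OF that] this[OF S(2)] show ?thesis
      by (simp add: scaleR_diff_right sum_subtractf)
  qed
  have cont: "isCont (\<lambda>x. A x b) a" for b
    using diff differentiable_imp_continuous_within by blast
  have evS: "\<forall>\<^sub>F x in nhds a. x \<in> S" using S by (rule eventually_nhds_in_open)
  have sm: "((\<lambda>x. \<Sum>b\<in>Basis. norm (A x b - A a b)) \<longlongrightarrow> 0) (nhds a)"
  proof -
    have "((\<lambda>x. norm (A x b - A a b)) \<longlongrightarrow> 0) (nhds a)" for b
    proof -
      have "((\<lambda>x. A x b) \<longlongrightarrow> A a b) (nhds a)"
        using cont[of b] tendsto_at_iff_tendsto_nhds[of "\<lambda>x. A x b" a] by (simp add: continuous_at)
      then show ?thesis by (simp add: LIM_zero_iff tendsto_norm_zero)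
    qed
    then have "((\<lambda>x. \<Sum>b\<in>Basis. norm (A x b - A a b)) \<longlongrightarrow> (\<Sum>b\<in>(Basis::'b set). 0)) (nhds a)"
      by (intro tendsto_sum)
    then show ?thesis by simp
  qed
  \<comment> \<open>The perturbation is kept below 1/(2C), so that after applying
    \<open>inv (A a)\<close>, of norm at most C, it costs half of the norm of \<open>?W x\<close>
    and can be moved to the left.\<close>
  have bnd: "\<forall>\<^sub>F x in nhds a. norm (?W x) \<le> 2 * C * norm v"
  proof -
    have "\<forall>\<^sub>F x in nhds a. (\<Sum>b\<in>Basis. norm (A x b - A a b)) < 1 / (2 * C)"
      using C(1) by (intro order_tendstoD(2)[OF sm]) auto
    with evS show ?thesis
    proof eventually_elim
      case (elim x)
      let ?w = "?W x"
      have "norm (A x ?w - A a ?w) \<le> (\<Sum>b\<in>Basis. norm ((?w \<bullet> b) *\<^sub>R (A x b - A a b)))"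
        by (subst expand[OF elim(1)]) (rule norm_sum)
      also have "\<dots> \<le> (\<Sum>b\<in>Basis. norm ?w * norm (A x b - A a b))"
        by (intro sum_mono) (auto intro!: mult_right_mono Basis_le_norm)
      also have "\<dots> = norm ?w * (\<Sum>b\<in>Basis. norm (A x b - A a b))"
        by (simp add: sum_distrib_left)
      also have "\<dots> \<le> norm ?w * (1 / (2 * C))"
        using elim(2) by (intro mult_left_mono) auto
      finally have 1: "norm (A x ?w - A a ?w) \<le> norm ?w / (2 * C)" by simp
      have "norm ?w = norm (?I (A a ?w))" by (simp add: IA)
      also have "\<dots> \<le> norm (A a ?w) * C" by (rule C(2))
      also have "norm (A a ?w) \<le> norm (A x ?w) + norm (A x ?w - A a ?w)"
        by (metis norm_minus_commute norm_triangle_sub)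
      also have "\<dots> \<le> norm v + norm ?w / (2 * C)"
        using 1 AW[OF elim(1)] by simp
      finally have "norm ?w \<le> (norm v + norm ?w / (2 * C)) * C" using C(1) by simp
      then show ?case using C(1) by (simp add: field_simps)
    qed
  qed
  have rep: "?W x = ?W a - ?I (\<Sum>b\<in>Basis. (?W x \<bullet> b) *\<^sub>R (A x b - A a b))" if "x \<in> S" for x
  proof -
    have "?I (A x (?W x) - A a (?W x)) = ?I v - ?W x"
      using AW[OF that] by (simp add: linear_diff[OF linI] IA)
    then have "?I (\<Sum>b\<in>Basis. (?W x \<bullet> b) *\<^sub>R (A x b - A a b)) = ?I v - ?W x"
      by (subst (asm) expand[OF that])
    then show ?thesis by simp
  qed
  have contW: "isCont ?W a"
  proof -
    have "((\<lambda>x. \<Sum>b\<in>Basis. (?W x \<bullet> b) *\<^sub>R (A x b - A a b)) \<longlongrightarrow> 0) (nhds a)"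
    proof (rule Lim_null_comparison)
      show "\<forall>\<^sub>F x in nhds a. norm (\<Sum>b\<in>Basis. (?W x \<bullet> b) *\<^sub>R (A x b - A a b)) \<le> 2 * C * norm v * (\<Sum>b\<in>Basis. norm (A x b - A a b))"
        using bnd
      proof eventually_elim
        case (elim x)
        have "norm (\<Sum>b\<in>Basis. (?W x \<bullet> b) *\<^sub>R (A x b - A a b)) \<le> (\<Sum>b\<in>Basis. norm ((?W x \<bullet> b) *\<^sub>R (A x b - A a b)))"
          by (rule norm_sum)
        also have "\<dots> \<le> (\<Sum>b\<in>Basis. 2 * C * norm v * norm (A x b - A a b))"
          using elim by (intro sum_mono) (auto intro!: mult_right_mono order_trans[OF Basis_le_norm])
        finally show ?case by (simp add: sum_distrib_left)
      qed
      show "((\<lambda>x. 2 * C * norm v * (\<Sum>b\<in>Basis. norm (A x b - A a b))) \<longlongrightarrow> 0) (nhds a)"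
        using tendsto_mult_right_zero[OF sm, of "2 * C * norm v"] by simp
    qed
    from tendsto_diff[OF tendsto_const bounded_linear.tendsto[OF blinI this], of "?W a"]
    have "((\<lambda>x. ?W a - ?I (\<Sum>b\<in>Basis. (?W x \<bullet> b) *\<^sub>R (A x b - A a b))) \<longlongrightarrow> ?W a) (nhds a)"
      by (simp add: linear_0[OF linI])
    then have "(?W \<longlongrightarrow> ?W a) (nhds a)"
      by (rule Lim_transform_eventually) (use evS rep in \<open>auto elim!: eventually_mono\<close>)
    then show ?thesis using tendsto_at_iff_tendsto_nhds[of ?W a] by (simp add: continuous_at)
  qed
  have 1: "((\<lambda>x. A x b - A a b) has_derivative (\<lambda>u. dir_deriv u (\<lambda>x. A x b) a)) (at a)" for b
    using has_derivative_diff[OF has_derivative_dir_deriv[OF diff[of b]] has_derivative_const] by simp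
  have "((\<lambda>x. \<Sum>b\<in>Basis. (?W x \<bullet> b) *\<^sub>R (A x b - A a b)) has_derivative
      (\<lambda>u. \<Sum>b\<in>Basis. (?W a \<bullet> b) *\<^sub>R dir_deriv u (\<lambda>x. A x b) a)) (at a)"
    by (intro has_derivative_sum has_derivative_cont_scaleR 1)
      (auto intro: isCont_inner contW)
  from has_derivative_diff[OF has_derivative_const bounded_linear.has_derivative[OF blinI this], of "?W a"]
  have "((\<lambda>x. ?W a - ?I (\<Sum>b\<in>Basis. (?W x \<bullet> b) *\<^sub>R (A x b - A a b))) has_derivative
      (\<lambda>u. - ?I (\<Sum>b\<in>Basis. (?W a \<bullet> b) *\<^sub>R dir_deriv u (\<lambda>x. A x b) a))) (at a)" by simp
  then show ?thesis
    by (rule has_derivative_transform_within_open[OF _ S]) (metis rep)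
qed

text \<open>The derivative formula expresses derivatives of the inverse through the inverse at fixed
  basis vectors and derivatives of A; one order of smoothness therefore produces the next.\<close>

lemma smooth_on_inverse_family:
  fixes A :: "'a::real_normed_vector \<Rightarrow> 'b::euclidean_space \<Rightarrow> 'b"
  assumes S: "open S" and lin: "\<And>x. x \<in> S \<Longrightarrow> linear (A x)"
    and bij: "\<And>x. x \<in> S \<Longrightarrow> bij (A x)"
    and sm: "\<And>w. smooth_on S (\<lambda>x. A x w)"
  shows "smooth_on S (\<lambda>x. inv (A x) v)"
proof -
  have der: "((\<lambda>x. inv (A x) v) has_derivative
    (\<lambda>u. - inv (A a) (\<Sum>b\<in>Basis. (inv (A a) v \<bullet> b) *\<^sub>R dir_deriv u (\<lambda>x. A x b) a))) (at a)"
    if "a \<in> S" for v a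
    by (rule inverse_family_has_derivative[OF S that lin bij])
      (use smooth_on_differentiable[OF sm that] in auto)
  have "C_on k S (\<lambda>x. inv (A x) v)" for k v
  proof (induction k arbitrary: v)
    case 0
    show ?case
      using der by (auto intro!: continuous_at_imp_continuous_on has_derivative_continuous)
  next
    case (Suc k)
    let ?y = "\<lambda>u x. (\<Sum>b\<in>Basis. (inv (A x) v \<bullet> b) *\<^sub>R dir_deriv u (\<lambda>x. A x b) x)"
    let ?r = "\<lambda>u x. - (\<Sum>c\<in>Basis. (?y u x \<bullet> c) *\<^sub>R inv (A x) c)"
    note * = C_on_sum[OF S] C_on_bilinear[OF bounded_bilinear_scaleR S]
      C_on_blin[OF bounded_linear_minus[OF bounded_linear_ident] S]
      C_on_blin[OF bounded_linear_inner_left S]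
    have "C_on k S (?r u)" for u
      using Suc.IH smooth_on_C[OF smooth_on_dir_deriv[OF sm]] by (intro *) auto
    moreover have "?r u x = dir_deriv u (\<lambda>x. inv (A x) v) x" if "x \<in> S" for u x
    proof -
      have linI: "linear (inv (A x))"
        using lin[OF that] bij[OF that] by (metis bij_betw_def inj_linear_imp_inv_linear)
      show ?thesis
        unfolding dir_deriv_eq[OF der[OF that]] linear_Basis_expand[OF linI, of "?y u x"] by (rule refl)
    qed
    ultimately have "C_on k S (dir_deriv u (\<lambda>x. inv (A x) v))" for u
      using C_on_cong[OF S, of "?r u" "dir_deriv u (\<lambda>x. inv (A x) v)" k for u] by auto
    then show ?case using differentiableI[OF der] by simp
  qed
  then show ?thesis by (simp add: smooth_on_def)
qed

text \<open>The C1 inverse function theorem supplies g with derivative \<open>inv\<close> of the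
  derivative of f at g. Bootstrapping: if g is C^k, then so is this derivative by
  \<open>smooth_on_inverse_family\<close>, and g is C^(k+1).\<close>

theorem smooth_inverse_function:
  fixes f :: "'a::euclidean_space \<Rightarrow> 'a"
  assumes S: "open S" "a \<in> S" and sm: "smooth_on S f"
    and inj: "\<And>v. dir_deriv v f a = 0 \<Longrightarrow> v = 0"
  obtains U V g where "a \<in> U" "U \<subseteq> S" "diffeo_inverse U V f g"
proof -
  define f' where "f' x = Blinfun (\<lambda>v. dir_deriv v f x)" for x
  have bl: "bounded_linear (\<lambda>v. dir_deriv v f x)" if "x \<in> S" for x
    using smooth_on_has_derivative[OF sm that] by (rule has_derivative_bounded_linear)
  have f': "blinfun_apply (f' x) = (\<lambda>v. dir_deriv v f x)" if "x \<in> S" for x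
    unfolding f'_def by (rule bounded_linear_Blinfun_apply[OF bl[OF that]])
  have lin: "linear (\<lambda>v. dir_deriv v f a)" using bl[OF S(2)] by (rule bounded_linear.linear)
  then have injL: "Fun.inj (\<lambda>v. dir_deriv v f a)"
    using inj linear_injective_0 by blast
  then obtain I where I: "linear I" "I \<circ> (\<lambda>v. dir_deriv v f a) = id"
    using linear_injective_left_inverse[OF lin] by blast
  have "Blinfun I o\<^sub>L f' a = id_blinfun"
    using I by (intro blinfun_eqI)
      (auto simp: f'[OF S(2)] bounded_linear_Blinfun_apply linear_conv_bounded_linear fun_eq_iff)
  moreover have "continuous_on S f'"
  proof (rule continuous_on_blinfun_componentwise)
    fix i :: 'a
    show "continuous_on S (\<lambda>x. blinfun_apply (f' x) i)"
      by (rule continuous_on_eq[OF smooth_on_continuous_on[OF smooth_on_dir_deriv[OF sm, of i]]])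
        (simp add: f')
  qed
  ultimately obtain U V g g' where U: "open U" "U \<subseteq> S" "a \<in> U" "open V" and hom: "homeomorphism U V f g"
    and g: "\<And>y. y \<in> V \<Longrightarrow> (g has_derivative (g' y)) (at y)"
    and g': "\<And>y. y \<in> V \<Longrightarrow> g' y = inv (blinfun_apply (f' (g y)))"
    and bij: "\<And>y. y \<in> V \<Longrightarrow> bij (blinfun_apply (f' (g y)))"
    using inverse_function_theorem[OF S(1) _ _ S(2), of f f' "Blinfun I"]
      smooth_on_has_derivative[OF sm] f' by metis
  have UV: "f ` U = V" "g ` V = U" "\<And>x. x \<in> U \<Longrightarrow> g (f x) = x" "\<And>y. y \<in> V \<Longrightarrow> f (g y) = y"
    using hom by (auto simp: homeomorphism_def)
  have "smooth_on U (\<lambda>x. inv (\<lambda>w. dir_deriv w f x) v)" for v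
  proof (rule smooth_on_inverse_family)
    show "smooth_on U (\<lambda>x. dir_deriv w f x)" for w
      using smooth_on_subset[OF smooth_on_dir_deriv[OF sm] U(2)] .
    show "bij (\<lambda>w. dir_deriv w f x)" if "x \<in> U" for x
      using bij[of "f x"] UV that f'[of x] U(2) by auto
  qed (use U bl bounded_linear.linear in auto)
  note smI = this
  have gU: "g y \<in> S" if "y \<in> V" for y using UV U that by auto
  have "C_on k V g" for k
  proof (induction k)
    case 0
    then show ?case using hom by (simp add: homeomorphism_def)
  next
    case (Suc k)
    have "C_on k V (\<lambda>y. inv (\<lambda>w. dir_deriv w f (g y)) v)" for v
      using C_on_compose[OF U(4,1) _ smooth_on_C[OF smI] Suc.IH] UV(2) by auto
    then have "C_on k V (dir_deriv v g)" for v
      by (rule C_on_cong[OF U(4), rotated]) (use dir_deriv_eq[OF g] g' f' gU in auto)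
    then show ?case using differentiableI[OF g] by simp
  qed
  then have "diffeo_inverse U V f g"
    unfolding diffeo_inverse_def using UV U smooth_on_subset[OF sm U(2)]
    by (auto simp: smooth_on_def)
  then show ?thesis using that U by blast
qed

text \<open>Inverse function theorem for (p, u) \<mapsto> (p, \<Phi> (p, u)). The domain on which
  this map is injective serves as M and yields the uniqueness clause.\<close>

theorem smooth_implicit_function:
  fixes \<Phi> :: "'p::euclidean_space \<times> 'u::euclidean_space \<Rightarrow> 'u"
  assumes S: "open S" "(p0, u0) \<in> S" and sm: "smooth_on S \<Phi>" and z: "\<Phi> (p0, u0) = 0"
    and inj: "\<And>w. dir_deriv (0, w) \<Phi> (p0, u0) = 0 \<Longrightarrow> w = 0"
  obtains N M \<phi> where "open N" "p0 \<in> N" "smooth_on N \<phi>" "\<phi> p0 = u0"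
    "\<And>p. p \<in> N \<Longrightarrow> (p, \<phi> p) \<in> S \<and> \<Phi> (p, \<phi> p) = 0"
    "open M" "(p0, u0) \<in> M" "\<And>p u. (p, u) \<in> M \<Longrightarrow> \<Phi> (p, u) = 0 \<Longrightarrow> p \<in> N \<and> u = \<phi> p"
proof -
  let ?f = "\<lambda>z. (fst z, \<Phi> z)"
  have smf: "smooth_on S ?f"
    by (intro smooth_on_Pair smooth_on_fst smooth_on_id S sm)
  have "v = 0" if v: "dir_deriv v ?f (p0, u0) = 0" for v
  proof -
    have "(?f has_derivative (\<lambda>v. (fst v, dir_deriv v \<Phi> (p0, u0)))) (at (p0, u0))"
      by (intro has_derivative_Pair has_derivative_fst has_derivative_ident
          smooth_on_has_derivative[OF sm S(2)])
    from dir_deriv_eq[OF this, of v] v have "fst v = 0" "dir_deriv v \<Phi> (p0, u0) = 0"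
      by (auto simp: zero_prod_def)
    then show ?thesis using inj[of "snd v"] by (metis prod.collapse zero_prod_def)
  qed
  from smooth_inverse_function[OF S smf this]
  obtain U V g where U: "(p0, u0) \<in> U" "U \<subseteq> S" and d: "diffeo_inverse U V ?f g"
    by blast
  then have UV: "open U" "open V" "smooth_on V g" "?f ` U = V" "g ` V = U"
    "\<And>w. w \<in> U \<Longrightarrow> g (?f w) = w" "\<And>v. v \<in> V \<Longrightarrow> ?f (g v) = v"
    by (auto simp: diffeo_inverse_def)
  define N where "N = {p. (p, 0::'u) \<in> V}"
  define \<phi> where "\<phi> p = snd (g (p, 0))" for p
  have oN: "open N"
  proof -
    have "N = (\<lambda>p. (p, 0)) -` V" by (auto simp: N_def)
    then show ?thesis using UV(2) by (auto intro!: open_vimage continuous_intros)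
  qed
  have fg: "fst (g (p, 0)) = p" "\<Phi> (g (p, 0)) = 0" "g (p, 0) \<in> U" if "p \<in> N" for p
    using UV(7)[of "(p, 0)"] UV(5) that by (auto simp: N_def)
  show ?thesis
  proof (rule that)
    have 0: "(p0, 0) \<in> V" using UV(4) U(1) z by force
    then show "p0 \<in> N" by (simp add: N_def)
    show "smooth_on N \<phi>"
      unfolding \<phi>_def
      by (intro smooth_on_snd smooth_on_compose[of N V "\<lambda>p. (p, 0)" g] smooth_on_Pair smooth_on_id smooth_on_const oN UV)
        (auto simp: N_def)
    show "\<phi> p0 = u0" using UV(6)[OF U(1)] z by (simp add: \<phi>_def)
    show "(p, \<phi> p) \<in> S \<and> \<Phi> (p, \<phi> p) = 0" if "p \<in> N" for p
      using fg[OF that] U(2) unfolding \<phi>_def by (metis prod.collapse subsetD)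
    show "p \<in> N \<and> u = \<phi> p" if "(p, u) \<in> U" "\<Phi> (p, u) = 0" for p u
      using UV(6)[OF that(1)] UV(4) that by (force simp: N_def \<phi>_def)
  qed (use oN UV U in auto)
qed

section \<open>Extension of smooth maps and Hadamard's lemma\<close>

lemma has_derivative_zero_quadratic:
  assumes "\<forall>\<^sub>F x in nhds a. norm (f x - f a) \<le> C * norm (x - a) ^ 2"
  shows "(f has_derivative (\<lambda>_. 0)) (at a)"
  unfolding has_derivative_at_alt
proof (intro conjI allI impI)
  fix e :: real assume e: "e > 0"
  obtain d where d: "d > 0" "\<And>x. dist x a < d \<Longrightarrow> norm (f x - f a) \<le> C * norm (x - a) ^ 2"
    using assms unfolding eventually_nhds_metric by blast
  have "norm (f y - f a - 0) \<le> e * norm (y - a)" if y: "norm (y - a) < min d (e / (\<bar>C\<bar> + 1))" for y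
  proof -
    have "norm (f y - f a) \<le> C * norm (y - a) ^ 2" using d(2)[of y] y by (simp add: dist_norm)
    also have "\<dots> \<le> (\<bar>C\<bar> + 1) * norm (y - a) ^ 2" by (intro mult_right_mono) auto
    also have "\<dots> = ((\<bar>C\<bar> + 1) * norm (y - a)) * norm (y - a)" by (simp add: power2_eq_square)
    also have "\<dots> \<le> e * norm (y - a)"
      using y by (intro mult_right_mono) (auto simp: field_simps)
    finally show ?thesis by simp
  qed
  moreover have "min d (e / (\<bar>C\<bar> + 1)) > 0" using d(1) e by (simp add: add_nonneg_pos)
  ultimately show "\<exists>d>0. \<forall>y. norm (y - a) < d \<longrightarrow> norm (f y - f a - 0) \<le> e * norm (y - a)" by blast
qed (rule bounded_linear_zero)

section \<open>A smooth cutoff function\<close>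

definition flat_exp :: "nat \<Rightarrow> real \<Rightarrow> real"
  where "flat_exp m x = (if x > 0 then exp (- 1 / x) / x ^ m else 0)"

text \<open>The inequality (1 + t/n)^n \<le> exp t with t = 1/x and n = m + k + 1 gives exp (-1/x)
  \<le> (n x)^n; dividing by \<open>x^m\<close> leaves \<open>x^(k + 1)\<close>.\<close>

lemma flat_exp_le: "x > 0 \<Longrightarrow> flat_exp m x \<le> real (m + k + 1) ^ (m + k + 1) * x ^ (k + 1)"
proof -
  assume x: "x > 0"
  let ?n = "m + k + 1"
  have "(1 / x / real ?n) ^ ?n \<le> (1 + 1 / x / real ?n) ^ ?n"
    using x by (intro power_mono) auto
  also have "\<dots> \<le> exp (1 / x)"
    using x by (intro exp_ge_one_plus_x_over_n_power_n) (auto intro: order_trans[of _ 0])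
  finally have "exp (- (1 / x)) \<le> inverse ((1 / x / real ?n) ^ ?n)"
    unfolding exp_minus using x by (intro le_imp_inverse_le) (auto intro!: zero_less_power divide_pos_pos)
  also have "\<dots> = (real ?n * x) ^ ?n" using x by (simp add: power_inverse[symmetric] field_simps)
  finally have "exp (- 1 / x) / x ^ m \<le> (real ?n * x) ^ ?n / x ^ m"
    using x by (intro divide_right_mono) auto
  also have "\<dots> = real ?n ^ ?n * x ^ (k + 1)"
    using x by (simp add: power_mult_distrib power_add)
  finally show ?thesis using x by (simp add: flat_exp_def)
qed

text \<open>The denominators \<open>x^m\<close> make the family closed under differentiation up to
  linear combinations. At 0 the quadratic bound from \<open>flat_exp_le\<close> with k = 1 forces
  the derivative to be 0.\<close>

lemma flat_exp_has_derivative: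
  "(flat_exp m has_real_derivative (flat_exp (m + 2) x - real m * flat_exp (m + 1) x)) (at x)"
proof (cases "x = 0")
  case True
  have "norm (flat_exp m y - flat_exp m 0) \<le> (real (m + 2) ^ (m + 2)) * norm (y - 0) ^ 2" for y
    using flat_exp_le[of y m 1] by (cases "y > 0") (auto simp: flat_exp_def numeral_2_eq_2)
  then have "(flat_exp m has_derivative (\<lambda>_. 0)) (at 0)"
    by (intro has_derivative_zero_quadratic[where C = "real (m + 2) ^ (m + 2)"]) (auto intro: always_eventually)
  then show ?thesis using True by (simp add: has_field_derivative_def flat_exp_def lambda_zero)
next
  case False
  show ?thesis
  proof (cases "x > 0")
    case True
    have "((\<lambda>x. exp (- 1 / x) / x ^ m) has_real_derivative
       (exp (- 1 / x) / x ^ (m + 2) - real m * (exp (- 1 / x) / x ^ (m + 1)))) (at x)"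
    proof -
      have "real m * x ^ (m - 1) * x = real m * x ^ m" by (cases m) auto
      then show ?thesis using True
        by (auto intro!: derivative_eq_intros simp: divide_simps power2_eq_square) (auto simp: algebra_simps)
    qed
    then have "(flat_exp m has_real_derivative
       (exp (- 1 / x) / x ^ (m + 2) - real m * (exp (- 1 / x) / x ^ (m + 1)))) (at x)"
      by (rule has_field_derivative_transform_within_open[where S = "{0<..}"])
        (use True in \<open>auto simp: flat_exp_def\<close>)
    then show ?thesis using True by (simp add: flat_exp_def)
  next
    case neg: False
    have "(flat_exp m has_real_derivative 0) (at x)"
      by (rule has_field_derivative_transform_within_open[where S = "{..<0}" and f = "\<lambda>_. 0"])
        (use False neg in \<open>auto simp: flat_exp_def\<close>)
    then show ?thesis using neg by (simp add: flat_exp_def)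
  qed
qed

lemma smooth_on_flat_exp: "smooth_on UNIV (flat_exp m)"
proof -
  have "C_on k UNIV (flat_exp m)" for k m
  proof (induction k arbitrary: m)
    case 0
    show ?case
      using DERIV_isCont[OF flat_exp_has_derivative] by (auto intro!: continuous_at_imp_continuous_on)
  next
    case (Suc k)
    have "dir_deriv v (flat_exp m) = (\<lambda>x. v * (flat_exp (m + 2) x + (- real m) * flat_exp (m + 1) x))" for v
      using dir_deriv_eq[OF flat_exp_has_derivative[unfolded has_field_derivative_def]] by (auto simp: algebra_simps)
    moreover have "C_on k UNIV (\<lambda>x. v * (flat_exp (m + 2) x + (- real m) * flat_exp (m + 1) x))" for v
      by (intro C_on_blin[OF bounded_linear_mult_right] C_on_add Suc.IH open_UNIV)
    ultimately show ?case
      using flat_exp_has_derivative differentiableI unfolding has_field_derivative_def by fastforce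
  qed
  then show ?thesis by (simp add: smooth_on_def)
qed

text \<open>The two half-lines s < 1 and s > 1/2 cover the line, so the denominator is positive. The
  argument is meant to be a squared norm, which is smooth at the origin as well.\<close>

definition cutoff :: "real \<Rightarrow> real"
  where "cutoff s = flat_exp 0 (1 - s) / (flat_exp 0 (1 - s) + flat_exp 0 (s - 1 / 2))"

lemma flat_exp_0_pos: "x > 0 \<Longrightarrow> flat_exp 0 x > 0"
  and flat_exp_0_nonneg: "flat_exp 0 x \<ge> 0"
  and flat_exp_0_eq_0: "x \<le> 0 \<Longrightarrow> flat_exp 0 x = 0"
  by (auto simp: flat_exp_def)

lemma cutoff_denom: "flat_exp 0 (1 - s) + flat_exp 0 (s - 1 / 2) > 0"
proof (cases "s < 1")
  case True
  then show ?thesis by (intro add_pos_nonneg flat_exp_0_pos flat_exp_0_nonneg) auto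
next
  case False
  then show ?thesis by (intro add_nonneg_pos flat_exp_0_pos flat_exp_0_nonneg) auto
qed

lemma smooth_on_cutoff: "smooth_on UNIV cutoff"
proof -
  have "flat_exp 0 (1 - s) + flat_exp 0 (s - 1 / 2) \<noteq> 0" for s
    using cutoff_denom[of s] by linarith
  then show ?thesis
    unfolding cutoff_def
    by (intro smooth_on_divide smooth_on_add smooth_on_compose_UNIV[OF _ smooth_on_flat_exp] smooth_on_diff
        smooth_on_const smooth_on_id open_UNIV) blast
qed

lemma cutoff_eq_1: "s \<le> 1 / 2 \<Longrightarrow> cutoff s = 1"
  using cutoff_denom[of s] by (simp add: cutoff_def flat_exp_0_eq_0)

lemma cutoff_eq_0: "s \<ge> 1 \<Longrightarrow> cutoff s = 0"
  by (simp add: cutoff_def flat_exp_0_eq_0)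

lemma flat_exp_0_mono: "x \<le> y \<Longrightarrow> flat_exp 0 x \<le> flat_exp 0 y"
  by (auto simp: flat_exp_def frac_le divide_left_mono)

text \<open>Cross-multiplied, the claim is a product of two monotone estimates for
  \<open>flat_exp 0\<close>. The sign of \<open>deriv cutoff\<close> that follows makes
  \<open>kernel_mass\<close> nonzero.\<close>

lemma cutoff_antimono: "s \<le> t \<Longrightarrow> cutoff t \<le> cutoff s"
proof -
  assume st: "s \<le> t"
  let ?a = "\<lambda>s. flat_exp 0 (1 - s)" and ?b = "\<lambda>s. flat_exp 0 (s - 1 / 2)"
  have "?a t * ?b s \<le> ?a s * ?b t"
    using st by (intro mult_mono flat_exp_0_mono flat_exp_0_nonneg) auto
  then have "?a t * (?a s + ?b s) \<le> ?a s * (?a t + ?b t)" by (simp add: algebra_simps)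
  then show ?thesis
    unfolding cutoff_def using cutoff_denom[of s] cutoff_denom[of t] by (simp add: divide_le_eq le_divide_eq mult.commute)
qed

lemma smooth_on_norm_sq:
  fixes a :: "'a::euclidean_space"
  shows "smooth_on UNIV (\<lambda>x. norm (x - a) ^ 2)"
  unfolding power2_norm_eq_inner
  by (intro smooth_on_bilinear[OF bounded_bilinear_inner] smooth_on_diff smooth_on_id smooth_on_const open_UNIV)

text \<open>Multiplication by a cutoff around a makes local data global without changing them near
  a. Later constructions can then ignore domains and work with functions smooth on the whole
  space.\<close>

lemma smooth_extension:
  fixes f :: "'a::euclidean_space \<Rightarrow> 'b::real_normed_vector"
  assumes "open S" "a \<in> S" "smooth_on S f"
  obtains F e where "smooth_on UNIV F" "e > 0" "\<And>x. dist x a < e \<Longrightarrow> x \<in> S \<and> F x = f x"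
proof -
  obtain r where r: "r > 0" "cball a r \<subseteq> S" using assms(1,2) open_contains_cball by blast
  define c where "c x = cutoff (norm (x - a) ^ 2 / r ^ 2)" for x
  define F where "F x = (if x \<in> S then c x *\<^sub>R f x else 0)" for x
  have smc: "smooth_on UNIV c"
    unfolding c_def
    by (intro smooth_on_compose_UNIV[OF _ smooth_on_cutoff] smooth_on_divide smooth_on_norm_sq smooth_on_const open_UNIV)
      (use r in auto)
  have "smooth_on S (\<lambda>x. c x *\<^sub>R f x)"
    by (intro smooth_on_scaleR assms smooth_on_subset[OF smc]) auto
  then have "smooth_on S F" by (rule smooth_on_cong[OF assms(1), rotated]) (simp add: F_def)
  moreover have "smooth_on (- cball a r) F"
  proof (rule smooth_on_cong[OF _ _ smooth_on_const[of _ 0]])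
    fix x assume "x \<in> - cball a r"
    then have "norm (x - a) > r" by (simp add: dist_norm norm_minus_commute)
    then have "norm (x - a) ^ 2 \<ge> r ^ 2" using r by (intro power_mono) auto
    then show "0 = F x" using r by (simp add: F_def c_def cutoff_eq_0)
  qed auto
  moreover have "S \<union> - cball a r = UNIV" using r by auto
  ultimately have "smooth_on UNIV F" using smooth_on_Un[OF assms(1), of "- cball a r" F] by auto
  moreover have "x \<in> S \<and> F x = f x" if "dist x a < r / 2" for x
  proof -
    have "norm (x - a) ^ 2 \<le> (r / 2) ^ 2" using that r by (intro power_mono) (auto simp: dist_norm)
    then have "norm (x - a) ^ 2 \<le> r ^ 2 / 4" by (simp add: power_divide)
    moreover have "0 \<le> norm (x - a) ^ 2" by simp
    ultimately have "norm (x - a) ^ 2 * 2 \<le> r ^ 2" by linarith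
    then have "norm (x - a) ^ 2 / r ^ 2 \<le> 1 / 2" using r by (simp add: field_simps)
    moreover have "x \<in> S" using that r by (auto simp: dist_commute)
    ultimately show ?thesis by (simp add: F_def c_def cutoff_eq_1)
  qed
  ultimately show ?thesis using that[of F "r / 2"] r by auto
qed

section \<open>Integrals depending on parameters and Hadamard's lemma\<close>

lemma integral_param_has_derivative:
  fixes g :: "'z::euclidean_space \<times> 'q::euclidean_space \<Rightarrow> 'c::banach"
  assumes sm: "smooth_on UNIV g"
  shows "((\<lambda>q. integral (cbox a b) (\<lambda>z. g (z, q))) has_derivative
    (\<lambda>v. integral (cbox a b) (\<lambda>z. dir_deriv (0, v) g (z, q)))) (at q)"
proof -
  define fx where "fx q z = Blinfun (\<lambda>v. dir_deriv (0, v) g (z, q))" for q z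
  have der: "((\<lambda>q. g (z, q)) has_derivative (\<lambda>v. dir_deriv (0, v) g (z, q))) (at q)" for z q
    by (rule has_derivative_compose[OF has_derivative_Pair[OF has_derivative_const has_derivative_ident]
        smooth_on_has_derivative[OF sm]]) simp
  have fx: "blinfun_apply (fx q z) = (\<lambda>v. dir_deriv (0, v) g (z, q))" for z q
    unfolding fx_def by (rule bounded_linear_Blinfun_apply[OF has_derivative_bounded_linear[OF der]])
  have swap: "continuous_on (UNIV \<times> cbox a b) (\<lambda>(q, z). h (z, q))" if "smooth_on UNIV h"
    for h :: "'z \<times> 'q \<Rightarrow> 'c"
    unfolding case_prod_unfold
    by (rule continuous_on_compose2[OF smooth_on_continuous_on[OF that]]) (auto intro!: continuous_intros)
  have cont: "continuous_on (UNIV \<times> cbox a b) (\<lambda>(q, z). fx q z)"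
    unfolding case_prod_unfold
  proof (rule continuous_on_blinfun_componentwise)
    fix i :: 'q
    show "continuous_on (UNIV \<times> cbox a b) (\<lambda>x. blinfun_apply (fx (fst x) (snd x)) i)"
      using swap[OF smooth_on_dir_deriv[OF sm, of "(0, i)"]] unfolding fx case_prod_unfold .
  qed
  have int: "(\<lambda>z. h (z, q)) integrable_on cbox a b" if "smooth_on UNIV h" for h :: "'z \<times> 'q \<Rightarrow> 'c" and q
    by (rule integrable_continuous, rule continuous_on_compose2[OF smooth_on_continuous_on[OF that]])
      (auto intro!: continuous_intros)
  have 1: "((\<lambda>q. integral (cbox a b) (\<lambda>z. g (z, q))) has_derivative blinfun_apply (integral (cbox a b) (fx q))) (at q within UNIV)"
    by (rule leibniz_rule[OF _ int[OF sm] cont]) (auto simp: fx der has_derivative_at_withinI)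
  have 2: "blinfun_apply (integral (cbox a b) (fx q)) v = integral (cbox a b) (\<lambda>z. dir_deriv (0, v) g (z, q))" for v
  proof -
    have "continuous_on (cbox a b) (fx q)"
      using continuous_on_compose2[OF cont, of "cbox a b" "\<lambda>z. (q, z)"]
      by (simp add: continuous_on_Pair continuous_on_const continuous_on_id image_subset_iff)
    then have "fx q integrable_on cbox a b" by (rule integrable_continuous)
    from blinfun_apply_integral[OF this] show ?thesis by (simp add: fx)
  qed
  show ?thesis by (rule has_derivative_eq_rhs[OF 1]) (rule ext, rule 2)
qed

lemma smooth_on_integral:
  fixes g :: "'z::euclidean_space \<times> 'q::euclidean_space \<Rightarrow> 'c::banach"
  assumes "smooth_on UNIV g"
  shows "smooth_on UNIV (\<lambda>q. integral (cbox a b) (\<lambda>z. g (z, q)))"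
proof (rule smooth_on_coinduct[where P = "\<lambda>F. \<exists>g. smooth_on UNIV g \<and> F = (\<lambda>q. integral (cbox a b) (\<lambda>z. g (z, q)))"])
  show "\<exists>g'. smooth_on UNIV g' \<and> (\<lambda>q. integral (cbox a b) (\<lambda>z. g (z, q))) = (\<lambda>q. integral (cbox a b) (\<lambda>z. g' (z, q)))"
    using assms by blast
next
  fix F x assume "\<exists>g. smooth_on UNIV g \<and> F = (\<lambda>q::'q. integral (cbox a b) (\<lambda>z. g (z, q)) :: 'c)"
  then show "F differentiable (at x)" using integral_param_has_derivative differentiableI by blast
next
  fix F v assume "\<exists>g. smooth_on UNIV g \<and> F = (\<lambda>q::'q. integral (cbox a b) (\<lambda>z. g (z, q)) :: 'c)"
  then obtain g where g: "smooth_on UNIV g" "F = (\<lambda>q. integral (cbox a b) (\<lambda>z. g (z, q)))" by blast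
  have "dir_deriv v F = (\<lambda>q. integral (cbox a b) (\<lambda>z. dir_deriv (0, v) g (z, q)))"
    unfolding g(2) by (rule ext) (rule dir_deriv_eq[OF integral_param_has_derivative[OF g(1)]])
  then show "\<exists>g. smooth_on UNIV g \<and> dir_deriv v F = (\<lambda>q. integral (cbox a b) (\<lambda>z. g (z, q)))"
    using smooth_on_dir_deriv[OF g(1)] by blast
qed

text \<open>Integrating the derivative along the segment t \<mapsto> (p, t l) and expanding it in
  the directions of l gives coefficients that are integrals over [0, 1], hence smooth in (p,
  l).\<close>

lemma Hadamard:
  fixes f :: "'p::euclidean_space \<times> 'l::euclidean_space \<Rightarrow> real"
  assumes sm: "smooth_on UNIV f" and z: "\<And>p. f (p, 0) = 0"
  obtains E where "\<And>b. smooth_on UNIV (E b)" "\<And>p l. f (p, l) = (\<Sum>b\<in>Basis. (l \<bullet> b) * E b (p, l))"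
    "\<And>b p. E b (p, 0) = dir_deriv (0, b) f (p, 0)"
proof
  define E where "E b q = integral (cbox 0 1) (\<lambda>t. dir_deriv (0, b) f (fst q, t *\<^sub>R snd q))" for b q
  have smI: "smooth_on UNIV (\<lambda>w. dir_deriv (0, b) f (fst (snd w), fst w *\<^sub>R snd (snd w)))"
    for b :: 'l
    by (rule smooth_on_compose_UNIV[OF _ smooth_on_dir_deriv[OF sm]])
      (intro smooth_on_Pair smooth_on_scaleR smooth_on_fst smooth_on_snd smooth_on_id open_UNIV)+
  show "smooth_on UNIV (E b)" for b
    using smooth_on_integral[OF smI, of 0 1 b] by (simp add: E_def[abs_def])
  show "E b (p, 0) = dir_deriv (0, b) f (p, 0)" for b p
    by (simp add: E_def)
  fix p l
  let ?D = "\<lambda>t b. dir_deriv (0, b) f (p, t *\<^sub>R l)"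
  have int: "(\<lambda>t. ?D t b) integrable_on {0..1}" for b
    by (rule integrable_continuous_interval, rule continuous_on_compose2[OF smooth_on_continuous_on[OF smooth_on_dir_deriv[OF sm]]])
      (auto intro!: continuous_intros)
  have "((\<lambda>t. f (p, t *\<^sub>R l)) has_vector_derivative ?D t l) (at t)" for t
  proof -
    have "((\<lambda>t. f (p, t *\<^sub>R l)) has_derivative (\<lambda>h. dir_deriv (0, h *\<^sub>R l) f (p, t *\<^sub>R l))) (at t)"
      by (rule has_derivative_compose[OF has_derivative_Pair[OF has_derivative_const
          has_derivative_scaleR_left[OF has_derivative_ident]] smooth_on_has_derivative[OF sm]]) simp
    moreover have "dir_deriv (0, h *\<^sub>R l) f (p, t *\<^sub>R l) = h *\<^sub>R ?D t l" for h
      using linear_cmul[OF dir_deriv_linear[OF smooth_on_differentiable[OF sm UNIV_I]], of h "(0, l)"]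
      by (simp add: zero_prod_def)
    ultimately show ?thesis by (simp add: has_vector_derivative_def)
  qed
  then have "((\<lambda>t. ?D t l) has_integral (f (p, 1 *\<^sub>R l) - f (p, 0 *\<^sub>R l))) {0..1}"
    by (intro fundamental_theorem_of_calculus) (auto intro: has_vector_derivative_at_within)
  then have "f (p, l) = integral {0..1} (\<lambda>t. ?D t l)" using z by (simp add: integral_unique)
  also have "(\<lambda>t. ?D t l) = (\<lambda>t. \<Sum>b\<in>Basis. (l \<bullet> b) * ?D t b)"
  proof
    fix t
    have "linear (?D t)"
      using linear_compose[of "\<lambda>b. (0, b)", OF _ dir_deriv_linear[OF smooth_on_differentiable[OF sm UNIV_I, of "(p, t *\<^sub>R l)"]]]
      by (simp add: o_def linear_iff)
    from linear_Basis_expand[OF this, of l] show "?D t l = (\<Sum>b\<in>Basis. (l \<bullet> b) * ?D t b)" by simp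
  qed
  also have "integral {0..1} \<dots> = (\<Sum>b\<in>Basis. integral {0..1} (\<lambda>t. (l \<bullet> b) * ?D t b))"
    by (rule integral_sum) (auto intro: integrable_on_mult_right int)
  also have "\<dots> = (\<Sum>b\<in>Basis. (l \<bullet> b) * E b (p, l))"
    by (simp add: E_def)
  finally show "f (p, l) = (\<Sum>b\<in>Basis. (l \<bullet> b) * E b (p, l))" .
qed

lemma smooth_divide_id:
  fixes f :: "real \<Rightarrow> real"
  assumes "smooth_on UNIV f"
  obtains g where "smooth_on UNIV g" "\<And>x. f x = f 0 + x * g x"
proof -
  have sm: "smooth_on UNIV (\<lambda>w::real \<times> real. f (snd w) - f 0)"
    by (intro smooth_on_diff smooth_on_const smooth_on_compose_UNIV[OF _ assms] smooth_on_snd smooth_on_id open_UNIV)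
  have z: "f (snd (p, 0)) - f 0 = 0" for p :: real by simp
  show ?thesis
  proof (rule Hadamard[OF sm z])
    fix E :: "real \<Rightarrow> real \<times> real \<Rightarrow> real"
    assume E: "\<And>b. smooth_on UNIV (E b)"
      "\<And>p l. f (snd (p, l)) - f 0 = (\<Sum>b\<in>Basis. (l \<bullet> b) * E b (p, l))"
    have "smooth_on UNIV (\<lambda>x. E 1 (0, x))"
      by (intro smooth_on_compose_UNIV[OF _ E(1)] smooth_on_Pair smooth_on_const smooth_on_id open_UNIV)
    moreover have "f x = f 0 + x * E 1 (0, x)" for x using E(2)[of 0 x] by simp
    ultimately show ?thesis by (rule that)
  qed
qed

section \<open>Flat functions\<close>

abbreviation smooth :: "('a::real_normed_vector \<Rightarrow> 'b::real_normed_vector) \<Rightarrow> bool"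
  where "smooth \<equiv> smooth_on UNIV"

lemmas smooth_UNIV_intros = smooth_on_const smooth_on_id[OF open_UNIV] smooth_on_add[OF open_UNIV]
  smooth_on_minus[OF open_UNIV] smooth_on_diff[OF open_UNIV] smooth_on_mult[OF open_UNIV]
  smooth_on_scaleR[OF open_UNIV] smooth_on_power[OF open_UNIV] smooth_on_sum[OF open_UNIV]
  smooth_on_Pair[OF open_UNIV] smooth_on_fst[OF open_UNIV] smooth_on_snd[OF open_UNIV]

lemma smooth_differentiable: "smooth f \<Longrightarrow> f differentiable (at x)"
  by (simp add: smooth_on_differentiable)

lemma smooth_of_real: "smooth f \<Longrightarrow> smooth (\<lambda>x. of_real (f x) :: 'b::real_normed_algebra_1)"
  by (rule smooth_on_blin[OF bounded_linear_of_real open_UNIV])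

lemma smooth_cnj: "smooth f \<Longrightarrow> smooth (\<lambda>x. cnj (f x))"
  by (rule smooth_on_blin[OF bounded_linear_cnj open_UNIV])

lemma smooth_divide_const:
  fixes f :: "'a::real_normed_vector \<Rightarrow> 'b::real_normed_field"
  shows "smooth f \<Longrightarrow> smooth (\<lambda>x. f x / c)"
  unfolding divide_inverse by (intro smooth_UNIV_intros)

lemma smooth_coinduct_Basis:
  fixes f :: "'a::euclidean_space \<Rightarrow> 'b::real_normed_vector"
  assumes "P f" and "\<And>g x. P g \<Longrightarrow> g differentiable (at x)"
    and "\<And>g b. P g \<Longrightarrow> b \<in> Basis \<Longrightarrow> P (dir_deriv b g)"
  shows "smooth f"
proof -
  have "C_on k UNIV g" if "P g" for k g
    using that
  proof (induction k arbitrary: g)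
    case 0
    then show ?case
      using assms(2) by (auto intro!: continuous_at_imp_continuous_on differentiable_imp_continuous_within)
  qed (use assms C_on_SucI_Basis[OF open_UNIV] in blast)
  then show ?thesis using assms(1) by (simp add: smooth_on_def)
qed

abbreviation pd :: "'a list \<Rightarrow> ('a::real_normed_vector \<Rightarrow> 'b::real_normed_vector) \<Rightarrow> 'a \<Rightarrow> 'b"
  where "pd \<equiv> fold dir_deriv"

lemma smooth_pd: "smooth f \<Longrightarrow> smooth (pd vs f)"
  by (induction vs arbitrary: f) (auto intro: smooth_on_dir_deriv)

lemma dir_deriv_add_smooth:
  "smooth f \<Longrightarrow> smooth g \<Longrightarrow> dir_deriv v (\<lambda>x. f x + g x) = (\<lambda>x. dir_deriv v f x + dir_deriv v g x)"
  by (rule ext) (intro dir_deriv_add smooth_differentiable)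

lemma dir_deriv_mult_smooth:
  fixes f g :: "'a::real_normed_vector \<Rightarrow> 'b::real_normed_algebra"
  shows "smooth f \<Longrightarrow> smooth g \<Longrightarrow>
    dir_deriv v (\<lambda>x. f x * g x) = (\<lambda>x. f x * dir_deriv v g x + dir_deriv v f x * g x)"
  by (rule ext) (intro dir_deriv_bilinear[OF bounded_bilinear_mult] smooth_differentiable)

lemma dir_deriv_sum_smooth:
  assumes "\<And>i. i \<in> I \<Longrightarrow> smooth (f i)"
  shows "dir_deriv v (\<lambda>x. \<Sum>i\<in>I. f i x) = (\<lambda>x. \<Sum>i\<in>I. dir_deriv v (f i) x)"
  by (rule ext) (rule dir_deriv_eq has_derivative_sum smooth_on_has_derivative assms UNIV_I | assumption)+

lemma pd_add: "smooth f \<Longrightarrow> smooth g \<Longrightarrow> pd vs (\<lambda>x. f x + g x) = (\<lambda>x. pd vs f x + pd vs g x)"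
  by (induction vs arbitrary: f g) (simp_all add: dir_deriv_add_smooth smooth_on_dir_deriv)

lemma pd_sum:
  "(\<And>i. i \<in> I \<Longrightarrow> smooth (f i)) \<Longrightarrow> pd vs (\<lambda>x. \<Sum>i\<in>I. f i x) = (\<lambda>x. \<Sum>i\<in>I. pd vs (f i) x)"
  by (induction vs arbitrary: f) (simp_all add: dir_deriv_sum_smooth smooth_on_dir_deriv)

lemma pd_cong_open:
  assumes "open S" "\<And>x. x \<in> S \<Longrightarrow> f x = g x" "x \<in> S"
  shows "pd vs f x = pd vs g x"
  using assms(2,3)
proof (induction vs arbitrary: f g)
  case (Cons v vs)
  show ?case using Cons.IH[of "dir_deriv v f" "dir_deriv v g"] Cons.prems
      dir_deriv_cong_open[OF assms(1), of _ f g] by simp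
qed simp

lemma smooth_bounded:
  fixes f :: "'a::euclidean_space \<Rightarrow> 'b::real_normed_vector"
  assumes "smooth f"
  obtains C where "C \<ge> 0" "\<And>x. norm x \<le> R \<Longrightarrow> norm (f x) \<le> C"
proof -
  have "compact (f ` cball 0 R)"
    using smooth_on_continuous_on[OF assms]
    by (intro compact_continuous_image) (auto intro: continuous_on_subset)
  then obtain C where "C > 0" "\<forall>y\<in>f ` cball 0 R. norm y \<le> C"
    using compact_imp_bounded bounded_pos by metis
  then show ?thesis using that[of C] by auto
qed

text \<open>Only basis directions are differentiated, so each order involves finitely many
  derivatives; the choice of scales in Borel's construction relies on this finiteness.\<close>

definition weighted :: "('a::euclidean_space \<Rightarrow> real) \<Rightarrow> ('a \<Rightarrow> complex) \<Rightarrow> bool"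
  where "weighted \<omega> a \<longleftrightarrow> smooth a \<and>
    (\<forall>vs\<in>lists Basis. \<forall>R. \<exists>C\<ge>0. \<forall>x. norm x \<le> R \<longrightarrow> norm (pd vs a x) \<le> C * \<omega> x)"

text \<open>Infinite-order vanishing is measured by powers of \<rho> instead of the zero set of
  \<rho>. This quantitative form permits division by any smooth p that dominates \<rho>.\<close>

definition flat :: "('a::euclidean_space \<Rightarrow> real) \<Rightarrow> ('a \<Rightarrow> complex) \<Rightarrow> bool"
  where "flat \<rho> a \<longleftrightarrow> (\<forall>N. weighted (\<lambda>x. \<rho> x ^ N) a)"

lemma weighted_smooth: "weighted \<omega> a \<Longrightarrow> smooth a"
  by (simp add: weighted_def)

lemma weightedD:
  assumes "weighted \<omega> a" "vs \<in> lists Basis"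
  shows "\<exists>C\<ge>0. \<forall>x. norm x \<le> R \<longrightarrow> norm (pd vs a x) \<le> C * \<omega> x"
  using assms unfolding weighted_def by blast

lemma weighted_dir_deriv: "weighted \<omega> a \<Longrightarrow> b \<in> Basis \<Longrightarrow> weighted \<omega> (dir_deriv b a)"
  unfolding weighted_def
  by (metis (no_types, lifting) fold_simps(2) lists.Cons smooth_on_dir_deriv)

lemma smooth_weighted_1: "smooth a \<Longrightarrow> weighted (\<lambda>_. 1) a"
  unfolding weighted_def by (metis mult.right_neutral smooth_bounded smooth_pd)

lemma weighted_mono:
  assumes "weighted \<omega> a" "\<And>R. \<exists>C\<ge>0. \<forall>x. norm x \<le> R \<longrightarrow> \<omega> x \<le> C * \<omega>' x"
  shows "weighted \<omega>' a"
  unfolding weighted_def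
proof (intro conjI ballI allI)
  show "smooth a" using assms(1) by (rule weighted_smooth)
  fix vs :: "'a list" and R :: real assume vs: "vs \<in> lists Basis"
  obtain C where C: "C \<ge> 0" "\<And>x. norm x \<le> R \<Longrightarrow> norm (pd vs a x) \<le> C * \<omega> x"
    using weightedD[OF assms(1) vs, of R] by blast
  obtain D where D: "D \<ge> 0" "\<And>x. norm x \<le> R \<Longrightarrow> \<omega> x \<le> D * \<omega>' x"
    using assms(2) by blast
  have "norm (pd vs a x) \<le> (C * D) * \<omega>' x" if "norm x \<le> R" for x
    using C(2)[OF that] mult_left_mono[OF D(2)[OF that] C(1)] by simp
  then show "\<exists>C\<ge>0. \<forall>x. norm x \<le> R \<longrightarrow> norm (pd vs a x) \<le> C * \<omega>' x"
    using C(1) D(1) by (intro exI[of _ "C * D"]) auto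
qed

lemma weighted_add:
  assumes "weighted \<omega> a" "weighted \<omega> b"
  shows "weighted \<omega> (\<lambda>x. a x + b x)"
  unfolding weighted_def
proof (intro conjI ballI allI)
  show "smooth (\<lambda>x. a x + b x)" using assms by (intro smooth_UNIV_intros weighted_smooth)
  fix vs :: "'a list" and R :: real assume vs: "vs \<in> lists Basis"
  obtain C where C: "C \<ge> 0" "\<And>x. norm x \<le> R \<Longrightarrow> norm (pd vs a x) \<le> C * \<omega> x"
    using weightedD[OF assms(1) vs, of R] by blast
  obtain D where D: "D \<ge> 0" "\<And>x. norm x \<le> R \<Longrightarrow> norm (pd vs b x) \<le> D * \<omega> x"
    using weightedD[OF assms(2) vs, of R] by blast
  have "norm (pd vs (\<lambda>x. a x + b x) x) \<le> (C + D) * \<omega> x" if "norm x \<le> R" for x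
    using C(2)[OF that] D(2)[OF that] norm_triangle_ineq[of "pd vs a x" "pd vs b x"]
    unfolding pd_add[OF assms[THEN weighted_smooth]] by (simp add: distrib_right)
  then show "\<exists>C\<ge>0. \<forall>x. norm x \<le> R \<longrightarrow> norm (pd vs (\<lambda>x. a x + b x) x) \<le> C * \<omega> x"
    using C(1) D(1) by (intro exI[of _ "C + D"]) auto
qed

lemma weighted_mult:
  assumes a: "weighted \<omega> a" and b: "weighted \<omega>' b"
  shows "weighted (\<lambda>x. \<omega> x * \<omega>' x) (\<lambda>x. a x * b x)"
proof -
  have "\<exists>C\<ge>0. \<forall>x. norm x \<le> R \<longrightarrow> norm (pd vs (\<lambda>x. a x * b x) x) \<le> C * (\<omega> x * \<omega>' x)"
    if "vs \<in> lists Basis" "weighted \<omega> a" "weighted \<omega>' b" for vs R a b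
    using that
  proof (induction vs arbitrary: a b rule: list.induct)
    case Nil
    obtain C where C: "C \<ge> 0" "\<And>x. norm x \<le> R \<Longrightarrow> norm (a x) \<le> C * \<omega> x"
      using weightedD[OF Nil(2) lists.Nil, of R] by auto
    obtain D where D: "D \<ge> 0" "\<And>x. norm x \<le> R \<Longrightarrow> norm (b x) \<le> D * \<omega>' x"
      using weightedD[OF Nil(3) lists.Nil, of R] by auto
    have "norm (a x * b x) \<le> (C * D) * (\<omega> x * \<omega>' x)" if "norm x \<le> R" for x
      using mult_mono[OF C(2)[OF that] D(2)[OF that]] order_trans[OF norm_ge_zero C(2)[OF that]]
      by (simp add: norm_mult mult_ac)
    then show ?case using C(1) D(1) by (intro exI[of _ "C * D"]) auto
  next
    case (Cons v vs)
    have v: "v \<in> Basis" "vs \<in> lists Basis" using Cons.prems by auto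
    note d = weighted_dir_deriv[OF Cons.prems(2) v(1)] weighted_dir_deriv[OF Cons.prems(3) v(1)]
    obtain C where C: "C \<ge> 0" "\<And>x. norm x \<le> R \<Longrightarrow> norm (pd vs (\<lambda>x. a x * dir_deriv v b x) x) \<le> C * (\<omega> x * \<omega>' x)"
      using Cons.IH[OF v(2) Cons.prems(2) d(2)] by blast
    obtain D where D: "D \<ge> 0" "\<And>x. norm x \<le> R \<Longrightarrow> norm (pd vs (\<lambda>x. dir_deriv v a x * b x) x) \<le> D * (\<omega> x * \<omega>' x)"
      using Cons.IH[OF v(2) d(1) Cons.prems(3)] by blast
    have sm: "smooth a" "smooth b" using Cons.prems by (auto intro: weighted_smooth)
    have eq: "pd (v # vs) (\<lambda>x. a x * b x) =
      (\<lambda>x. pd vs (\<lambda>x. a x * dir_deriv v b x) x + pd vs (\<lambda>x. dir_deriv v a x * b x) x)"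
      using sm by (simp add: dir_deriv_mult_smooth pd_add smooth_UNIV_intros smooth_on_dir_deriv)
    have "norm (pd (v # vs) (\<lambda>x. a x * b x) x) \<le> (C + D) * (\<omega> x * \<omega>' x)" if "norm x \<le> R" for x
      unfolding eq distrib_right by (rule norm_triangle_le[OF add_mono[OF C(2)[OF that] D(2)[OF that]]])
    then show ?case using C(1) D(1) by (intro exI[of _ "C + D"]) auto
  qed
  moreover have "smooth (\<lambda>x. a x * b x)"
    by (intro smooth_UNIV_intros weighted_smooth[OF a] weighted_smooth[OF b])
  ultimately show ?thesis
    unfolding weighted_def[of "\<lambda>x. \<omega> x * \<omega>' x"] using a b by blast
qed

lemma weighted_mult_smooth:
  assumes "weighted \<omega> a" "smooth b"
  shows "weighted \<omega> (\<lambda>x. a x * b x)"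
  using weighted_mult[OF assms(1) smooth_weighted_1[OF assms(2)]] by simp

lemma flat_smooth: "flat \<rho> a \<Longrightarrow> smooth a"
  unfolding flat_def using weighted_smooth by blast

lemma flat_dir_deriv: "flat \<rho> a \<Longrightarrow> b \<in> Basis \<Longrightarrow> flat \<rho> (dir_deriv b a)"
  by (auto simp: flat_def weighted_dir_deriv)

lemma flat_add: "flat \<rho> a \<Longrightarrow> flat \<rho> b \<Longrightarrow> flat \<rho> (\<lambda>x. a x + b x)"
  by (auto simp: flat_def weighted_add)

lemma flat_mult_smooth: "flat \<rho> a \<Longrightarrow> smooth b \<Longrightarrow> flat \<rho> (\<lambda>x. a x * b x)"
  by (auto simp: flat_def weighted_mult_smooth)

lemma flat_bound:
  assumes "flat \<rho> a"
  shows "\<exists>C\<ge>0. \<forall>x. norm x \<le> R \<longrightarrow> norm (a x) \<le> C * \<rho> x ^ N"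
  using assms weightedD[of "\<lambda>x. \<rho> x ^ N" a "[]" R] by (auto simp: flat_def)

lemma smooth_flat_1: "smooth a \<Longrightarrow> flat (\<lambda>_. 1) a"
  by (simp add: flat_def smooth_weighted_1)

text \<open>Flatness concerns all derivatives; in a class closed under basis derivatives it is
  enough to estimate the members themselves.\<close>

lemma flat_coinduct:
  assumes "P f"
    and "\<And>g x. P g \<Longrightarrow> g differentiable (at x)"
    and "\<And>g b. P g \<Longrightarrow> b \<in> Basis \<Longrightarrow> P (dir_deriv b g)"
    and bd: "\<And>g N R. P g \<Longrightarrow> \<exists>C\<ge>0. \<forall>x. norm x \<le> R \<longrightarrow> norm (g x) \<le> C * \<rho> x ^ N"
  shows "flat \<rho> f"
proof -
  have "smooth f" by (rule smooth_coinduct_Basis[where P = P]) (use assms in auto)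
  moreover have "P (pd vs g)" if "vs \<in> lists Basis" "P g" for vs g
    using that assms(3) by (induction vs arbitrary: g rule: list.induct) auto
  ultimately show ?thesis
    unfolding flat_def weighted_def using assms(1) bd by blast
qed

lemma flat_mono:
  assumes "flat \<rho> a" "\<And>x. \<rho> x \<ge> 0" "\<And>R. \<exists>C\<ge>0. \<forall>x. norm x \<le> R \<longrightarrow> \<rho> x \<le> C * \<rho>' x"
  shows "flat \<rho>' a"
  unfolding flat_def
proof
  fix N
  have "\<exists>C\<ge>0. \<forall>x. norm x \<le> R \<longrightarrow> \<rho> x ^ N \<le> C * \<rho>' x ^ N" for R
  proof -
    obtain C where C: "C \<ge> 0" "\<forall>x. norm x \<le> R \<longrightarrow> \<rho> x \<le> C * \<rho>' x" using assms(3) by blast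
    then have "\<rho> x ^ N \<le> C ^ N * \<rho>' x ^ N" if "norm x \<le> R" for x
      using power_mono[of "\<rho> x" "C * \<rho>' x" N] assms(2) that by (simp add: power_mult_distrib)
    then show ?thesis using C(1) by (intro exI[of _ "C ^ N"]) auto
  qed
  then show "weighted (\<lambda>x. \<rho>' x ^ N) a"
    by (rule weighted_mono[OF assms(1)[unfolded flat_def, rule_format, of N]])
qed

text \<open>Geometric mean of the two hypotheses at exponent 2N: the product of the bounds for |g|
  bounds |g|^2 by a multiple of (\<rho> \<sigma>)^(2N).\<close>

lemma flat_both:
  assumes "flat \<rho> a" "flat \<sigma> a" "\<And>x. \<rho> x \<ge> 0" "\<And>x. \<sigma> x \<ge> 0"
  shows "flat (\<lambda>x. \<rho> x * \<sigma> x) a"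
proof (rule flat_coinduct[where P = "\<lambda>a. flat \<rho> a \<and> flat \<sigma> a"])
  fix g :: "'a \<Rightarrow> complex" and N R assume g: "flat \<rho> g \<and> flat \<sigma> g"
  obtain C where C: "C \<ge> 0" "\<And>x. norm x \<le> R \<Longrightarrow> norm (g x) \<le> C * \<rho> x ^ (N + N)"
    using flat_bound[of \<rho> g R "N + N"] g by blast
  obtain D where D: "D \<ge> 0" "\<And>x. norm x \<le> R \<Longrightarrow> norm (g x) \<le> D * \<sigma> x ^ (N + N)"
    using flat_bound[of \<sigma> g R "N + N"] g by blast
  have "norm (g x) \<le> (C + D) * (\<rho> x * \<sigma> x) ^ N" if "norm x \<le> R" for x
  proof (rule power2_le_imp_le)
    have "norm (g x) ^ 2 \<le> (C * \<rho> x ^ (N + N)) * (D * \<sigma> x ^ (N + N))"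
      unfolding power2_eq_square using C D that assms(3,4)[of x] by (intro mult_mono) auto
    also have "\<dots> = (C * D) * ((\<rho> x * \<sigma> x) ^ N) ^ 2"
      by (simp add: power_add power_mult_distrib power2_eq_square mult_ac)
    also have "\<dots> \<le> (C + D) ^ 2 * ((\<rho> x * \<sigma> x) ^ N) ^ 2"
      using C(1) D(1) by (intro mult_right_mono zero_le_power2) (auto simp: power2_eq_square algebra_simps)
    finally show "norm (g x) ^ 2 \<le> ((C + D) * (\<rho> x * \<sigma> x) ^ N) ^ 2" by (simp add: power_mult_distrib)
  qed (use C(1) D(1) assms in auto)
  then show "\<exists>C\<ge>0. \<forall>x. norm x \<le> R \<longrightarrow> norm (g x) \<le> C * (\<rho> x * \<sigma> x) ^ N"
    using C(1) D(1) by (intro exI[of _ "C + D"]) auto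
qed (use assms in \<open>auto intro: flat_dir_deriv smooth_differentiable flat_smooth\<close>)

text \<open>Differentiation costs one power of e, and every power is available, so the class of
  smooth functions divisible by all powers of e is closed under differentiation.\<close>

lemma flat_of_power_multiples:
  assumes e: "smooth e" and ex: "\<And>N. \<exists>T. smooth T \<and> (\<forall>x. g x = e x ^ N * T x)"
  shows "flat (\<lambda>x. norm (e x)) g"
proof (rule flat_coinduct[where P = "\<lambda>g. \<forall>N. \<exists>T. smooth T \<and> g = (\<lambda>x. e x ^ N * T x)"])
  show "\<forall>N. \<exists>T. smooth T \<and> g = (\<lambda>x. e x ^ N * T x)"
    using ex by (auto simp: fun_eq_iff)
next
  fix h :: "'a \<Rightarrow> complex" and x assume "\<forall>N. \<exists>T. smooth T \<and> h = (\<lambda>x. e x ^ N * T x)"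
  then obtain T where "smooth T" "h = (\<lambda>x. e x ^ 0 * T x)" by blast
  then show "h differentiable (at x)" using smooth_differentiable by simp
next
  fix h :: "'a \<Rightarrow> complex" and b assume h: "\<forall>N. \<exists>T. smooth T \<and> h = (\<lambda>x. e x ^ N * T x)"
  show "\<forall>N. \<exists>T. smooth T \<and> dir_deriv b h = (\<lambda>x. e x ^ N * T x)"
  proof
    fix N
    obtain T where T: "smooth T" "h = (\<lambda>x. e x ^ Suc N * T x)" using h by blast
    let ?T = "\<lambda>x. e x * dir_deriv b T x + of_nat (Suc N) * dir_deriv b e x * T x"
    have "dir_deriv b h x = e x ^ N * ?T x" for x
    proof -
      have "((\<lambda>x. e x ^ Suc N * T x) has_derivative
        (\<lambda>v. e x ^ Suc N * dir_deriv v T x + (of_nat (Suc N) * dir_deriv v e x * e x ^ N) * T x)) (at x)"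
        using has_derivative_mult[OF has_derivative_power[OF smooth_on_has_derivative[OF e UNIV_I], of "Suc N" x]
            smooth_on_has_derivative[OF T(1) UNIV_I]] by (simp add: mult_ac)
      from dir_deriv_eq[OF this] show ?thesis unfolding T(2) by (simp add: algebra_simps)
    qed
    moreover have "smooth ?T"
      by (intro smooth_UNIV_intros smooth_on_dir_deriv e T)
    ultimately show "\<exists>T. smooth T \<and> dir_deriv b h = (\<lambda>x. e x ^ N * T x)" by blast
  qed
next
  fix h :: "'a \<Rightarrow> complex" and N R assume "\<forall>N. \<exists>T. smooth T \<and> h = (\<lambda>x. e x ^ N * T x)"
  then obtain T where T: "smooth T" "h = (\<lambda>x. e x ^ N * T x)" by blast
  obtain C where C: "C \<ge> 0" "\<And>x. norm x \<le> R \<Longrightarrow> norm (T x) \<le> C" using smooth_bounded[OF T(1)] by metis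
  have "norm (h x) \<le> C * norm (e x) ^ N" if "norm x \<le> R" for x
    using mult_right_mono[OF C(2)[OF that], of "norm (e x) ^ N"] by (simp add: T(2) norm_mult norm_power mult_ac)
  then show "\<exists>C\<ge>0. \<forall>x. norm x \<le> R \<longrightarrow> norm (h x) \<le> C * norm (e x) ^ N" using C(1) by blast
qed

text \<open>At a zero of p, flatness at exponent m + 2 leaves \<open>g / p^m\<close> of size |p|^2,
  which is O(|y - x|^2); so the derivative is 0 there, in agreement with the formula under division
  by 0.\<close>

lemma flat_divide_has_derivative:
  fixes p :: "'a::euclidean_space \<Rightarrow> complex"
  assumes g: "flat \<rho> g" and p: "smooth p" and \<rho>: "\<And>x. \<rho> x \<ge> 0"
    and le: "\<And>R. \<exists>C\<ge>0. \<forall>x. norm x \<le> R \<longrightarrow> \<rho> x \<le> C * norm (p x)"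
  shows "((\<lambda>x. g x / p x ^ m) has_derivative
     (\<lambda>v. (p x * dir_deriv v g x - of_nat m * g x * dir_deriv v p x) / p x ^ Suc m)) (at x)"
proof (cases "p x = 0")
  case False
  have "((\<lambda>x. g x / p x ^ m) has_derivative
     (\<lambda>v. - g x * (inverse (p x ^ m) * (of_nat m * dir_deriv v p x * p x ^ (m - 1)) * inverse (p x ^ m)) + dir_deriv v g x / p x ^ m)) (at x)"
    using False by (intro has_derivative_divide has_derivative_power smooth_on_has_derivative[OF p] smooth_on_has_derivative[OF flat_smooth[OF g]]) auto
  moreover have "- g x * (inverse (p x ^ m) * (of_nat m * d * p x ^ (m - 1)) * inverse (p x ^ m)) + d' / p x ^ m =
     (p x * d' - of_nat m * g x * d) / p x ^ Suc m" for d d'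
    using False by (cases m) (auto simp: field_simps)
  ultimately show ?thesis by simp
next
  case True
  obtain C where C: "C \<ge> 0" "\<And>y. norm y \<le> norm x + 1 \<Longrightarrow> norm (g y) \<le> C * \<rho> y ^ (m + 2)"
    using flat_bound[OF g, of "norm x + 1" "m + 2"] by blast
  obtain D where D: "D \<ge> 0" "\<And>y. norm y \<le> norm x + 1 \<Longrightarrow> \<rho> y \<le> D * norm (p y)" using le by blast
  obtain K where K: "K > 0" "\<forall>\<^sub>F y in nhds x. norm (p y - p x) \<le> K * norm (y - x)"
    using differentiable_Lipschitz_at[OF smooth_differentiable[OF p]] by blast
  have gx: "g x = 0" using C(2)[of x] D(2)[of x] \<rho>[of x] True by simp
  have "\<forall>\<^sub>F y in nhds x. dist y x < 1"
    unfolding eventually_nhds_metric by (rule exI[of _ 1]) auto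
  with K(2) have "\<forall>\<^sub>F y in nhds x. norm (g y / p y ^ m - g x / p x ^ m) \<le> (C * D ^ (m + 2) * K ^ 2) * norm (y - x) ^ 2"
  proof eventually_elim
    case (elim y)
    have y: "norm y \<le> norm x + 1"
      using elim(2) norm_triangle_ineq2[of y x] by (simp add: dist_norm)
    have py: "norm (p y) \<le> K * norm (y - x)" using elim(1) True by simp
    have "norm (g y) \<le> C * (D * norm (p y)) ^ (m + 2)"
      using C(2)[OF y] mult_left_mono[OF power_mono[OF D(2)[OF y] \<rho>] C(1), of "m + 2"] by linarith
    then have "norm (g y / p y ^ m) \<le> C * (D * norm (p y)) ^ (m + 2) / norm (p y) ^ m"
      by (simp add: norm_divide norm_power divide_right_mono)
    also have "\<dots> \<le> C * D ^ (m + 2) * norm (p y) ^ 2"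
      by (cases "p y = 0") (auto simp: power_mult_distrib power_add C(1) D(1) power2_eq_square mult_ac)
    also have "\<dots> \<le> C * D ^ (m + 2) * (K * norm (y - x)) ^ 2"
      using C(1) D(1) py by (intro mult_left_mono power_mono) auto
    finally show ?case by (simp add: gx power_mult_distrib mult_ac)
  qed
  then have "((\<lambda>x. g x / p x ^ m) has_derivative (\<lambda>_. 0)) (at x)"
    by (rule has_derivative_zero_quadratic)
  then show ?thesis using True by simp
qed

text \<open>Division by \<open>0\<close> yields \<open>0\<close>, which here is the correct limit on the zero set of \<open>p\<close>.\<close>

lemma flat_divide:
  fixes p :: "'a::euclidean_space \<Rightarrow> complex"
  assumes g: "flat \<rho> g" and p: "smooth p" and \<rho>: "\<And>x. \<rho> x \<ge> 0"
    and le: "\<And>R. \<exists>C\<ge>0. \<forall>x. norm x \<le> R \<longrightarrow> \<rho> x \<le> C * norm (p x)"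
  shows "flat \<rho> (\<lambda>x. g x / p x)"
proof (rule flat_coinduct[where P = "\<lambda>f. \<exists>g m. flat \<rho> g \<and> f = (\<lambda>x. g x / p x ^ m)"])
  show "\<exists>g' m. flat \<rho> g' \<and> (\<lambda>x. g x / p x) = (\<lambda>x. g' x / p x ^ m)"
    using g by (intro exI[of _ g] exI[of _ 1]) simp
next
  fix f x assume "\<exists>g m. flat \<rho> g \<and> f = (\<lambda>x. g x / p x ^ m)"
  then show "f differentiable (at x)" using flat_divide_has_derivative[OF _ p \<rho> le] differentiableI by blast
next
  fix f and b :: 'a assume b: "b \<in> Basis" and "\<exists>g m. flat \<rho> g \<and> f = (\<lambda>x. g x / p x ^ m)"
  then obtain g m where g: "flat \<rho> g" "f = (\<lambda>x. g x / p x ^ m)" by blast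
  let ?g = "\<lambda>x. dir_deriv b g x * p x + g x * (- of_nat m * dir_deriv b p x)"
  have "flat \<rho> ?g"
    by (intro flat_add flat_mult_smooth flat_dir_deriv g b p smooth_UNIV_intros smooth_on_dir_deriv)
  moreover have "dir_deriv b f = (\<lambda>x. ?g x / p x ^ Suc m)"
    unfolding g(2) by (rule ext, subst dir_deriv_eq[OF flat_divide_has_derivative[OF g(1) p \<rho> le]]) (simp_all add: algebra_simps)
  ultimately show "\<exists>g m. flat \<rho> g \<and> dir_deriv b f = (\<lambda>x. g x / p x ^ m)" by blast
next
  fix f N R assume "\<exists>g m. flat \<rho> g \<and> f = (\<lambda>x. g x / p x ^ m)"
  then obtain g m where g: "flat \<rho> g" "f = (\<lambda>x. g x / p x ^ m)" by blast
  obtain C where C: "C \<ge> 0" "\<And>y. norm y \<le> R \<Longrightarrow> norm (g y) \<le> C * \<rho> y ^ (N + m)"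
    using flat_bound[OF g(1), of R "N + m"] by blast
  obtain D where D: "D \<ge> 0" "\<And>y. norm y \<le> R \<Longrightarrow> \<rho> y \<le> D * norm (p y)" using le by blast
  have "norm (f x) \<le> (C * D ^ m) * \<rho> x ^ N" if x: "norm x \<le> R" for x
  proof (cases "p x = 0")
    case True
    then show ?thesis
      using C(1) D(1) \<rho>[of x] C(2)[OF x] D(2)[OF x] by (cases m) (auto simp: g(2))
  next
    case False
    have "norm (g x) \<le> C * (\<rho> x ^ N * (D * norm (p x)) ^ m)"
      using C(2)[OF x] mult_left_mono[OF mult_left_mono[OF power_mono[OF D(2)[OF x] \<rho>, of m], of "\<rho> x ^ N"] C(1)] \<rho>[of x]
      by (simp add: power_add)
    then show ?thesis using False by (simp add: g(2) norm_divide norm_power divide_le_eq power_mult_distrib mult_ac)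
  qed
  then show "\<exists>C\<ge>0. \<forall>x. norm x \<le> R \<longrightarrow> norm (f x) \<le> C * \<rho> x ^ N"
    using C(1) D(1) by (intro exI[of _ "C * D ^ m"]) auto
qed

section \<open>Almost analytic extension\<close>

text \<open>The threshold k0 may depend on the derivative and on the ball. This is what a choice of
  scales term by term can guarantee, and it suffices for differentiating termwise any number of
  times.\<close>

definition rapid_series :: "(nat \<Rightarrow> 'a::euclidean_space \<Rightarrow> complex) \<Rightarrow> bool"
  where "rapid_series u \<longleftrightarrow> (\<forall>k. smooth (u k)) \<and>
    (\<forall>vs\<in>lists Basis. \<forall>R. \<exists>k0. \<forall>k\<ge>k0. \<forall>x. norm x \<le> R \<longrightarrow> norm (pd vs (u k) x) \<le> (1 / 2) ^ k)"

lemma rapid_series_dir_deriv: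
  assumes "rapid_series u" "b \<in> Basis"
  shows "rapid_series (\<lambda>k. dir_deriv b (u k))"
  unfolding rapid_series_def
proof (intro conjI allI ballI)
  show "smooth (dir_deriv b (u k))" for k
    using assms(1) by (simp add: rapid_series_def smooth_on_dir_deriv)
  fix vs :: "'a list" and R :: real assume "vs \<in> lists Basis"
  then have "b # vs \<in> lists Basis" using assms(2) by simp
  then show "\<exists>k0. \<forall>k\<ge>k0. \<forall>x. norm x \<le> R \<longrightarrow> norm (pd vs (dir_deriv b (u k)) x) \<le> (1 / 2) ^ k"
    using assms(1) unfolding rapid_series_def by (metis fold_simps(2))
qed

lemma half_tail:
  fixes f :: "nat \<Rightarrow> complex"
  assumes "\<And>k. k \<ge> n \<Longrightarrow> norm (f k) \<le> (1 / 2) ^ k * c"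
  shows "summable f" "norm (suminf f - sum f {..<n}) \<le> 2 * c * (1 / 2) ^ n"
proof -
  have g: "(\<lambda>k. (1 / 2) ^ (k + n) * c) sums (2 * c * (1 / 2) ^ n)"
    using sums_mult[OF geometric_sums[of "1 / 2 :: real"], of "c * (1 / 2) ^ n"] by (simp add: power_add mult_ac)
  have s: "summable (\<lambda>k. f (k + n))"
    by (rule summable_comparison_test'[OF sums_summable[OF g], of 0]) (use assms in auto)
  then show sf: "summable f" by (simp add: summable_iff_shift)
  have "norm (\<Sum>k. f (k + n)) \<le> (\<Sum>k. (1 / 2) ^ (k + n) * c)"
    by (rule norm_suminf_le) (use assms sums_summable[OF g] in auto)
  then show "norm (suminf f - sum f {..<n}) \<le> 2 * c * (1 / 2) ^ n"
    using suminf_minus_initial_segment[OF sf, of n] sums_unique[OF g] by simp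
qed

lemma rapid_series_tail:
  assumes "rapid_series u" "vs \<in> lists Basis"
  shows "\<exists>k0. \<forall>n\<ge>k0. \<forall>x. norm x \<le> R \<longrightarrow>
    norm ((\<Sum>k. pd vs (u k) x) - (\<Sum>k<n. pd vs (u k) x)) \<le> 2 * (1 / 2) ^ n" (is ?A)
    and "summable (\<lambda>k. pd vs (u k) x)"
proof -
  have *: "\<exists>k0. \<forall>k\<ge>k0. \<forall>x. norm x \<le> R \<longrightarrow> norm (pd vs (u k) x) \<le> (1 / 2) ^ k * 1" for R
    using assms by (simp add: rapid_series_def)
  obtain k0 where k0: "\<And>k x. k \<ge> k0 \<Longrightarrow> norm x \<le> R \<Longrightarrow> norm (pd vs (u k) x) \<le> (1 / 2) ^ k * 1"
    using *[of R] by blast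
  then have "norm ((\<Sum>k. pd vs (u k) x) - (\<Sum>k<n. pd vs (u k) x)) \<le> 2 * 1 * (1 / 2) ^ n"
    if "n \<ge> k0" "norm x \<le> R" for n x
    by (intro half_tail(2)) (use that in auto)
  then show ?A by auto
  obtain k0 where k0: "\<And>k y. k \<ge> k0 \<Longrightarrow> norm y \<le> norm x \<Longrightarrow> norm (pd vs (u k) y) \<le> (1 / 2) ^ k * 1"
    using *[of "norm x"] by blast
  show "summable (\<lambda>k. pd vs (u k) x)"
    by (rule half_tail(1)[OF k0]) auto
qed

text \<open>Termwise differentiation asks for uniform convergence of the full differentials on a
  convex set. The tails in the finitely many basis directions are combined by taking the largest of
  their thresholds.\<close>

lemma rapid_series_has_derivative:
  assumes u: "rapid_series u"
  shows "((\<lambda>x. \<Sum>k. u k x) has_derivative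
    (\<lambda>h. \<Sum>b\<in>Basis. (h \<bullet> b) *\<^sub>R (\<Sum>k. dir_deriv b (u k) x))) (at x)"
proof -
  define R where "R = norm x + 1"
  let ?S = "ball (0::'a) R"
  let ?g = "\<lambda>x h. \<Sum>b\<in>Basis. (h \<bullet> b) *\<^sub>R (\<Sum>k. dir_deriv b (u k) x)"
  have sm: "smooth (u k)" for k using u by (simp add: rapid_series_def)
  have "\<exists>k0. \<forall>n\<ge>k0. \<forall>x. norm x \<le> R \<longrightarrow>
      norm ((\<Sum>k. dir_deriv b (u k) x) - (\<Sum>k<n. dir_deriv b (u k) x)) \<le> 2 * (1 / 2) ^ n"
    if "b \<in> Basis" for b
    using rapid_series_tail(1)[OF u, of "[b]" R] that by simp
  then obtain K where K: "\<And>b n x. b \<in> Basis \<Longrightarrow> n \<ge> K b \<Longrightarrow> norm x \<le> R \<Longrightarrow>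
      norm ((\<Sum>k. dir_deriv b (u k) x) - (\<Sum>k<n. dir_deriv b (u k) x)) \<le> 2 * (1 / 2) ^ n"
    by metis
  define M where "M = Max (K ` Basis)"
  have M: "K b \<le> M" if "b \<in> Basis" for b unfolding M_def using that by simp
  have "\<exists>g. \<forall>y\<in>?S. (\<lambda>k. u k y) sums g y \<and> (g has_derivative ?g y) (at y within ?S)"
  proof (rule has_derivative_series)
    show "convex ?S" by simp
    show "(u k has_derivative (\<lambda>h. dir_deriv h (u k) y)) (at y within ?S)" for k y
      using smooth_on_has_derivative[OF sm] by (auto intro: has_derivative_at_withinI)
    show "x \<in> ?S" by (simp add: R_def)
    show "(\<lambda>k. u k x) sums (\<Sum>k. u k x)"
      using rapid_series_tail(2)[OF u lists.Nil, of x] by (simp add: summable_sums)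
    fix e :: real assume e: "e > 0"
    have "(\<lambda>n. real DIM('a) * (2 * (1 / 2) ^ n)) \<longlonglongrightarrow> real DIM('a) * (2 * 0)"
      by (intro tendsto_intros LIMSEQ_power_zero) auto
    then have "\<forall>\<^sub>F n in sequentially. real DIM('a) * (2 * (1 / 2) ^ n) < e"
      using e by (intro order_tendstoD(2)[where y = "real DIM('a) * (2 * 0)"]) auto
    then show "\<forall>\<^sub>F n in sequentially. \<forall>y\<in>?S. \<forall>h. norm ((\<Sum>i<n. dir_deriv h (u i) y) - ?g y h) \<le> e * norm h"
      using eventually_ge_at_top[of M]
    proof eventually_elim
      case (elim n)
      show ?case
      proof (intro ballI allI)
        fix y h assume y: "y \<in> ?S"
        have "(\<Sum>i<n. dir_deriv h (u i) y) = (\<Sum>i<n. \<Sum>b\<in>Basis. (h \<bullet> b) *\<^sub>R dir_deriv b (u i) y)"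
          by (intro sum.cong refl dir_deriv_Basis smooth_differentiable sm)
        also have "\<dots> = (\<Sum>b\<in>Basis. (h \<bullet> b) *\<^sub>R (\<Sum>i<n. dir_deriv b (u i) y))"
          by (subst sum.swap) (simp add: scaleR_sum_right)
        finally have eq: "?g y h - (\<Sum>i<n. dir_deriv h (u i) y) =
          (\<Sum>b\<in>Basis. (h \<bullet> b) *\<^sub>R ((\<Sum>k. dir_deriv b (u k) y) - (\<Sum>i<n. dir_deriv b (u i) y)))"
          by (simp add: sum_subtractf scaleR_diff_right)
        have "norm ((\<Sum>i<n. dir_deriv h (u i) y) - ?g y h) = norm (?g y h - (\<Sum>i<n. dir_deriv h (u i) y))"
          by (rule norm_minus_commute)
        also have "\<dots> \<le>
          (\<Sum>b\<in>Basis. norm ((h \<bullet> b) *\<^sub>R ((\<Sum>k. dir_deriv b (u k) y) - (\<Sum>i<n. dir_deriv b (u i) y))))"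
          unfolding eq by (rule norm_sum)
        also have "\<dots> \<le> (\<Sum>b\<in>(Basis::'a set). norm h * (2 * (1 / 2) ^ n))"
        proof (rule sum_mono)
          fix b :: 'a assume b: "b \<in> Basis"
          have "norm ((\<Sum>k. dir_deriv b (u k) y) - (\<Sum>i<n. dir_deriv b (u i) y)) \<le> 2 * (1 / 2) ^ n"
            using K[OF b, of n y] M[OF b] elim(2) y by simp
          then show "norm ((h \<bullet> b) *\<^sub>R ((\<Sum>k. dir_deriv b (u k) y) - (\<Sum>i<n. dir_deriv b (u i) y))) \<le> norm h * (2 * (1 / 2) ^ n)"
            unfolding norm_scaleR using Basis_le_norm[OF b, of h] by (intro mult_mono) auto
        qed
        also have "\<dots> = (real DIM('a) * (2 * (1 / 2) ^ n)) * norm h" by simp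
        also have "\<dots> \<le> e * norm h" using elim(1) by (intro mult_right_mono) auto
        finally show "norm ((\<Sum>i<n. dir_deriv h (u i) y) - ?g y h) \<le> e * norm h" .
      qed
    qed
  qed
  then obtain g where g: "\<And>y. y \<in> ?S \<Longrightarrow> (\<lambda>k. u k y) sums g y"
    "\<And>y. y \<in> ?S \<Longrightarrow> (g has_derivative ?g y) (at y within ?S)" by blast
  have x: "x \<in> ?S" by (simp add: R_def)
  have "(g has_derivative ?g x) (at x)"
    using g(2)[OF x] at_within_open[OF x open_ball] by simp
  then show ?thesis
    by (rule has_derivative_transform_within_open[OF _ open_ball x]) (use g(1) sums_unique in blast)
qed

lemma dir_deriv_rapid_series:
  assumes "rapid_series u" "b \<in> Basis"
  shows "dir_deriv b (\<lambda>x. \<Sum>k. u k x) = (\<lambda>x. \<Sum>k. dir_deriv b (u k) x)"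
proof
  fix x
  have "dir_deriv b (\<lambda>x. \<Sum>k. u k x) x = (\<Sum>c\<in>Basis. (b \<bullet> c) *\<^sub>R (\<Sum>k. dir_deriv c (u k) x))"
    by (rule dir_deriv_eq[OF rapid_series_has_derivative[OF assms(1)]])
  also have "\<dots> = (\<Sum>c\<in>Basis. if c = b then (\<Sum>k. dir_deriv c (u k) x) else 0)"
    by (rule sum.cong) (use assms(2) in \<open>auto simp: inner_Basis\<close>)
  also have "\<dots> = (\<Sum>k. dir_deriv b (u k) x)" using assms(2) by simp
  finally show "dir_deriv b (\<lambda>x. \<Sum>k. u k x) x = (\<Sum>k. dir_deriv b (u k) x)" .
qed

lemma smooth_rapid_series: "rapid_series u \<Longrightarrow> smooth (\<lambda>x. \<Sum>k. u k x)"
proof (rule smooth_coinduct_Basis[where P = "\<lambda>f. \<exists>u. rapid_series u \<and> f = (\<lambda>x. \<Sum>k. u k x)"])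
  fix f x assume "\<exists>u. rapid_series u \<and> f = (\<lambda>x::'a. \<Sum>k. u k x)"
  then show "f differentiable (at x)" using rapid_series_has_derivative differentiableI by blast
next
  fix f and b :: 'a assume b: "b \<in> Basis" and "\<exists>u. rapid_series u \<and> f = (\<lambda>x::'a. \<Sum>k. u k x)"
  then obtain u where u: "rapid_series u" "f = (\<lambda>x. \<Sum>k. u k x)" by blast
  show "\<exists>u. rapid_series u \<and> dir_deriv b f = (\<lambda>x. \<Sum>k. u k x)"
    using dir_deriv_rapid_series[OF u(1) b] rapid_series_dir_deriv[OF u(1) b] u(2) by blast
qed blast

lemma pd_rapid_series:
  "vs \<in> lists Basis \<Longrightarrow> rapid_series u \<Longrightarrow> pd vs (\<lambda>x. \<Sum>k. u k x) = (\<lambda>x. \<Sum>k. pd vs (u k) x)"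
  by (induction vs arbitrary: u rule: list.induct) (auto simp: dir_deriv_rapid_series rapid_series_dir_deriv)

lemma pd_cmult:
  fixes f :: "'a::real_normed_vector \<Rightarrow> complex"
  assumes "smooth f"
  shows "pd vs (\<lambda>x. c * f x) = (\<lambda>x. c * pd vs f x)"
  using assms
proof (induction vs arbitrary: f)
  case (Cons w ws)
  have "dir_deriv w (\<lambda>x. c * f x) = (\<lambda>x. c * dir_deriv w f x)"
    by (rule ext) (rule dir_deriv_blin[OF bounded_linear_mult_right smooth_differentiable[OF Cons.prems]])
  then show ?case using Cons by (simp add: smooth_on_dir_deriv)
qed simp

section \<open>Borel summation with functions as coefficients\<close>

definition bounded_smooth :: "(complex \<Rightarrow> complex) \<Rightarrow> bool"
  where "bounded_smooth B \<longleftrightarrow> smooth B \<and> (\<forall>vs\<in>lists Basis. \<exists>C. \<forall>w. norm (pd vs B w) \<le> C)"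

lemma bounded_smooth_dir_deriv: "bounded_smooth B \<Longrightarrow> b \<in> Basis \<Longrightarrow> bounded_smooth (dir_deriv b B)"
  unfolding bounded_smooth_def by (metis (no_types, lifting) fold_simps(2) lists.Cons smooth_on_dir_deriv)

lemma bounded_smooth_compact:
  assumes "smooth B" "\<And>w. norm w > 1 \<Longrightarrow> B w = 0"
  shows "bounded_smooth B"
  unfolding bounded_smooth_def
proof (intro conjI ballI)
  fix vs :: "complex list"
  have o: "open {w :: complex. norm w > 1}" by (intro open_Collect_less continuous_intros)
  have pd0: "pd vs (\<lambda>_. 0 :: complex) = (\<lambda>_. 0)" for vs :: "complex list"
  proof (induction vs)
    case (Cons v vs)
    have "dir_deriv v (\<lambda>_. 0 :: complex) = (\<lambda>_. 0)"
      by (rule ext) (rule dir_deriv_eq, rule has_derivative_const)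
    then show ?case using Cons by simp
  qed simp
  have "pd vs B w = 0" if "norm w > 1" for w
    using pd_cong_open[OF o, of B "\<lambda>_. 0" w vs] assms(2) that by (simp add: pd0)
  moreover obtain C where "C \<ge> 0" "\<And>w. norm w \<le> 1 \<Longrightarrow> norm (pd vs B w) \<le> C"
    using smooth_bounded[OF smooth_pd[OF assms(1)]] by metis
  ultimately show "\<exists>C. \<forall>w. norm (pd vs B w) \<le> C" by (metis norm_zero not_le)
qed (rule assms)

text \<open>Each derivative that falls on \<open>B (e x / of_real \<epsilon>)\<close> costs a factor
  1/\<epsilon>, and \<epsilon> \<le> 1 lets the highest power dominate. B needs global bounds
  because its argument leaves every bounded set as \<epsilon> tends to 0.\<close>

lemma scaled_estimate:
  fixes a :: "'a::euclidean_space \<Rightarrow> complex"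
  assumes "weighted \<omega> a" "smooth e" "bounded_smooth B" "vs \<in> lists Basis"
  shows "\<exists>C\<ge>0. \<forall>\<epsilon>. 0 < \<epsilon> \<and> \<epsilon> \<le> 1 \<longrightarrow> (\<forall>x. norm x \<le> R \<longrightarrow>
    norm (pd vs (\<lambda>x. a x * B (e x / of_real \<epsilon>)) x) \<le> C / \<epsilon> ^ length vs * \<omega> x)"
  using assms(1,3,4)
proof (induction vs arbitrary: a B rule: list.induct)
  case Nil
  obtain C where C: "C \<ge> 0" "\<And>x. norm x \<le> R \<Longrightarrow> norm (a x) \<le> C * \<omega> x"
    using weightedD[OF Nil(1) lists.Nil, of R] by auto
  obtain D where D: "\<And>w. norm (B w) \<le> D"
    using Nil(2) unfolding bounded_smooth_def by (metis fold_simps(1) lists.Nil)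
  have D0: "D \<ge> 0" using D[of 0] norm_ge_zero order_trans by blast
  have *: "norm (a x * B w) \<le> C * D * \<omega> x" if "norm x \<le> R" for x w
  proof -
    have "0 \<le> C * \<omega> x" using C(2)[OF that] norm_ge_zero[of "a x"] by linarith
    from mult_mono[OF C(2)[OF that] D[of w] this] show ?thesis by (simp add: norm_mult mult_ac)
  qed
  show ?case
  proof (intro exI conjI allI impI)
    show "0 \<le> C * D" using C(1) D0 by simp
    fix \<epsilon> :: real and x :: 'a assume x: "norm x \<le> R"
    show "norm (pd [] (\<lambda>x. a x * B (e x / of_real \<epsilon>)) x) \<le> C * D / \<epsilon> ^ length ([] :: 'a list) * \<omega> x"
      using *[OF x, of "e x / of_real \<epsilon>"] by simp
  qed
next
  case (Cons v vs)
  have v: "v \<in> Basis" "vs \<in> lists Basis" using Cons.prems by auto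
  have sm: "smooth a" "smooth B"
    using Cons.prems weighted_smooth by (auto simp: bounded_smooth_def)
  define a' where "a' b x = a x * of_real (dir_deriv v e x \<bullet> b)" for b x
  have wa': "weighted \<omega> (a' b)" for b
    unfolding a'_def
    by (intro weighted_mult_smooth Cons.prems smooth_of_real smooth_on_blin[OF bounded_linear_inner_left open_UNIV] smooth_on_dir_deriv assms)
  obtain C where C: "C \<ge> 0" "\<And>\<epsilon> x. 0 < \<epsilon> \<Longrightarrow> \<epsilon> \<le> 1 \<Longrightarrow> norm x \<le> R \<Longrightarrow>
    norm (pd vs (\<lambda>x. dir_deriv v a x * B (e x / of_real \<epsilon>)) x) \<le> C / \<epsilon> ^ length vs * \<omega> x"
    using Cons.IH[OF weighted_dir_deriv[OF Cons.prems(1) v(1)] Cons.prems(2) v(2)] by blast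
  let ?bd = "\<lambda>b C. C \<ge> 0 \<and> (\<forall>\<epsilon>. 0 < \<epsilon> \<and> \<epsilon> \<le> 1 \<longrightarrow> (\<forall>x. norm x \<le> R \<longrightarrow>
    norm (pd vs (\<lambda>x. a' b x * dir_deriv b B (e x / of_real \<epsilon>)) x) \<le> C / \<epsilon> ^ length vs * \<omega> x))"
  have "\<forall>b\<in>Basis. \<exists>C. ?bd b C"
    using Cons.IH[OF wa' bounded_smooth_dir_deriv[OF Cons.prems(2)] v(2)] by blast
  from bchoice[OF this] obtain Df where Df: "\<forall>b\<in>Basis. ?bd b (Df b)" by blast
  define D where "D = Df"
  have D: "\<And>b. b \<in> Basis \<Longrightarrow> D b \<ge> 0" "\<And>b \<epsilon> x. b \<in> Basis \<Longrightarrow> 0 < \<epsilon> \<Longrightarrow> \<epsilon> \<le> 1 \<Longrightarrow> norm x \<le> R \<Longrightarrow>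
    norm (pd vs (\<lambda>x. a' b x * dir_deriv b B (e x / of_real \<epsilon>)) x) \<le> D b / \<epsilon> ^ length vs * \<omega> x"
    using Df unfolding D_def by blast+
  show ?case
  proof (intro exI conjI allI impI)
    show "0 \<le> C + (\<Sum>b\<in>Basis. D b)" using C(1) D(1) by (simp add: sum_nonneg)
    fix \<epsilon> :: real and x :: 'a assume \<epsilon>: "0 < \<epsilon> \<and> \<epsilon> \<le> 1" and x: "norm x \<le> R"
    have se: "smooth (\<lambda>x. e x / of_real \<epsilon>)" by (intro smooth_divide_const assms)
    have smB: "smooth (\<lambda>x. dir_deriv b B (e x / of_real \<epsilon>))" for b
      by (rule smooth_on_compose_UNIV[OF open_UNIV smooth_on_dir_deriv[OF sm(2)] se])
    have smB0: "smooth (\<lambda>x. B (e x / of_real \<epsilon>))"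
      by (rule smooth_on_compose_UNIV[OF open_UNIV sm(2) se])
    have de: "dir_deriv v (\<lambda>x. e x / of_real \<epsilon>) y = dir_deriv v e y / of_real \<epsilon>" for y
      using dir_deriv_blin[OF bounded_linear_divide smooth_differentiable[OF assms(2)]] by blast
    have "dir_deriv v (\<lambda>x. B (e x / of_real \<epsilon>)) y =
      (\<Sum>b\<in>Basis. of_real (1 / \<epsilon>) * (of_real (dir_deriv v e y \<bullet> b) * dir_deriv b B (e y / of_real \<epsilon>)))" for y
      unfolding dir_deriv_compose[OF smooth_differentiable[OF se] smooth_differentiable[OF sm(2)]] de
    proof (intro sum.cong refl)
      fix b :: complex
      have "(dir_deriv v e y / of_real \<epsilon>) \<bullet> b = (dir_deriv v e y \<bullet> b) / \<epsilon>"
        by (simp add: inner_complex_def add_divide_distrib)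
      then show "((dir_deriv v e y / of_real \<epsilon>) \<bullet> b) *\<^sub>R dir_deriv b B (e y / of_real \<epsilon>) =
        of_real (1 / \<epsilon>) * (of_real (dir_deriv v e y \<bullet> b) * dir_deriv b B (e y / of_real \<epsilon>))"
        by (simp add: scaleR_conv_of_real)
    qed
    then have "dir_deriv v (\<lambda>x. a x * B (e x / of_real \<epsilon>)) =
      (\<lambda>x. (\<Sum>b\<in>Basis. of_real (1 / \<epsilon>) * (a' b x * dir_deriv b B (e x / of_real \<epsilon>))) + dir_deriv v a x * B (e x / of_real \<epsilon>))"
      by (simp add: dir_deriv_mult_smooth[OF sm(1) smB0] fun_eq_iff sum_distrib_left a'_def mult_ac)
    moreover have "pd vs (\<lambda>x. (\<Sum>b\<in>Basis. of_real (1 / \<epsilon>) * (a' b x * dir_deriv b B (e x / of_real \<epsilon>))) + dir_deriv v a x * B (e x / of_real \<epsilon>)) x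
      = (\<Sum>b\<in>Basis. of_real (1 / \<epsilon>) * pd vs (\<lambda>x. a' b x * dir_deriv b B (e x / of_real \<epsilon>)) x) + pd vs (\<lambda>x. dir_deriv v a x * B (e x / of_real \<epsilon>)) x"
    proof -
      have s1: "smooth (\<lambda>x. a' b x * dir_deriv b B (e x / of_real \<epsilon>))" for b
        by (intro smooth_UNIV_intros smB weighted_smooth[OF wa'])
      have s2: "smooth (\<lambda>x. of_real (1 / \<epsilon>) * (a' b x * dir_deriv b B (e x / of_real \<epsilon>)))" for b
        by (intro smooth_on_mult[OF open_UNIV] smooth_on_const s1)
      have s3: "smooth (\<lambda>x. \<Sum>b\<in>Basis. of_real (1 / \<epsilon>) * (a' b x * dir_deriv b B (e x / of_real \<epsilon>)))"
        by (intro smooth_on_sum[OF open_UNIV] s2)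
      have s4: "smooth (\<lambda>x. dir_deriv v a x * B (e x / of_real \<epsilon>))"
        by (intro smooth_on_mult[OF open_UNIV] smooth_on_dir_deriv sm smB0)
      show ?thesis unfolding pd_add[OF s3 s4] pd_sum[OF s2] pd_cmult[OF s1] by (rule refl)
    qed
    ultimately have eq: "pd (v # vs) (\<lambda>x. a x * B (e x / of_real \<epsilon>)) x =
      (\<Sum>b\<in>Basis. of_real (1 / \<epsilon>) * pd vs (\<lambda>x. a' b x * dir_deriv b B (e x / of_real \<epsilon>)) x) + pd vs (\<lambda>x. dir_deriv v a x * B (e x / of_real \<epsilon>)) x"
      by simp
    have "norm (pd (v # vs) (\<lambda>x. a x * B (e x / of_real \<epsilon>)) x) \<le>
      (\<Sum>b\<in>Basis. norm (of_real (1 / \<epsilon>) * pd vs (\<lambda>x. a' b x * dir_deriv b B (e x / of_real \<epsilon>)) x)) + C / \<epsilon> ^ length vs * \<omega> x"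
      unfolding eq using C(2) \<epsilon> x by (intro norm_triangle_le add_mono norm_sum) auto
    also have "\<dots> \<le> (\<Sum>b\<in>Basis. D b / \<epsilon> ^ Suc (length vs) * \<omega> x) + C / \<epsilon> ^ Suc (length vs) * \<omega> x"
    proof (intro add_mono sum_mono)
      fix b :: complex assume b: "b \<in> Basis"
      show "norm (of_real (1 / \<epsilon>) * pd vs (\<lambda>x. a' b x * dir_deriv b B (e x / of_real \<epsilon>)) x) \<le> D b / \<epsilon> ^ Suc (length vs) * \<omega> x"
        using mult_left_mono[OF D(2)[OF b _ _ x, of \<epsilon>], of "1 / \<epsilon>"] \<epsilon> by (simp add: norm_mult norm_divide mult_ac)
    next
      have "0 \<le> C / \<epsilon> ^ length vs * \<omega> x"
        using C(2)[of \<epsilon> x] \<epsilon> x norm_ge_zero order_trans by blast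
      then have "(C / \<epsilon> ^ length vs * \<omega> x) * 1 \<le> (C / \<epsilon> ^ length vs * \<omega> x) * (1 / \<epsilon>)"
        using \<epsilon> by (intro mult_left_mono) auto
      then show "C / \<epsilon> ^ length vs * \<omega> x \<le> C / \<epsilon> ^ Suc (length vs) * \<omega> x" by (simp add: mult_ac)
    qed
    also have "\<dots> = (C + (\<Sum>b\<in>Basis. D b)) / \<epsilon> ^ length (v # vs) * \<omega> x"
      by (simp add: add_divide_distrib sum_divide_distrib sum_distrib_right distrib_right)
    finally show "norm (pd (v # vs) (\<lambda>x. a x * B (e x / of_real \<epsilon>)) x) \<le> (C + (\<Sum>b\<in>Basis. D b)) / \<epsilon> ^ length (v # vs) * \<omega> x" .
  qed
qed

lemma smooth_cutoff_norm:
  "smooth (\<lambda>w::complex. of_real (cutoff (norm w ^ 2)) :: complex)"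
  using smooth_on_norm_sq[of "0::complex"]
  by (intro smooth_of_real smooth_on_compose_UNIV[OF open_UNIV smooth_on_cutoff]) simp

text \<open>The power \<open>w^-N\<close> with its pole cut out. It is the smooth quotient of 1 -
  cutoff by \<open>w^N\<close> in Borel's lemma and, for N = 1, the regularized Cauchy
  kernel.\<close>

definition regular_inverse_power :: "nat \<Rightarrow> complex \<Rightarrow> complex"
  where "regular_inverse_power N w = (1 - of_real (cutoff (norm w ^ 2))) / w ^ N"

lemma cutoff_norm_small: "norm w < 1 / 2 \<Longrightarrow> cutoff (norm w ^ 2) = 1" for w :: complex
proof -
  assume "norm w < 1 / 2"
  then have "norm w ^ 2 \<le> (1 / 2) ^ 2" by (intro power_mono) auto
  then show ?thesis by (intro cutoff_eq_1) (simp add: power2_eq_square)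
qed

lemma smooth_regular_inverse_power: "smooth (regular_inverse_power N)"
proof -
  have "smooth_on (- {0}) (regular_inverse_power N)"
    unfolding regular_inverse_power_def
    by (intro smooth_on_divide smooth_on_diff smooth_on_const smooth_on_power smooth_on_id
        smooth_on_subset[OF smooth_cutoff_norm]) auto
  moreover have "smooth_on (ball 0 (1 / 2)) (regular_inverse_power N)"
    by (rule smooth_on_cong[OF open_ball _ smooth_on_const[of _ 0]])
      (simp add: regular_inverse_power_def cutoff_norm_small)
  moreover have "- {0} \<union> ball (0::complex) (1 / 2) = UNIV" by auto
  ultimately show ?thesis
    using smooth_on_Un[of "- {0}" "ball (0::complex) (1 / 2)"] by (metis open_Compl closed_singleton open_ball)
qed

lemma regular_inverse_power_mult:
  "w ^ N * regular_inverse_power N w = 1 - of_real (cutoff (norm w ^ 2))"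
  by (cases "w = 0") (auto simp: regular_inverse_power_def cutoff_eq_1)

definition cutoff_power :: "nat \<Rightarrow> complex \<Rightarrow> complex"
  where "cutoff_power m w = w ^ m * of_real (cutoff (norm w ^ 2))"

lemma bounded_smooth_cutoff_power: "bounded_smooth (cutoff_power m)"
proof (rule bounded_smooth_compact)
  show "smooth (cutoff_power m)"
    unfolding cutoff_power_def by (intro smooth_UNIV_intros smooth_cutoff_norm)
  fix w :: complex assume "norm w > 1"
  then have "norm w ^ 2 \<ge> 1" by (simp add: one_le_power)
  then show "cutoff_power m w = 0" by (simp add: cutoff_power_def cutoff_eq_0)
qed

text \<open>Capping the weight at 1 makes its powers decrease with the exponent, so one bound by the
  k-th power gives both plain boundedness and the bound by \<rho>^N for every N \<le> k.\<close>

lemma flat_weighted_min: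
  assumes "flat \<rho> a" "\<And>x. \<rho> x \<ge> 0"
  shows "weighted (\<lambda>x. min 1 (\<rho> x) ^ k) a"
  unfolding weighted_def
proof (intro conjI ballI allI)
  show "smooth a" using assms(1) by (rule flat_smooth)
  fix vs :: "'a list" and R :: real assume vs: "vs \<in> lists Basis"
  obtain C where C: "C \<ge> 0" "\<And>x. norm x \<le> R \<Longrightarrow> norm (pd vs a x) \<le> C * \<rho> x ^ k"
    using weightedD[OF assms(1)[unfolded flat_def, rule_format, of k] vs, of R] by blast
  obtain D where D: "D \<ge> 0" "\<And>x. norm x \<le> R \<Longrightarrow> norm (pd vs a x) \<le> D * \<rho> x ^ 0"
    using weightedD[OF assms(1)[unfolded flat_def, rule_format, of 0] vs, of R] by blast
  have "norm (pd vs a x) \<le> (C + D) * min 1 (\<rho> x) ^ k" if x: "norm x \<le> R" for x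
  proof (cases "\<rho> x \<le> 1")
    case True
    then show ?thesis using C(2)[OF x] D(1) assms(2)[of x] by (simp add: min_def distrib_right add_increasing2)
  next
    case False
    then show ?thesis using D(2)[OF x] C(1) by (simp add: min_def)
  qed
  then show "\<exists>C\<ge>0. \<forall>x. norm x \<le> R \<longrightarrow> norm (pd vs a x) \<le> C * min 1 (\<rho> x) ^ k"
    using C(1) D(1) by (intro exI[of _ "C + D"]) auto
qed

text \<open>The \<open>k\<close>-th term, divided by \<open>e ^ N\<close>, of the Borel sum below.\<close>

definition borel_term :: "('a \<Rightarrow> complex) \<Rightarrow> ('a \<Rightarrow> complex) \<Rightarrow> nat \<Rightarrow> nat \<Rightarrow> real \<Rightarrow> 'a \<Rightarrow> complex"
  where "borel_term a e N k \<epsilon> x = of_real \<epsilon> ^ (k - N) * (a x * cutoff_power (k - N) (e x / of_real \<epsilon>))"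

lemma smooth_borel_term:
  fixes a :: "'a::euclidean_space \<Rightarrow> complex"
  assumes "smooth a" "smooth e"
  shows "smooth (borel_term a e N k \<epsilon>)"
  unfolding borel_term_def
  by (intro smooth_UNIV_intros assms smooth_on_compose_UNIV[OF open_UNIV _ smooth_divide_const])
    (use bounded_smooth_cutoff_power in \<open>simp add: bounded_smooth_def\<close>)

text \<open>The prefactor \<epsilon>^(k - N) outweighs the loss of \<epsilon>^(-length vs) from
  differentiation: at least one factor \<epsilon> remains, and it can be made small.\<close>

lemma borel_term_small:
  fixes a :: "'a::euclidean_space \<Rightarrow> complex"
  assumes a: "weighted \<omega> a" and e: "smooth e" and k: "N + length vs < k" and vs: "vs \<in> lists Basis"
    and \<omega>: "\<And>x. \<omega> x \<ge> 0" and c: "c > 0"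
  shows "\<exists>\<delta>>0. \<forall>\<epsilon>. 0 < \<epsilon> \<and> \<epsilon> \<le> 1 \<and> \<epsilon> \<le> \<delta> \<longrightarrow> (\<forall>x. norm x \<le> R \<longrightarrow>
    norm (pd vs (borel_term a e N k \<epsilon>) x) \<le> c * \<omega> x)"
proof -
  obtain C where C: "C \<ge> 0" "\<And>\<epsilon> x. 0 < \<epsilon> \<Longrightarrow> \<epsilon> \<le> 1 \<Longrightarrow> norm x \<le> R \<Longrightarrow>
    norm (pd vs (\<lambda>x. a x * cutoff_power (k - N) (e x / of_real \<epsilon>)) x) \<le> C / \<epsilon> ^ length vs * \<omega> x"
    using scaled_estimate[OF a e bounded_smooth_cutoff_power vs, of R "k - N"] by blast
  have "norm (pd vs (borel_term a e N k \<epsilon>) x) \<le> c * \<omega> x"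
    if \<epsilon>: "0 < \<epsilon>" "\<epsilon> \<le> 1" "\<epsilon> \<le> c / (C + 1)" and x: "norm x \<le> R" for \<epsilon> x
  proof -
    have sm: "smooth (\<lambda>x. a x * cutoff_power (k - N) (e x / of_real \<epsilon>))"
      using bounded_smooth_cutoff_power
      by (intro smooth_UNIV_intros weighted_smooth[OF a] smooth_on_compose_UNIV[OF open_UNIV _ smooth_divide_const[OF e]])
        (simp add: bounded_smooth_def)
    define j where "j = k - N - length vs - 1"
    have kj: "k - N = length vs + Suc j" using k by (simp add: j_def)
    have "norm (pd vs (borel_term a e N k \<epsilon>) x) =
      \<epsilon> ^ (k - N) * norm (pd vs (\<lambda>x. a x * cutoff_power (k - N) (e x / of_real \<epsilon>)) x)"
      unfolding borel_term_def[abs_def] pd_cmult[OF sm] using \<epsilon> by (simp add: norm_mult norm_power)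
    also have "\<dots> \<le> \<epsilon> ^ (k - N) * (C / \<epsilon> ^ length vs * \<omega> x)"
      using C(2)[OF \<epsilon>(1,2) x] \<epsilon> by (intro mult_left_mono) auto
    also have "\<dots> = C * \<omega> x * \<epsilon> ^ Suc j" using \<epsilon> by (simp add: kj power_add field_simps)
    also have "\<dots> \<le> C * \<omega> x * \<epsilon>"
      using \<epsilon> C(1) \<omega>[of x] power_le_one[of \<epsilon> j] by (intro mult_left_mono) (auto simp: mult_left_le)
    also have "\<dots> \<le> (C + 1) * \<epsilon> * \<omega> x"
      using \<epsilon> \<omega>[of x] by (simp add: algebra_simps)
    also have "\<dots> \<le> c * \<omega> x"
      using \<epsilon>(3) C(1) \<omega>[of x] by (intro mult_right_mono) (auto simp: field_simps)
    finally show ?thesis .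
  qed
  then show ?thesis using C(1) c by (intro exI[of _ "c / (C + 1)"]) auto
qed

text \<open>Borel's lemma: S has the expansion \<Sum> a_k e^k along e = 0. The k-th term is cut off
  to the region |e| < \<epsilon>_k, with \<epsilon>_k so small that its quotient by
  \<open>e^N\<close>, together with the derivatives of order below k - N, is at most 2^-k on the
  ball of radius k. The additional weight min 1 \<rho> to the power k makes the sum flat along
  \<rho>.\<close>

lemma borel_sum:
  fixes a :: "nat \<Rightarrow> 'a::euclidean_space \<Rightarrow> complex"
  assumes a: "\<And>k. flat \<rho> (a k)" and e: "smooth e" and \<rho>: "\<And>x. \<rho> x \<ge> 0"
  shows "\<exists>S. flat \<rho> S \<and> (\<forall>x. e x = 0 \<longrightarrow> S x = 0) \<and>
    (\<forall>N. \<exists>T. smooth T \<and> (\<forall>x. S x = (\<Sum>k = 1..<N. a k x * e x ^ k) + e x ^ N * T x))"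
proof -
  let ?\<mu> = "\<lambda>x. min 1 (\<rho> x)"
  let ?P = "\<lambda>k \<epsilon>. 0 < \<epsilon> \<and> \<epsilon> \<le> 1 \<and> (\<forall>N. \<forall>vs\<in>lists Basis. N + length vs < k \<longrightarrow>
     (\<forall>x. norm x \<le> real k \<longrightarrow> norm (pd vs (borel_term (a k) e N k \<epsilon>) x) \<le> (1 / 2) ^ k * ?\<mu> x ^ k))"
  have "\<exists>\<epsilon>. ?P k \<epsilon>" for k
  proof -
    \<comment> \<open>The conditions on the k-th scale are indexed by a finite set of pairs (N, vs),
      so the smallest of the admissible bounds is still positive.\<close>
    define I where "I = {..k} \<times> {vs. set vs \<subseteq> (Basis :: 'a set) \<and> length vs \<le> k}"
    have fin: "finite I" unfolding I_def by (intro finite_cartesian_product finite_lists_length_le) auto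
    let ?Q = "\<lambda>q \<delta>. \<delta> > 0 \<and> (fst q + length (snd q) < k \<longrightarrow> (\<forall>\<epsilon>. 0 < \<epsilon> \<and> \<epsilon> \<le> 1 \<and> \<epsilon> \<le> \<delta> \<longrightarrow> (\<forall>x. norm x \<le> real k \<longrightarrow>
      norm (pd (snd q) (borel_term (a k) e (fst q) k \<epsilon>) x) \<le> (1 / 2) ^ k * ?\<mu> x ^ k)))"
    have "\<forall>q\<in>I. \<exists>\<delta>. ?Q q \<delta>"
    proof
      fix q assume q: "q \<in> I"
      show "\<exists>\<delta>. ?Q q \<delta>"
      proof (cases "fst q + length (snd q) < k")
        case True
        have "snd q \<in> lists Basis" using q by (auto simp: I_def)
        from borel_term_small[OF flat_weighted_min[OF a \<rho>, of k k] e True this, of "(1 / 2) ^ k" "real k"]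
        show ?thesis using \<rho> by auto
      qed (auto intro: exI[of _ 1])
    qed
    from bchoice[OF this] obtain \<delta> where \<delta>: "\<forall>q\<in>I. ?Q q (\<delta> q)" by blast
    define \<epsilon> where "\<epsilon> = Min (insert 1 (\<delta> ` I))"
    have \<epsilon>: "\<epsilon> \<le> 1" "\<And>q. q \<in> I \<Longrightarrow> \<epsilon> \<le> \<delta> q" "\<epsilon> > 0"
      unfolding \<epsilon>_def using fin \<delta> by auto
    have "?P k \<epsilon>"
    proof (intro conjI allI ballI impI)
      fix N vs and x :: 'a assume h: "vs \<in> lists (Basis :: 'a set)" "N + length vs < k" "norm x \<le> real k"
      then have "(N, vs) \<in> I" by (auto simp: I_def)
      with \<delta> \<epsilon> h show "norm (pd vs (borel_term (a k) e N k \<epsilon>) x) \<le> (1 / 2) ^ k * ?\<mu> x ^ k"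
        by fastforce
    qed (use \<epsilon> in auto)
    then show ?thesis by blast
  qed
  then have "\<forall>k. \<exists>\<epsilon>. ?P k \<epsilon>" by blast
  from choice[OF this] obtain \<epsilon> where \<epsilon>: "\<And>k. ?P k (\<epsilon> k)" by blast
  \<comment> \<open>The index k = 0 is dropped even for N = 0: the expansion starts with e, and this
    makes S vanish where e does.\<close>
  define u where "u N k = (if max 1 N \<le> k then borel_term (a k) e N k (\<epsilon> k) else (\<lambda>_. 0))" for N k
  have smu: "smooth (u N k)" for N k
    unfolding u_def using smooth_borel_term[OF flat_smooth[OF a] e] by (simp add: smooth_on_const)
  have bound: "norm (pd vs (u N k) x) \<le> (1 / 2) ^ k * ?\<mu> x ^ k"
    if "vs \<in> lists Basis" "N + length vs < k" "norm x \<le> R" "R \<le> real k" for N vs k x R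
    using \<epsilon>[of k] that by (auto simp: u_def)
  have \<mu>: "0 \<le> ?\<mu> x" "?\<mu> x \<le> 1" for x using \<rho>[of x] by auto
  have rapid: "rapid_series (u N)" for N
    unfolding rapid_series_def
  proof (intro conjI allI ballI smu)
    fix vs :: "'a list" and R :: real assume vs: "vs \<in> lists Basis"
    have "norm (pd vs (u N k) x) \<le> (1 / 2) ^ k" if "k \<ge> max (nat \<lceil>R\<rceil>) (N + length vs + 1)" "norm x \<le> R" for k x
    proof -
      have "norm (pd vs (u N k) x) \<le> (1 / 2) ^ k * ?\<mu> x ^ k"
        by (rule bound[OF vs _ that(2)]) (use that in linarith)+
      also have "\<dots> \<le> (1 / 2) ^ k * 1" by (intro mult_left_mono power_le_one \<mu>) auto
      finally show ?thesis by simp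
    qed
    then show "\<exists>k0. \<forall>k\<ge>k0. \<forall>x. norm x \<le> R \<longrightarrow> norm (pd vs (u N k) x) \<le> (1 / 2) ^ k" by blast
  qed
  have summ: "summable (\<lambda>k. u N k x)" for N x
    using rapid_series_tail(2)[OF rapid lists.Nil, of N x] by simp
  have \<epsilon>0: "\<epsilon> k \<noteq> 0" for k using \<epsilon>[of k] by auto
  have u_eq: "e x ^ N * u N k x = a k x * e x ^ k * of_real (cutoff (norm (e x / of_real (\<epsilon> k)) ^ 2))"
    if "max 1 N \<le> k" for N k x
  proof -
    have "e x ^ N * e x ^ (k - N) = e x ^ k" using that by (simp flip: power_add)
    then show ?thesis
      using that \<epsilon>0[of k] by (simp add: u_def borel_term_def cutoff_power_def power_divide mult_ac)
  qed
  define S where "S x = (\<Sum>k. u 0 k x)" for x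
  show ?thesis
  proof (rule exI[of _ S], intro conjI allI impI)
    show "S x = 0" if "e x = 0" for x
    proof -
      have "u 0 k x = 0" for k
        using u_eq[of 0 k x] that by (cases "k = 0") (auto simp: u_def)
      then show ?thesis by (simp add: S_def)
    qed
  next
    show "flat \<rho> S"
      unfolding flat_def weighted_def
    proof (intro allI conjI ballI)
      show "smooth S" unfolding S_def[abs_def] by (rule smooth_rapid_series[OF rapid])
      fix N :: nat and vs :: "'a list" and R :: real assume vs: "vs \<in> lists Basis"
      \<comment> \<open>Beyond n all requirements hold together: k \<ge> R puts x into the ball of
        the estimate, k > length vs makes the estimate available, and k \<ge> N turns the capped
        weight into \<rho>^N.\<close>
      define n where "n = N + nat \<lceil>R\<rceil> + length vs + 1"
      have flu: "flat \<rho> (u 0 k)" for k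
      proof (cases "k \<ge> 1")
        case True
        have "smooth (\<lambda>x. of_real (\<epsilon> k) ^ k * cutoff_power k (e x / of_real (\<epsilon> k)))"
          using bounded_smooth_cutoff_power[of k]
          by (intro smooth_UNIV_intros smooth_on_compose_UNIV[OF open_UNIV _ smooth_divide_const[OF e]])
            (simp add: bounded_smooth_def)
        from flat_mult_smooth[OF a this, of k] show ?thesis
          using True by (simp add: u_def borel_term_def[abs_def] mult_ac)
      next
        case False
        have "flat \<rho> (\<lambda>x. a k x * 0)" by (intro flat_mult_smooth a smooth_on_const)
        then show ?thesis using False by (simp add: u_def)
      qed
      have "\<exists>C. \<forall>k. C k \<ge> 0 \<and> (\<forall>x. norm x \<le> R \<longrightarrow> norm (pd vs (u 0 k) x) \<le> C k * \<rho> x ^ N)"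
        using weightedD[OF flu[unfolded flat_def, rule_format] vs] by (intro choice) blast
      then obtain C where C: "\<And>k. C k \<ge> 0" "\<And>k x. norm x \<le> R \<Longrightarrow> norm (pd vs (u 0 k) x) \<le> C k * \<rho> x ^ N"
        by blast
      have "norm (pd vs S x) \<le> (2 + (\<Sum>k<n. C k)) * \<rho> x ^ N" if x: "norm x \<le> R" for x
      proof -
        have b: "norm (pd vs (u 0 k) x) \<le> (1 / 2) ^ k * \<rho> x ^ N" if k: "k \<ge> n" for k
        proof -
          have "norm (pd vs (u 0 k) x) \<le> (1 / 2) ^ k * ?\<mu> x ^ k"
            by (rule bound[OF vs _ x]) (use k in \<open>unfold n_def, linarith\<close>)+
          also have "?\<mu> x ^ k \<le> ?\<mu> x ^ N"
            using k by (intro power_decreasing \<mu>) (simp add: n_def)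
          also have "?\<mu> x ^ N \<le> \<rho> x ^ N" by (intro power_mono \<mu>) auto
          finally show ?thesis by simp
        qed
        have "norm (pd vs S x) = norm (\<Sum>k. pd vs (u 0 k) x)"
          unfolding S_def[abs_def] by (simp add: pd_rapid_series[OF vs rapid])
        also have "\<dots> \<le> norm ((\<Sum>k. pd vs (u 0 k) x) - (\<Sum>k<n. pd vs (u 0 k) x)) + norm (\<Sum>k<n. pd vs (u 0 k) x)"
          by (metis diff_add_cancel norm_triangle_ineq)
        also have "\<dots> \<le> 2 * \<rho> x ^ N * (1 / 2) ^ n + (\<Sum>k<n. C k * \<rho> x ^ N)"
          by (intro add_mono half_tail(2)[OF b] order_trans[OF norm_sum] sum_mono C(2)[OF x])
        also have "\<dots> \<le> 2 * \<rho> x ^ N * 1 + (\<Sum>k<n. C k * \<rho> x ^ N)"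
          using \<rho>[of x] by (intro add_mono mult_left_mono power_le_one order_refl) auto
        finally show ?thesis by (simp add: sum_distrib_right algebra_simps)
      qed
      then show "\<exists>C\<ge>0. \<forall>x. norm x \<le> R \<longrightarrow> norm (pd vs S x) \<le> C * \<rho> x ^ N"
        using C(1) by (intro exI[of _ "2 + (\<Sum>k<n. C k)"]) (auto intro!: add_nonneg_nonneg sum_nonneg)
    qed
  next
    fix N
    let ?K = "\<lambda>k x. regular_inverse_power N (e x / of_real (\<epsilon> k))"
    \<comment> \<open>The terms with k \<ge> N are divided by \<open>e^N\<close> explicitly. An
      earlier term differs from \<open>a k x * e x ^ k\<close> by its factor 1 - cutoff, which is
      \<open>e^N\<close> times a smooth function given by
      \<open>regular_inverse_power\<close>.\<close>
    define T where "T x = (\<Sum>k. u N k x) - (\<Sum>k = 1..<N. a k x * e x ^ k * (?K k x / of_real (\<epsilon> k) ^ N))" for x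
    have "smooth T"
      unfolding T_def[abs_def]
      by (intro smooth_UNIV_intros smooth_rapid_series[OF rapid] flat_smooth[OF a] e smooth_divide_const
          smooth_on_compose_UNIV[OF open_UNIV smooth_regular_inverse_power])
    moreover have "S x = (\<Sum>k = 1..<N. a k x * e x ^ k) + e x ^ N * T x" for x
    proof -
      have "S x - e x ^ N * (\<Sum>k. u N k x) = (\<Sum>k. u 0 k x - e x ^ N * u N k x)"
        unfolding S_def suminf_mult[OF summ, symmetric] by (rule suminf_diff[OF summ summable_mult[OF summ]])
      also have "\<dots> = (\<Sum>k\<in>{1..<N}. u 0 k x - e x ^ N * u N k x)"
      proof (rule suminf_finite)
        fix k assume "k \<notin> {1..<N}"
        then consider "k = 0" | "max 1 N \<le> k" by force
        then show "u 0 k x - e x ^ N * u N k x = 0"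
          using u_eq[of 0 k x] u_eq[of N k x] by cases (auto simp: u_def)
      qed simp
      also have "\<dots> = (\<Sum>k = 1..<N. a k x * e x ^ k - e x ^ N * (a k x * e x ^ k * (?K k x / of_real (\<epsilon> k) ^ N)))"
      proof (rule sum.cong[OF refl])
        fix k assume k: "k \<in> {1..<N}"
        have "e x ^ N * (?K k x / of_real (\<epsilon> k) ^ N) = 1 - of_real (cutoff (norm (e x / of_real (\<epsilon> k)) ^ 2))"
          using regular_inverse_power_mult[of "e x / of_real (\<epsilon> k)" N] by (simp add: power_divide)
        then have "a k x * e x ^ k * of_real (cutoff (norm (e x / of_real (\<epsilon> k)) ^ 2)) =
          a k x * e x ^ k * (1 - e x ^ N * (?K k x / of_real (\<epsilon> k) ^ N))" by simp
        moreover have "u 0 k x = a k x * e x ^ k * of_real (cutoff (norm (e x / of_real (\<epsilon> k)) ^ 2))"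
          using u_eq[of 0 k x] k by simp
        moreover have "u N k x = 0" using k by (simp add: u_def)
        ultimately show "u 0 k x - e x ^ N * u N k x =
          a k x * e x ^ k - e x ^ N * (a k x * e x ^ k * (?K k x / of_real (\<epsilon> k) ^ N))"
          by (simp add: algebra_simps)
      qed
      finally show ?thesis
        by (simp add: T_def sum_subtractf sum_distrib_left algebra_simps)
    qed
    ultimately show "\<exists>T. smooth T \<and> (\<forall>x. S x = (\<Sum>k = 1..<N. a k x * e x ^ k) + e x ^ N * T x)" by blast
  qed
qed

section \<open>The operator d/d(conj z) in the plane of the first two coordinates, with
  parameters\<close>

definition dbar :: "(real \<times> real \<times> 'p::euclidean_space \<Rightarrow> complex) \<Rightarrow> real \<times> real \<times> 'p \<Rightarrow> complex"
  where "dbar g x = (dir_deriv (1, 0, 0) g x + \<i> * dir_deriv (0, 1, 0) g x) / 2"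

lemma Basis_xy: "(1, 0, 0) \<in> (Basis :: (real \<times> real \<times> 'p::euclidean_space) set)"
  "(0, 1, 0) \<in> (Basis :: (real \<times> real \<times> 'p::euclidean_space) set)"
  by (auto simp: Basis_prod_def zero_prod_def)

lemma smooth_dbar: "smooth g \<Longrightarrow> smooth (dbar g)"
  unfolding dbar_def[abs_def] by (intro smooth_divide_const smooth_UNIV_intros smooth_on_dir_deriv)

lemma dbar_add: "smooth f \<Longrightarrow> smooth g \<Longrightarrow> dbar (\<lambda>x. f x + g x) x = dbar f x + dbar g x"
  by (simp add: dbar_def dir_deriv_add_smooth algebra_simps add_divide_distrib)

lemma dbar_mult: "smooth f \<Longrightarrow> smooth g \<Longrightarrow> dbar (\<lambda>x. f x * g x) x = f x * dbar g x + dbar f x * g x"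
  by (simp add: dbar_def dir_deriv_mult_smooth algebra_simps add_divide_distrib)

lemma dbar_const: "dbar (\<lambda>_. c) x = 0"
proof -
  have "dir_deriv v (\<lambda>_. c) x = 0" for v
    by (rule dir_deriv_eq) (rule has_derivative_const)
  then show ?thesis by (simp add: dbar_def)
qed

lemma dbar_cmult: "smooth f \<Longrightarrow> dbar (\<lambda>x. c * f x) x = c * dbar f x"
  by (simp add: dbar_mult smooth_on_const dbar_const)

lemma dbar_power:
  assumes "smooth e"
  shows "dbar (\<lambda>x. e x ^ n) x = of_nat n * e x ^ (n - 1) * dbar e x"
proof (induction n)
  case (Suc n)
  have "dbar (\<lambda>x. e x ^ Suc n) x = e x * dbar (\<lambda>x. e x ^ n) x + dbar e x * e x ^ n"
    using assms by (simp add: dbar_mult smooth_UNIV_intros)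
  also have "\<dots> = of_nat (Suc n) * e x ^ (Suc n - 1) * dbar e x"
    unfolding Suc by (cases n) (simp_all add: algebra_simps)
  finally show ?case .
qed (simp add: dbar_const)

lemma flat_dbar: "flat \<rho> g \<Longrightarrow> flat \<rho> (dbar g)"
proof -
  assume g: "flat \<rho> g"
  have "flat \<rho> (\<lambda>x. dir_deriv (1, 0, 0) g x * (1 / 2) + dir_deriv (0, 1, 0) g x * (\<i> / 2))"
    by (intro flat_add flat_mult_smooth flat_dir_deriv g Basis_xy smooth_on_const)
  then show ?thesis by (simp add: dbar_def[abs_def] field_simps)
qed

text \<open>The correction of \<open>F\<close> is the formal solution \<open>\<Sum> (-e)\<^sup>k / k! D\<^sup>k F\<close>, \<open>D = e\<^sub>1\<inverse> dbar\<close>, of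
  \<open>dbar F' = 0\<close> along \<open>e = 0\<close>: as \<open>D e = 1\<close>, the series telescopes.\<close>

lemma nirenberg_step:
  fixes F :: "real \<times> real \<times> 'p::euclidean_space \<Rightarrow> complex"
  assumes F: "smooth F" and e: "smooth e" and e1: "smooth e1" and de: "\<And>x. dbar e x = e1 x"
    and fl: "flat \<rho> (dbar F)" and \<rho>: "\<And>x. \<rho> x \<ge> 0"
    and le: "\<And>R. \<exists>C\<ge>0. \<forall>x. norm x \<le> R \<longrightarrow> \<rho> x \<le> C * norm (e1 x)"
  obtains F' where "smooth F'" "flat (\<lambda>x. \<rho> x * norm (e x)) (dbar F')"
    "\<And>x. e x = 0 \<or> \<rho> x = 0 \<Longrightarrow> F' x = F x"
proof -
  define h where "h = rec_nat F (\<lambda>_ g x. dbar g x / e1 x)"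
  have h0: "h 0 = F" and hS: "h (Suc k) = (\<lambda>x. dbar (h k) x / e1 x)" for k
    by (simp_all add: h_def)
  have flh: "flat \<rho> (dbar (h k))" for k
    by (induction k) (auto simp: h0 hS fl intro!: flat_dbar flat_divide[OF _ e1 \<rho> le])
  have flh': "flat \<rho> (h (Suc k))" for k
    unfolding hS by (rule flat_divide[OF flh e1 \<rho> le])
  have smh: "smooth (h k)" for k
    using F flat_smooth[OF flh'] h0 by (cases k) auto
  \<comment> \<open>Where e1 vanishes the quotient is 0 by default. There \<open>le\<close> forces
    \<rho> = 0, and flatness forces \<open>dbar (h k) x = 0\<close>, so the equation holds at these
    points too.\<close>
  have e1h: "e1 x * h (Suc k) x = dbar (h k) x" for k x
  proof (cases "e1 x = 0")
    case True
    obtain C where "\<rho> x \<le> C * norm (e1 x)" using le[of "norm x"] order_refl by blast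
    then have "\<rho> x = 0" using True \<rho>[of x] by simp
    moreover obtain D where "norm (dbar (h k) x) \<le> D * \<rho> x ^ 1"
      using flat_bound[OF flh, of "norm x" k 1] order_refl by blast
    ultimately show ?thesis using True by simp
  qed (simp add: hS)
  \<comment> \<open>The term k = 0 of the formal solution is F itself, for which no flatness is
    available; it stays outside the Borel sum. The correction therefore vanishes wherever e or
    \<rho> does.\<close>
  define a where "a k x = (if k = 0 then 0 else (- 1) ^ k / fact k * h k x)" for k x
  have fla: "flat \<rho> (a k)" for k
  proof (cases k)
    case 0
    have "flat \<rho> (\<lambda>x. dbar F x * 0)" by (intro flat_mult_smooth fl smooth_on_const)
    then show ?thesis using 0 by (simp add: a_def[abs_def])
  next
    case (Suc j)
    have "flat \<rho> (\<lambda>x. h (Suc j) x * ((- 1) ^ k / fact k))" by (intro flat_mult_smooth flh' smooth_on_const)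
    then show ?thesis using Suc by (simp add: a_def[abs_def] mult_ac)
  qed
  obtain S where S: "flat \<rho> S" "\<And>x. e x = 0 \<Longrightarrow> S x = 0"
    "\<And>N. \<exists>T. smooth T \<and> (\<forall>x. S x = (\<Sum>k = 1..<N. a k x * e x ^ k) + e x ^ N * T x)"
    using borel_sum[of \<rho> a e, OF fla e \<rho>] by blast
  define F' where "F' x = F x + S x" for x
  have smF': "smooth F'" unfolding F'_def[abs_def] by (intro smooth_UNIV_intros F flat_smooth[OF S(1)])
  let ?P = "\<lambda>n x. \<Sum>k<n. (- 1) ^ k / fact k * (h k x * e x ^ k)"
  have smt: "smooth (\<lambda>x. (- 1) ^ k / fact k * (h k x * e x ^ k))" for k
    by (intro smooth_UNIV_intros smh e)
  have smP: "smooth (?P n)" for n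
    by (intro smooth_on_sum[OF open_UNIV] smt)
  have tel: "dbar (?P (Suc n)) x = (- 1) ^ n / fact n * (e x ^ n * (e1 x * h (Suc n) x))" for n x
  proof (induction n)
    case 0
    then show ?case by (simp add: e1h h0)
  next
    case (Suc n)
    have "dbar (?P (Suc (Suc n))) x = dbar (?P (Suc n)) x
      + (- 1) ^ Suc n / fact (Suc n) * dbar (\<lambda>x. h (Suc n) x * e x ^ Suc n) x"
      using dbar_add[OF smP[of "Suc n"] smt[of "Suc n"], of x]
        dbar_cmult[OF smooth_on_mult[OF open_UNIV smh[of "Suc n"] smooth_on_power[OF open_UNIV e]], of "(- 1) ^ Suc n / fact (Suc n)" "Suc n" x]
      by (simp only: sum.lessThan_Suc)
    also have "dbar (\<lambda>x. h (Suc n) x * e x ^ Suc n) x =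
      h (Suc n) x * (of_nat (Suc n) * e x ^ n * e1 x) + e1 x * h (Suc (Suc n)) x * e x ^ Suc n"
      using dbar_mult[OF smh[of "Suc n"] smooth_on_power[OF open_UNIV e, of "Suc n"], of x]
        dbar_power[OF e, of "Suc n" x] de e1h[of x "Suc n"] by simp
    also have "dbar (?P (Suc n)) x + (- 1) ^ Suc n / fact (Suc n) * \<dots> =
      (- 1) ^ Suc n / fact (Suc n) * (e x ^ Suc n * (e1 x * h (Suc (Suc n)) x))"
      unfolding Suc.IH by (simp add: fact_Suc field_simps del: of_nat_Suc)
    finally show ?case .
  qed
  \<comment> \<open>When the series is cut after the term with index N, telescoping leaves a single
    term with \<open>e^N\<close>, and the Borel remainder \<open>e^(N + 1) T\<close> loses one power
    under \<open>dbar\<close>. So \<open>dbar F'\<close> is divisible by every power of e.\<close>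
  have "flat (\<lambda>x. norm (e x)) (dbar F')"
  proof (rule flat_of_power_multiples[OF e])
    fix N
    obtain T where T: "smooth T" "\<And>x. S x = (\<Sum>k = 1..<Suc N. a k x * e x ^ k) + e x ^ Suc N * T x"
      using S(3)[of "Suc N"] by blast
    have "(\<Sum>k = 1..<Suc N. a k x * e x ^ k) + F x = ?P (Suc N) x" for x
    proof -
      have "?P (Suc N) x = F x + (\<Sum>k = 1..<Suc N. (- 1) ^ k / fact k * (h k x * e x ^ k))"
        by (simp add: lessThan_atLeast0 sum.atLeast_Suc_lessThan[of 0 "Suc N"] h0 del: sum.op_ivl_Suc)
      also have "(\<Sum>k = 1..<Suc N. (- 1) ^ k / fact k * (h k x * e x ^ k)) = (\<Sum>k = 1..<Suc N. a k x * e x ^ k)"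
        by (rule sum.cong) (auto simp: a_def)
      finally show ?thesis by simp
    qed
    then have F'eq: "F' = (\<lambda>x. ?P (Suc N) x + e x ^ Suc N * T x)"
      by (auto simp: F'_def T(2) fun_eq_iff algebra_simps)
    let ?T = "\<lambda>x. (- 1) ^ N / fact N * (e1 x * h (Suc N) x) + (e x * dbar T x + of_nat (Suc N) * e1 x * T x)"
    have "dbar F' x = e x ^ N * ?T x" for x
    proof -
      have "dbar F' x = dbar (?P (Suc N)) x + dbar (\<lambda>x. e x ^ Suc N * T x) x"
        unfolding F'eq by (rule dbar_add[OF smP]) (intro smooth_UNIV_intros e T(1))
      also have "dbar (\<lambda>x. e x ^ Suc N * T x) x = e x ^ Suc N * dbar T x + of_nat (Suc N) * e x ^ N * e1 x * T x"
        using dbar_mult[OF smooth_on_power[OF open_UNIV e, of "Suc N"] T(1), of x] dbar_power[OF e, of "Suc N" x] de by simp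
      finally show ?thesis unfolding tel by (simp add: algebra_simps)
    qed
    moreover have "smooth ?T" by (intro smooth_UNIV_intros e1 e T(1) smh smooth_dbar)
    ultimately show "\<exists>T. smooth T \<and> (\<forall>x. dbar F' x = e x ^ N * T x)" by blast
  qed
  moreover have "flat \<rho> (dbar F')"
  proof -
    have "dbar F' = (\<lambda>x. dbar F x + dbar S x)"
      unfolding F'_def[abs_def] by (rule ext) (rule dbar_add[OF F flat_smooth[OF S(1)]])
    then show ?thesis using flat_add[OF fl flat_dbar[OF S(1)]] by (simp only:)
  qed
  ultimately have "flat (\<lambda>x. \<rho> x * norm (e x)) (dbar F')"
    using flat_both[of \<rho> "dbar F'" "\<lambda>x. norm (e x)"] \<rho> norm_ge_zero by blast
  moreover have "F' x = F x" if "e x = 0 \<or> \<rho> x = 0" for x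
  proof -
    obtain C where "norm (S x) \<le> C * \<rho> x ^ 1" using flat_bound[OF S(1), of "norm x" 1] order_refl by blast
    then show ?thesis using that S(2)[of x] by (auto simp: F'_def)
  qed
  ultimately show ?thesis using that smF' by blast
qed

definition zc :: "real \<times> real \<times> 'p \<Rightarrow> complex"
  where "zc w = Complex (fst w) (fst (snd w))"

lemma bounded_linear_zc: "bounded_linear (zc :: real \<times> real \<times> 'p::euclidean_space \<Rightarrow> complex)"
  by (rule linear_conv_bounded_linear[THEN iffD1]) (auto intro!: linearI simp: zc_def complex_eq_iff)

lemma smooth_zc: "smooth (zc :: real \<times> real \<times> 'p::euclidean_space \<Rightarrow> complex)"
  by (rule smooth_on_linear[OF bounded_linear_zc open_UNIV])

definition ppoly :: "(nat \<Rightarrow> 'p \<Rightarrow> complex) \<Rightarrow> nat \<Rightarrow> real \<times> real \<times> 'p \<Rightarrow> complex"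
  where "ppoly c n w = (\<Sum>i\<le>n. c i (snd (snd w)) * zc w ^ i)"

lemma smooth_ppoly:
  fixes c :: "nat \<Rightarrow> 'p::euclidean_space \<Rightarrow> complex"
  assumes "\<And>i. smooth (c i)"
  shows "smooth (ppoly c n)"
proof -
  have "smooth (\<lambda>w :: real \<times> real \<times> 'p. c i (snd (snd w)))" for i
    by (rule smooth_on_compose_UNIV[OF open_UNIV assms]) (intro smooth_UNIV_intros)
  then show ?thesis unfolding ppoly_def[abs_def] by (intro smooth_UNIV_intros smooth_zc)
qed

text \<open>A polynomial P in z is holomorphic in z, so \<open>dbar\<close> of its conjugate is the
  conjugate of P'; the parameter p stays fixed in the two directions involved.\<close>

lemma dbar_cnj_ppoly:
  fixes c :: "nat \<Rightarrow> 'p::euclidean_space \<Rightarrow> complex"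
  assumes c: "\<And>i. smooth (c i)"
  shows "dbar (\<lambda>w. cnj (ppoly c (Suc n) w)) w = cnj (ppoly (\<lambda>i p. of_nat (Suc i) * c (Suc i) p) n w)"
proof -
  let ?D = "\<lambda>h. \<Sum>i\<le>Suc n. c i (snd (snd w)) * (of_nat i * zc h * zc w ^ (i - 1)) + dir_deriv (snd (snd h)) (c i) (snd (snd w)) * zc w ^ i"
  have "(ppoly c (Suc n) has_derivative ?D) (at w)"
    unfolding ppoly_def[abs_def]
    by (intro has_derivative_sum has_derivative_mult has_derivative_power bounded_linear_imp_has_derivative bounded_linear_zc
        has_derivative_compose[OF _ smooth_on_has_derivative[OF c UNIV_I]] has_derivative_snd has_derivative_ident)
  then have "((\<lambda>w. cnj (ppoly c (Suc n) w)) has_derivative (\<lambda>h. cnj (?D h))) (at w)"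
    by (rule bounded_linear.has_derivative[OF bounded_linear_cnj])
  note d = dir_deriv_eq[OF this]
  have d0: "dir_deriv 0 (c i) p = 0" for i p
    using linear_0[OF dir_deriv_linear[OF smooth_differentiable[OF c]]] .
  let ?s = "\<Sum>i\<le>Suc n. c i (snd (snd w)) * (of_nat i * zc w ^ (i - 1))"
  have z: "zc (1::real, 0::real, 0::'p) = 1" "zc (0::real, 1::real, 0::'p) = \<i>"
    by (auto simp: zc_def complex_eq_iff)
  have "?D (1, 0, 0) = ?s" "?D (0, 1, 0) = \<i> * ?s"
    by (simp_all add: z d0 sum_distrib_left mult_ac del: sum.atMost_Suc)
  then have "dbar (\<lambda>w. cnj (ppoly c (Suc n) w)) w = cnj ?s"
    unfolding dbar_def d by (simp del: sum.atMost_Suc)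
  also have "?s = ppoly (\<lambda>i p. of_nat (Suc i) * c (Suc i) p) n w"
    unfolding ppoly_def by (subst sum.atMost_Suc_shift) (simp add: mult_ac)
  finally show ?thesis .
qed

lemma norm_snd_fst_le: "\<bar>fst (snd w)\<bar> \<le> norm w" for w :: "real \<times> real \<times> 'p::euclidean_space"
  using norm_fst_le[of "fst (snd w)" "snd (snd w)"] norm_snd_le[of "snd w" "fst w"] by simp

text \<open>Induction through the derivatives of the polynomial P. \<open>nirenberg_step\<close>
  wants e with \<open>dbar e = e1\<close> and data that are already flat where e1 vanishes: e = cnj
  P and e1 = cnj P' qualify as soon as \<open>dbar F\<close> is flat along the zeros of P', which is
  the case of lower degree. The chain ends with a constant polynomial, where e = Im z and e1 =
  \<i>/2; the constant nonzero leading coefficient guarantees this end.\<close>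

theorem nirenberg_extension:
  fixes f :: "real \<times> 'p::euclidean_space \<Rightarrow> complex" and c :: "nat \<Rightarrow> 'p \<Rightarrow> complex"
  assumes f: "smooth f" and c: "\<And>i. smooth (c i)" and top: "\<And>p. c n p = \<gamma>" "\<gamma> \<noteq> 0"
  shows "\<exists>F. smooth F \<and> (\<forall>x p. F (x, 0, p) = f (x, p)) \<and>
    flat (\<lambda>w. \<bar>fst (snd w)\<bar> * norm (ppoly c n w)) (dbar F)"
  using c top
proof (induction n arbitrary: c \<gamma>)
  case 0
  let ?F = "\<lambda>w :: real \<times> real \<times> 'p. f (fst w, snd (snd w))"
  let ?e = "\<lambda>w :: real \<times> real \<times> 'p. complex_of_real (fst (snd w))"
  have smF: "smooth ?F"
    by (intro smooth_on_compose_UNIV[OF open_UNIV f] smooth_UNIV_intros)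
  have sme: "smooth ?e" by (intro smooth_of_real smooth_UNIV_intros)
  have de: "dbar ?e w = \<i> / 2" for w
  proof -
    have "(?e has_derivative (\<lambda>h. complex_of_real (fst (snd h)))) (at w)"
      by (intro bounded_linear.has_derivative[OF bounded_linear_of_real] has_derivative_fst has_derivative_snd has_derivative_ident)
    from dir_deriv_eq[OF this] show ?thesis by (simp add: dbar_def)
  qed
  have le: "\<exists>C\<ge>0. \<forall>w :: real \<times> real \<times> 'p. norm w \<le> R \<longrightarrow> 1 \<le> C * norm (\<i> / 2)" for R
    by (intro exI[of _ 2]) (simp add: norm_divide)
  obtain F' where F': "smooth F'" "flat (\<lambda>w. 1 * norm (?e w)) (dbar F')" "\<And>w. ?e w = 0 \<or> (1::real) = 0 \<Longrightarrow> F' w = ?F w"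
    by (rule nirenberg_step[OF smF sme smooth_on_const de smooth_flat_1[OF smooth_dbar[OF smF]] _ le]) auto
  have "flat (\<lambda>w. \<bar>fst (snd w)\<bar> * norm (ppoly c 0 w)) (dbar F')"
    by (rule flat_mono[OF F'(2)])
      (use 0 in \<open>auto simp: ppoly_def intro!: exI[of _ "1 / norm \<gamma>"]\<close>)
  then show ?case using F' by auto
next
  case (Suc n)
  let ?c = "\<lambda>i p. of_nat (Suc i) * c (Suc i) p"
  have smc: "smooth (?c i)" for i by (intro smooth_UNIV_intros Suc.prems)
  have "?c n p = of_nat (Suc n) * \<gamma>" for p using Suc.prems by simp
  moreover have "of_nat (Suc n) * \<gamma> \<noteq> 0" using Suc.prems(3) by (simp del: of_nat_Suc)
  ultimately obtain F where F: "smooth F" "\<And>x p. F (x, 0, p) = f (x, p)"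
    "flat (\<lambda>w. \<bar>fst (snd w)\<bar> * norm (ppoly ?c n w)) (dbar F)"
    using Suc.IH[of ?c "of_nat (Suc n) * \<gamma>"] smc by blast
  have sm: "smooth (ppoly c (Suc n))" "smooth (ppoly ?c n)"
    using Suc.prems smc by (intro smooth_ppoly; simp)+
  have le: "\<exists>C\<ge>0. \<forall>w. norm w \<le> R \<longrightarrow> \<bar>fst (snd w)\<bar> * norm (ppoly ?c n w) \<le> C * norm (cnj (ppoly ?c n w))" for R
  proof (intro exI[of _ "max 0 R"] conjI allI impI)
    fix w :: "real \<times> real \<times> 'p" assume "norm w \<le> R"
    then have "\<bar>fst (snd w)\<bar> \<le> max 0 R" using norm_snd_fst_le[of w] by linarith
    then show "\<bar>fst (snd w)\<bar> * norm (ppoly ?c n w) \<le> max 0 R * norm (cnj (ppoly ?c n w))"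
      unfolding complex_mod_cnj by (rule mult_right_mono) simp
  qed simp
  obtain F' where F': "smooth F'"
    "flat (\<lambda>w. \<bar>fst (snd w)\<bar> * norm (ppoly ?c n w) * norm (cnj (ppoly c (Suc n) w))) (dbar F')"
    "\<And>w. cnj (ppoly c (Suc n) w) = 0 \<or> \<bar>fst (snd w)\<bar> * norm (ppoly ?c n w) = 0 \<Longrightarrow> F' w = F w"
    by (rule nirenberg_step[OF F(1) smooth_cnj[OF sm(1)] smooth_cnj[OF sm(2)] dbar_cnj_ppoly[OF Suc.prems(1)] F(3) _ le]) auto
  have "flat (\<lambda>w. \<bar>fst (snd w)\<bar> * norm (ppoly c (Suc n) w)) (dbar F')"
  proof (rule flat_mono[OF F'(2)])
    fix R :: real
    obtain C where C: "C \<ge> 0" "\<And>w. norm w \<le> R \<Longrightarrow> norm (ppoly ?c n w) \<le> C"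
      using smooth_bounded[OF sm(2)] by metis
    have "\<bar>fst (snd w)\<bar> * norm (ppoly ?c n w) * norm (cnj (ppoly c (Suc n) w)) \<le>
      C * (\<bar>fst (snd w)\<bar> * norm (ppoly c (Suc n) w))" if "norm w \<le> R" for w
      using mult_right_mono[OF C(2)[OF that], of "\<bar>fst (snd w)\<bar> * norm (ppoly c (Suc n) w)"] by (simp add: mult_ac)
    then show "\<exists>C\<ge>0. \<forall>w. norm w \<le> R \<longrightarrow> \<bar>fst (snd w)\<bar> * norm (ppoly ?c n w) * norm (cnj (ppoly c (Suc n) w))
      \<le> C * (\<bar>fst (snd w)\<bar> * norm (ppoly c (Suc n) w))" using C(1) by blast
  qed auto
  moreover have "F' (x, 0, p) = f (x, p)" for x p using F'(3)[of "(x, 0, p)"] F(2) by simp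
  ultimately show ?case using F'(1) by blast
qed

section \<open>Malgrange division\<close>

lemma dir_deriv_scaleR: "smooth v \<Longrightarrow> dir_deriv (c *\<^sub>R w) v x = c *\<^sub>R dir_deriv w v x"
  using linear_cmul[OF dir_deriv_linear[OF smooth_differentiable]] .

lemma integral_dir_deriv_x:
  fixes v :: "real \<times> real \<times> 'p::euclidean_space \<Rightarrow> complex"
  assumes v: "smooth v" and z: "\<And>b. v (l, b, p) = 0" "\<And>b. v (u, b, p) = 0" and lu: "l \<le> u"
  shows "integral (cbox (l, l) (u, u)) (\<lambda>(a, b). dir_deriv (1, 0, 0) v (a, b, p)) = 0"
proof -
  have cont: "continuous_on A (\<lambda>(a, b). dir_deriv (1, 0, 0) v (a, b, p))" for A
    unfolding case_prod_unfold
    by (rule continuous_on_compose2[OF smooth_on_continuous_on[OF smooth_on_dir_deriv[OF v]]])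
      (auto intro!: continuous_intros)
  have inner: "integral {l..u} (\<lambda>a. dir_deriv (1, 0, 0) v (a, b, p)) = 0" for b
  proof -
    have "((\<lambda>a. v (a, b, p)) has_vector_derivative dir_deriv (1, 0, 0) v (a, b, p)) (at a)" for a
    proof -
      have "((\<lambda>a. v (a, b, p)) has_derivative (\<lambda>h. dir_deriv (h, 0) v (a, b, p))) (at a)"
        by (rule has_derivative_compose[OF has_derivative_Pair[OF has_derivative_ident has_derivative_const]
            smooth_on_has_derivative[OF v UNIV_I]])
      moreover have "dir_deriv (h, 0) v (a, b, p) = h *\<^sub>R dir_deriv (1, 0, 0) v (a, b, p)" for h
        using dir_deriv_scaleR[OF v, of h "(1, 0, 0)" "(a, b, p)"] by (simp add: zero_prod_def)
      ultimately show ?thesis by (simp add: has_vector_derivative_def)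
    qed
    then have "((\<lambda>a. dir_deriv (1, 0, 0) v (a, b, p)) has_integral (v (u, b, p) - v (l, b, p))) {l..u}"
      using lu by (intro fundamental_theorem_of_calculus) (auto intro: has_vector_derivative_at_within)
    then show ?thesis using z by (simp add: integral_unique)
  qed
  have "integral (cbox (l, l) (u, u)) (\<lambda>(a, b). dir_deriv (1, 0, 0) v (a, b, p)) =
    integral (cbox l u) (\<lambda>a. integral (cbox l u) (\<lambda>b. dir_deriv (1, 0, 0) v (a, b, p)))"
    using integral_prod_continuous[OF cont] by simp
  also have "\<dots> = integral (cbox l u) (\<lambda>b. integral (cbox l u) (\<lambda>a. dir_deriv (1, 0, 0) v (a, b, p)))"
    by (rule integral_swap_continuous[OF cont])
  finally show ?thesis using inner by simp
qed

lemma integral_dir_deriv_y: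
  fixes v :: "real \<times> real \<times> 'p::euclidean_space \<Rightarrow> complex"
  assumes v: "smooth v" and z: "\<And>a. v (a, l, p) = 0" "\<And>a. v (a, u, p) = 0" and lu: "l \<le> u"
  shows "integral (cbox (l, l) (u, u)) (\<lambda>(a, b). dir_deriv (0, 1, 0) v (a, b, p)) = 0"
proof -
  have cont: "continuous_on A (\<lambda>(a, b). dir_deriv (0, 1, 0) v (a, b, p))" for A
    unfolding case_prod_unfold
    by (rule continuous_on_compose2[OF smooth_on_continuous_on[OF smooth_on_dir_deriv[OF v]]])
      (auto intro!: continuous_intros)
  have inner: "integral {l..u} (\<lambda>b. dir_deriv (0, 1, 0) v (a, b, p)) = 0" for a
  proof -
    have "((\<lambda>b. v (a, b, p)) has_vector_derivative dir_deriv (0, 1, 0) v (a, b, p)) (at b)" for b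
    proof -
      have "((\<lambda>b. (a, b, p)) has_derivative (\<lambda>h. (0, h, 0))) (at b)"
        by (intro has_derivative_Pair has_derivative_ident has_derivative_const)
      from has_derivative_compose[OF this smooth_on_has_derivative[OF v UNIV_I]]
      have 1: "((\<lambda>b. v (a, b, p)) has_derivative (\<lambda>h. dir_deriv (0, h, 0) v (a, b, p))) (at b)" .
      have 2: "dir_deriv (0, h, 0) v (a, b, p) = h *\<^sub>R dir_deriv (0, 1, 0) v (a, b, p)" for h
        using dir_deriv_scaleR[OF v, of h "(0, 1, 0)" "(a, b, p)"] by simp
      show ?thesis
        unfolding has_vector_derivative_def by (rule has_derivative_eq_rhs[OF 1]) (rule ext, rule 2)
    qed
    then have "((\<lambda>b. dir_deriv (0, 1, 0) v (a, b, p)) has_integral (v (a, u, p) - v (a, l, p))) {l..u}"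
      using lu by (intro fundamental_theorem_of_calculus) (auto intro: has_vector_derivative_at_within)
    then show ?thesis using z by (simp add: integral_unique)
  qed
  show ?thesis using integral_prod_continuous[OF cont] inner by simp
qed

lemma integrable_slice:
  fixes v :: "real \<times> real \<times> 'p::euclidean_space \<Rightarrow> complex"
  assumes "smooth v"
  shows "(\<lambda>(a, b). v (a, b, p)) integrable_on cbox l u"
  unfolding case_prod_unfold
  by (rule integrable_continuous, rule continuous_on_compose2[OF smooth_on_continuous_on[OF assms]])
    (auto intro!: continuous_intros)

text \<open>Stokes' formula without boundary term: the support lies well inside the box, and each
  partial derivative integrates to a difference of boundary values.\<close>

lemma integral_dbar:
  fixes v :: "real \<times> real \<times> 'p::euclidean_space \<Rightarrow> complex"
  assumes v: "smooth v" and z: "\<And>a b. \<bar>a\<bar> \<ge> 1 \<or> \<bar>b\<bar> \<ge> 1 \<Longrightarrow> v (a, b, p) = 0"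
  shows "integral (cbox (-2, -2) (2, 2)) (\<lambda>(a, b). dbar v (a, b, p)) = 0"
proof -
  let ?B = "cbox (-2, -2) (2, 2) :: (real \<times> real) set"
  have int: "(\<lambda>(a, b). dir_deriv w v (a, b, p)) integrable_on ?B" for w
    by (rule integrable_slice[OF smooth_on_dir_deriv[OF v]])
  have "integral ?B (\<lambda>(a, b). dbar v (a, b, p)) =
    integral ?B (\<lambda>z. (1 / 2) * ((\<lambda>(a, b). dir_deriv (1, 0, 0) v (a, b, p)) z + \<i> * (\<lambda>(a, b). dir_deriv (0, 1, 0) v (a, b, p)) z))"
    by (rule integral_cong) (auto simp: dbar_def)
  also have "\<dots> = (1 / 2) * (integral ?B (\<lambda>(a, b). dir_deriv (1, 0, 0) v (a, b, p)) + \<i> * integral ?B (\<lambda>(a, b). dir_deriv (0, 1, 0) v (a, b, p)))"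
    by (simp only: integral_mult_right integral_add[OF int integrable_on_mult_right[OF int]])
  also have "\<dots> = 0"
    using integral_dir_deriv_x[OF v, of "-2" p 2] integral_dir_deriv_y[OF v, of "-2" p 2] z by simp
  finally show ?thesis .
qed

section \<open>The Cauchy kernel with its pole cut out, and the Cauchy-Pompeiu formula\<close>

abbreviation cauchy_kernel :: "complex \<Rightarrow> complex"
  where "cauchy_kernel \<equiv> regular_inverse_power 1"

definition dbar_kernel :: "complex \<Rightarrow> complex"
  where "dbar_kernel w = (dir_deriv 1 cauchy_kernel w + \<i> * dir_deriv \<i> cauchy_kernel w) / 2"

lemma smooth_dbar_kernel: "smooth dbar_kernel"
  unfolding dbar_kernel_def[abs_def]
  by (intro smooth_divide_const smooth_UNIV_intros smooth_on_dir_deriv smooth_regular_inverse_power)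

text \<open>Off the origin 1/w is holomorphic and d/d(conj w) of |w|^2 is w, so the pole cancels and
  only the derivative of the cutoff is left. Near the origin both sides vanish.\<close>

lemma dbar_kernel_eq: "dbar_kernel w = of_real (- deriv cutoff (norm w ^ 2))"
proof (cases "norm w < 1 / 2")
  case True
  have "dir_deriv v cauchy_kernel w = dir_deriv v (\<lambda>_. 0) w" for v
    by (rule dir_deriv_cong_open[of "ball 0 (1 / 2)"]) (use True in \<open>auto simp: regular_inverse_power_def cutoff_norm_small\<close>)
  moreover have "dir_deriv v (\<lambda>_::complex. 0 :: complex) w = 0" for v
    by (rule dir_deriv_eq) (rule has_derivative_const)
  moreover have "deriv cutoff (norm w ^ 2) = 0"
  proof -
    have "norm w ^ 2 < 1 / 2"
      using power_strict_mono[OF True norm_ge_zero, of 2] by (simp add: power2_eq_square)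
    then have "(cutoff has_real_derivative 0) (at (norm w ^ 2))"
      by - (rule has_field_derivative_transform_within_open[where S = "{..<1 / 2}" and f = "\<lambda>_. 1"],
        auto simp: cutoff_eq_1)
    then show ?thesis by (rule DERIV_imp_deriv)
  qed
  ultimately show ?thesis by (simp add: dbar_kernel_def)
next
  case False
  then have w: "w \<noteq> 0" by auto
  let ?c' = "deriv cutoff (norm w ^ 2)"
  have "cutoff differentiable (at (norm w ^ 2))" by (rule smooth_differentiable[OF smooth_on_cutoff])
  then have "(cutoff has_real_derivative ?c') (at (norm w ^ 2))"
    using DERIV_deriv_iff_real_differentiable by blast
  then have "(cutoff has_derivative (\<lambda>h. h * ?c')) (at (norm w ^ 2))"
    by (simp add: has_field_derivative_def mult_commute_abs)
  moreover have "((\<lambda>w. norm w ^ 2) has_derivative (\<lambda>h. 2 * (w \<bullet> h))) (at w)"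
    unfolding power2_norm_eq_inner by (auto intro!: derivative_eq_intros simp: inner_commute)
  ultimately have "((\<lambda>w. cutoff (norm w ^ 2)) has_derivative (\<lambda>h. (2 * (w \<bullet> h)) * ?c')) (at w)"
    using has_derivative_compose[of "\<lambda>w. norm w ^ 2" _ w UNIV cutoff] by blast
  then have "(cauchy_kernel has_derivative (\<lambda>h. - (1 - of_real (cutoff (norm w ^ 2))) * (inverse w * h * inverse w)
     + (0 - of_real ((2 * (w \<bullet> h)) * ?c')) / w)) (at w)"
    unfolding regular_inverse_power_def[abs_def] power_one_right using w
    by (intro has_derivative_divide has_derivative_diff has_derivative_const has_derivative_ident
        bounded_linear.has_derivative[OF bounded_linear_of_real]) auto
  note d = dir_deriv_eq[OF this]
  have "w = of_real (w \<bullet> 1) + \<i> * of_real (w \<bullet> \<i>)" by (simp add: complex_eq_iff inner_complex_def)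
  then have "(of_real (w \<bullet> 1) + \<i> * of_real (w \<bullet> \<i>)) / w = 1" using w by simp
  moreover have "(2 * (s * c) / w + \<i> * (2 * (t * c) / w)) / 2 = c * ((s + \<i> * t) / w)" for s t c
    using w by (simp add: field_simps)
  ultimately have 1: "(2 * (of_real (w \<bullet> 1) * of_real ?c') / w + \<i> * (2 * (of_real (w \<bullet> \<i>) * of_real ?c') / w)) / 2 = of_real ?c'"
    by simp
  have "dbar_kernel w = - ((2 * (of_real (w \<bullet> 1) * of_real ?c') / w + \<i> * (2 * (of_real (w \<bullet> \<i>) * of_real ?c') / w)) / 2)"
  proof -
    have "(- K * (inverse w * 1 * inverse w) + (0 - a) / w + \<i> * (- K * (inverse w * \<i> * inverse w) + (0 - b) / w)) / 2
      = - ((a / w + \<i> * (b / w)) / 2)" for K a b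
      using w by (simp add: field_simps)
    then show ?thesis unfolding dbar_kernel_def d by (simp only: of_real_mult of_real_numeral mult.assoc)
  qed
  then show ?thesis unfolding 1 by simp
qed

lemma dbar_kernel_eq_0: "norm w > 1 \<Longrightarrow> dbar_kernel w = 0"
proof -
  assume w: "norm w > 1"
  have "norm w ^ 2 > 1" using power_strict_mono[OF w, of 2] by simp
  then have "(cutoff has_real_derivative 0) (at (norm w ^ 2))"
    by - (rule has_field_derivative_transform_within_open[where S = "{1<..}" and f = "\<lambda>_. 0"],
      auto simp: cutoff_eq_0)
  then show ?thesis by (simp add: dbar_kernel_eq DERIV_imp_deriv)
qed

definition kernel_mass :: complex
  where "kernel_mass = integral (cbox (-1, -1) (1, 1)) (\<lambda>(a, b). dbar_kernel (Complex a b))"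

lemma continuous_on_Complex: "continuous_on A (\<lambda>z. Complex (fst z) (snd z))"
  unfolding Complex_eq by (intro continuous_intros)

text \<open>The integrand \<open>- deriv cutoff\<close> is continuous and nonnegative. A zero
  integral would make the derivative vanish on (0, 1), although the cutoff falls from 1 to 0
  there.\<close>

lemma kernel_mass_nonzero: "kernel_mass \<noteq> 0"
proof
  assume z: "kernel_mass = 0"
  let ?B = "cbox (-1, -1) (1, 1) :: (real \<times> real) set"
  let ?g = "\<lambda>z::real \<times> real. - deriv cutoff (norm (Complex (fst z) (snd z)) ^ 2)"
  have dc: "(cutoff has_real_derivative deriv cutoff s) (at s)" for s
    using smooth_differentiable[OF smooth_on_cutoff] DERIV_deriv_iff_real_differentiable by blast
  have nonpos: "deriv cutoff s \<le> 0" for s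
  proof (rule ccontr)
    assume "\<not> deriv cutoff s \<le> 0"
    then obtain d where d: "d > 0" "\<And>h. h > 0 \<Longrightarrow> h < d \<Longrightarrow> cutoff s < cutoff (s + h)"
      using DERIV_pos_inc_right[OF dc[of s]] by auto
    from d(2)[of "d / 2"] d(1) cutoff_antimono[of s "s + d / 2"] show False by simp
  qed
  have kc: "continuous_on ?B (\<lambda>z. dbar_kernel (Complex (fst z) (snd z)))"
    by (rule continuous_on_compose2[OF smooth_on_continuous_on[OF smooth_dbar_kernel] continuous_on_Complex]) auto
  have eq: "?g z = Re (dbar_kernel (Complex (fst z) (snd z)))" for z by (simp add: dbar_kernel_eq)
  have cont: "continuous_on ?B ?g" unfolding eq by (intro continuous_intros kc)
  have "((\<lambda>z. dbar_kernel (Complex (fst z) (snd z))) has_integral kernel_mass) ?B"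
    using integrable_integral[OF integrable_continuous[OF kc]] by (simp add: kernel_mass_def case_prod_unfold)
  then have "((\<lambda>z. Re (dbar_kernel (Complex (fst z) (snd z)))) has_integral Re kernel_mass) ?B"
    by (rule has_integral_linear[OF _ bounded_linear_Re, unfolded o_def])
  then have int: "(?g has_integral 0) ?B" unfolding eq using z by simp
  have g0: "?g w = 0" if "w \<in> ?B" for w
    by (rule has_integral_0_cbox_imp_0[OF cont _ int _ that]) (use nonpos in \<open>auto simp: box_eq_empty Basis_prod_def\<close>)
  \<comment> \<open>The point (sqrt s, 0) of the square has squared modulus s.\<close>
  have "deriv cutoff s = 0" if "0 < s" "s < 1" for s
    using g0[of "(sqrt s, 0)"] that real_sqrt_le_1_iff[of s]
    by (simp add: cbox_Pair_eq cmod_def order_trans[of "-1" 0])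
  moreover obtain s where "0 < s" "s < 1" "cutoff 1 - cutoff 0 = (1 - 0) * deriv cutoff s"
    using MVT2[of 0 1 cutoff "deriv cutoff"] dc by auto
  ultimately show False by (simp add: cutoff_eq_0 cutoff_eq_1)
qed

text \<open>The constant \<open>kernel_mass\<close> is \<open>\<pi>\<close>, but only \<open>kernel_mass \<noteq> 0\<close> is needed.\<close>

theorem cauchy_pompeiu:
  fixes F :: "real \<times> real \<times> 'p::euclidean_space \<Rightarrow> complex"
  assumes F: "smooth F" and supp: "\<And>a b. \<bar>a\<bar> \<ge> 1 \<or> \<bar>b\<bar> \<ge> 1 \<Longrightarrow> F (a, b, p) = 0"
    and G: "continuous_on UNIV G" and FG: "\<And>a b. dbar F (a, b, p) = G (a, b) * (Complex a b - of_real x)"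
    and x: "\<bar>x\<bar> \<le> 1"
  shows "integral (cbox (-2, -2) (2, 2)) G = - kernel_mass * F (x, 0, p)"
proof -
  let ?B = "cbox (-2, -2) (2, 2) :: (real \<times> real) set"
  let ?z = "\<lambda>a b. Complex a b - complex_of_real x"
  have "bounded (G ` ?B)"
    using G by (intro compact_imp_bounded compact_continuous_image compact_cbox) (auto intro: continuous_on_subset)
  then obtain M where M: "M > 0" "\<And>w. w \<in> ?B \<Longrightarrow> norm (G w) \<le> M" by (auto simp: bounded_pos)
  obtain L where L: "L \<ge> 0" "\<And>w. norm w \<le> 1 \<Longrightarrow> norm (dbar_kernel w) \<le> L"
    using smooth_bounded[OF smooth_dbar_kernel] by metis
  have Lall: "norm (dbar_kernel w) \<le> L" for w
    using L dbar_kernel_eq_0[of w] by (cases "norm w \<le> 1") auto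
  \<comment> \<open>Stokes' formula is applied to F times the kernel of scale \<epsilon> about x.
    The product rule splits the integrand into \<open>G - h1 + h2\<close> and F(x, 0, p) times
    \<open>h3\<close>: \<open>h3\<close> has integral \<open>kernel_mass\<close> at every scale,
    \<open>h1\<close> lives on a square of area 4 \<epsilon>^2, and \<open>h2\<close> is small by
    continuity of F, its kernel having bounded L1 norm.\<close>
  have est: "norm (integral ?B G + kernel_mass * F (x, 0, p)) \<le> d + 4 * L * d" if d: "d > 0" for d
  proof -
    have "isCont F (x, 0, p)" by (rule smooth_on_isCont[OF F UNIV_I])
    then obtain \<delta> where \<delta>: "\<delta> > 0" "\<And>w. dist w (x, 0, p) < \<delta> \<Longrightarrow> norm (F w - F (x, 0, p)) < d"
      using d unfolding continuous_at_eps_delta by (metis dist_norm)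
    \<comment> \<open>The bound 1/2 keeps the square inside the box because |x| \<le> 1, \<delta>/4
      keeps it inside the \<delta>-ball, and d/(4M + 1) makes the bound 4 M \<epsilon>^2 for the
      integral of \<open>h1\<close> at most d.\<close>
    define \<epsilon> where "\<epsilon> = min (1 / 2) (min (\<delta> / 4) (d / (4 * M + 1)))"
    have "\<epsilon> > 0" using \<delta>(1) d M(1) by (auto simp: \<epsilon>_def)
    moreover have "\<epsilon> \<le> 1 / 2" "\<epsilon> \<le> \<delta> / 4" "\<epsilon> \<le> d / (4 * M + 1)"
      unfolding \<epsilon>_def by (meson min.cobounded1 min.cobounded2 order_trans)+
    ultimately have \<epsilon>: "\<epsilon> > 0" "\<epsilon> \<le> 1 / 2" "\<epsilon> \<le> \<delta> / 4" "\<epsilon> \<le> d / (4 * M + 1)" .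
    let ?S = "cbox (x - \<epsilon>, - \<epsilon>) (x + \<epsilon>, \<epsilon>) :: (real \<times> real) set"
    have SB: "?S \<subseteq> ?B" using \<epsilon> x by (auto simp: cbox_Pair_eq)
    have content: "measure lborel ?S = 4 * \<epsilon> ^ 2" using \<epsilon> by (simp add: content_Pair power2_eq_square)
    have small: "norm (?z a b / of_real \<epsilon>) > 1" if "(a, b) \<notin> ?S" for a b
    proof -
      have "\<bar>a - x\<bar> > \<epsilon> \<or> \<bar>b\<bar> > \<epsilon>" using that by (auto simp: cbox_Pair_eq)
      moreover have "\<bar>a - x\<bar> \<le> norm (?z a b)" "\<bar>b\<bar> \<le> norm (?z a b)"
        using abs_Re_le_cmod[of "?z a b"] abs_Im_le_cmod[of "?z a b"] by auto
      ultimately have "norm (?z a b) > \<epsilon>" by linarith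
      then show ?thesis using \<epsilon> by (simp add: norm_divide)
    qed
    let ?ks = "\<lambda>w :: real \<times> real \<times> 'p. cauchy_kernel ((zc w - of_real x) / of_real \<epsilon>) / of_real \<epsilon>"
    have smz: "smooth (\<lambda>w :: real \<times> real \<times> 'p. (zc w - of_real x) / of_real \<epsilon>)"
      by (intro smooth_divide_const smooth_UNIV_intros smooth_zc)
    have smk: "smooth ?ks"
      by (intro smooth_divide_const smooth_on_compose_UNIV[OF open_UNIV smooth_regular_inverse_power smz])
    have dk: "dbar ?ks w = dbar_kernel ((zc w - of_real x) / of_real \<epsilon>) / of_real \<epsilon> ^ 2" for w
    proof -
      let ?y = "(zc w - of_real x) / of_real \<epsilon>"
      have "((\<lambda>w :: real \<times> real \<times> 'p. (zc w - of_real x) / of_real \<epsilon>) has_derivative (\<lambda>h. (zc h - 0) / of_real \<epsilon>)) (at w)"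
        by (intro bounded_linear.has_derivative[OF bounded_linear_divide] has_derivative_diff
            bounded_linear_imp_has_derivative bounded_linear_zc has_derivative_const)
      note d0 = has_derivative_compose[OF this smooth_on_has_derivative[OF smooth_regular_inverse_power[of 1] UNIV_I]]
      have "(?ks has_derivative (\<lambda>h. dir_deriv ((zc h - 0) / of_real \<epsilon>) cauchy_kernel ?y / of_real \<epsilon>)) (at w)"
        by (rule bounded_linear.has_derivative[OF bounded_linear_divide d0])
      note d = dir_deriv_eq[OF this, unfolded diff_zero]
      have lin: "dir_deriv (u / of_real \<epsilon>) cauchy_kernel ?y = dir_deriv u cauchy_kernel ?y / of_real \<epsilon>" for u
        using dir_deriv_scaleR[OF smooth_regular_inverse_power, of "1 / \<epsilon>" u 1 ?y]
        by (simp add: scaleR_conv_of_real field_simps)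
      have z1: "zc (1::real, 0::real, 0::'p) = 1" "zc (0::real, 1::real, 0::'p) = \<i>"
        by (auto simp: zc_def complex_eq_iff)
      have "(A / e / e + \<i> * (B / e / e)) / 2 = (A + \<i> * B) / 2 / e ^ 2" for A B e :: complex
        by (simp add: add_divide_distrib power2_eq_square mult.commute)
      then show ?thesis unfolding dbar_def d lin z1 dbar_kernel_def .
    qed
    define h1 where "h1 = (\<lambda>(a, b). G (a, b) * of_real (cutoff (norm (?z a b / of_real \<epsilon>) ^ 2)))"
    define h2 where "h2 = (\<lambda>(a, b). (F (a, b, p) - F (x, 0, p)) * (dbar_kernel (?z a b / of_real \<epsilon>) / of_real \<epsilon> ^ 2))"
    define h3 where "h3 = (\<lambda>(a, b). dbar_kernel (?z a b / of_real \<epsilon>) / complex_of_real \<epsilon> ^ 2)"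
    have cz: "continuous_on UNIV (\<lambda>w. Complex (fst w) (snd w) - complex_of_real x)"
      by (intro continuous_intros continuous_on_Complex)
    have ck: "continuous_on UNIV (\<lambda>w. dbar_kernel ((Complex (fst w) (snd w) - complex_of_real x) / of_real \<epsilon>))"
      by (rule continuous_on_compose2[OF smooth_on_continuous_on[OF smooth_dbar_kernel]])
        (use \<epsilon> in \<open>auto intro!: continuous_intros continuous_on_Complex\<close>)
    have cF: "continuous_on UNIV (\<lambda>w. F (fst w, snd w, p))"
      by (rule continuous_on_compose2[OF smooth_on_continuous_on[OF F]]) (auto intro!: continuous_intros)
    have cc: "continuous_on UNIV (\<lambda>w. complex_of_real (cutoff (norm ((Complex (fst w) (snd w) - complex_of_real x) / of_real \<epsilon>) ^ 2)))"
      by (rule continuous_on_compose2[OF smooth_on_continuous_on[OF smooth_cutoff_norm]])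
        (use \<epsilon> in \<open>auto intro!: continuous_intros continuous_on_Complex\<close>)
    have c1: "continuous_on UNIV h1"
      unfolding h1_def case_prod_unfold using G cc by (auto intro!: continuous_intros)
    have c2: "continuous_on UNIV h2"
      unfolding h2_def case_prod_unfold using \<epsilon> by (auto intro!: continuous_intros cF ck)
    have c3: "continuous_on UNIV h3"
      unfolding h3_def case_prod_unfold using \<epsilon> by (auto intro!: continuous_intros ck)
    have int: "h integrable_on cbox l u" if "continuous_on UNIV h" for h :: "real \<times> real \<Rightarrow> complex" and l u
      by (rule integrable_continuous) (rule continuous_on_subset[OF that], simp)
    have "integral ?B (\<lambda>(a, b). dbar (\<lambda>w. F w * ?ks w) (a, b, p)) = 0"
      by (rule integral_dbar[OF smooth_on_mult[OF open_UNIV F smk]]) (simp add: supp)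
    moreover have "dbar (\<lambda>w. F w * ?ks w) (a, b, p) = G (a, b) - h1 (a, b) + h2 (a, b) + F (x, 0, p) * h3 (a, b)" for a b
    proof -
      have k1: "?z a b * (cauchy_kernel (?z a b / of_real \<epsilon>) / of_real \<epsilon>) = 1 - of_real (cutoff (norm (?z a b / of_real \<epsilon>) ^ 2))"
        using regular_inverse_power_mult[of "?z a b / of_real \<epsilon>" 1] by (simp add: field_simps)
      have k2: "dbar F (a, b, p) * ?ks (a, b, p) = G (a, b) - h1 (a, b)"
        unfolding FG zc_def fst_conv snd_conv mult.assoc k1 h1_def case_prod_conv by (simp add: right_diff_distrib)
      have k3: "F (a, b, p) * (dbar_kernel (?z a b / of_real \<epsilon>) / of_real \<epsilon> ^ 2) = h2 (a, b) + F (x, 0, p) * h3 (a, b)"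
        unfolding h2_def h3_def case_prod_conv left_diff_distrib by simp
      have k4: "dbar ?ks (a, b, p) = dbar_kernel (?z a b / of_real \<epsilon>) / of_real \<epsilon> ^ 2"
        unfolding dk by (simp add: zc_def)
      show ?thesis
        unfolding dbar_mult[OF F smk] k2 k4 k3 by simp
    qed
    ultimately have "0 = integral ?B (\<lambda>w. G w - h1 w + h2 w + F (x, 0, p) * h3 w)"
      by (simp add: case_prod_unfold)
    also have "\<dots> = integral ?B G - integral ?B h1 + integral ?B h2 + F (x, 0, p) * integral ?B h3"
      using int[OF G] int[OF c1] int[OF c2] int[OF c3]
      by (simp add: integral_add integral_diff integrable_add integrable_diff integrable_on_mult_right)
    finally have main: "integral ?B G + F (x, 0, p) * integral ?B h3 = integral ?B h1 - integral ?B h2"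
      by (simp add: algebra_simps)
    have restrict: "(h has_integral integral ?B h) ?S" if "continuous_on UNIV h" "\<And>w. w \<notin> ?S \<Longrightarrow> h w = 0"
      for h :: "real \<times> real \<Rightarrow> complex"
    proof -
      have i: "(h has_integral integral ?S h) ?S" using int[OF that(1)] by (rule integrable_integral)
      from has_integral_on_superset[OF this that(2) SB] have "integral ?B h = integral ?S h" by (simp add: integral_unique)
      then show ?thesis using i by simp
    qed
    \<comment> \<open>Rescaling about (x, 0) by \<epsilon> has Jacobian \<epsilon>^2, which cancels
      the denominator of \<open>h3\<close>.\<close>
    have h3: "integral ?B h3 = kernel_mass"
    proof -
      have "((\<lambda>(a, b). dbar_kernel (Complex a b)) has_integral kernel_mass) (cbox (-1, -1) (1, 1))"
        unfolding kernel_mass_def case_prod_unfold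
        by (rule integrable_integral, rule integrable_continuous, rule continuous_on_compose2[OF smooth_on_continuous_on[OF smooth_dbar_kernel] continuous_on_Complex]) auto
      from has_integral_affinity'[OF this, of "1 / \<epsilon>" "(- x / \<epsilon>, 0)"] \<epsilon>
      have "((\<lambda>w. dbar_kernel (Complex (fst w / \<epsilon> - x / \<epsilon>) (snd w / \<epsilon>))) has_integral (\<epsilon> ^ 2 *\<^sub>R kernel_mass)) ?S"
        by (simp add: case_prod_unfold power2_eq_square algebra_simps inverse_eq_divide)
      moreover have "Complex (a / \<epsilon> - x / \<epsilon>) (b / \<epsilon>) = ?z a b / of_real \<epsilon>" for a b
        by (simp add: complex_eq_iff diff_divide_distrib)
      ultimately have "((\<lambda>(a, b). dbar_kernel (?z a b / of_real \<epsilon>)) has_integral (\<epsilon> ^ 2 *\<^sub>R kernel_mass)) ?S"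
        by (simp add: case_prod_unfold)
      from has_integral_divide[OF this, of "of_real \<epsilon> ^ 2"] \<epsilon>
      have "(h3 has_integral kernel_mass) ?S"
        by (simp add: h3_def case_prod_unfold scaleR_conv_of_real)
      from has_integral_on_superset[OF this _ SB] show ?thesis
        using small dbar_kernel_eq_0 by (force simp: h3_def intro!: integral_unique)
    qed
    have b1: "norm (integral ?B h1) \<le> d"
    proof -
      have "norm (integral ?B h1) \<le> M * measure lborel ?S"
      proof (rule has_integral_bound[OF _ restrict[OF c1]])
        show "h1 w = 0" if "w \<notin> ?S" for w
        proof -
          obtain a b where w: "w = (a, b)" by (cases w)
          have "norm (?z a b / of_real \<epsilon>) ^ 2 \<ge> 1"
            using small[of a b] that w by (intro one_le_power) auto
          then show ?thesis by (simp add: h1_def w cutoff_eq_0)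
        qed
        show "norm (h1 w) \<le> M" if "w \<in> ?S" for w
        proof -
          obtain a b where w: "w = (a, b)" by (cases w)
          have "0 \<le> cutoff s \<and> cutoff s \<le> 1" for s
            using cutoff_antimono[of s "max s 1"] cutoff_antimono[of "min s 0" s] by (simp add: cutoff_eq_0 cutoff_eq_1)
          then have "norm (complex_of_real (cutoff s)) \<le> 1" for s by simp
          then have "norm (h1 w) \<le> norm (G w) * 1"
            unfolding h1_def w by (simp only: case_prod_conv norm_mult) (intro mult_left_mono; simp)
          then show ?thesis using M(2)[of w] SB that by force
        qed
      qed (use M in auto)
      also have "\<dots> = (4 * M * \<epsilon>) * \<epsilon>" by (simp add: content power2_eq_square)
      also have "\<dots> \<le> (4 * M * \<epsilon>) * 1" using \<epsilon> M by (intro mult_left_mono) auto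
      also have "\<dots> \<le> (4 * M + 1) * \<epsilon>" using \<epsilon> by (simp add: algebra_simps)
      also have "\<dots> \<le> d" using \<epsilon>(4) M(1) by (simp add: field_simps)
      finally show ?thesis .
    qed
    have b2: "norm (integral ?B h2) \<le> 4 * L * d"
    proof -
      have "norm (integral ?B h2) \<le> (d * (L / \<epsilon> ^ 2)) * measure lborel ?S"
      proof (rule has_integral_bound[OF _ restrict[OF c2]])
        show "h2 w = 0" if "w \<notin> ?S" for w
          using small[of "fst w" "snd w"] that dbar_kernel_eq_0 by (auto simp: h2_def case_prod_unfold)
        show "norm (h2 w) \<le> d * (L / \<epsilon> ^ 2)" if "w \<in> ?S" for w
        proof -
          obtain a b where w: "w = (a, b)" by (cases w)
          have "dist (a, b, p) (x, 0, p) \<le> \<bar>a - x\<bar> + \<bar>b\<bar>"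
            by (simp add: dist_Pair_Pair dist_real_def sqrt_sum_squares_le_sum_abs)
          also have "\<dots> \<le> 2 * \<epsilon>" using that w by (auto simp: cbox_Pair_eq)
          also have "\<dots> < \<delta>" using \<epsilon> \<delta>(1) by linarith
          finally have "norm (F (a, b, p) - F (x, 0, p)) \<le> d" using \<delta>(2)[of "(a, b, p)"] by simp
          moreover have "norm (dbar_kernel (?z a b / of_real \<epsilon>) / of_real \<epsilon> ^ 2) \<le> L / \<epsilon> ^ 2"
            using Lall by (simp add: norm_divide norm_power divide_right_mono)
          ultimately show ?thesis unfolding w h2_def case_prod_conv norm_mult using d by (intro mult_mono) auto
        qed
      qed (use d L in auto)
      also have "\<dots> = 4 * L * d" unfolding content using \<epsilon> by simp
      finally show ?thesis .
    qed
    have "integral ?B G + kernel_mass * F (x, 0, p) = integral ?B h1 - integral ?B h2"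
      using main h3 by (simp add: mult.commute)
    then show ?thesis using norm_triangle_ineq4[of "integral ?B h1" "integral ?B h2"] b1 b2 by simp
  qed
  have "norm (integral ?B G + kernel_mass * F (x, 0, p)) \<le> 0 + e" if "e > 0" for e
  proof -
    have D: "1 + 4 * L > 0" using L(1) by simp
    have "e / (1 + 4 * L) + 4 * L * (e / (1 + 4 * L)) = e / (1 + 4 * L) * (1 + 4 * L)"
      by (simp add: distrib_left)
    also have "\<dots> = e" using D by simp
    finally show ?thesis using est[of "e / (1 + 4 * L)"] that D by simp
  qed
  then have "norm (integral ?B G + kernel_mass * F (x, 0, p)) \<le> 0" by (rule field_le_epsilon)
  then show ?thesis by (simp add: eq_neg_iff_add_eq_0)
qed

lemma flat_dir_deriv_any:
  assumes "flat \<rho> g"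
  shows "flat \<rho> (dir_deriv v g)"
proof -
  have *: "flat \<rho> (\<lambda>x. \<Sum>b\<in>A. dir_deriv b g x * of_real (v \<bullet> b))" if "finite A" "A \<subseteq> Basis" for A
    using that
  proof (induction A rule: finite_induct)
    case empty
    have "flat \<rho> (\<lambda>x. g x * 0)" by (intro flat_mult_smooth assms smooth_on_const)
    then show ?case by simp
  next
    case (insert b A)
    have "flat \<rho> (\<lambda>x. dir_deriv b g x * of_real (v \<bullet> b) + (\<Sum>b\<in>A. dir_deriv b g x * of_real (v \<bullet> b)))"
      using insert by (intro flat_add flat_mult_smooth flat_dir_deriv assms smooth_on_const) auto
    then show ?case using insert by simp
  qed
  have "dir_deriv v g = (\<lambda>x. \<Sum>b\<in>Basis. dir_deriv b g x * of_real (v \<bullet> b))"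
    by (rule ext, rule trans[OF dir_deriv_Basis[OF smooth_differentiable[OF flat_smooth[OF assms]]]])
      (simp add: scaleR_conv_of_real mult.commute)
  then show ?thesis by (rule ssubst) (rule *[OF finite_Basis order_refl])
qed

text \<open>Differentiating along b becomes differentiating g along L b, so composites of flat
  functions with L form a closed class. In the division L inserts an additional real variable x
  between z and p.\<close>

lemma flat_compose_linear:
  fixes L :: "'b::euclidean_space \<Rightarrow> 'a::euclidean_space"
  assumes g: "flat \<rho> g" and L: "bounded_linear L"
  shows "flat (\<lambda>x. \<rho> (L x)) (\<lambda>x. g (L x))"
proof (rule flat_coinduct[where P = "\<lambda>h. \<exists>g. flat \<rho> g \<and> h = (\<lambda>x. g (L x))"])
  have der: "((\<lambda>x. g (L x)) has_derivative (\<lambda>v. dir_deriv (L v) g (L x))) (at x)" if "flat \<rho> g" for g x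
    by (rule has_derivative_compose[OF bounded_linear_imp_has_derivative[OF L] smooth_on_has_derivative[OF flat_smooth[OF that] UNIV_I]])
  fix h assume "\<exists>g. flat \<rho> g \<and> h = (\<lambda>x. g (L x))"
  then obtain g where h: "flat \<rho> g" "h = (\<lambda>x. g (L x))" by blast
  show "h differentiable (at x)" for x using der[OF h(1)] h(2) differentiableI by blast
  show "\<exists>g. flat \<rho> g \<and> dir_deriv b h = (\<lambda>x. g (L x))" for b
    using dir_deriv_eq[OF der[OF h(1)]] flat_dir_deriv_any[OF h(1), of "L b"] unfolding h(2) by blast
  fix N R
  obtain K where K: "K > 0" "\<And>x. norm (L x) \<le> norm x * K" using bounded_linear.pos_bounded[OF L] by blast
  obtain C where C: "C \<ge> 0" "\<And>x. norm x \<le> \<bar>R\<bar> * K \<Longrightarrow> norm (g x) \<le> C * \<rho> x ^ N"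
    using flat_bound[OF h(1), of "\<bar>R\<bar> * K" N] by blast
  have "norm (L x) \<le> \<bar>R\<bar> * K" if "norm x \<le> R" for x
    using K(2)[of x] mult_right_mono[of "norm x" "\<bar>R\<bar>" K] that K(1) by linarith
  then show "\<exists>C\<ge>0. \<forall>x. norm x \<le> R \<longrightarrow> norm (h x) \<le> C * \<rho> (L x) ^ N"
    using C unfolding h(2) by blast
qed (use g in blast)

text \<open>A globally smooth substitute for 1/w that is exact for |w| \<ge> m. The divisor is
  bounded below only on an annulus and for parameters near the base point, whereas the integrands
  have to be smooth everywhere.\<close>

definition regular_inverse :: "real \<Rightarrow> complex \<Rightarrow> complex"
  where "regular_inverse m w = regular_inverse_power 1 (w / of_real m) / of_real m"

lemma smooth_regular_inverse: "smooth f \<Longrightarrow> smooth (\<lambda>x. regular_inverse m (f x))"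
  for f :: "'a::real_normed_vector \<Rightarrow> complex"
  unfolding regular_inverse_def
  by (intro smooth_divide_const smooth_on_compose_UNIV[OF open_UNIV smooth_regular_inverse_power])

lemma regular_inverse_eq:
  assumes "m > 0" "norm w \<ge> m"
  shows "regular_inverse m w = 1 / w"
proof -
  have "norm (w / of_real m) ^ 2 \<ge> 1"
    using assms by (intro one_le_power) (simp add: norm_divide)
  then show ?thesis using assms
    by (simp add: regular_inverse_def regular_inverse_power_def cutoff_eq_0)
qed

definition circle_cutoff :: "real \<times> real \<times> 'p \<Rightarrow> complex"
  where "circle_cutoff w = of_real (cutoff (norm (zc w) ^ 2))"

lemma smooth_circle_cutoff: "smooth (circle_cutoff :: real \<times> real \<times> 'p::euclidean_space \<Rightarrow> complex)"
  unfolding circle_cutoff_def[abs_def]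
  by (rule smooth_on_compose_UNIV[OF open_UNIV smooth_cutoff_norm smooth_zc])

lemma dbar_cong_open:
  "open S \<Longrightarrow> w \<in> S \<Longrightarrow> (\<And>x. x \<in> S \<Longrightarrow> f x = g x) \<Longrightarrow> dbar f w = dbar g w"
  unfolding dbar_def using dir_deriv_cong_open[of S w f g] by simp

lemma dbar_circle_cutoff:
  fixes w :: "real \<times> real \<times> 'p::euclidean_space"
  assumes "norm (zc w) < 2 / 3 \<or> norm (zc w) > 1"
  shows "dbar circle_cutoff w = 0"
proof -
  have cz: "continuous_on UNIV (zc :: real \<times> real \<times> 'p \<Rightarrow> complex)"
    by (rule smooth_on_continuous_on[OF smooth_zc])
  from assms show ?thesis
  proof
    assume "norm (zc w) < 2 / 3"
    have "circle_cutoff x = 1" if "norm (zc x) < 2 / 3" for x :: "real \<times> real \<times> 'p"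
    proof -
      have "norm (zc x) ^ 2 \<le> (2 / 3) ^ 2" using that by (intro power_mono) auto
      also have "(2 / 3 :: real) ^ 2 \<le> 1 / 2" by (simp add: power2_eq_square)
      finally show ?thesis by (simp add: circle_cutoff_def cutoff_eq_1)
    qed
    then have "dbar circle_cutoff w = dbar (\<lambda>_. 1) w"
      by (intro dbar_cong_open[of "{x. norm (zc x) < 2 / 3}"])
        (use \<open>norm (zc w) < 2 / 3\<close> in \<open>auto intro!: open_Collect_less continuous_intros cz\<close>)
    then show ?thesis by (simp add: dbar_const)
  next
    assume "norm (zc w) > 1"
    have "circle_cutoff x = 0" if "norm (zc x) > 1" for x :: "real \<times> real \<times> 'p"
      using one_le_power[of "norm (zc x)" 2] that by (simp add: circle_cutoff_def cutoff_eq_0)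
    then have "dbar circle_cutoff w = dbar (\<lambda>_. 0) w"
      by (intro dbar_cong_open[of "{x. norm (zc x) > 1}"])
        (use \<open>norm (zc w) > 1\<close> in \<open>auto intro!: open_Collect_less continuous_intros cz\<close>)
    then show ?thesis by (simp add: dbar_const)
  qed
qed

text \<open>The coefficient of \<open>x ^ i\<close> in the divided difference \<open>(P z - P x) / (z - x)\<close>.\<close>

definition quot_coeff :: "(nat \<Rightarrow> 'p \<Rightarrow> complex) \<Rightarrow> nat \<Rightarrow> nat \<Rightarrow> real \<times> real \<times> 'p \<Rightarrow> complex"
  where "quot_coeff C n i w = (\<Sum>j\<in>{i<..n}. C j (snd (snd w)) * zc w ^ (j - Suc i))"

lemma smooth_quot_coeff:
  fixes C :: "nat \<Rightarrow> 'p::euclidean_space \<Rightarrow> complex"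
  assumes "\<And>i. smooth (C i)"
  shows "smooth (quot_coeff C n i)"
proof -
  have "smooth (\<lambda>w :: real \<times> real \<times> 'p. C i (snd (snd w)))" for i
    by (rule smooth_on_compose_UNIV[OF open_UNIV assms]) (intro smooth_UNIV_intros)
  then show ?thesis unfolding quot_coeff_def[abs_def] by (intro smooth_UNIV_intros smooth_zc)
qed

lemma ppoly_diff:
  "ppoly C n (a, b, p) - ppoly C n (x, 0, p) =
    (\<Sum>i<n. quot_coeff C n i (a, b, p) * of_real x ^ i) * (Complex a b - of_real x)"
proof -
  let ?z = "Complex a b" and ?x = "complex_of_real x"
  have zx: "zc (x, 0::real, p) = ?x" by (simp add: zc_def complex_eq_iff)
  have "ppoly C n (a, b, p) - ppoly C n (x, 0, p) = (\<Sum>j\<le>n. C j p * (?z ^ j - ?x ^ j))"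
    unfolding ppoly_def zx by (simp add: zc_def sum_subtractf right_diff_distrib)
  also have "\<dots> = (\<Sum>j\<le>n. \<Sum>i<j. C j p * ?z ^ (j - Suc i) * ?x ^ i) * (?z - ?x)"
  proof -
    have "?z ^ j - ?x ^ j = (\<Sum>i<j. ?z ^ (j - Suc i) * ?x ^ i) * (?z - ?x)" for j
      using power_diff_sumr2[of ?x j ?z] by (simp add: algebra_simps)
    then show ?thesis by (simp add: sum_distrib_left sum_distrib_right mult_ac)
  qed
  also have "(\<Sum>j\<le>n. \<Sum>i<j. C j p * ?z ^ (j - Suc i) * ?x ^ i) =
    (\<Sum>i<n. \<Sum>j\<in>{i<..n}. C j p * ?z ^ (j - Suc i) * ?x ^ i)"
    unfolding sum.Sigma[OF finite_atMost ballI[OF finite_lessThan]] sum.Sigma[OF finite_lessThan ballI[OF finite_greaterThanAtMost]]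
    by (rule sum.reindex_bij_witness[of _ "\<lambda>(i, j). (j, i)" "\<lambda>(j, i). (i, j)"]) auto
  also have "\<dots> = (\<Sum>i<n. quot_coeff C n i (a, b, p) * ?x ^ i)"
    by (simp add: quot_coeff_def zc_def sum_distrib_right)
  finally show ?thesis .
qed

lemma smooth_plane_integral:
  fixes g :: "real \<times> real \<times> 'q::euclidean_space \<Rightarrow> complex"
  assumes "smooth g"
  shows "smooth (\<lambda>q. integral (cbox l u) (\<lambda>(a, b). g (a, b, q)))"
proof -
  have "smooth (\<lambda>w :: (real \<times> real) \<times> 'q. g (fst (fst w), snd (fst w), snd w))"
    by (rule smooth_on_compose_UNIV[OF open_UNIV assms]) (intro smooth_UNIV_intros)
  from smooth_on_integral[OF this, of l u] show ?thesis by (simp add: case_prod_unfold)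
qed

text \<open>In the Cauchy-Pompeiu integral of the cut-off extension \<theta> F, the kernel is split
  as 1/(z - x) = P(x)/(P(z)(z - x)) + ((P(z) - P(x))/(z - x))/P(z). The first part gives the
  quotient; the second is a polynomial in x of degree below n and gives the remainder. The
  integrands are smooth because \<open>dbar F\<close> is flat along the zeros of P and along the
  real axis, which contains z = x. Real parts are taken at the end, as x and P(x) are real.\<close>

theorem malgrange_division:
  fixes f :: "real \<times> 'p::euclidean_space \<Rightarrow> real" and c :: "nat \<Rightarrow> 'p \<Rightarrow> real"
  assumes f: "smooth f" and c: "\<And>i. smooth (c i)" and c0: "\<And>i. i < n \<Longrightarrow> c i p0 = 0"
  obtains \<epsilon> q r where "\<epsilon> > 0" "smooth q" "\<And>i. smooth (r i)"
    "\<And>x p. \<bar>x\<bar> < \<epsilon> \<Longrightarrow> dist p p0 < \<epsilon> \<Longrightarrow>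
      f (x, p) = q (x, p) * (x ^ n + (\<Sum>i<n. c i p * x ^ i)) + (\<Sum>i<n. r i p * x ^ i)"
proof -
  define C where "C i = (if i < n then (\<lambda>p. complex_of_real (c i p)) else (\<lambda>_. 1))" for i
  have smC: "smooth (C i)" for i
    by (simp add: C_def smooth_of_real[OF c] smooth_on_const)
  let ?\<Pi> = "ppoly C n"
  note sm\<Pi> = smooth_ppoly[of C n, OF smC]
  have "\<exists>F. smooth F \<and> (\<forall>x p. F (x, 0, p) = complex_of_real (f (x, p))) \<and>
    flat (\<lambda>w. \<bar>fst (snd w)\<bar> * norm (?\<Pi> w)) (dbar F)"
    by (rule nirenberg_extension[where \<gamma> = 1, OF smooth_of_real[OF f] smC]) (simp_all add: C_def)
  then obtain F where F: "smooth F" "\<And>x p. F (x, 0, p) = complex_of_real (f (x, p))"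
    and fl: "flat (\<lambda>w. \<bar>fst (snd w)\<bar> * norm (?\<Pi> w)) (dbar F)" by blast
  let ?\<theta> = "circle_cutoff :: real \<times> real \<times> 'p \<Rightarrow> complex"
  let ?\<rho> = "\<lambda>w :: real \<times> real \<times> 'p. \<bar>fst (snd w)\<bar> * norm (?\<Pi> w)"
  have dF0: "dbar F w = 0" if "?\<Pi> w = 0 \<or> fst (snd w) = 0" for w
  proof -
    obtain D where "norm (dbar F w) \<le> D * ?\<rho> w ^ 1" using flat_bound[OF fl, of "norm w" 1] order_refl by blast
    then show ?thesis using that by auto
  qed
  \<comment> \<open>On the annulus |z| \<ge> 2/3 that carries \<open>dbar ?\<theta>\<close>, |z^n|
    is at least 6m. Near p0 the lower terms add up to at most 3m, so |P| \<ge> 3m, and |z - x| \<ge>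
    1/3 keeps the product with z - x above m.\<close>
  define m where "m = (2 / 3 :: real) ^ n / 6"
  have m: "m > 0" "3 * m \<le> 1 / 2" "m \<le> 3 * m" using power_le_one[of "2 / 3 :: real" n] by (auto simp: m_def)
  define L where "L w = (fst w, fst (snd w), snd (snd (snd w)))" for w :: "real \<times> real \<times> real \<times> 'p"
  have L: "bounded_linear L"
    unfolding L_def[abs_def]
    by (intro bounded_linear_Pair bounded_linear_fst bounded_linear_fst_comp bounded_linear_snd_comp bounded_linear_snd bounded_linear_ident)
  let ?zx = "\<lambda>w :: real \<times> real \<times> real \<times> 'p. zc w - of_real (fst (snd (snd w)))"
  have smzx: "smooth ?zx" by (intro smooth_UNIV_intros smooth_zc smooth_of_real)
  have comp: "smooth (\<lambda>w. g (L w))" if "smooth g" for g :: "real \<times> real \<times> 'p \<Rightarrow> complex"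
    by (rule smooth_on_compose_UNIV[OF open_UNIV that smooth_on_linear[OF L open_UNIV]])
  \<comment> \<open>These two functions are \<open>dbar\<close> of \<theta> F divided by P and by P
    (z - x). The summand containing \<open>dbar F\<close> is divided by flatness, the one containing
    \<open>dbar ?\<theta>\<close> through \<open>regular_inverse\<close>.\<close>
  define Ri where "Ri w = ?\<theta> w * (dbar F w / ?\<Pi> w) + dbar ?\<theta> w * F w * regular_inverse m (?\<Pi> w)" for w
  define Qi where "Qi w = ?\<theta> (L w) * (dbar F (L w) / (?\<Pi> (L w) * ?zx w))
      + dbar ?\<theta> (L w) * F (L w) * regular_inverse m (?\<Pi> (L w) * ?zx w)" for w
  have \<rho>0: "0 \<le> ?\<rho> w" for w by simp
  have "flat ?\<rho> (\<lambda>w. dbar F w / ?\<Pi> w)"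
  proof (rule flat_divide[OF fl sm\<Pi> \<rho>0])
    show "\<exists>C\<ge>0. \<forall>w. norm w \<le> R \<longrightarrow> ?\<rho> w \<le> C * norm (?\<Pi> w)" for R
    proof (intro exI[of _ "max 0 R"] conjI allI impI)
      fix w :: "real \<times> real \<times> 'p" assume "norm w \<le> R"
      then have "\<bar>fst (snd w)\<bar> \<le> max 0 R" using norm_snd_fst_le[of w] by linarith
      then show "?\<rho> w \<le> max 0 R * norm (?\<Pi> w)" by (rule mult_right_mono) simp
    qed simp
  qed
  then have smRi: "smooth Ri"
    unfolding Ri_def[abs_def]
    by (intro smooth_on_add[OF open_UNIV] smooth_on_mult[OF open_UNIV] smooth_circle_cutoff flat_smooth smooth_dbar F smooth_regular_inverse sm\<Pi>)
  have "flat (\<lambda>w. ?\<rho> (L w)) (\<lambda>w. dbar F (L w) / (?\<Pi> (L w) * ?zx w))"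
  proof (rule flat_divide[OF flat_compose_linear[OF fl L] smooth_on_mult[OF open_UNIV comp[OF sm\<Pi>] smzx] \<rho>0])
    show "\<exists>C\<ge>0. \<forall>w. norm w \<le> R \<longrightarrow> ?\<rho> (L w) \<le> C * norm (?\<Pi> (L w) * ?zx w)" for R
    proof (intro exI[of _ 1] conjI allI impI)
      fix w :: "real \<times> real \<times> real \<times> 'p"
      have "\<bar>fst (snd (L w))\<bar> \<le> norm (?zx w)"
        using abs_Im_le_cmod[of "?zx w"] by (simp add: L_def zc_def)
      then have "\<bar>fst (snd (L w))\<bar> * norm (?\<Pi> (L w)) \<le> norm (?zx w) * norm (?\<Pi> (L w))" by (rule mult_right_mono) simp
      then show "?\<rho> (L w) \<le> 1 * norm (?\<Pi> (L w) * ?zx w)" by (simp add: norm_mult mult.commute)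
    qed simp
  qed
  then have smQi: "smooth Qi"
    unfolding Qi_def[abs_def]
    by (intro smooth_on_add[OF open_UNIV] smooth_on_mult[OF open_UNIV] comp smooth_circle_cutoff flat_smooth smooth_dbar F
        smooth_regular_inverse sm\<Pi> smzx)
  let ?B = "cbox (-2, -2) (2, 2) :: (real \<times> real) set"
  define qc where "qc y = integral ?B (\<lambda>(a, b). Qi (a, b, y))" for y
  define rc where "rc i p = integral ?B (\<lambda>(a, b). Ri (a, b, p) * quot_coeff C n i (a, b, p))" for i p
  have smRK: "smooth (\<lambda>w. Ri w * quot_coeff C n i w)" for i
    by (intro smooth_on_mult[OF open_UNIV] smRi smooth_quot_coeff smC)
  have smqc: "smooth qc" unfolding qc_def[abs_def] by (rule smooth_plane_integral[OF smQi])
  have smrc: "smooth (rc i)" for i unfolding rc_def[abs_def] by (rule smooth_plane_integral[OF smRK])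
  define q where "q y = Re (- qc y / kernel_mass)" for y
  define r where "r i p = Re (- rc i p / kernel_mass)" for i p
  have "isCont (\<lambda>p. \<Sum>i<n. \<bar>c i p\<bar>) p0"
    by (intro continuous_intros smooth_on_isCont[OF c UNIV_I])
  moreover have "0 < 3 * m" using m(1) by simp
  ultimately obtain d where "d > 0" "\<forall>p. dist p p0 < d \<longrightarrow> dist (\<Sum>i<n. \<bar>c i p\<bar>) (\<Sum>i<n. \<bar>c i p0\<bar>) < 3 * m"
    unfolding continuous_at_eps_delta by blast
  moreover have "(\<Sum>i<n. \<bar>c i p0\<bar>) = 0" using c0 by simp
  ultimately have d: "d > 0" "\<And>p. dist p p0 < d \<Longrightarrow> (\<Sum>i<n. \<bar>c i p\<bar>) \<le> 3 * m"
    unfolding dist_real_def by fastforce+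
  show ?thesis
  proof (rule that)
    show "min (1 / 3) d > 0" using d by simp
    show "smooth q" unfolding q_def[abs_def]
      by (intro smooth_on_blin[OF bounded_linear_Re open_UNIV] smooth_divide_const smooth_on_minus[OF open_UNIV] smqc)
    show "smooth (r i)" for i unfolding r_def[abs_def]
      by (intro smooth_on_blin[OF bounded_linear_Re open_UNIV] smooth_divide_const smooth_on_minus[OF open_UNIV] smrc)
    fix x p assume x: "\<bar>x\<bar> < min (1 / 3) d" and p: "dist p p0 < min (1 / 3) d"
    let ?P = "x ^ n + (\<Sum>i<n. c i p * x ^ i)"
    have \<Pi>x: "?\<Pi> (x, 0, p) = of_real ?P"
    proof -
      have "zc (x, 0::real, p) = of_real x" by (simp add: zc_def complex_eq_iff)
      then show ?thesis unfolding ppoly_def by (simp add: C_def lessThan_Suc_atMost[symmetric])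
    qed
    have large: "norm (?\<Pi> (a, b, p)) \<ge> m" "norm (?\<Pi> (a, b, p) * (Complex a b - of_real x)) \<ge> m" "Complex a b \<noteq> of_real x"
      if "dbar ?\<theta> (a, b, p) \<noteq> 0" for a b
    proof -
      let ?z = "Complex a b"
      have z: "norm ?z \<ge> 2 / 3" "norm ?z \<le> 1"
        using dbar_circle_cutoff[of "(a, b, p)"] that unfolding zc_def fst_conv snd_conv by linarith+
      have "norm (\<Sum>i<n. C i p * ?z ^ i) \<le> (\<Sum>i<n. \<bar>c i p\<bar> * 1)"
      proof (rule sum_norm_le)
        fix i assume "i \<in> {..<n}"
        then have "norm (C i p * ?z ^ i) = \<bar>c i p\<bar> * norm ?z ^ i" by (simp add: C_def norm_mult norm_power)
        also have "\<dots> \<le> \<bar>c i p\<bar> * 1" using z by (intro mult_left_mono power_le_one) auto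
        finally show "norm (C i p * ?z ^ i) \<le> \<bar>c i p\<bar> * 1" .
      qed
      also have "\<dots> \<le> 3 * m" using d(2)[of p] p by simp
      finally have 1: "norm (\<Sum>i<n. C i p * ?z ^ i) \<le> 3 * m" .
      have 2: "6 * m \<le> norm (?z ^ n)" unfolding m_def norm_power using z by (simp add: power_mono)
      have "?\<Pi> (a, b, p) = ?z ^ n + (\<Sum>i<n. C i p * ?z ^ i)"
        unfolding ppoly_def by (simp add: zc_def lessThan_Suc_atMost[symmetric] C_def)
      then have 3: "norm (?\<Pi> (a, b, p)) \<ge> 3 * m"
        using norm_diff_ineq[of "?z ^ n" "\<Sum>i<n. C i p * ?z ^ i"] 1 2 by simp
      then show "norm (?\<Pi> (a, b, p)) \<ge> m" using m by linarith
      have 4: "norm (?z - of_real x) \<ge> 1 / 3"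
        using norm_triangle_ineq2[of ?z "of_real x"] z(1) x by simp
      then show "?z \<noteq> of_real x" by auto
      show "norm (?\<Pi> (a, b, p) * (?z - of_real x)) \<ge> m"
        unfolding norm_mult using mult_mono[OF 3 4] m by simp
    qed
    let ?S = "\<lambda>a b. \<Sum>i<n. quot_coeff C n i (a, b, p) * of_real x ^ i"
    define G where "G = (\<lambda>(a, b). Ri (a, b, p) * ?S a b + of_real ?P * Qi (a, b, x, p))"
    have "dbar (\<lambda>w. ?\<theta> w * F w) (a, b, p) = G (a, b) * (Complex a b - of_real x)" for a b
    proof -
      let ?w = "(a, b, p)" and ?z = "Complex a b"
      have D: "dbar (\<lambda>w. ?\<theta> w * F w) ?w = ?\<theta> ?w * dbar F ?w + dbar ?\<theta> ?w * F ?w"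
        by (rule dbar_mult[OF smooth_circle_cutoff F(1)])
      have zw: "L (a, b, x, p) = ?w" "?zx (a, b, x, p) = ?z - of_real x" by (auto simp: L_def zc_def)
      have "dbar F ?w / ?\<Pi> ?w * ?\<Pi> ?w = dbar F ?w" using dF0[of ?w] by (cases "?\<Pi> ?w = 0") auto
      moreover have "dbar ?\<theta> ?w * F ?w * regular_inverse m (?\<Pi> ?w) * ?\<Pi> ?w = dbar ?\<theta> ?w * F ?w"
      proof (cases "dbar ?\<theta> ?w = 0")
        case False
        show ?thesis using regular_inverse_eq[OF m(1) large(1)[OF False]] large(1)[OF False] m(1) by auto
      qed simp
      ultimately have R\<Pi>: "Ri ?w * ?\<Pi> ?w = dbar (\<lambda>w. ?\<theta> w * F w) ?w"
        unfolding D Ri_def distrib_right by (simp only: mult.assoc)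
      \<comment> \<open>At z = x the left quotient is 0 by division by 0. There z is real and
        \<open>dbar F\<close> vanishes, so the right side is 0 as well.\<close>
      have "dbar F ?w / (?\<Pi> ?w * (?z - of_real x)) * (?z - of_real x) = dbar F ?w / ?\<Pi> ?w"
      proof (cases "?z = of_real x")
        case True
        then have "b = 0" by (simp add: complex_eq_iff)
        then show ?thesis using dF0[of ?w] by simp
      qed simp
      moreover have "dbar ?\<theta> ?w * F ?w * regular_inverse m (?\<Pi> ?w * (?z - of_real x)) * (?z - of_real x) =
        dbar ?\<theta> ?w * F ?w * regular_inverse m (?\<Pi> ?w)"
      proof (cases "dbar ?\<theta> ?w = 0")
        case False
        show ?thesis using regular_inverse_eq[OF m(1) large(1)[OF False]] regular_inverse_eq[OF m(1) large(2)[OF False]] large(3)[OF False]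
          by simp
      qed simp
      ultimately have QR: "Qi (a, b, x, p) * (?z - of_real x) = Ri ?w"
        unfolding Qi_def Ri_def zw distrib_right by (simp only: mult.assoc)
      have "G (a, b) * (?z - of_real x) = Ri ?w * (?S a b * (?z - of_real x)) + of_real ?P * (Qi (a, b, x, p) * (?z - of_real x))"
        unfolding G_def by (simp only: case_prod_conv distrib_right mult.assoc)
      also have "\<dots> = Ri ?w * (?\<Pi> ?w - of_real ?P) + of_real ?P * Ri ?w"
        unfolding QR ppoly_diff[symmetric] \<Pi>x by simp
      also have "\<dots> = Ri ?w * ?\<Pi> ?w" by (simp add: algebra_simps)
      finally show ?thesis using R\<Pi> by simp
    qed
    note DG = this
    have intQ: "(\<lambda>(a, b). Qi (a, b, x, p)) integrable_on ?B" by (rule integrable_slice[OF smQi])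
    have intR: "(\<lambda>(a, b). Ri (a, b, p) * quot_coeff C n i (a, b, p)) integrable_on ?B" for i
      by (rule integrable_slice[OF smRK])
    have Geq: "G = (\<lambda>w. (\<Sum>i<n. (\<lambda>(a, b). Ri (a, b, p) * quot_coeff C n i (a, b, p)) w * of_real x ^ i)
       + of_real ?P * (\<lambda>(a, b). Qi (a, b, x, p)) w)"
      by (auto simp: G_def fun_eq_iff sum_distrib_left mult_ac)
    have contG: "continuous_on UNIV G"
    proof -
      have slice: "continuous_on UNIV (\<lambda>(a, b). g (a, b, y))" if "smooth g" for g :: "real \<times> real \<times> 'y::euclidean_space \<Rightarrow> complex" and y
        unfolding case_prod_unfold
        by (rule continuous_on_compose2[OF smooth_on_continuous_on[OF that]]) (auto intro!: continuous_intros)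
      show ?thesis unfolding Geq
        by (intro continuous_on_add continuous_on_sum continuous_on_mult continuous_on_const slice[OF smRK] slice[OF smQi])
    qed
    have "integral ?B G = - kernel_mass * (?\<theta> (x, 0, p) * F (x, 0, p))"
    proof (rule cauchy_pompeiu[OF _ _ contG DG])
      show "smooth (\<lambda>w. ?\<theta> w * F w)" by (intro smooth_on_mult[OF open_UNIV] smooth_circle_cutoff F)
      show "?\<theta> (a, b, p) * F (a, b, p) = 0" if "\<bar>a\<bar> \<ge> 1 \<or> \<bar>b\<bar> \<ge> 1" for a b
      proof -
        have "norm (Complex a b) \<ge> 1"
          using abs_Re_le_cmod[of "Complex a b"] abs_Im_le_cmod[of "Complex a b"] that by auto
        then show ?thesis using one_le_power[of "norm (Complex a b)" 2] by (simp add: circle_cutoff_def zc_def cutoff_eq_0)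
      qed
      show "\<bar>x\<bar> \<le> 1" using x by simp
    qed
    also have "?\<theta> (x, 0, p) = 1"
    proof -
      have "\<bar>x\<bar> ^ 2 \<le> (1 / 3) ^ 2" using x by (intro power_mono) auto
      also have "(1 / 3 :: real) ^ 2 \<le> 1 / 2" by (simp add: power2_eq_square)
      finally show ?thesis by (intro trans[OF circle_cutoff_def]) (simp add: zc_def cutoff_eq_1 cmod_def)
    qed
    finally have I1: "integral ?B G = - kernel_mass * of_real (f (x, p))" using F(2) by simp
    have I2: "integral ?B G = (\<Sum>i<n. rc i p * of_real x ^ i) + of_real ?P * qc (x, p)"
      unfolding Geq rc_def qc_def
      by (subst integral_add) (auto intro!: integrable_sum integrable_on_mult_left integrable_on_mult_right intR intQ simp: integral_sum integrable_on_mult_left[OF intR])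
    have gen: "y = - s / kernel_mass + P * (- Q / kernel_mass)" if "- kernel_mass * y = s + P * Q" for y s P Q
    proof -
      have s: "s = - kernel_mass * y - P * Q" using that by simp
      show ?thesis unfolding s using kernel_mass_nonzero by (simp add: field_simps)
    qed
    have "(\<Sum>i<n. (- rc i p / kernel_mass) * of_real x ^ i) = - (\<Sum>i<n. rc i p * of_real x ^ i) / kernel_mass"
      by (simp add: sum_divide_distrib sum_negf)
    with gen[OF trans[OF I1[symmetric] I2]]
    have "complex_of_real (f (x, p)) = (\<Sum>i<n. (- rc i p / kernel_mass) * of_real x ^ i) + of_real ?P * (- qc (x, p) / kernel_mass)"
      by (simp only:)
    then have "f (x, p) = Re ((\<Sum>i<n. (- rc i p / kernel_mass) * of_real x ^ i) + of_real ?P * (- qc (x, p) / kernel_mass))"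
      by (metis Re_complex_of_real)
    also have "\<dots> = (\<Sum>i<n. r i p * x ^ i) + ?P * q (x, p)"
    proof -
      have e: "complex_of_real x ^ i = of_real (x ^ i)" for i by simp
      show ?thesis
        unfolding r_def q_def e
        by (simp only: plus_complex.sel Re_sum times_complex.sel Re_complex_of_real Im_complex_of_real
            mult_zero_right mult_zero_left diff_zero)
    qed
    finally show "f (x, p) = q (x, p) * ?P + (\<Sum>i<n. r i p * x ^ i)" by simp
  qed
qed

section \<open>Right-left equivalence\<close>

lemma diffeo_inverse_sym: "diffeo_inverse W V f g \<Longrightarrow> diffeo_inverse V W g f"
  unfolding diffeo_inverse_def by (elim conjE, intro conjI)

lemma diffeo_germI:
  fixes f :: "'a::euclidean_space \<Rightarrow> 'a"
  assumes "open S" "a \<in> S" "smooth_on S f" "\<And>v. dir_deriv v f a = 0 \<Longrightarrow> v = 0" "f a = b"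
  shows "diffeo_germ f a b"
proof (rule smooth_inverse_function[OF assms(1-4)])
  fix U V g assume "a \<in> U" "diffeo_inverse U V f g"
  then show ?thesis using assms(5) unfolding diffeo_germ_def by blast
qed

lemma diffeo_germ_inverse:
  assumes "diffeo_germ h a b"
  obtains U V k where "a \<in> U" "b \<in> V" "diffeo_inverse U V h k" "diffeo_germ k b a"
proof -
  obtain U V k where *: "h a = b" "a \<in> U" "diffeo_inverse U V h k"
    using assms by (auto simp: diffeo_germ_def)
  then have "b \<in> V" "k b = a" by (auto simp: diffeo_inverse_def)
  moreover from this have "diffeo_germ k b a"
    using diffeo_inverse_sym[OF *(3)] unfolding diffeo_germ_def by blast
  ultimately show ?thesis using that * by blast
qed

lemma diffeo_germ_differentiable: "diffeo_germ h a b \<Longrightarrow> h differentiable (at a)"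
  unfolding diffeo_germ_def diffeo_inverse_def using smooth_on_differentiable by blast

lemma diffeo_germ_tendsto: "diffeo_germ h a b \<Longrightarrow> (h \<longlongrightarrow> b) (nhds a)"
proof -
  assume h: "diffeo_germ h a b"
  then have "isCont h a" using diffeo_germ_differentiable differentiable_imp_continuous_within by blast
  moreover have "h a = b" using h by (simp add: diffeo_germ_def)
  ultimately show ?thesis using tendsto_at_iff_tendsto_nhds[of h a] by (simp add: continuous_at)
qed

lemma diffeo_germ_compose:
  fixes f :: "'a::euclidean_space \<Rightarrow> 'b::euclidean_space" and g :: "'b \<Rightarrow> 'c::euclidean_space"
  assumes "diffeo_germ f a b" "diffeo_germ g b c"
  shows "diffeo_germ (\<lambda>x. g (f x)) a c"
proof -
  obtain U V k where f: "f a = b" "a \<in> U" "diffeo_inverse U V f k"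
    using assms(1) by (auto simp: diffeo_germ_def)
  obtain U' V' k' where g: "g b = c" "b \<in> U'" "diffeo_inverse U' V' g k'"
    using assms(2) by (auto simp: diffeo_germ_def)
  have F: "open U" "open V" "smooth_on U f" "smooth_on V k" "f ` U = V" "k ` V = U"
    "\<And>w. w \<in> U \<Longrightarrow> k (f w) = w" "\<And>v. v \<in> V \<Longrightarrow> f (k v) = v"
    using f(3) unfolding diffeo_inverse_def by blast+
  have G: "open U'" "open V'" "smooth_on U' g" "smooth_on V' k'" "g ` U' = V'" "k' ` V' = U'"
    "\<And>w. w \<in> U' \<Longrightarrow> k' (g w) = w" "\<And>v. v \<in> V' \<Longrightarrow> g (k' v) = v"
    using g(3) unfolding diffeo_inverse_def by blast+
  define W where "W = U \<inter> f -` U'"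
  define W' where "W' = V' \<inter> k' -` V"
  have oW: "open W" unfolding W_def
    by (rule continuous_open_preimage[OF smooth_on_continuous_on[OF F(3)] F(1) G(1)])
  have oW': "open W'" unfolding W'_def
    by (rule continuous_open_preimage[OF smooth_on_continuous_on[OF G(4)] G(2) F(2)])
  have 1: "g (f x) \<in> W'" "k (k' (g (f x))) = x" if "x \<in> W" for x
  proof -
    have x: "x \<in> U" "f x \<in> U'" "f x \<in> V" using that F(5) by (auto simp: W_def)
    then show "g (f x) \<in> W'" using G(5) G(7)[OF x(2)] by (auto simp: W'_def)
    show "k (k' (g (f x))) = x" using F(7)[OF x(1)] G(7)[OF x(2)] by simp
  qed
  have 2: "k (k' y) \<in> W" "g (f (k (k' y))) = y" if "y \<in> W'" for y
  proof -
    have y: "y \<in> V'" "k' y \<in> V" "k' y \<in> U'" using that G(6) by (auto simp: W'_def)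
    then show "k (k' y) \<in> W" using F(6) F(8)[OF y(2)] by (auto simp: W_def)
    show "g (f (k (k' y))) = y" using F(8)[OF y(2)] G(8)[OF y(1)] by simp
  qed
  have "smooth_on W (\<lambda>x. g (f x))"
    by (rule smooth_on_compose[OF oW G(1) _ G(3) smooth_on_subset[OF F(3)]]) (auto simp: W_def)
  moreover have "smooth_on W' (\<lambda>y. k (k' y))"
    by (rule smooth_on_compose[OF oW' F(2) _ F(4) smooth_on_subset[OF G(4)]]) (auto simp: W'_def)
  moreover have "(\<lambda>x. g (f x)) ` W = W'"
    using 1 2 by (intro equalityI subsetI) (auto intro!: image_eqI[where x = "k (k' y)" for y])
  moreover have "(\<lambda>y. k (k' y)) ` W' = W"
    using 1 2 by (intro equalityI subsetI) (auto intro!: image_eqI[where x = "g (f y)" for y])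
  ultimately have "diffeo_inverse W W' (\<lambda>x. g (f x)) (\<lambda>y. k (k' y))"
    unfolding diffeo_inverse_def using oW oW' 1(2) 2(2) by blast
  moreover have "a \<in> W" using f g by (simp add: W_def)
  ultimately show ?thesis using f g unfolding diffeo_germ_def by blast
qed

text \<open>Continuity of f at a keeps \<open>f x\<close> in the set where \<psi> is inverted, so
  the identity can first be solved for f and then composed with the inverse of \<phi>.\<close>

lemma right_left_equivalent_sym:
  fixes f :: "'a::euclidean_space \<Rightarrow> 'b::euclidean_space"
  assumes "right_left_equivalent f a g b" "isCont f a"
  shows "right_left_equivalent g b f a"
proof -
  obtain \<phi> \<psi> where \<phi>: "diffeo_germ \<phi> a b" and \<psi>: "diffeo_germ \<psi> (f a) (g b)"
    and eq: "\<forall>\<^sub>F x in nhds a. \<psi> (f x) = g (\<phi> x)"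
    using assms(1) by (auto simp: right_left_equivalent_def)
  obtain U V \<phi>' where U: "a \<in> U" "b \<in> V" "diffeo_inverse U V \<phi> \<phi>'" "diffeo_germ \<phi>' b a"
    by (rule diffeo_germ_inverse[OF \<phi>])
  obtain U' V' \<psi>' where U': "f a \<in> U'" "g b \<in> V'" "diffeo_inverse U' V' \<psi> \<psi>'" "diffeo_germ \<psi>' (g b) (f a)"
    by (rule diffeo_germ_inverse[OF \<psi>])
  have "(f \<longlongrightarrow> f a) (nhds a)"
    using assms(2) tendsto_at_iff_tendsto_nhds[of f a] by (simp add: continuous_at)
  then have "\<forall>\<^sub>F x in nhds a. f x \<in> U'"
    using U'(1,3) by (auto simp: diffeo_inverse_def tendsto_def)
  with eq have "\<forall>\<^sub>F x in nhds a. \<psi>' (g (\<phi> x)) = f x"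
    by eventually_elim (use U'(3) in \<open>auto simp: diffeo_inverse_def\<close>)
  from eventually_compose_filterlim[OF this diffeo_germ_tendsto[OF U(4)]]
  have "\<forall>\<^sub>F y in nhds b. \<psi>' (g (\<phi> (\<phi>' y))) = f (\<phi>' y)" .
  moreover have "\<forall>\<^sub>F y in nhds b. y \<in> V"
    using U by (intro eventually_nhds_in_open) (auto simp: diffeo_inverse_def)
  ultimately have "\<forall>\<^sub>F y in nhds b. \<psi>' (g y) = f (\<phi>' y)"
    by eventually_elim (use U(3) in \<open>auto simp: diffeo_inverse_def\<close>)
  then show ?thesis unfolding right_left_equivalent_def using U(4) U'(4) by blast
qed

lemma right_left_equivalent_trans:
  fixes f :: "'a::euclidean_space \<Rightarrow> 'b::euclidean_space"
  assumes "right_left_equivalent f a g b" "right_left_equivalent g b h c"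
  shows "right_left_equivalent f a h c"
proof -
  obtain \<phi> \<psi> where 1: "diffeo_germ \<phi> a b" "diffeo_germ \<psi> (f a) (g b)"
    "\<forall>\<^sub>F x in nhds a. \<psi> (f x) = g (\<phi> x)"
    using assms(1) by (auto simp: right_left_equivalent_def)
  obtain \<phi>' \<psi>' where 2: "diffeo_germ \<phi>' b c" "diffeo_germ \<psi>' (g b) (h c)"
    "\<forall>\<^sub>F x in nhds b. \<psi>' (g x) = h (\<phi>' x)"
    using assms(2) by (auto simp: right_left_equivalent_def)
  from eventually_compose_filterlim[OF 2(3) diffeo_germ_tendsto[OF 1(1)]] 1(3)
  have "\<forall>\<^sub>F x in nhds a. \<psi>' (\<psi> (f x)) = h (\<phi>' (\<phi> x))" by eventually_elim simp
  then show ?thesis unfolding right_left_equivalent_def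
    using diffeo_germ_compose[OF 1(1) 2(1)] diffeo_germ_compose[OF 1(2) 2(2)] by blast
qed

text \<open>The Lojasiewicz exponent of a germ distinguishes the three models.\<close>

definition lojasiewicz :: "nat \<Rightarrow> ('a::real_normed_vector \<Rightarrow> 'b::real_normed_vector) \<Rightarrow> 'a \<Rightarrow> bool"
  where "lojasiewicz m f a \<longleftrightarrow> (\<exists>c>0. \<forall>\<^sub>F x in nhds a. c * norm (x - a) ^ m \<le> norm (f x - f a))"

text \<open>The inverse of \<phi> is Lipschitz at b with constant K, and \<psi> is Lipschitz at
  \<open>f a\<close> with constant K'. The inequality for g therefore holds for f with c replaced by
  c/(K^m K').\<close>

lemma lojasiewicz_right_left_equivalent:
  fixes f :: "'a::euclidean_space \<Rightarrow> 'b::euclidean_space"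
  assumes "right_left_equivalent f a g b" "isCont f a" "lojasiewicz m g b"
  shows "lojasiewicz m f a"
proof -
  obtain \<phi> \<psi> where \<phi>: "diffeo_germ \<phi> a b" and \<psi>: "diffeo_germ \<psi> (f a) (g b)"
    and eq: "\<forall>\<^sub>F x in nhds a. \<psi> (f x) = g (\<phi> x)"
    using assms(1) by (auto simp: right_left_equivalent_def)
  obtain U V k where U: "a \<in> U" "b \<in> V" "diffeo_inverse U V \<phi> k" "diffeo_germ k b a"
    by (rule diffeo_germ_inverse[OF \<phi>])
  obtain c where c: "c > 0" "\<forall>\<^sub>F y in nhds b. c * norm (y - b) ^ m \<le> norm (g y - g b)"
    using assms(3) by (auto simp: lojasiewicz_def)
  obtain K where K: "K > 0" "\<forall>\<^sub>F y in nhds b. norm (k y - k b) \<le> K * norm (y - b)"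
    using differentiable_Lipschitz_at[OF diffeo_germ_differentiable[OF U(4)]] by blast
  obtain K' where K': "K' > 0" "\<forall>\<^sub>F z in nhds (f a). norm (\<psi> z - \<psi> (f a)) \<le> K' * norm (z - f a)"
    using differentiable_Lipschitz_at[OF diffeo_germ_differentiable[OF \<psi>]] by blast
  have fa: "(f \<longlongrightarrow> f a) (nhds a)"
    using assms(2) tendsto_at_iff_tendsto_nhds[of f a] by (simp add: continuous_at)
  have "\<forall>\<^sub>F x in nhds a. x \<in> U"
    using U by (intro eventually_nhds_in_open) (auto simp: diffeo_inverse_def)
  with eq eventually_compose_filterlim[OF c(2) diffeo_germ_tendsto[OF \<phi>]]
    eventually_compose_filterlim[OF K(2) diffeo_germ_tendsto[OF \<phi>]] eventually_compose_filterlim[OF K'(2) fa]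
  have "\<forall>\<^sub>F x in nhds a. (c / (K ^ m * K')) * norm (x - a) ^ m \<le> norm (f x - f a)"
  proof eventually_elim
    case (elim x)
    have "k (\<phi> x) = x" "k b = a" "\<psi> (f a) = g b"
      using U elim \<psi> by (auto simp: diffeo_inverse_def diffeo_germ_def)
    then have "norm (x - a) \<le> K * norm (\<phi> x - b)" using elim(3) by simp
    then have "norm (x - a) ^ m \<le> K ^ m * norm (\<phi> x - b) ^ m"
      using power_mono[of "norm (x - a)" "K * norm (\<phi> x - b)" m] by (simp add: power_mult_distrib)
    then have "c * norm (x - a) ^ m \<le> K ^ m * (c * norm (\<phi> x - b) ^ m)" using c(1) by (simp add: mult_left_mono mult.left_commute)
    also have "\<dots> \<le> K ^ m * norm (g (\<phi> x) - g b)" using elim(2) K(1) by (intro mult_left_mono) auto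
    also have "\<dots> \<le> K ^ m * (K' * norm (f x - f a))"
      using elim(4) K(1) elim(1) \<open>\<psi> (f a) = g b\<close> by (intro mult_left_mono) auto
    finally show ?case using K(1) K'(1) by (simp add: field_simps)
  qed
  moreover have "c / (K ^ m * K') > 0" using c K K' by simp
  ultimately show ?thesis unfolding lojasiewicz_def by blast
qed

lemma lojasiewicz_mono:
  assumes "lojasiewicz m f a" "m \<le> m'"
  shows "lojasiewicz m' f a"
proof -
  obtain c where c: "c > 0" "\<forall>\<^sub>F x in nhds a. c * norm (x - a) ^ m \<le> norm (f x - f a)"
    using assms(1) by (auto simp: lojasiewicz_def)
  have "\<forall>\<^sub>F x in nhds a. dist x a < 1"
    unfolding eventually_nhds_metric by (rule exI[of _ 1]) auto
  with c(2) have "\<forall>\<^sub>F x in nhds a. c * norm (x - a) ^ m' \<le> norm (f x - f a)"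
  proof eventually_elim
    case (elim x)
    have "norm (x - a) ^ m' \<le> norm (x - a) ^ m"
      using elim(2) assms(2) by (intro power_decreasing) (auto simp: dist_norm)
    then show ?case using elim(1) c(1) by (meson mult_left_mono less_imp_le order_trans)
  qed
  then show ?thesis using c(1) by (auto simp: lojasiewicz_def)
qed

text \<open>On a vertical segment the displacement of f is O(v^(m + 1)), which falls below c v^m for
  small v.\<close>

lemma not_lojasiewicz:
  fixes f :: "real \<times> real \<Rightarrow> 'b::real_normed_vector"
  assumes "\<delta> > 0" and le: "\<And>v. 0 < v \<Longrightarrow> v < \<delta> \<Longrightarrow> norm (f (a1, a2 + v) - f (a1, a2)) \<le> K * v ^ Suc m"
  shows "\<not> lojasiewicz m f (a1, a2)"
proof
  assume "lojasiewicz m f (a1, a2)"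
  then obtain c where c: "c > 0" "\<forall>\<^sub>F x in nhds (a1, a2). c * norm (x - (a1, a2)) ^ m \<le> norm (f x - f (a1, a2))"
    by (auto simp: lojasiewicz_def)
  then obtain d where d: "d > 0" "\<And>x. dist x (a1, a2) < d \<Longrightarrow> c * norm (x - (a1, a2)) ^ m \<le> norm (f x - f (a1, a2))"
    unfolding eventually_nhds_metric by blast
  define v where "v = min (\<delta> / 2) (min (d / 2) (c / (2 * (\<bar>K\<bar> + 1))))"
  have v: "v > 0" using assms(1) d(1) c(1) by (simp add: v_def add_nonneg_pos)
  have v': "v \<le> \<delta> / 2" "v \<le> d / 2" "v \<le> c / (2 * (\<bar>K\<bar> + 1))"
    unfolding v_def by (meson min.cobounded1 min.cobounded2 order_trans)+
  have "c * v ^ m \<le> norm (f (a1, a2 + v) - f (a1, a2))"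
    using d(2)[of "(a1, a2 + v)"] v v'(2) by (simp add: dist_Pair_Pair dist_real_def)
  also have "\<dots> \<le> K * v ^ Suc m" using le[of v] v v'(1) assms(1) by simp
  also have "\<dots> \<le> (\<bar>K\<bar> + 1) * v ^ Suc m" using v by (intro mult_right_mono) auto
  also have "\<dots> = (\<bar>K\<bar> + 1) * v * v ^ m" by simp
  finally have "c \<le> (\<bar>K\<bar> + 1) * v" using v by (simp add: mult_le_cancel_right)
  also have "\<dots> \<le> c / 2" using v'(3) by (simp add: field_simps)
  finally show False using c(1) by simp
qed

text \<open>The first component controls u. In the component \<open>4 v^3 + 2 u v\<close> or
  \<open>5 v^4 + 2 u v\<close> the mixed term is at most 2|u| for |v| \<le> 1, so what remains
  controls the power of v; the cuspidal edge has \<open>v^2\<close> as a component.\<close>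

lemma lojasiewicz_models:
  shows lojasiewicz_cuspidal_edge: "lojasiewicz 2 (\<lambda>(u, v). (u, v^2, v^3) :: real \<times> real \<times> real) (0, 0)"
    and lojasiewicz_swallowtail:
      "lojasiewicz 3 (\<lambda>(u, v). (u, 3 * v^4 + u * v^2, 4 * v^3 + 2 * u * v) :: real \<times> real \<times> real) (0, 0)"
    and lojasiewicz_butterfly:
      "lojasiewicz 4 (\<lambda>(u, v). (u, 5 * v^4 + 2 * u * v, u * v^2 + 4 * v^5) :: real \<times> real \<times> real) (0, 0)"
proof -
  have loj: "lojasiewicz m f (0, 0)"
    if m: "m \<ge> 1" and f0: "f (0, 0) = 0" and u: "\<And>u v. fst (f (u, v)) = u" and K: "K > 0"
      and le: "\<And>u v. \<bar>u\<bar> \<le> 1 \<Longrightarrow> \<bar>v\<bar> \<le> 1 \<Longrightarrow> \<bar>v\<bar> ^ m \<le> K * norm (f (u, v))"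
    for m K and f :: "real \<times> real \<Rightarrow> real \<times> real \<times> real"
  proof -
    have pow: "norm (a, b) ^ m \<le> 2 ^ m * (1 + K) * N"
      if ab: "\<bar>a\<bar> \<le> 1" "\<bar>a\<bar> \<le> N" "\<bar>b\<bar> ^ m \<le> K * N" for a b N :: real
    proof -
      have "norm (a, b) \<le> \<bar>a\<bar> + \<bar>b\<bar>"
        unfolding norm_Pair by (simp add: sqrt_sum_squares_le_sum_abs)
      also have "\<dots> \<le> 2 * max \<bar>a\<bar> \<bar>b\<bar>" by simp
      finally have "norm (a, b) ^ m \<le> (2 * max \<bar>a\<bar> \<bar>b\<bar>) ^ m" by (intro power_mono) auto
      also have "\<dots> \<le> 2 ^ m * (\<bar>a\<bar> ^ m + \<bar>b\<bar> ^ m)"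
        by (auto simp: power_mult_distrib max_def)
      also have "\<dots> \<le> 2 ^ m * ((1 + K) * N)"
      proof (rule mult_left_mono)
        have "\<bar>a\<bar> ^ m \<le> \<bar>a\<bar>" using power_decreasing[of 1 m "\<bar>a\<bar>"] m ab(1) by simp
        then show "\<bar>a\<bar> ^ m + \<bar>b\<bar> ^ m \<le> (1 + K) * N" using ab(2,3) by (simp add: distrib_right)
      qed simp
      finally show ?thesis by (simp only: mult.assoc)
    qed
    define c where "c = 1 / (2 ^ m * (1 + K))"
    have c: "c > 0" using K by (simp add: c_def add_pos_pos)
    have le': "c * norm (x - (0, 0)) ^ m \<le> norm (f x - f (0, 0))" if x: "dist x (0, 0) < 1" for x
    proof -
      obtain a b where ab: "x = (a, b)" by (cases x)
      have n: "norm (a, b) < 1" using x by (simp add: ab dist_norm)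
      have b: "\<bar>a\<bar> \<le> 1" "\<bar>b\<bar> \<le> 1" using n norm_fst_le[of a b] norm_snd_le[of b a] by simp_all
      have "\<bar>a\<bar> \<le> norm (f (a, b))" using norm_fst_le[of "fst (f (a, b))" "snd (f (a, b))"] unfolding prod.collapse by (simp add: u)
      from pow[OF b(1) this le[OF b]] have "norm (a, b) ^ m \<le> 2 ^ m * (1 + K) * norm (f (a, b))" .
      then show ?thesis using K by (simp add: ab f0 c_def pos_divide_le_eq add_pos_pos mult.commute)
    qed
    have "\<forall>\<^sub>F x in nhds (0, 0). c * norm (x - (0, 0)) ^ m \<le> norm (f x - f (0, 0))"
      unfolding eventually_nhds_metric using le' zero_less_one by blast
    then show ?thesis using c unfolding lojasiewicz_def by blast
  qed
  have le3: "\<bar>a\<bar> \<le> norm (a, b, c)" "\<bar>b\<bar> \<le> norm (a, b, c)" "\<bar>c\<bar> \<le> norm (a, b, c)" for a b c :: real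
    using norm_fst_le[of b c] norm_snd_le[of c b] norm_snd_le[of "(b, c)" a] norm_fst_le[of a "(b, c)"] by auto
  show "lojasiewicz 2 (\<lambda>(u, v). (u, v^2, v^3) :: real \<times> real \<times> real) (0, 0)"
    by (rule loj[of _ _ 1]) (use le3(2)[of "v ^ 2" for v] in \<open>auto simp: zero_prod_def\<close>)
  have le_add: "\<bar>v\<bar> ^ m * c \<le> \<bar>c * v ^ m + 2 * u * v\<bar> + 2 * \<bar>u\<bar>"
    if "\<bar>v\<bar> \<le> 1" "c \<ge> 0" for u v c :: real and m
  proof -
    have "\<bar>c * v ^ m\<bar> \<le> \<bar>c * v ^ m + 2 * u * v\<bar> + 2 * (\<bar>u\<bar> * \<bar>v\<bar>)"
      using abs_triangle_ineq4[of "c * v ^ m + 2 * u * v" "2 * u * v"] by (simp add: abs_mult)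
    moreover have "\<bar>u\<bar> * \<bar>v\<bar> \<le> \<bar>u\<bar> * 1" using that by (intro mult_left_mono) auto
    ultimately show ?thesis using that by (simp add: abs_mult power_abs mult.commute)
  qed
  show "lojasiewicz 3 (\<lambda>(u, v). (u, 3 * v^4 + u * v^2, 4 * v^3 + 2 * u * v) :: real \<times> real \<times> real) (0, 0)"
  proof (rule loj[of _ _ 1])
    fix u v :: real assume "\<bar>u\<bar> \<le> 1" "\<bar>v\<bar> \<le> 1"
    then show "\<bar>v\<bar> ^ 3 \<le> 1 * norm (case (u, v) of (u, v) \<Rightarrow> (u, 3 * v^4 + u * v^2, 4 * v^3 + 2 * u * v))"
      using le3[where a = u and b = "3 * v^4 + u * v^2" and c = "4 * v^3 + 2 * u * v"] le_add[of v 4 3 u]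
      unfolding case_prod_conv by linarith
  qed (auto simp: zero_prod_def)
  show "lojasiewicz 4 (\<lambda>(u, v). (u, 5 * v^4 + 2 * u * v, u * v^2 + 4 * v^5) :: real \<times> real \<times> real) (0, 0)"
  proof (rule loj[of _ _ 1])
    fix u v :: real assume "\<bar>u\<bar> \<le> 1" "\<bar>v\<bar> \<le> 1"
    then show "\<bar>v\<bar> ^ 4 \<le> 1 * norm (case (u, v) of (u, v) \<Rightarrow> (u, 5 * v^4 + 2 * u * v, u * v^2 + 4 * v^5))"
      using le3[where a = u and b = "5 * v^4 + 2 * u * v" and c = "u * v^2 + 4 * v^5"] le_add[of v 5 4 u]
      unfolding case_prod_conv by linarith
  qed (auto simp: zero_prod_def)
qed

lemma norm_triple_le: "norm (a, b, c) \<le> \<bar>a\<bar> + \<bar>b\<bar> + \<bar>c\<bar>" for a b c :: real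
  using norm_Pair_le[of a "(b, c)"] norm_Pair_le[of b c] by simp

lemma not_lojasiewicz_swallowtail:
  "\<not> lojasiewicz 2 (\<lambda>(u, v). (u, 3 * v^4 + u * v^2, 4 * v^3 + 2 * u * v) :: real \<times> real \<times> real) (0, 0)"
proof (rule not_lojasiewicz[of 1 _ _ _ 7])
  fix v :: real assume v: "0 < v" "v < 1"
  have 1: "v ^ 4 \<le> v ^ 3" using v by (intro power_decreasing) auto
  have "norm (0 :: real, 3 * v ^ 4, 4 * v ^ 3) \<le> \<bar>0\<bar> + \<bar>3 * v ^ 4\<bar> + \<bar>4 * v ^ 3\<bar>" by (rule norm_triple_le)
  also have "\<dots> = 3 * v ^ 4 + 4 * v ^ 3" using v by simp
  also have "\<dots> \<le> 7 * v ^ 3" using 1 by linarith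
  finally show "norm ((\<lambda>(u, v). (u, 3 * v^4 + u * v^2, 4 * v^3 + 2 * u * v)) (0, 0 + v) -
    (\<lambda>(u, v). (u, 3 * v^4 + u * v^2, 4 * v^3 + 2 * u * v)) (0 :: real, 0)) \<le> 7 * v ^ Suc 2"
    by simp
qed simp

lemma not_lojasiewicz_butterfly:
  "\<not> lojasiewicz 3 (\<lambda>(u, v). (u, 5 * v^4 + 2 * u * v, u * v^2 + 4 * v^5) :: real \<times> real \<times> real) (0, 0)"
proof (rule not_lojasiewicz[of 1 _ _ _ 9])
  fix v :: real assume v: "0 < v" "v < 1"
  have 1: "v ^ 5 \<le> v ^ 4" using v by (intro power_decreasing) auto
  have "norm (0 :: real, 5 * v ^ 4, 4 * v ^ 5) \<le> \<bar>0\<bar> + \<bar>5 * v ^ 4\<bar> + \<bar>4 * v ^ 5\<bar>" by (rule norm_triple_le)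
  also have "\<dots> = 5 * v ^ 4 + 4 * v ^ 5" using v by simp
  also have "\<dots> \<le> 9 * v ^ 4" using 1 by linarith
  finally show "norm ((\<lambda>(u, v). (u, 5 * v^4 + 2 * u * v, u * v^2 + 4 * v^5)) (0, 0 + v) -
    (\<lambda>(u, v). (u, 5 * v^4 + 2 * u * v, u * v^2 + 4 * v^5)) (0 :: real, 0)) \<le> 9 * v ^ Suc 3"
    by simp
qed simp

section \<open>Normal forms of unfoldings\<close>

type_synonym R3 = "real \<times> real \<times> real"

text \<open>The constant term is the limit at 0 and vanishes; dividing the bound by |x| then gives
  the same situation for the quotient of p by x and k - 1.\<close>

lemma poly_coeff_eq_0:
  fixes p :: "real poly"
  assumes "e > 0" "\<And>x. x \<noteq> 0 \<Longrightarrow> \<bar>x\<bar> < e \<Longrightarrow> \<bar>poly p x\<bar> \<le> C * \<bar>x\<bar> ^ k" "j < k"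
  shows "coeff p j = 0"
  using assms(2,3)
proof (induction k arbitrary: p j)
  case (Suc k)
  obtain a q where p: "p = pCons a q" by (cases p)
  have "isCont (\<lambda>x. \<bar>poly p x\<bar>) 0" "isCont (\<lambda>x. C * \<bar>x\<bar> ^ Suc k) 0" by (intro continuous_intros)+
  then have t: "((\<lambda>x. \<bar>poly p x\<bar>) \<longlongrightarrow> \<bar>poly p 0\<bar>) (at 0)" "((\<lambda>x. C * \<bar>x\<bar> ^ Suc k) \<longlongrightarrow> C * \<bar>0\<bar> ^ Suc k) (at 0)"
    unfolding isCont_def by blast+
  have ev: "\<forall>\<^sub>F x in at 0. \<bar>poly p x\<bar> \<le> C * \<bar>x\<bar> ^ Suc k"
    unfolding eventually_at using assms(1) Suc.prems(1) by (intro exI[of _ e]) (auto simp: dist_real_def)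
  have "\<bar>poly p 0\<bar> \<le> C * \<bar>0\<bar> ^ Suc k" by (rule tendsto_le[OF at_neq_bot t(2) t(1) ev])
  then have a: "a = 0" by (simp add: p)
  have "\<bar>poly q x\<bar> \<le> C * \<bar>x\<bar> ^ k" if "x \<noteq> 0" "\<bar>x\<bar> < e" for x
    using Suc.prems(1)[OF that] that by (simp add: p a abs_mult mult_ac)
  from Suc.IH[OF this] show ?case using Suc.prems(2) by (cases j) (auto simp: p a)
qed simp

text \<open>The implicit solution is extended to the whole space. The last clause keeps local
  uniqueness in usable form: wherever the constant u0 solves the equation, it is the solution found.
  \<open>solve_rows\<close> uses it to get vanishing along a whole subspace of parameters.\<close>

lemma implicit_function_global:
  fixes \<Phi> :: "'p::euclidean_space \<times> 'u::euclidean_space \<Rightarrow> 'u"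
  assumes sm: "smooth \<Phi>" and z: "\<Phi> (p0, u0) = 0"
    and inj: "\<And>w. dir_deriv (0, w) \<Phi> (p0, u0) = 0 \<Longrightarrow> w = 0"
  shows "\<exists>\<phi> \<epsilon>. smooth \<phi> \<and> \<epsilon> > 0 \<and> \<phi> p0 = u0 \<and> (\<forall>p. dist p p0 < \<epsilon> \<longrightarrow> \<Phi> (p, \<phi> p) = 0) \<and>
    (\<forall>p. dist p p0 < \<epsilon> \<longrightarrow> \<Phi> (p, u0) = 0 \<longrightarrow> \<phi> p = u0)"
proof (rule smooth_implicit_function[OF open_UNIV UNIV_I sm z inj])
  fix N M \<phi>
  assume N: "open N" "p0 \<in> N" "smooth_on N \<phi>" "\<phi> p0 = u0"
    "\<And>p. p \<in> N \<Longrightarrow> (p, \<phi> p) \<in> UNIV \<and> \<Phi> (p, \<phi> p) = 0"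
    and M: "open M" "(p0, u0) \<in> M" "\<And>p u. (p, u) \<in> M \<Longrightarrow> \<Phi> (p, u) = 0 \<Longrightarrow> p \<in> N \<and> u = \<phi> p"
  obtain F e where F: "smooth F" "e > 0" "\<And>x. dist x p0 < e \<Longrightarrow> x \<in> N \<and> F x = \<phi> x"
    using smooth_extension[OF N(1-3)] by blast
  obtain d where d: "d > 0" "\<And>w. dist w (p0, u0) < d \<Longrightarrow> w \<in> M"
    using M(1,2) unfolding open_dist by blast
  have "F p0 = u0" using F(2) F(3)[of p0] N(4) by simp
  moreover have "\<Phi> (p, F p) = 0" if "dist p p0 < min e d" for p using F(3)[of p] N(5) that by auto
  moreover have "F p = u0" if "dist p p0 < min e d" "\<Phi> (p, u0) = 0" for p
    using M(3)[of p u0] d(2)[of "(p, u0)"] F(3)[of p] that by (auto simp: dist_Pair_Pair)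
  ultimately show ?thesis using F(1,2) d(1) by (intro exI[of _ F] exI[of _ "min e d"]) auto
qed auto

lemma malgrange_division_family:
  fixes f :: "nat \<Rightarrow> real \<times> 'p::euclidean_space \<Rightarrow> real" and c :: "nat \<Rightarrow> 'p \<Rightarrow> real"
  assumes f: "\<And>i. smooth (f i)" and c: "\<And>i. smooth (c i)" and c0: "\<And>i. i < n \<Longrightarrow> c i p0 = 0"
  shows "\<exists>\<epsilon> q r. \<epsilon> > 0 \<and> (\<forall>i. smooth (q i)) \<and> (\<forall>i j. smooth (r i j)) \<and>
    (\<forall>i<k. \<forall>x p. \<bar>x\<bar> < \<epsilon> \<longrightarrow> dist p p0 < \<epsilon> \<longrightarrow>
      f i (x, p) = q i (x, p) * (x ^ n + (\<Sum>j<n. c j p * x ^ j)) + (\<Sum>j<n. r i j p * x ^ j))"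
proof -
  let ?D = "\<lambda>i \<epsilon> q r. \<epsilon> > 0 \<and> smooth q \<and> (\<forall>j. smooth (r j)) \<and> (\<forall>x p. \<bar>x\<bar> < \<epsilon> \<longrightarrow> dist p p0 < \<epsilon> \<longrightarrow>
      f i (x, p) = q (x, p) * (x ^ n + (\<Sum>j<n. c j p * x ^ j)) + (\<Sum>j<n. r j p * x ^ j))"
  have "\<exists>\<epsilon> q r. ?D i \<epsilon> q r" for i
    by (rule malgrange_division[of "f i" c n p0, OF f c c0]) blast+
  then have "\<forall>i. \<exists>t. ?D i (fst t) (fst (snd t)) (snd (snd t))" by fastforce
  from choice[OF this] obtain t where t: "\<And>i. ?D i (fst (t i)) (fst (snd (t i))) (snd (snd (t i)))" by blast
  define \<epsilon> where "\<epsilon> i = fst (t i)" for i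
  define q where "q i = fst (snd (t i))" for i
  define r where "r i = snd (snd (t i))" for i
  have D: "?D i (\<epsilon> i) (q i) (r i)" for i unfolding \<epsilon>_def q_def r_def by (rule t)
  define e where "e = Min (insert 1 (\<epsilon> ` {..<k}))"
  have e: "e > 0" "\<And>i. i < k \<Longrightarrow> e \<le> \<epsilon> i" unfolding e_def using D by auto
  show ?thesis
    by (rule exI[of _ e], rule exI[of _ q], rule exI[of _ r]) (use D e in \<open>fastforce\<close>)
qed

text \<open>\<open>normal_form n A Q\<close>: after a change of variable \<open>T\<close> and a reparametrization \<open>b\<close>, the unfolding of
  \<open>x ^ n\<close> by \<open>A 0, A 1, A 2\<close> becomes the model family \<open>Q\<close>, up to a factor. The conditions on
  \<open>dir_deriv (1, 0, 0)\<close> make the first model coordinate \<open>l\<^sub>1\<close> correspond to \<open>A 2\<close> to first order.\<close>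

definition normal_form :: "nat \<Rightarrow> (nat \<Rightarrow> real \<Rightarrow> real) \<Rightarrow> (R3 \<Rightarrow> real \<Rightarrow> real) \<Rightarrow> bool"
  where "normal_form n A Q \<longleftrightarrow> (\<exists>b T q \<epsilon>. (\<forall>i. smooth (b i)) \<and> smooth T \<and> smooth q \<and> \<epsilon> > 0 \<and>
    (\<forall>i<3. b i 0 = 0) \<and> (\<forall>v. (\<forall>i<3. dir_deriv v (b i) 0 = 0) \<longrightarrow> v = 0) \<and>
    dir_deriv (1, 0, 0) (b 0) 0 = 0 \<and> dir_deriv (1, 0, 0) (b 1) 0 = 0 \<and> dir_deriv (1, 0, 0) (b 2) 0 \<noteq> 0 \<and>
    T (0, 0) = 0 \<and> dir_deriv (1, 0) T (0, 0) \<noteq> 0 \<and>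
    (\<forall>X l. \<bar>X\<bar> < \<epsilon> \<longrightarrow> norm l < \<epsilon> \<longrightarrow>
      T (X, l) ^ n + (\<Sum>i<3. b i l * A i (T (X, l))) = q (X, l) * Q l X))"

section \<open>Row equations: making the remainders of the frame match the model
  coefficients\<close>

lemma has_derivative_mult_zero:
  fixes f g :: "'a::real_normed_vector \<Rightarrow> real"
  assumes "(f has_derivative f') (at a)" "g differentiable (at a)" "f a = 0"
  shows "((\<lambda>x. f x * g x) has_derivative (\<lambda>h. f' h * g a)) (at a)"
  using has_derivative_cont_scaleR[OF _ assms(1,3), of g] assms(2) differentiable_imp_continuous_within[of g a UNIV]
  by (simp add: mult.commute)

lemma sum_lessThan_3: "(\<Sum>i<3::nat. f i) = f 0 + f 1 + (f 2 :: 'a::comm_monoid_add)"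
  by (simp add: numeral_3_eq_3 numeral_2_eq_2)

text \<open>Implicit function theorem for the four unknowns b 0, b 1, b 2 and e. At the base point
  the Jacobian is triangular with 1, 1, 1 and the negative of the derivative of \<open>C 3\<close>
  in e on the diagonal. For l = 0 the zero vector solves the equations for every c, so uniqueness
  makes b and e vanish there.\<close>

lemma solve_rows:
  fixes R :: "nat \<Rightarrow> nat \<Rightarrow> real \<times> 'c::euclidean_space \<times> R3 \<Rightarrow> real" and C :: "nat \<Rightarrow> real \<times> R3 \<Rightarrow> real"
  assumes R: "\<And>i j. smooth (R i j)" and C: "\<And>j. smooth (C j)" and C0: "\<And>j. C j (0, 0) = 0"
    and Ce: "\<And>j. j < 3 \<Longrightarrow> dir_deriv (1, 0) (C j) (0, 0) = 0" "dir_deriv (1, 0) (C 3) (0, 0) \<noteq> 0"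
    and tri: "R 0 0 (0, c0, 0) = 1" "R 1 0 (0, c0, 0) = 0" "R 2 0 (0, c0, 0) = 0" "R 1 1 (0, c0, 0) = 1"
      "R 2 1 (0, c0, 0) = 0" "R 2 2 (0, c0, 0) = 1"
  shows "\<exists>b e \<epsilon>. (\<forall>i. smooth (b i)) \<and> smooth e \<and> \<epsilon> > 0 \<and>
    (\<forall>p. dist p (c0, 0) < \<epsilon> \<longrightarrow> (\<forall>j<4. (\<Sum>i<3. b i p * R i j (e p, p)) = C j (e p, snd p))) \<and>
    (\<forall>c. dist c c0 < \<epsilon> \<longrightarrow> e (c, 0) = 0 \<and> (\<forall>i<3. b i (c, 0) = 0))"
proof -
  let ?e = "\<lambda>z :: ('c \<times> R3) \<times> real \<times> real \<times> real \<times> real. snd (snd (snd (snd z)))"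
  let ?b0 = "\<lambda>z :: ('c \<times> R3) \<times> real \<times> real \<times> real \<times> real. fst (snd z)"
  let ?b1 = "\<lambda>z :: ('c \<times> R3) \<times> real \<times> real \<times> real \<times> real. fst (snd (snd z))"
  let ?b2 = "\<lambda>z :: ('c \<times> R3) \<times> real \<times> real \<times> real \<times> real. fst (snd (snd (snd z)))"
  define row where "row j z = ?b0 z * R 0 j (?e z, fst z) + ?b1 z * R 1 j (?e z, fst z) + ?b2 z * R 2 j (?e z, fst z)
     - C j (?e z, snd (fst z))" for j z
  define \<Phi> where "\<Phi> z = (row 0 z, row 1 z, row 2 z, row 3 z)" for z
  have smR: "smooth (\<lambda>z. R i j (?e z, fst z))" for i j
    by (rule smooth_on_compose_UNIV[OF open_UNIV R]) (intro smooth_UNIV_intros)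
  have smC: "smooth (\<lambda>z. C j (?e z, snd (fst z)))" for j
    by (rule smooth_on_compose_UNIV[OF open_UNIV C]) (intro smooth_UNIV_intros)
  have smrow: "smooth (row j)" for j
    unfolding row_def[abs_def]
    by (intro smooth_on_add[OF open_UNIV] smooth_on_diff[OF open_UNIV] smooth_on_mult[OF open_UNIV] smR smC)
      (intro smooth_UNIV_intros)+
  have sm\<Phi>: "smooth \<Phi>" unfolding \<Phi>_def[abs_def] by (intro smooth_on_Pair[OF open_UNIV] smrow)
  have row0: "row j ((c, 0), 0) = 0" for j c by (simp add: row_def C0)
  have drow: "dir_deriv w (row j) ((c0, 0), 0) =
    ?b0 w * R 0 j (0, c0, 0) + ?b1 w * R 1 j (0, c0, 0) + ?b2 w * R 2 j (0, c0, 0)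
     - dir_deriv (?e w, snd (fst w)) (C j) (0, 0)" for j w
  proof -
    let ?a = "((c0, 0), 0) :: ('c \<times> R3) \<times> real \<times> real \<times> real \<times> real"
    have b: "(?b0 has_derivative ?b0) (at ?a)" "(?b1 has_derivative ?b1) (at ?a)" "(?b2 has_derivative ?b2) (at ?a)"
      "((\<lambda>z. (?e z, snd (fst z))) has_derivative (\<lambda>w. (?e w, snd (fst w)))) (at ?a)"
      by (intro has_derivative_Pair has_derivative_fst has_derivative_snd has_derivative_ident)+
    have dC: "((\<lambda>z. C j (?e z, snd (fst z))) has_derivative (\<lambda>w. dir_deriv (?e w, snd (fst w)) (C j) (0, 0))) (at ?a)"
      using has_derivative_compose[OF b(4) smooth_on_has_derivative[OF C UNIV_I]] by simp
    have "(row j has_derivative (\<lambda>w. ?b0 w * R 0 j (?e ?a, fst ?a) + ?b1 w * R 1 j (?e ?a, fst ?a) + ?b2 w * R 2 j (?e ?a, fst ?a)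
      - dir_deriv (?e w, snd (fst w)) (C j) (0, 0))) (at ?a)"
      unfolding row_def[abs_def]
      by (intro has_derivative_add has_derivative_diff has_derivative_mult_zero b dC smooth_differentiable[OF smR]) auto
    from dir_deriv_eq[OF this] show ?thesis by simp
  qed
  have "w = 0" if "dir_deriv (0, w) \<Phi> ((c0, 0), 0) = 0" for w
  proof -
    have "(\<Phi> has_derivative (\<lambda>w. (dir_deriv w (row 0) ((c0, 0), 0), dir_deriv w (row 1) ((c0, 0), 0),
       dir_deriv w (row 2) ((c0, 0), 0), dir_deriv w (row 3) ((c0, 0), 0)))) (at ((c0, 0), 0))"
      unfolding \<Phi>_def[abs_def] by (intro has_derivative_Pair smooth_on_has_derivative[OF smrow UNIV_I])
    from dir_deriv_eq[OF this, of "(0, w)"] that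
    have z: "dir_deriv (0, w) (row 0) ((c0, 0), 0) = 0" "dir_deriv (0, w) (row 1) ((c0, 0), 0) = 0"
       "dir_deriv (0, w) (row 2) ((c0, 0), 0) = 0" "dir_deriv (0, w) (row 3) ((c0, 0), 0) = 0"
      by (auto simp: zero_prod_def)
    obtain x0 x1 x2 x3 where w: "w = (x0, x1, x2, x3)" by (cases w)
    have dCe: "dir_deriv (x3, 0) (C j) (0, 0) = x3 * dir_deriv (1, 0) (C j) (0, 0)" for j
      using dir_deriv_scaleR[OF C, of x3 "(1, 0)"] by simp
    have x0: "x0 = 0" using z(1) Ce(1)[of 0] tri unfolding drow by (simp add: w dCe)
    then have x1: "x1 = 0" using z(2) Ce(1)[of 1] tri unfolding drow by (simp add: w dCe)
    then have x2: "x2 = 0" using z(3) Ce(1)[of 2] tri x0 unfolding drow by (simp add: w dCe)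
    then have "x3 = 0" using z(4) Ce(2) x0 x1 unfolding drow by (simp add: w dCe)
    then show ?thesis using w x0 x1 x2 by (simp add: zero_prod_def)
  qed
  moreover have "\<Phi> ((c0, 0), 0) = 0" using row0 by (simp add: \<Phi>_def zero_prod_def)
  ultimately obtain \<phi> \<epsilon> where \<phi>: "smooth \<phi>" "\<epsilon> > 0" "\<And>p. dist p (c0, 0) < \<epsilon> \<Longrightarrow> \<Phi> (p, \<phi> p) = 0"
    "\<And>p. dist p (c0, 0) < \<epsilon> \<Longrightarrow> \<Phi> (p, 0) = 0 \<Longrightarrow> \<phi> p = 0"
    using implicit_function_global[OF sm\<Phi>, of "(c0, 0)" 0] by blast
  define b where "b i p = (if i = 0 then fst (\<phi> p) else if i = 1 then fst (snd (\<phi> p)) else fst (snd (snd (\<phi> p))))" for i :: nat and p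
  define e where "e p = snd (snd (snd (\<phi> p)))" for p
  have "smooth (b i)" for i
    unfolding b_def[abs_def] using \<phi>(1) by (cases "i = 0"; cases "i = 1") (auto intro!: smooth_on_fst smooth_on_snd)
  moreover have "smooth e" unfolding e_def[abs_def] using \<phi>(1) by (auto intro!: smooth_on_fst smooth_on_snd)
  moreover have "(\<Sum>i<3. b i p * R i j (e p, p)) = C j (e p, snd p)" if "dist p (c0, 0) < \<epsilon>" "j < 4" for p j
  proof -
    have "row k (p, \<phi> p) = 0" if "k \<in> {0, 1, 2, 3}" for k
      using \<phi>(3)[OF \<open>dist p (c0, 0) < \<epsilon>\<close>] that by (auto simp: \<Phi>_def zero_prod_def)
    moreover have "j \<in> {0, 1, 2, 3}" using \<open>j < 4\<close> by auto
    ultimately have "row j (p, \<phi> p) = 0" by blast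
    then show ?thesis by (simp add: row_def sum_lessThan_3 b_def e_def)
  qed
  moreover have "e (c, 0) = 0 \<and> (\<forall>i<3. b i (c, 0) = 0)" if "dist c c0 < \<epsilon>" for c
  proof -
    have "\<phi> (c, 0) = 0"
      using row0 that by (intro \<phi>(4)) (auto simp: dist_Pair_Pair \<Phi>_def zero_prod_def[symmetric])
    then show ?thesis by (simp add: b_def e_def)
  qed
  ultimately show ?thesis using \<phi>(2) by (intro exI[of _ b] exI[of _ e] exI[of _ \<epsilon>]) auto
qed

text \<open>At a common zero of the b i the product rule keeps only their own derivatives, so the
  differentiated rows are linear equations for these derivatives.\<close>

lemma rows_derivative:
  fixes R :: "nat \<Rightarrow> 'a::real_normed_vector \<Rightarrow> real"
  assumes b: "\<And>i. smooth (b i)" and R: "\<And>i. smooth (R i)" and C: "smooth C"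
    and ev: "\<forall>\<^sub>F x in nhds a. (\<Sum>i<3. b i x * R i x) = C x" and z: "\<And>i. i < 3 \<Longrightarrow> b i a = 0"
  shows "(\<Sum>i<3. dir_deriv v (b i) a * R i a) = dir_deriv v C a"
proof -
  have "((\<lambda>x. \<Sum>i<3. b i x * R i x) has_derivative (\<lambda>h. \<Sum>i<3. dir_deriv h (b i) a * R i a)) (at a)"
    by (intro has_derivative_sum has_derivative_mult_zero smooth_on_has_derivative[OF b] smooth_differentiable[OF R] z) auto
  from dir_deriv_eq[OF this] have "dir_deriv v (\<lambda>x. \<Sum>i<3. b i x * R i x) a = (\<Sum>i<3. dir_deriv v (b i) a * R i a)" .
  moreover obtain S where "open S" "a \<in> S" "\<And>x. x \<in> S \<Longrightarrow> (\<Sum>i<3. b i x * R i x) = C x"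
    using ev unfolding eventually_nhds by blast
  ultimately show ?thesis using dir_deriv_cong_open[of S a "\<lambda>x. \<Sum>i<3. b i x * R i x" C v] by simp
qed

text \<open>For k \<le> n the term \<open>q x * x ^ n\<close> is of size |x|^k near 0, so the
  remainder and the polynomial t agree up to O(|x|^k) and share their coefficients below k.\<close>

lemma remainder_coeff:
  fixes f :: "real \<Rightarrow> real" and r :: "nat \<Rightarrow> real"
  assumes "\<epsilon> > 0" and q: "smooth q"
    and div: "\<And>x. \<bar>x\<bar> < \<epsilon> \<Longrightarrow> f x = q x * x ^ n + (\<Sum>j<n. r j * x ^ j)"
    and t: "\<delta> > 0" "\<And>x. \<bar>x\<bar> < \<delta> \<Longrightarrow> \<bar>f x - poly t x\<bar> \<le> C * \<bar>x\<bar> ^ k" and k: "k \<le> n" "j < k"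
  shows "r j = coeff t j"
proof -
  define p where "p = (\<Sum>j<n. monom (r j) j) - t"
  obtain D where D: "D \<ge> 0" "\<And>x. norm x \<le> 1 \<Longrightarrow> norm (q x) \<le> D" using smooth_bounded[OF q] by metis
  have "\<bar>poly p x\<bar> \<le> (C + D) * \<bar>x\<bar> ^ k" if x: "x \<noteq> 0" "\<bar>x\<bar> < min \<epsilon> (min \<delta> 1)" for x
  proof -
    have "poly p x = (f x - poly t x) - q x * x ^ n"
      using div[of x] x by (simp add: p_def poly_sum poly_monom)
    then have "\<bar>poly p x\<bar> \<le> \<bar>f x - poly t x\<bar> + \<bar>q x\<bar> * \<bar>x\<bar> ^ n"
      using abs_triangle_ineq4[of "f x - poly t x" "q x * x ^ n"] by (simp add: abs_mult power_abs)
    also have "\<dots> \<le> C * \<bar>x\<bar> ^ k + D * \<bar>x\<bar> ^ k"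
      using x k D t by (intro add_mono mult_mono power_decreasing) (auto simp: real_norm_def[symmetric] simp del: real_norm_def)
    finally show ?thesis by (simp add: distrib_right)
  qed
  then have "coeff p j = 0"
    by (intro poly_coeff_eq_0[of "min \<epsilon> (min \<delta> 1)" p "C + D" k, OF _ _ k(2)]) (use assms(1) t(1) in auto)
  moreover have "coeff (\<Sum>j<n. monom (r j) j) j = r j"
    using k by (simp add: coeff_sum)
  ultimately show ?thesis by (simp add: p_def)
qed

text \<open>Index 3 stands for the coefficient of \<open>x^(n - 1)\<close>, which equals n times the
  translation for the models and so determines it. The indices 0, 1, 2 then determine the
  parameters.\<close>

definition row_target :: "nat \<Rightarrow> (nat \<Rightarrow> real \<times> R3 \<Rightarrow> real) \<Rightarrow> nat \<Rightarrow> real \<times> R3 \<Rightarrow> real"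
  where "row_target n K j = (if n = 3 \<and> j = 2 then (\<lambda>z. fst (snd z)) else if j = 3 then K (n - 1) else K j)"

definition row_coeff :: "nat \<Rightarrow> (nat \<Rightarrow> nat \<Rightarrow> 'a \<Rightarrow> real) \<Rightarrow> nat \<Rightarrow> nat \<Rightarrow> 'a \<Rightarrow> real"
  where "row_coeff n r i j = (if n = 3 \<and> j = 2 then (\<lambda>_. if i = 2 then 1 else 0) else if j = 3 then r i (n - 1) else r i j)"

text \<open>Division of the frame functions \<open>f 0, f 1, f 2\<close> by the translated model polynomial with
  coefficients \<open>K j (e, l)\<close>. For \<open>n = 3\<close> the model has only two coefficients, and the third row is
  replaced by the equation that the last frame coordinate is the trivial parameter; for \<open>n = 5\<close> the
  row of \<open>x\<^sup>3\<close> is left unsolved.\<close>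

definition row_solution :: "nat \<Rightarrow> (nat \<Rightarrow> real \<times> 'c::euclidean_space \<Rightarrow> real) \<Rightarrow> (nat \<Rightarrow> real \<times> R3 \<Rightarrow> real) \<Rightarrow> 'c \<Rightarrow>
    (nat \<Rightarrow> real \<times> real \<times> 'c \<times> R3 \<Rightarrow> real) \<Rightarrow> (nat \<Rightarrow> nat \<Rightarrow> real \<times> 'c \<times> R3 \<Rightarrow> real) \<Rightarrow>
    (nat \<Rightarrow> 'c \<times> R3 \<Rightarrow> real) \<Rightarrow> ('c \<times> R3 \<Rightarrow> real) \<Rightarrow> real \<Rightarrow> bool"
  where "row_solution n f K c0 q r b e \<epsilon> \<longleftrightarrow> (\<forall>i. smooth (q i)) \<and> (\<forall>i j. smooth (r i j)) \<and> (\<forall>i. smooth (b i)) \<and> smooth e \<and> \<epsilon> > 0 \<and>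
    (\<forall>i<3. \<forall>x s c l. \<bar>x\<bar> < \<epsilon> \<longrightarrow> dist (s, c, l) (0, c0, 0) < \<epsilon> \<longrightarrow>
       f i (x, c) = q i (x, s, c, l) * (x ^ n + (\<Sum>j<n. K j (s, l) * x ^ j)) + (\<Sum>j<n. r i j (s, c, l) * x ^ j)) \<and>
    (\<forall>p. dist p (c0, 0) < \<epsilon> \<longrightarrow> (\<forall>j<4. (\<Sum>i<3. b i p * row_coeff n r i j (e p, p)) = row_target n K j (e p, snd p))) \<and>
    (\<forall>c. dist c c0 < \<epsilon> \<longrightarrow> e (c, 0) = 0 \<and> (\<forall>i<3. b i (c, 0) = 0)) \<and>
    (\<forall>c v j. dist c c0 < \<epsilon> \<longrightarrow> j < 3 \<longrightarrow>
       (\<Sum>i<3. dir_deriv (0, v) (b i) (c, 0) * row_coeff n r i j (0, c, 0)) = dir_deriv (0, v) (row_target n K j) (0, 0)) \<and>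
    (\<forall>i<3. \<forall>c k j t. dist c c0 < \<epsilon> \<longrightarrow> k \<le> n \<longrightarrow> j < k \<longrightarrow>
       (\<exists>\<delta>>0. \<exists>C. \<forall>x. \<bar>x\<bar> < \<delta> \<longrightarrow> \<bar>f i (x, c) - poly t x\<bar> \<le> C * \<bar>x\<bar> ^ k) \<longrightarrow> r i j (0, c, 0) = coeff t j)"

lemma row_solutionD:
  assumes "row_solution n f K c0 q r b e \<epsilon>"
  shows "smooth (q i)" "smooth (r i j)" "smooth (b i)" "smooth e" "\<epsilon> > 0"
    and "i < 3 \<Longrightarrow> \<bar>x\<bar> < \<epsilon> \<Longrightarrow> dist (s, c, l) (0, c0, 0) < \<epsilon> \<Longrightarrow>
      f i (x, c) = q i (x, s, c, l) * (x ^ n + (\<Sum>j<n. K j (s, l) * x ^ j)) + (\<Sum>j<n. r i j (s, c, l) * x ^ j)"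
    and "dist p (c0, 0) < \<epsilon> \<Longrightarrow> j < 4 \<Longrightarrow> (\<Sum>i<3. b i p * row_coeff n r i j (e p, p)) = row_target n K j (e p, snd p)"
    and "dist c c0 < \<epsilon> \<Longrightarrow> e (c, 0) = 0" "dist c c0 < \<epsilon> \<Longrightarrow> i < 3 \<Longrightarrow> b i (c, 0) = 0"
    and "dist c c0 < \<epsilon> \<Longrightarrow> j < 3 \<Longrightarrow>
      (\<Sum>i<3. dir_deriv (0, v) (b i) (c, 0) * row_coeff n r i j (0, c, 0)) = dir_deriv (0, v) (row_target n K j) (0, 0)"
    and "i < 3 \<Longrightarrow> dist c c0 < \<epsilon> \<Longrightarrow> k \<le> n \<Longrightarrow> j < k \<Longrightarrow>
      \<exists>\<delta>>0. \<exists>C. \<forall>x. \<bar>x\<bar> < \<delta> \<longrightarrow> \<bar>f i (x, c) - poly t x\<bar> \<le> C * \<bar>x\<bar> ^ k \<Longrightarrow> r i j (0, c, 0) = coeff t j"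
proof -
  note A = assms[unfolded row_solution_def]
  note A0 = A[THEN conjunct1, rule_format]
  note A1 = A[THEN conjunct2, THEN conjunct1, rule_format]
  note A2 = A[THEN conjunct2, THEN conjunct2, THEN conjunct1, rule_format]
  note A3 = A[THEN conjunct2, THEN conjunct2, THEN conjunct2, THEN conjunct1, rule_format]
  note A4 = A[THEN conjunct2, THEN conjunct2, THEN conjunct2, THEN conjunct2, THEN conjunct1, rule_format]
  note A5 = A[THEN conjunct2, THEN conjunct2, THEN conjunct2, THEN conjunct2, THEN conjunct2, THEN conjunct1, rule_format]
  note A6 = A[THEN conjunct2, THEN conjunct2, THEN conjunct2, THEN conjunct2, THEN conjunct2, THEN conjunct2, THEN conjunct1, rule_format]
  note A7 = A[THEN conjunct2, THEN conjunct2, THEN conjunct2, THEN conjunct2, THEN conjunct2, THEN conjunct2, THEN conjunct2, THEN conjunct1, rule_format]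
  note A8 = A[THEN conjunct2, THEN conjunct2, THEN conjunct2, THEN conjunct2, THEN conjunct2, THEN conjunct2, THEN conjunct2, THEN conjunct2]
  show "smooth (q i)" "smooth (r i j)" "smooth (b i)" "smooth e" "\<epsilon> > 0" by (rule A0 A1 A2 A3 A4)+
  show "i < 3 \<Longrightarrow> \<bar>x\<bar> < \<epsilon> \<Longrightarrow> dist (s, c, l) (0, c0, 0) < \<epsilon> \<Longrightarrow>
      f i (x, c) = q i (x, s, c, l) * (x ^ n + (\<Sum>j<n. K j (s, l) * x ^ j)) + (\<Sum>j<n. r i j (s, c, l) * x ^ j)"
    by (rule A5)
  show "dist p (c0, 0) < \<epsilon> \<Longrightarrow> j < 4 \<Longrightarrow> (\<Sum>i<3. b i p * row_coeff n r i j (e p, p)) = row_target n K j (e p, snd p)"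
    by (rule A6)
  show "dist c c0 < \<epsilon> \<Longrightarrow> e (c, 0) = 0" by (rule A7[THEN conjunct1])
  show "dist c c0 < \<epsilon> \<Longrightarrow> i < 3 \<Longrightarrow> b i (c, 0) = 0" by (rule A7[THEN conjunct2, rule_format])
  show "dist c c0 < \<epsilon> \<Longrightarrow> j < 3 \<Longrightarrow>
      (\<Sum>i<3. dir_deriv (0, v) (b i) (c, 0) * row_coeff n r i j (0, c, 0)) = dir_deriv (0, v) (row_target n K j) (0, 0)"
    by (rule A8[THEN conjunct1, rule_format])
  show "i < 3 \<Longrightarrow> dist c c0 < \<epsilon> \<Longrightarrow> k \<le> n \<Longrightarrow> j < k \<Longrightarrow>
      \<exists>\<delta>>0. \<exists>C. \<forall>x. \<bar>x\<bar> < \<delta> \<longrightarrow> \<bar>f i (x, c) - poly t x\<bar> \<le> C * \<bar>x\<bar> ^ k \<Longrightarrow> r i j (0, c, 0) = coeff t j"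
    using A[THEN conjunct2, THEN conjunct2, THEN conjunct2, THEN conjunct2, THEN conjunct2, THEN conjunct2, THEN conjunct2, THEN conjunct2, THEN conjunct2]
    by blast
qed

text \<open>At the base point the divisor is \<open>x^n\<close>, and the remainder coefficients are
  Taylor coefficients of the f i by \<open>remainder_coeff\<close>; a triangular frame thus gives
  the triangular matrix required by \<open>solve_rows\<close>. The variable c stays free because for
  the butterfly it is chosen afterwards, as a function of l.\<close>

lemma core_rows:
  fixes f :: "nat \<Rightarrow> real \<times> 'c::euclidean_space \<Rightarrow> real" and K :: "nat \<Rightarrow> real \<times> R3 \<Rightarrow> real"
  assumes n: "n \<in> {3, 4, 5}" and f: "\<And>i. smooth (f i)" and K: "\<And>j. smooth (K j)" and K0: "\<And>j. K j (0, 0) = 0"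
    and Ke: "\<And>j. j < 3 \<Longrightarrow> dir_deriv (1, 0) (row_target n K j) (0, 0) = 0" "dir_deriv (1, 0) (K (n - 1)) (0, 0) \<noteq> 0"
    and ft: "\<And>i. i < 3 \<Longrightarrow> \<exists>\<delta>>0. \<exists>C. \<forall>x. \<bar>x\<bar> < \<delta> \<longrightarrow> \<bar>f i (x, c0) - poly (t i) x\<bar> \<le> C * \<bar>x\<bar> ^ 3"
    and tri: "\<And>i. i < 3 \<Longrightarrow> coeff (t i) i = 1" "\<And>i j. i < 3 \<Longrightarrow> j < i \<Longrightarrow> coeff (t i) j = 0"
  shows "\<exists>q r b e \<epsilon>. row_solution n f K c0 q r b e \<epsilon>"
proof -
  let ?f = "\<lambda>i (w :: real \<times> real \<times> 'c \<times> R3). f i (fst w, fst (snd (snd w)))"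
  let ?c = "\<lambda>j (p :: real \<times> 'c \<times> R3). K j (fst p, snd (snd p))"
  have smf: "smooth (?f i)" for i
    by (rule smooth_on_compose_UNIV[OF open_UNIV f]) (intro smooth_UNIV_intros)
  have smc: "smooth (?c j)" for j
    by (rule smooth_on_compose_UNIV[OF open_UNIV K]) (intro smooth_UNIV_intros)
  have "?c j (0, c0, 0) = 0" for j by (simp add: K0)
  from malgrange_division_family[of ?f ?c n "(0, c0, 0)" 3, OF smf smc this]
  obtain \<epsilon>1 q r where \<epsilon>1: "\<epsilon>1 > 0" and q: "\<And>i. smooth (q i)" and r: "\<And>i j. smooth (r i j)"
    and div: "\<And>i x p. i < 3 \<Longrightarrow> \<bar>x\<bar> < \<epsilon>1 \<Longrightarrow> dist p (0, c0, 0) < \<epsilon>1 \<Longrightarrow>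
      ?f i (x, p) = q i (x, p) * (x ^ n + (\<Sum>j<n. ?c j p * x ^ j)) + (\<Sum>j<n. r i j p * x ^ j)"
    by blast
  have rc: "r i j (0, c, 0) = coeff t j"
    if i: "i < 3" and c: "dist c c0 < \<epsilon>1" and k: "k \<le> n" "j < k"
      and "\<exists>\<delta>>0. \<exists>C. \<forall>x. \<bar>x\<bar> < \<delta> \<longrightarrow> \<bar>f i (x, c) - poly t x\<bar> \<le> C * \<bar>x\<bar> ^ k" for i c k j t
  proof -
    obtain \<delta> C where \<delta>: "\<delta> > 0" "\<And>x. \<bar>x\<bar> < \<delta> \<Longrightarrow> \<bar>f i (x, c) - poly t x\<bar> \<le> C * \<bar>x\<bar> ^ k" using \<open>\<exists>\<delta>>0. _\<close> by blast
    have "smooth (\<lambda>x. q i (x, 0, c, 0))"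
      by (rule smooth_on_compose_UNIV[OF open_UNIV q]) (intro smooth_UNIV_intros)
    moreover have "f i (x, c) = q i (x, 0, c, 0) * x ^ n + (\<Sum>j<n. r i j (0, c, 0) * x ^ j)" if "\<bar>x\<bar> < \<epsilon>1" for x
      using div[OF i that, of "(0, c, 0)"] c by (simp add: K0 dist_Pair_Pair)
    ultimately show ?thesis by (rule remainder_coeff[OF \<epsilon>1 _ _ \<delta> k])
  qed
  have smR: "smooth (row_coeff n r i j)" for i j
    using r by (simp add: row_coeff_def smooth_on_const)
  have smC: "smooth (row_target n K j)" for j
    using K by (auto simp: row_target_def intro!: smooth_on_fst[OF open_UNIV] smooth_on_snd[OF open_UNIV] smooth_on_id)
  have C0: "row_target n K j (0, 0) = 0" for j by (simp add: row_target_def K0)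
  have n3: "3 \<le> n" using n by auto
  have tr: "r i j (0, c0, 0) = (if i = j then 1 else 0)" if "i < 3" "j \<le> i" for i j
  proof -
    have "r i j (0, c0, 0) = coeff (t i) j"
      by (rule rc[OF that(1) _ n3 _ ft[OF that(1)]]) (use that \<epsilon>1 in auto)
    also have "\<dots> = (if i = j then 1 else 0)" using tri(1)[OF that(1)] tri(2)[OF that(1), of j] that by auto
    finally show ?thesis .
  qed
  have "\<exists>b e \<epsilon>. (\<forall>i. smooth (b i)) \<and> smooth e \<and> \<epsilon> > 0 \<and>
    (\<forall>p. dist p (c0, 0) < \<epsilon> \<longrightarrow> (\<forall>j<4. (\<Sum>i<3. b i p * row_coeff n r i j (e p, p)) = row_target n K j (e p, snd p))) \<and>
    (\<forall>c. dist c c0 < \<epsilon> \<longrightarrow> e (c, 0) = 0 \<and> (\<forall>i<3. b i (c, 0) = 0))"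
  proof (rule solve_rows[OF smR smC C0 Ke(1)])
    show "dir_deriv (1, 0) (row_target n K 3) (0, 0) \<noteq> 0" using Ke(2) by (simp add: row_target_def)
  qed (use tr in \<open>auto simp: row_coeff_def\<close>)
  then obtain b e \<epsilon>2 where b: "\<And>i. smooth (b i)" and e: "smooth e" and \<epsilon>2: "\<epsilon>2 > 0"
    and rows: "\<And>p j. dist p (c0, 0) < \<epsilon>2 \<Longrightarrow> j < 4 \<Longrightarrow> (\<Sum>i<3. b i p * row_coeff n r i j (e p, p)) = row_target n K j (e p, snd p)"
    and zero: "\<And>c. dist c c0 < \<epsilon>2 \<Longrightarrow> e (c, 0) = 0" "\<And>c i. dist c c0 < \<epsilon>2 \<Longrightarrow> i < 3 \<Longrightarrow> b i (c, 0) = 0"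
    by blast
  have der: "(\<Sum>i<3. dir_deriv (0, v) (b i) (c, 0) * row_coeff n r i j (0, c, 0)) = dir_deriv (0, v) (row_target n K j) (0, 0)"
    if c: "dist c c0 < \<epsilon>2" and j: "j < 3" for c v j
  proof -
    have sm1: "smooth (\<lambda>p. row_coeff n r i j (e p, p))" for i
      by (rule smooth_on_compose_UNIV[OF open_UNIV smR]) (intro smooth_UNIV_intros e)
    have sm2: "smooth (\<lambda>p. row_target n K j (e p, snd p))"
      by (rule smooth_on_compose_UNIV[OF open_UNIV smC]) (intro smooth_UNIV_intros e)
    have "\<forall>\<^sub>F p in nhds (c, 0). p \<in> ball (c0, 0) \<epsilon>2"
      using c by (intro eventually_nhds_in_open) (auto simp: dist_Pair_Pair dist_commute)
    then have "\<forall>\<^sub>F p in nhds (c, 0). (\<Sum>i<3. b i p * row_coeff n r i j (e p, p)) = row_target n K j (e p, snd p)"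
      by eventually_elim (use rows j in \<open>auto simp: dist_commute\<close>)
    from rows_derivative[OF b sm1 sm2 this zero(2)[OF c]]
    have "(\<Sum>i<3. dir_deriv (0, v) (b i) (c, 0) * row_coeff n r i j (0, c, 0)) = dir_deriv (0, v) (\<lambda>p. row_target n K j (e p, snd p)) (c, 0)"
      by (simp add: zero(1)[OF c])
    also have "\<dots> = dir_deriv (dir_deriv (0, v) e (c, 0), v) (row_target n K j) (0, 0)"
    proof -
      have "((\<lambda>p. (e p, snd p)) has_derivative (\<lambda>h. (dir_deriv h e (c, 0), snd h))) (at (c, 0))"
        by (intro has_derivative_Pair smooth_on_has_derivative[OF e UNIV_I] has_derivative_snd has_derivative_ident)
      from dir_deriv_eq[OF has_derivative_compose[OF this smooth_on_has_derivative[OF smC UNIV_I]]]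
      show ?thesis by (simp add: zero(1)[OF c])
    qed
    \<comment> \<open>The rows with index below 3 do not react to the translation to first order, so
      the derivative of e drops out.\<close>
    also have "\<dots> = dir_deriv (0, v) (row_target n K j) (0, 0)"
    proof -
      define s where "s = dir_deriv (0, v) e (c, 0)"
      have "dir_deriv (s, v) (row_target n K j) (0, 0) =
        dir_deriv (s *\<^sub>R (1, 0)) (row_target n K j) (0, 0) + dir_deriv (0, v) (row_target n K j) (0, 0)"
        using linear_add[OF dir_deriv_linear[OF smooth_differentiable[OF smC]], of "s *\<^sub>R (1, 0)" "(0, v)" j "(0, 0)"] by simp
      then show ?thesis unfolding s_def[symmetric] dir_deriv_scaleR[OF smC] Ke(1)[OF j] by simp
    qed
    finally show ?thesis .
  qed
  let ?\<epsilon> = "min \<epsilon>1 \<epsilon>2"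
  show ?thesis
    unfolding row_solution_def
    apply (rule exI[of _ q], rule exI[of _ r], rule exI[of _ b], rule exI[of _ e], rule exI[of _ ?\<epsilon>])
    apply (intro conjI allI impI q r b e)
    subgoal using \<epsilon>1 \<epsilon>2 by simp
    subgoal for i x s c l using div[of i x "(s, c, l)"] by simp
    subgoal using rows by simp
    subgoal using zero by simp
    subgoal using zero by simp
    subgoal using der by simp
    subgoal using rc by auto
    done
qed

text \<open>By the rows, the remainders of the a i combine to \<Sum> K j x^j, which is P - x^n;
  adding \<open>x^n\<close> completes P.\<close>

lemma remainder_vanishes:
  fixes a :: "nat \<Rightarrow> real"
  assumes "\<And>i. i < 3 \<Longrightarrow> a i = q i * P + (\<Sum>j<n. r i j * x ^ j)"
    and P: "P = x ^ n + (\<Sum>j<n. K j * x ^ j)"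
    and rows: "\<And>j. j < n \<Longrightarrow> (\<Sum>i<3. b i * r i j) = K j"
  shows "x ^ n + (\<Sum>i<3. b i * a i) = (1 + (\<Sum>i<3. b i * q i)) * P"
proof -
  have "(\<Sum>i<3. b i * a i) = (\<Sum>i<3. b i * (q i * P + (\<Sum>j<n. r i j * x ^ j)))"
    by (rule sum.cong[OF refl]) (simp add: assms(1))
  also have "\<dots> = (\<Sum>i<3. b i * q i) * P + (\<Sum>i<3. \<Sum>j<n. b i * r i j * x ^ j)"
    by (simp add: distrib_left sum.distrib sum_distrib_left sum_distrib_right mult_ac)
  also have "(\<Sum>i<3. \<Sum>j<n. b i * r i j * x ^ j) = (\<Sum>j<n. (\<Sum>i<3. b i * r i j) * x ^ j)"
    by (subst sum.swap) (simp add: sum_distrib_right)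
  also have "\<dots> = (\<Sum>j<n. K j * x ^ j)" using rows by simp
  finally show ?thesis using P by (simp add: distrib_right)
qed

lemma isCont_dist_less:
  fixes f :: "'a::real_normed_vector \<Rightarrow> 'b::metric_space"
  assumes "isCont f 0" "\<epsilon> > 0"
  shows "\<exists>d>0. \<forall>l. norm l < d \<longrightarrow> dist (f l) (f 0) < \<epsilon>"
proof -
  have "\<exists>d>0. \<forall>l. dist l 0 < d \<longrightarrow> dist (f l) (f 0) < \<epsilon>"
    using assms unfolding continuous_at_eps_delta by blast
  then show ?thesis unfolding dist_norm[of _ "0 :: 'a"] diff_0_right .
qed

text \<open>The functions 1, x, x^2 up to order 3: the best that constant linear changes of the
  three parameters of the generating family can achieve.\<close>

definition frame :: "(nat \<Rightarrow> real \<Rightarrow> real) \<Rightarrow> nat \<Rightarrow> real \<Rightarrow> real"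
  where "frame \<alpha> i x = x ^ i + x ^ 3 * \<alpha> i x"

text \<open>For n = 3 and 4 the rows account for every coefficient of the divisor, so the
  substitution x = X - e(l) removes the whole remainder. The frame agrees with 1, x, x^2 up to order
  3, which makes the 3 by 3 matrix of the rows the identity at the base point; b therefore has the
  same differential at 0 as the row targets.\<close>

lemma normal_form_translation:
  fixes K :: "nat \<Rightarrow> real \<times> R3 \<Rightarrow> real"
  assumes n: "n \<in> {3, 4}" and \<alpha>: "\<And>i. smooth (\<alpha> i)" and K: "\<And>j. smooth (K j)" and K0: "\<And>j. K j (0, 0) = 0"
    and Ke: "\<And>j. j < 3 \<Longrightarrow> dir_deriv (1, 0) (row_target n K j) (0, 0) = 0" "dir_deriv (1, 0) (K (n - 1)) (0, 0) \<noteq> 0"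
    and KQ: "\<And>x s l. x ^ n + (\<Sum>j<n. K j (s, l) * x ^ j) = Q l (x + s)"
    and inj: "\<And>v. (\<And>j. j < 3 \<Longrightarrow> dir_deriv (0, v) (row_target n K j) (0, 0) = 0) \<Longrightarrow> v = 0"
    and L: "dir_deriv (0, 1, 0, 0) (row_target n K 0) (0, 0) = 0" "dir_deriv (0, 1, 0, 0) (row_target n K 1) (0, 0) = 0"
      "dir_deriv (0, 1, 0, 0) (row_target n K 2) (0, 0) \<noteq> 0"
  shows "normal_form n (frame \<alpha>) Q"
proof -
  \<comment> \<open>The second component is a dummy filling the place of the variable c, which is
    set to 0 below.\<close>
  let ?f = "\<lambda>i (w :: real \<times> real). frame \<alpha> i (fst w)"
  have smf: "smooth (?f i)" for i
    unfolding frame_def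
    by (intro smooth_UNIV_intros smooth_on_compose_UNIV[OF open_UNIV \<alpha>])
  have ft: "\<exists>\<delta>>0. \<exists>C. \<forall>x. \<bar>x\<bar> < \<delta> \<longrightarrow> \<bar>?f i (x, c) - poly (monom 1 i) x\<bar> \<le> C * \<bar>x\<bar> ^ 3" for i c
  proof -
    obtain D where D: "\<And>x. norm x \<le> 1 \<Longrightarrow> norm (\<alpha> i x) \<le> D" using smooth_bounded[OF \<alpha>] by metis
    have "\<bar>?f i (x, c) - poly (monom 1 i) x\<bar> \<le> D * \<bar>x\<bar> ^ 3" if "\<bar>x\<bar> < 1" for x
      using mult_right_mono[OF D[of x], of "\<bar>x\<bar> ^ 3"] that by (simp add: frame_def poly_monom abs_mult power_abs mult.commute)
    then show ?thesis by (intro exI[of _ 1]) auto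
  qed
  have n': "n \<in> {3, 4, 5}" using n by auto
  have tri: "\<And>i. i < 3 \<Longrightarrow> coeff (monom 1 i :: real poly) i = 1"
    "\<And>i j. i < 3 \<Longrightarrow> j < i \<Longrightarrow> coeff (monom 1 i :: real poly) j = 0" by auto
  obtain q r b e \<epsilon> where sol: "row_solution n ?f K 0 q r b e \<epsilon>"
    using core_rows[of n ?f K 0 "\<lambda>i. monom 1 i", OF n' smf K K0 Ke ft tri] by blast
  note q = row_solutionD(1)[OF sol] and r = row_solutionD(2)[OF sol] and b = row_solutionD(3)[OF sol]
    and e = row_solutionD(4)[OF sol] and \<epsilon> = row_solutionD(5)[OF sol] and div = row_solutionD(6)[OF sol]
    and rows = row_solutionD(7)[OF sol] and zero = row_solutionD(8,9)[OF sol] and der = row_solutionD(10)[OF sol]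
    and rc = row_solutionD(11)[OF sol]
  define b' where "b' i l = b i (0, l)" for i l
  define e' where "e' l = e (0, l)" for l
  have smb: "smooth (b' i)" for i
    unfolding b'_def by (rule smooth_on_compose_UNIV[OF open_UNIV b]) (intro smooth_UNIV_intros)
  have sme: "smooth e'"
    unfolding e'_def by (rule smooth_on_compose_UNIV[OF open_UNIV e]) (intro smooth_UNIV_intros)
  have db: "dir_deriv v (b' i) 0 = dir_deriv (0, v) (b i) (0, 0)" for v i
  proof -
    have "((\<lambda>l. (0, l)) has_derivative (\<lambda>h. (0, h))) (at (0 :: R3))"
      by (intro has_derivative_Pair has_derivative_const has_derivative_ident)
    from dir_deriv_eq[OF has_derivative_compose[OF this smooth_on_has_derivative[OF b UNIV_I]]]
    show ?thesis by (simp add: b'_def[abs_def])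
  qed
  have r0: "row_coeff n r i j (0, 0, 0) = (if i = j then 1 else 0)" if "i < 3" "j < 3" for i j
  proof -
    have "r i j (0, 0, 0) = coeff (monom 1 i) j"
      by (rule rc[OF that(1) _ _ that(2) ft]) (use \<epsilon> n in auto)
    then show ?thesis using that by (auto simp: row_coeff_def)
  qed
  have dbL: "dir_deriv v (b' j) 0 = dir_deriv (0, v) (row_target n K j) (0, 0)" if "j < 3" for v j
  proof -
    have "(\<Sum>i<3. dir_deriv (0, v) (b i) (0, 0) * row_coeff n r i j (0, 0, 0)) = (\<Sum>i<3. if i = j then dir_deriv (0, v) (b i) (0, 0) else 0)"
      using that by (intro sum.cong refl) (simp add: r0)
    then show ?thesis using der[of 0 j v] \<epsilon> that by (simp add: db)
  qed
  have "e' 0 = 0" using zero(1)[of 0] \<epsilon> by (simp add: e'_def)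
  moreover have "0 < \<epsilon> / 2" using \<epsilon> by simp
  ultimately obtain d where d: "d > 0" "\<And>l. norm l < d \<Longrightarrow> \<bar>e' l\<bar> < \<epsilon> / 2"
    using isCont_dist_less[OF smooth_on_isCont[OF sme UNIV_I], of "\<epsilon> / 2"] unfolding dist_norm real_norm_def by auto
  define T where "T w = fst w - e' (snd w)" for w
  define qq where "qq w = 1 + (\<Sum>i<3. b' i (snd w) * q i (T w, e' (snd w), 0, snd w))" for w
  have smT: "smooth T"
    unfolding T_def by (intro smooth_UNIV_intros smooth_on_compose_UNIV[OF open_UNIV sme])
  have smq: "smooth qq"
  proof -
    have "smooth (\<lambda>w. q i (T w, e' (snd w), 0, snd w))" for i
      by (rule smooth_on_compose_UNIV[OF open_UNIV q])
        (intro smooth_on_Pair[OF open_UNIV] smT smooth_on_compose_UNIV[OF open_UNIV sme] smooth_UNIV_intros)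
    moreover have "smooth (\<lambda>w. b' i (snd w))" for i
      by (rule smooth_on_compose_UNIV[OF open_UNIV smb]) (intro smooth_UNIV_intros)
    ultimately show ?thesis unfolding qq_def
      by (intro smooth_on_add[OF open_UNIV] smooth_on_sum[OF open_UNIV] smooth_on_mult[OF open_UNIV] smooth_on_const)
  qed
  have main: "T (X, l) ^ n + (\<Sum>i<3. b' i l * frame \<alpha> i (T (X, l))) = qq (X, l) * Q l X"
    if X: "\<bar>X\<bar> < min (\<epsilon> / 2) d" and l: "norm l < min (\<epsilon> / 2) d" for X l
  proof -
    let ?x = "T (X, l)" and ?s = "e' l"
    have s: "\<bar>?s\<bar> < \<epsilon> / 2" using d(2)[of l] l by simp
    have x: "\<bar>?x\<bar> < \<epsilon>" using X s unfolding T_def fst_conv snd_conv by linarith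
    have "dist (?s, 0 :: real, l) (0, 0, 0) \<le> \<bar>?s\<bar> + norm l"
      using norm_Pair_le[of ?s "(0 :: real, l)"] by (simp add: dist_norm norm_Pair)
    also have "\<dots> < \<epsilon>" using s l by linarith
    finally have dist1: "dist (?s, 0 :: real, l) (0, 0, 0) < \<epsilon>" .
    have dist2: "dist (0 :: real, l) (0, 0) < \<epsilon>"
    proof -
      have "dist (0 :: real, l) (0, 0) = norm l" unfolding dist_Pair_Pair by (simp add: dist_norm)
      then show ?thesis using l norm_ge_zero[of l] by linarith
    qed
    have "?x ^ n + (\<Sum>i<3. b' i l * frame \<alpha> i ?x) = (1 + (\<Sum>i<3. b' i l * q i (?x, ?s, 0, l))) * Q l X"
    proof (rule remainder_vanishes[where q = "\<lambda>i. q i (?x, ?s, 0, l)" and r = "\<lambda>i j. r i j (?s, 0, l)"])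
      show "Q l X = ?x ^ n + (\<Sum>j<n. K j (?s, l) * ?x ^ j)"
        unfolding KQ by (simp add: T_def)
      show "frame \<alpha> i ?x = q i (?x, ?s, 0, l) * Q l X + (\<Sum>j<n. r i j (?s, 0, l) * ?x ^ j)" if "i < 3" for i
        using div[OF that x dist1] unfolding KQ by (simp add: T_def)
      fix j assume j: "j < n"
      consider "j < 2" | "j = 2" "n = 3" | "j = 2" "n = 4" | "j = 3" "n = 4" using n j by force
      then show "(\<Sum>i<3. b' i l * r i j (?s, 0, l)) = K j (?s, l)"
        using rows[OF dist2, of j] rows[OF dist2, of 3]
        by cases (auto simp: row_coeff_def row_target_def b'_def e'_def)
    qed
    then show ?thesis by (simp add: qq_def)
  qed
  have dT: "dir_deriv (1, 0) T (0, 0) = 1"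
  proof -
    have "((\<lambda>w. e' (snd w)) has_derivative (\<lambda>h. dir_deriv (snd h) e' (snd (0 :: real, 0)))) (at (0 :: real, 0))"
    proof -
      have "((\<lambda>w. snd w) has_derivative (\<lambda>h. snd h)) (at (0 :: real, 0 :: R3))"
        by (intro has_derivative_snd has_derivative_ident)
      from has_derivative_compose[OF this smooth_on_has_derivative[OF sme UNIV_I]] show ?thesis .
    qed
    then have "(T has_derivative (\<lambda>h. fst h - dir_deriv (snd h) e' (snd (0 :: real, 0)))) (at (0, 0))"
      unfolding T_def[abs_def] by (intro has_derivative_diff has_derivative_fst has_derivative_ident)
    moreover have "dir_deriv 0 e' 0 = 0"
      using linear_0[OF dir_deriv_linear[OF smooth_differentiable[OF sme]]] .
    ultimately show ?thesis by (simp add: dir_deriv_eq)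
  qed
  show ?thesis
    unfolding normal_form_def
    apply (rule exI[of _ b'], rule exI[of _ T], rule exI[of _ qq], rule exI[of _ "min (\<epsilon> / 2) d"])
    apply (intro conjI allI impI smb smT smq)
    subgoal using \<epsilon> d by simp
    subgoal using zero(2)[of 0] \<epsilon> by (simp add: b'_def)
    subgoal using inj dbL by simp
    subgoal using dbL[of 0] L by simp
    subgoal using dbL[of 1] L by simp
    subgoal using dbL[of 2] L by simp
    subgoal using zero(1)[of 0] \<epsilon> by (simp add: T_def e'_def)
    subgoal using dT by simp
    subgoal using main by simp
    done
qed

text \<open>Each singularity model parametrizes the set of \<open>l\<close> for which its polynomial has a double root:
  at the value of the model at \<open>(u, v)\<close> the double root is \<open>v\<close>.\<close>

definition cusp_poly :: "R3 \<Rightarrow> real \<Rightarrow> real"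
  where "cusp_poly l X = X ^ 3 - 3 * fst (snd l) * X + 2 * snd (snd l)"

definition swallowtail_poly :: "R3 \<Rightarrow> real \<Rightarrow> real"
  where "swallowtail_poly l X = X ^ 4 + fst l * X\<^sup>2 - snd (snd l) * X + fst (snd l)"

definition butterfly_poly :: "R3 \<Rightarrow> real \<Rightarrow> real"
  where "butterfly_poly l X = X ^ 5 + fst l * X\<^sup>2 - fst (snd l) * X + snd (snd l)"

lemma dir_deriv_fst_snd:
  "dir_deriv v (\<lambda>z :: real \<times> R3. fst (snd z)) a = fst (snd v)"
  by (rule dir_deriv_eq) (auto intro!: derivative_eq_intros)

section \<open>The models of order 3 and 4\<close>

lemma normal_form_cusp:
  assumes "\<And>i. smooth (\<alpha> i)"
  shows "normal_form 3 (frame \<alpha>) cusp_poly"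
proof -
  \<comment> \<open>The coefficients in x of the translated model
    \<open>cusp_poly l (x + s)\<close>, with s = \<open>fst z\<close> and l =
    \<open>snd z\<close>.\<close>
  define K :: "nat \<Rightarrow> real \<times> R3 \<Rightarrow> real" where
    "K j = (if j = 0 then (\<lambda>z. fst z ^ 3 - 3 * fst (snd (snd z)) * fst z + 2 * snd (snd (snd z)))
      else if j = 1 then (\<lambda>z. 3 * (fst z)\<^sup>2 - 3 * fst (snd (snd z))) else (\<lambda>z. 3 * fst z))" for j
  have smK: "smooth (K j)" for j
    unfolding K_def by (auto intro!: smooth_UNIV_intros)
  have d0: "dir_deriv v (K 0) (0, 0) = 2 * snd (snd (snd v))" for v
    unfolding K_def by (rule dir_deriv_eq) (auto intro!: derivative_eq_intros)
  have d1: "dir_deriv v (K 1) (0, 0) = - 3 * fst (snd (snd v))" for v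
    unfolding K_def by (rule dir_deriv_eq) (auto intro!: derivative_eq_intros)
  have d2: "dir_deriv v (K 2) (0, 0) = 3 * fst v" for v
    unfolding K_def by (rule dir_deriv_eq) (auto intro!: derivative_eq_intros)
  have rt: "row_target 3 K 0 = K 0" "row_target 3 K 1 = K 1" "row_target 3 K 2 = (\<lambda>z. fst (snd z))"
    by (simp_all add: row_target_def)
  show ?thesis
  proof (rule normal_form_translation[OF _ assms smK])
    show "x ^ 3 + (\<Sum>j<3. K j (s, l) * x ^ j) = cusp_poly l (x + s)" for x s l
      by (simp add: sum_lessThan_3 K_def cusp_poly_def power2_eq_square power3_eq_cube algebra_simps)
    have "dir_deriv (1, 0) (K 2) (0, 0) = 3"
      unfolding d2 by simp
    then show "dir_deriv (1, 0) (K (3 - 1)) (0, 0) \<noteq> 0" by simp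
    show "dir_deriv (1, 0) (row_target 3 K j) (0, 0) = 0" if "j < 3" for j
    proof -
      consider "j = 0" | "j = 1" | "j = 2" using \<open>j < 3\<close> by linarith
      then show ?thesis by cases (simp_all only: rt d0 d1 dir_deriv_fst_snd, simp_all)
    qed
    fix v :: R3
    assume a: "\<And>j. j < 3 \<Longrightarrow> dir_deriv (0, v) (row_target 3 K j) (0, 0) = 0"
    show "v = 0"
      using a[of 0] a[of 1] a[of 2] unfolding rt d0 d1 dir_deriv_fst_snd by (simp add: prod_eq_iff)
  qed (simp_all only: rt d0 d1 d2 dir_deriv_fst_snd, simp_all add: K_def)
qed

lemma normal_form_swallowtail:
  assumes "\<And>i. smooth (\<alpha> i)"
  shows "normal_form 4 (frame \<alpha>) swallowtail_poly"
proof -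
  define K :: "nat \<Rightarrow> real \<times> R3 \<Rightarrow> real" where
    "K j = (if j = 0 then (\<lambda>z. fst z ^ 4 + fst (snd z) * (fst z)\<^sup>2 - snd (snd (snd z)) * fst z + fst (snd (snd z)))
      else if j = 1 then (\<lambda>z. 4 * fst z ^ 3 + 2 * fst (snd z) * fst z - snd (snd (snd z)))
      else if j = 2 then (\<lambda>z. 6 * (fst z)\<^sup>2 + fst (snd z)) else (\<lambda>z. 4 * fst z))" for j
  have smK: "smooth (K j)" for j
    unfolding K_def by (auto intro!: smooth_UNIV_intros)
  have d0: "dir_deriv v (K 0) (0, 0) = fst (snd (snd v))" for v
    unfolding K_def by (rule dir_deriv_eq) (auto intro!: derivative_eq_intros)
  have d1: "dir_deriv v (K 1) (0, 0) = - snd (snd (snd v))" for v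
    unfolding K_def by (rule dir_deriv_eq) (auto intro!: derivative_eq_intros)
  have d2: "dir_deriv v (K 2) (0, 0) = fst (snd v)" for v
    unfolding K_def by (rule dir_deriv_eq) (auto intro!: derivative_eq_intros)
  have d3: "dir_deriv v (K 3) (0, 0) = 4 * fst v" for v
    unfolding K_def by (rule dir_deriv_eq) (auto intro!: derivative_eq_intros)
  have rt: "row_target 4 K 0 = K 0" "row_target 4 K 1 = K 1" "row_target 4 K 2 = K 2"
    by (simp_all add: row_target_def)
  show ?thesis
  proof (rule normal_form_translation[OF _ assms smK])
    show "x ^ 4 + (\<Sum>j<4. K j (s, l) * x ^ j) = swallowtail_poly l (x + s)" for x s l
      by (simp add: lessThan_nat_numeral K_def swallowtail_poly_def power4_eq_xxxx power2_eq_square power3_eq_cube algebra_simps)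
    have "dir_deriv (1, 0) (K 3) (0, 0) = 4"
      unfolding d3 by simp
    then show "dir_deriv (1, 0) (K (4 - 1)) (0, 0) \<noteq> 0" by simp
    show "dir_deriv (1, 0) (row_target 4 K j) (0, 0) = 0" if "j < 3" for j
    proof -
      consider "j = 0" | "j = 1" | "j = 2" using \<open>j < 3\<close> by linarith
      then show ?thesis by cases (simp_all only: rt d0 d1 d2, simp_all)
    qed
    fix v :: R3
    assume a: "\<And>j. j < 3 \<Longrightarrow> dir_deriv (0, v) (row_target 4 K j) (0, 0) = 0"
    show "v = 0"
      using a[of 0] a[of 1] a[of 2] unfolding rt d0 d1 d2 by (simp add: prod_eq_iff)
  qed (simp_all only: rt d0 d1 d2, simp_all add: K_def)
qed

section \<open>The model of order 5: twisting the coordinate on the line\<close>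

definition omega :: "R3 \<Rightarrow> real \<Rightarrow> real"
  where "omega c x = 1 + fst c * x + fst (snd c) * x\<^sup>2 + snd (snd c) * x ^ 3"

text \<open>The frame function after the twist, modulo \<open>x^4\<close>. At this precision the
  perturbation of the frame enters only through its value a at 0, since it carries the factor
  \<open>x^3\<close> and \<omega> is 1 at 0.\<close>

definition jet :: "real \<Rightarrow> R3 \<Rightarrow> nat \<Rightarrow> real poly"
  where "jet a c i = monom 1 i * [:1, fst c, fst (snd c), snd (snd c):] ^ (5 - i) + monom a 3"

lemma coeff_jet:
  "coeff (jet a c 0) 0 = 1" "coeff (jet a c 0) 1 = 5 * fst c" "coeff (jet a c 0) 2 = 5 * fst (snd c) + 10 * (fst c)\<^sup>2"
  "coeff (jet a c 0) 3 = 5 * snd (snd c) + 20 * fst c * fst (snd c) + 10 * fst c ^ 3 + a"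
  "coeff (jet a c 1) 0 = 0" "coeff (jet a c 1) 1 = 1" "coeff (jet a c 1) 2 = 4 * fst c"
  "coeff (jet a c 1) 3 = 4 * fst (snd c) + 6 * (fst c)\<^sup>2 + a"
  "coeff (jet a c 2) 0 = 0" "coeff (jet a c 2) 1 = 0" "coeff (jet a c 2) 2 = 1" "coeff (jet a c 2) 3 = 3 * fst c + a"
proof -
  obtain x y z where c: "c = (x, y, z)" by (cases c)
  let ?p = "[:1, x, y, z:]"
  have p2: "?p ^ 2 = [:1, 2 * x, 2 * y + x\<^sup>2, 2 * z + 2 * x * y, y\<^sup>2 + 2 * x * z, 2 * y * z, z\<^sup>2:]"
    by (simp add: power2_eq_square algebra_simps)
  have p3: "?p ^ 3 = ?p * ?p ^ 2" by (simp add: power3_eq_cube power2_eq_square)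
  have p4: "?p ^ 4 = ?p ^ 2 * ?p ^ 2" by (simp only: power4_eq_xxxx power2_eq_square mult.assoc)
  have p5: "?p ^ 5 = ?p * (?p ^ 2 * ?p ^ 2)" by (simp only: p4[symmetric]) (simp add: eval_nat_numeral)
  show "coeff (jet a c 0) 0 = 1" "coeff (jet a c 0) 1 = 5 * fst c" "coeff (jet a c 0) 2 = 5 * fst (snd c) + 10 * (fst c)\<^sup>2"
    "coeff (jet a c 0) 3 = 5 * snd (snd c) + 20 * fst c * fst (snd c) + 10 * fst c ^ 3 + a"
    unfolding c jet_def coeff_add diff_zero fst_conv snd_conv p5 p2
    by (simp_all add: coeff_monom_mult coeff_pCons power2_eq_square power3_eq_cube algebra_simps numeral_2_eq_2 numeral_3_eq_3)
  show "coeff (jet a c 1) 0 = 0" "coeff (jet a c 1) 1 = 1" "coeff (jet a c 1) 2 = 4 * fst c"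
    "coeff (jet a c 1) 3 = 4 * fst (snd c) + 6 * (fst c)\<^sup>2 + a"
  proof -
    have 5: "5 - 1 = (4 :: nat)" by simp
    show "coeff (jet a c 1) 0 = 0" "coeff (jet a c 1) 1 = 1" "coeff (jet a c 1) 2 = 4 * fst c"
      "coeff (jet a c 1) 3 = 4 * fst (snd c) + 6 * (fst c)\<^sup>2 + a"
      unfolding c jet_def coeff_add 5 fst_conv snd_conv p4 p2
      by (simp_all add: coeff_monom_mult coeff_pCons power2_eq_square algebra_simps numeral_2_eq_2 numeral_3_eq_3)
  qed
  show "coeff (jet a c 2) 0 = 0" "coeff (jet a c 2) 1 = 0" "coeff (jet a c 2) 2 = 1" "coeff (jet a c 2) 3 = 3 * fst c + a"
  proof -
    have 5: "5 - 2 = (3 :: nat)" by simp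
    show "coeff (jet a c 2) 0 = 0" "coeff (jet a c 2) 1 = 0" "coeff (jet a c 2) 2 = 1" "coeff (jet a c 2) 3 = 3 * fst c + a"
      unfolding c jet_def coeff_add 5 fst_conv snd_conv p3 p2
      by (simp_all add: coeff_monom_mult coeff_pCons power2_eq_square algebra_simps numeral_2_eq_2 numeral_3_eq_3)
  qed
qed

lemma poly_jet: "poly (jet a c i) x = x ^ i * omega c x ^ (5 - i) + a * x ^ 3"
  by (simp add: jet_def poly_monom omega_def power2_eq_square power3_eq_cube algebra_simps)

lemma smooth_omega: "smooth (\<lambda>w :: real \<times> R3. omega (snd w) (fst w))"
  unfolding omega_def by (intro smooth_UNIV_intros)

text \<open>The frame after the substitution \<open>x \<mapsto> x / \<omega>(x)\<close> and multiplication by \<open>\<omega>\<^sup>5\<close>; here \<open>\<rho>\<close>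
  stands for \<open>1 / \<omega>\<close>.\<close>

definition twisted_frame :: "(nat \<Rightarrow> real \<Rightarrow> real) \<Rightarrow> (real \<times> R3 \<Rightarrow> real) \<Rightarrow> nat \<Rightarrow> real \<times> R3 \<Rightarrow> real"
  where "twisted_frame \<alpha> \<rho> i w = fst w ^ i * omega (snd w) (fst w) ^ (5 - i) +
    fst w ^ 3 * (omega (snd w) (fst w)) \<^sup>2 * \<alpha> i (fst w * \<rho> w)"

lemma smooth_twisted_frame:
  assumes "smooth (\<alpha> i)" "smooth \<rho>"
  shows "smooth (twisted_frame \<alpha> \<rho> i)"
  unfolding twisted_frame_def[abs_def]
  by (intro smooth_on_add[OF open_UNIV] smooth_on_mult[OF open_UNIV] smooth_on_power[OF open_UNIV] smooth_omega
      smooth_on_compose_UNIV[OF open_UNIV assms(1)] assms(2) smooth_on_fst[OF open_UNIV] smooth_on_id[OF open_UNIV])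

lemma twisted_frame_jet:
  assumes \<alpha>: "smooth (\<alpha> i)" and \<rho>: "smooth \<rho>"
  shows "\<exists>\<delta>>0. \<exists>C. \<forall>x. \<bar>x\<bar> < \<delta> \<longrightarrow> \<bar>twisted_frame \<alpha> \<rho> i (x, c) - poly (jet (\<alpha> i 0) c i) x\<bar> \<le> C * \<bar>x\<bar> ^ 4"
proof -
  define g where "g x = (omega c x)\<^sup>2 * \<alpha> i (x * \<rho> (x, c))" for x
  have "smooth (\<lambda>x. omega c x)" unfolding omega_def by (intro smooth_UNIV_intros)
  moreover have "smooth (\<lambda>x. \<rho> (x, c))" by (rule smooth_on_compose_UNIV[OF open_UNIV \<rho>]) (intro smooth_UNIV_intros)
  ultimately have "smooth g"
    unfolding g_def[abs_def]
    by (intro smooth_on_mult[OF open_UNIV] smooth_on_power[OF open_UNIV] smooth_on_compose_UNIV[OF open_UNIV \<alpha>] smooth_on_id[OF open_UNIV])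
  then have "\<exists>h. smooth h \<and> (\<forall>x. g x = g 0 + x * h x)" by (rule smooth_divide_id) blast
  then obtain h where h: "smooth h" "\<And>x. g x = g 0 + x * h x" by blast
  obtain D where D: "\<And>x. norm x \<le> 1 \<Longrightarrow> norm (h x) \<le> D" using smooth_bounded[OF h(1)] by metis
  have "\<bar>twisted_frame \<alpha> \<rho> i (x, c) - poly (jet (\<alpha> i 0) c i) x\<bar> \<le> D * \<bar>x\<bar> ^ 4" if "\<bar>x\<bar> < 1" for x
  proof -
    have "twisted_frame \<alpha> \<rho> i (x, c) - poly (jet (\<alpha> i 0) c i) x = x ^ 3 * (g x - g 0)"
      by (simp add: twisted_frame_def poly_jet g_def algebra_simps) (simp add: omega_def)
    also have "\<dots> = h x * x ^ 4" using h(2)[of x] by (simp add: eval_nat_numeral)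
    finally show ?thesis using mult_right_mono[OF D[of x], of "\<bar>x\<bar> ^ 4"] that by (simp add: abs_mult power_abs)
  qed
  then show ?thesis by (intro exI[of _ 1]) auto
qed

text \<open>As \<rho> \<omega> = 1, multiplication by \<rho>^5 turns x^i \<omega>^(5 - i) into (x
  \<rho>)^i and x^3 \<omega>^2 into (x \<rho>)^3. This is the origin of the exponents 5 - i and 2 in
  \<open>twisted_frame\<close>.\<close>

lemma twisted_frame_eq:
  assumes "omega c x * \<rho> (x, c) = 1" "i < 3"
  shows "\<rho> (x, c) ^ 5 * twisted_frame \<alpha> \<rho> i (x, c) = frame \<alpha> i (x * \<rho> (x, c))"
proof -
  let ?w = "omega c x" and ?r = "\<rho> (x, c)"
  have 1: "?r ^ 5 * ?w ^ 2 = ?r ^ 3" 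
  proof -
    have "?r ^ 5 * ?w ^ 2 = ?r ^ 3 * (?w * ?r) ^ 2" by (simp add: power_mult_distrib eval_nat_numeral)
    then show ?thesis using assms by simp
  qed
  have "?r ^ 5 * ?w ^ (5 - i) = ?r ^ i"
  proof -
    have "?r ^ 5 = ?r ^ i * ?r ^ (5 - i)" using assms(2) by (simp flip: power_add)
    then have "?r ^ 5 * ?w ^ (5 - i) = ?r ^ i * (?w * ?r) ^ (5 - i)" by (simp add: power_mult_distrib)
    then show ?thesis using assms by simp
  qed
  then have 2: "?r ^ 5 * (x ^ i * ?w ^ (5 - i)) = (x * ?r) ^ i" by (simp add: power_mult_distrib mult_ac)
  have "?r ^ 5 * (x ^ 3 * ?w ^ 2 * \<alpha> i (x * ?r)) = (?r ^ 5 * ?w ^ 2) * x ^ 3 * \<alpha> i (x * ?r)" by simp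
  also have "\<dots> = (x * ?r) ^ 3 * \<alpha> i (x * ?r)" unfolding 1 by (simp add: power_mult_distrib)
  finally show ?thesis using 2 by (simp add: twisted_frame_def frame_def distrib_left)
qed

lemma dist_Pair_le: "dist (a, b) (c, d) \<le> dist a c + dist b d"
  by (simp add: dist_Pair_Pair sqrt_sum_squares_le_sum)

lemma Basis_R3: "(Basis :: R3 set) = {(1, 0, 0), (0, 1, 0), (0, 0, 1)}"
  by (auto simp: Basis_prod_def zero_prod_def)

lemma Hadamard_ex:
  fixes f :: "'p::euclidean_space \<times> 'l::euclidean_space \<Rightarrow> real"
  assumes "smooth f" "\<And>p. f (p, 0) = 0"
  shows "\<exists>E. (\<forall>b. smooth (E b)) \<and> (\<forall>p l. f (p, l) = (\<Sum>b\<in>Basis. (l \<bullet> b) * E b (p, l))) \<and>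
    (\<forall>b p. E b (p, 0) = dir_deriv (0, b) f (p, 0))"
  by (rule Hadamard[OF assms]) blast

text \<open>The coefficients \<open>c\<close> of \<open>\<omega>\<close> are spent on the row of \<open>x\<^sup>3\<close>. Its residual vanishes at \<open>l = 0\<close>, so by
  Hadamard it is a combination of the coordinates of \<open>l\<close>; the three coefficients form a triangular
  system for \<open>c\<close>, with slopes \<open>3\<close>, \<open>-4\<close> and \<open>5\<close>.\<close>

lemma normal_form_butterfly:
  assumes \<alpha>: "\<And>i. smooth (\<alpha> i)"
  shows "normal_form 5 (frame \<alpha>) butterfly_poly"
proof -
  \<comment> \<open>The base value of c makes the \<open>x^3\<close> coefficients of the three jets
    vanish: the jet with i = 2 gives c1, then i = 1 gives c2, and i = 0 gives c3.\<close>
  define c1 where "c1 = - \<alpha> 2 0 / 3"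
  define c2 where "c2 = - (6 * c1\<^sup>2 + \<alpha> 1 0) / 4"
  define c3 where "c3 = - (20 * c1 * c2 + 10 * c1 ^ 3 + \<alpha> 0 0) / 5"
  define cs :: R3 where "cs = (c1, c2, c3)"
  define S where "S = {w :: real \<times> R3. omega (snd w) (fst w) \<noteq> 0}"
  have "open S" unfolding S_def omega_def by (intro open_Collect_neq continuous_intros)
  moreover have "(0, cs) \<in> S" by (simp add: S_def omega_def)
  moreover have "smooth_on S (\<lambda>w. inverse (omega (snd w) (fst w)))"
    by (rule smooth_on_inverse[OF \<open>open S\<close> smooth_on_subset[OF smooth_omega]]) (auto simp: S_def)
  ultimately obtain \<rho> d where \<rho>: "smooth \<rho>" and d: "d > 0"
    and \<rho>S: "\<And>w. dist w (0, cs) < d \<Longrightarrow> w \<in> S \<and> \<rho> w = inverse (omega (snd w) (fst w))"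
    using smooth_extension[of S "(0, cs)"] by blast
  have \<rho>1: "omega c x * \<rho> (x, c) = 1" if "dist (x, c) (0, cs) < d" for x c
    using \<rho>S[OF that] by (simp add: S_def)
  \<comment> \<open>The coefficients of \<open>butterfly_poly l (x + s)\<close>. That of
    \<open>x^3\<close> is 10 s^2: it contains no l and is quadratic in the translation.\<close>
  define K :: "nat \<Rightarrow> real \<times> R3 \<Rightarrow> real" where
    "K j = (if j = 0 then (\<lambda>z. fst z ^ 5 + fst (snd z) * (fst z)\<^sup>2 - fst (snd (snd z)) * fst z + snd (snd (snd z)))
      else if j = 1 then (\<lambda>z. 5 * fst z ^ 4 + 2 * fst (snd z) * fst z - fst (snd (snd z)))
      else if j = 2 then (\<lambda>z. 10 * fst z ^ 3 + fst (snd z))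
      else if j = 3 then (\<lambda>z. 10 * (fst z)\<^sup>2) else (\<lambda>z. 5 * fst z))" for j
  have smK: "smooth (K j)" for j
    unfolding K_def by (auto intro!: smooth_UNIV_intros)
  have K0: "K j (0, 0) = 0" for j by (simp add: K_def)
  have d0: "dir_deriv v (K 0) (0, 0) = snd (snd (snd v))" for v
    unfolding K_def by (rule dir_deriv_eq) (auto intro!: derivative_eq_intros)
  have d1: "dir_deriv v (K 1) (0, 0) = - fst (snd (snd v))" for v
    unfolding K_def by (rule dir_deriv_eq) (auto intro!: derivative_eq_intros)
  have d2: "dir_deriv v (K 2) (0, 0) = fst (snd v)" for v
    unfolding K_def by (rule dir_deriv_eq) (auto intro!: derivative_eq_intros)
  have d4: "dir_deriv v (K 4) (0, 0) = 5 * fst v" for v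
    unfolding K_def by (rule dir_deriv_eq) (auto intro!: derivative_eq_intros)
  have rt: "row_target 5 K 0 = K 0" "row_target 5 K 1 = K 1" "row_target 5 K 2 = K 2" "row_target 5 K 3 = K 4"
    by (simp_all add: row_target_def)
  have row: "row_coeff 5 r i 0 = r i 0" "row_coeff 5 r i 1 = r i 1" "row_coeff 5 r i 2 = r i 2" "row_coeff 5 r i 3 = r i 4"
    for i and r :: "nat \<Rightarrow> nat \<Rightarrow> real \<times> R3 \<times> R3 \<Rightarrow> real" by (simp_all add: row_coeff_def)
  have KQ: "x ^ 5 + (\<Sum>j<5. K j (s, l) * x ^ j) = butterfly_poly l (x + s)" for x s l
    by (simp add: lessThan_nat_numeral K_def butterfly_poly_def eval_nat_numeral algebra_simps)
  have Ke1: "dir_deriv (1, 0) (row_target 5 K j) (0, 0) = 0" if "j < 3" for j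
  proof -
    consider "j = 0" | "j = 1" | "j = 2" using \<open>j < 3\<close> by linarith
    then show ?thesis by cases (simp_all only: rt d0 d1 d2, simp_all)
  qed
  have "dir_deriv (1, 0) (K 4) (0, 0) = 5" unfolding d4 by simp
  then have Ke2: "dir_deriv (1, 0) (K (5 - 1)) (0, 0) \<noteq> 0" by simp
  define f where "f = twisted_frame \<alpha> \<rho>"
  define J where "J i c = jet (\<alpha> i 0) c i" for i c
  have smf: "smooth (f i)" for i unfolding f_def by (rule smooth_twisted_frame[OF \<alpha> \<rho>])
  have ft4: "\<exists>\<delta>>0. \<exists>C. \<forall>x. \<bar>x\<bar> < \<delta> \<longrightarrow> \<bar>f i (x, c) - poly (J i c) x\<bar> \<le> C * \<bar>x\<bar> ^ 4" for i c
    unfolding f_def J_def by (rule twisted_frame_jet[where \<alpha> = \<alpha> and i = i, OF \<alpha> \<rho>])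
  have ft3: "\<exists>\<delta>>0. \<exists>C. \<forall>x. \<bar>x\<bar> < \<delta> \<longrightarrow> \<bar>f i (x, c) - poly (J i c) x\<bar> \<le> C * \<bar>x\<bar> ^ 3" for i c
  proof -
    obtain \<delta> C where \<delta>: "\<delta> > 0" "\<And>x. \<bar>x\<bar> < \<delta> \<Longrightarrow> \<bar>f i (x, c) - poly (J i c) x\<bar> \<le> C * \<bar>x\<bar> ^ 4" using ft4[of i c] by blast
    have "\<bar>f i (x, c) - poly (J i c) x\<bar> \<le> \<bar>C\<bar> * \<bar>x\<bar> ^ 3" if "\<bar>x\<bar> < min \<delta> 1" for x
    proof -
      have "C * \<bar>x\<bar> ^ 4 \<le> \<bar>C\<bar> * \<bar>x\<bar> ^ 3"
        by (rule mult_mono) (use that power_decreasing[of 3 4 "\<bar>x\<bar>"] in auto)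
      then show ?thesis using \<delta>(2)[of x] that by simp
    qed
    then show ?thesis using \<delta>(1) by (intro exI[of _ "min \<delta> 1"]) auto
  qed
  have tri: "coeff (J i c) i = 1" "j < i \<Longrightarrow> coeff (J i c) j = 0" if "i < 3" for i j c
  proof -
    consider "i = 0" | "i = 1" | "i = 2" using \<open>i < 3\<close> by linarith
    then show "coeff (J i c) i = 1" by cases (simp_all only: J_def coeff_jet)
    assume "j < i"
    then consider "i = 1" "j = 0" | "i = 2" "j = 0" | "i = 2" "j = 1" using \<open>i < 3\<close> by linarith
    then show "coeff (J i c) j = 0" by cases (simp_all only: J_def coeff_jet)
  qed
  have n: "(5 :: nat) \<in> {3, 4, 5}" by simp
  obtain q r b e \<epsilon> where sol: "row_solution 5 f K cs q r b e \<epsilon>"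
    using core_rows[of 5 f K cs "\<lambda>i. J i cs", OF n smf smK K0 Ke1 Ke2 ft3 tri] by blast
  note q = row_solutionD(1)[OF sol] and r = row_solutionD(2)[OF sol] and b = row_solutionD(3)[OF sol]
    and e = row_solutionD(4)[OF sol] and \<epsilon> = row_solutionD(5)[OF sol] and div = row_solutionD(6)[OF sol]
    and rows = row_solutionD(7)[OF sol] and zero = row_solutionD(8,9)[OF sol] and der = row_solutionD(10)[OF sol]
    and rc = row_solutionD(11)[OF sol]
  have r0: "r i j (0, c, 0) = coeff (J i c) j" if "dist c cs < \<epsilon>" "i < 3" "j < 4" for i j c
    by (rule rc[OF that(2,1) _ that(3) ft4]) simp
  have rJ: "r 0 0 (0, c, 0) = 1" "r 0 1 (0, c, 0) = 5 * fst c" "r 0 2 (0, c, 0) = 5 * fst (snd c) + 10 * (fst c)\<^sup>2"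
    "r 0 3 (0, c, 0) = 5 * snd (snd c) + 20 * fst c * fst (snd c) + 10 * fst c ^ 3 + \<alpha> 0 0"
    "r 1 0 (0, c, 0) = 0" "r 1 1 (0, c, 0) = 1" "r 1 2 (0, c, 0) = 4 * fst c"
    "r 1 3 (0, c, 0) = 4 * fst (snd c) + 6 * (fst c)\<^sup>2 + \<alpha> 1 0"
    "r 2 0 (0, c, 0) = 0" "r 2 1 (0, c, 0) = 0" "r 2 2 (0, c, 0) = 1" "r 2 3 (0, c, 0) = 3 * fst c + \<alpha> 2 0"
    if "dist c cs < \<epsilon>" for c
    by (subst r0[OF that], simp, simp, simp only: J_def coeff_jet)+
  \<comment> \<open>The derivatives of b 0, b 1, b 2 along v at (c, 0), found by forward
    substitution: the rows 0, 1, 2 are unitriangular there, with right sides v3, -v2, v1 for v =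
    (v1, v2, v3).\<close>
  define B where "B i v c = (if i = 0 then snd (snd v) else if i = 1 then - fst (snd v) - snd (snd v) * (5 * fst c)
     else fst v - snd (snd v) * (5 * fst (snd c) + 10 * (fst c)\<^sup>2)
       + (fst (snd v) + snd (snd v) * (5 * fst c)) * (4 * fst c))" for i :: nat and v c :: R3
  have db: "dir_deriv (0, v) (b 0) (c, 0) = B 0 v c" "dir_deriv (0, v) (b 1) (c, 0) = B 1 v c"
    "dir_deriv (0, v) (b 2) (c, 0) = B 2 v c" if c: "dist c cs < \<epsilon>" for c v
  proof -
    let ?d = "\<lambda>i. dir_deriv (0, v) (b i) (c, 0)"
    have e0: "?d 0 = snd (snd v)" using der[OF c, of 0 v] unfolding rt d0 row sum_lessThan_3 rJ[OF c] by simp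
    then show "?d 0 = B 0 v c" by (simp add: B_def)
    have "?d 0 * (5 * fst c) + ?d 1 = - fst (snd v)" using der[OF c, of 1 v] unfolding rt d1 row sum_lessThan_3 rJ[OF c] by simp
    then have e1: "?d 1 = - fst (snd v) - snd (snd v) * (5 * fst c)" unfolding e0 by linarith
    then show "?d 1 = B 1 v c" by (simp add: B_def)
    have "?d 0 * (5 * fst (snd c) + 10 * (fst c)\<^sup>2) + ?d 1 * (4 * fst c) + ?d 2 = fst v"
      using der[OF c, of 2 v] unfolding rt d2 row sum_lessThan_3 rJ[OF c] by simp
    then have "?d 2 = fst v - snd (snd v) * (5 * fst (snd c) + 10 * (fst c)\<^sup>2)
      - (- fst (snd v) - snd (snd v) * (5 * fst c)) * (4 * fst c)" unfolding e0 e1 by linarith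
    then show "?d 2 = B 2 v c" unfolding B_def by (simp add: algebra_simps)
  qed
  \<comment> \<open>The residual of the row of \<open>x^3\<close>, whose target is 10 times the
    square of the translation.\<close>
  define g where "g w = (\<Sum>i<3. b i w * r i 3 (e w, w)) - e w * (10 * e w)" for w
  have smr: "smooth (\<lambda>w. r i j (e w, w))" for i j
    by (rule smooth_on_compose_UNIV[OF open_UNIV r]) (intro smooth_UNIV_intros e)
  have smg: "smooth g"
    unfolding g_def[abs_def] by (intro smooth_UNIV_intros b e smr)
  \<comment> \<open>The residual is known to vanish at l = 0 only for c near the base value, while
    Hadamard's lemma asks for it globally. Near the base value the subtraction changes
    nothing.\<close>
  define G where "G w = g w - g (fst w, 0)" for w
  have smg0: "smooth (\<lambda>w :: R3 \<times> R3. g (fst w, 0))"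
    by (rule smooth_on_compose_UNIV[OF open_UNIV smg]) (intro smooth_UNIV_intros)
  have smG: "smooth G"
    unfolding G_def[abs_def] by (intro smooth_on_diff[OF open_UNIV] smg smg0)
  have "G (c, 0) = 0" for c by (simp add: G_def)
  from Hadamard_ex[OF smG this]
  obtain E where E: "\<And>v. smooth (E v)" "\<And>c l. G (c, l) = (\<Sum>v\<in>Basis. (l \<bullet> v) * E v (c, l))"
    "\<And>v c. E v (c, 0) = dir_deriv (0, v) G (c, 0)" by blast
  define P where "P v c = (5 * snd (snd c) + 20 * fst c * fst (snd c) + 10 * fst c ^ 3 + \<alpha> 0 0) * B 0 v c
    + (4 * fst (snd c) + 6 * (fst c)\<^sup>2 + \<alpha> 1 0) * B 1 v c + (3 * fst c + \<alpha> 2 0) * B 2 v c" for v c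
  have EP: "E v (c, 0) = P v c" if c: "dist c cs < \<epsilon>" for v c
  proof -
    have "(g has_derivative (\<lambda>h. (\<Sum>i<3. dir_deriv h (b i) (c, 0) * r i 3 (e (c, 0), c, 0)) - dir_deriv h e (c, 0) * (10 * e (c, 0)))) (at (c, 0))"
      unfolding g_def[abs_def]
      by (intro has_derivative_diff has_derivative_sum has_derivative_mult_zero smooth_on_has_derivative[OF b] smooth_on_has_derivative[OF e]
          smooth_differentiable[OF smr] smooth_differentiable[OF smooth_on_mult[OF open_UNIV smooth_on_const e]] zero[OF c] UNIV_I) auto
    then have 1: "(g has_derivative (\<lambda>h. \<Sum>i<3. dir_deriv h (b i) (c, 0) * r i 3 (0, c, 0))) (at (c, 0))"
      by (simp add: zero(1)[OF c])
    have "((\<lambda>w :: R3 \<times> R3. (fst w, 0 :: R3)) has_derivative (\<lambda>h. (fst h, 0))) (at (c, 0))"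
      by (intro has_derivative_Pair has_derivative_const has_derivative_fst has_derivative_ident)
    from has_derivative_compose[OF this smooth_on_has_derivative[OF smg UNIV_I]]
    have 2: "((\<lambda>w :: R3 \<times> R3. g (fst w, 0)) has_derivative (\<lambda>h. dir_deriv (fst h, 0) g (c, 0))) (at (c, 0))" by simp
    have "E v (c, 0) = (\<Sum>i<3. dir_deriv (0, v) (b i) (c, 0) * r i 3 (0, c, 0)) - dir_deriv (0, 0) g (c, 0)"
      unfolding E(3) G_def[abs_def] using dir_deriv_eq[OF has_derivative_diff[OF 1 2], of "(0, v)"] by simp
    moreover have "dir_deriv (0, 0) g (c, 0) = 0"
      using linear_0[OF dir_deriv_linear[OF smooth_differentiable[OF smg]]] by (simp add: zero_prod_def)
    ultimately show ?thesis unfolding sum_lessThan_3 db[OF c] rJ[OF c] P_def by simp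
  qed
  \<comment> \<open>In the Hadamard expansion G = \<Sum> l_v E_v the residual vanishes as soon as
    the three coefficients do, which gives three equations for the three components of c. At l = 0
    their left sides are the explicit functions P.\<close>
  define \<Phi> where "\<Phi> w = (E (1, 0, 0) (snd w, fst w), E (0, 1, 0) (snd w, fst w), E (0, 0, 1) (snd w, fst w))" for w
  have sm\<Phi>: "smooth \<Phi>"
  proof -
    have "smooth (\<lambda>w. E v (snd w, fst w))" for v
      by (rule smooth_on_compose_UNIV[OF open_UNIV E(1)]) (intro smooth_UNIV_intros)
    then show ?thesis unfolding \<Phi>_def[abs_def] by (intro smooth_on_Pair[OF open_UNIV])
  qed
  have t0: "3 * c1 + \<alpha> 2 0 = 0" "4 * c2 + 6 * c1\<^sup>2 + \<alpha> 1 0 = 0" "5 * c3 + 20 * c1 * c2 + 10 * c1 ^ 3 + \<alpha> 0 0 = 0"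
  proof -
    show "3 * c1 + \<alpha> 2 0 = 0" by (simp add: c1_def)
    have "4 * c2 = - (6 * c1\<^sup>2 + \<alpha> 1 0)" by (simp add: c2_def)
    then show "4 * c2 + 6 * c1\<^sup>2 + \<alpha> 1 0 = 0" by linarith
    have "5 * c3 = - (20 * c1 * c2 + 10 * c1 ^ 3 + \<alpha> 0 0)" by (simp add: c3_def)
    then show "5 * c3 + 20 * c1 * c2 + 10 * c1 ^ 3 + \<alpha> 0 0 = 0" by linarith
  qed
  have "P v cs = 0" for v using t0 by (simp add: P_def cs_def)
  then have \<Phi>0: "\<Phi> (0, cs) = 0" using EP[of cs] \<epsilon> by (simp add: \<Phi>_def zero_prod_def)
  have inj: "w = 0" if w: "dir_deriv (0, w) \<Phi> (0, cs) = 0" for w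
  proof -
    have "((\<lambda>c :: R3. (0 :: R3, c)) has_derivative (\<lambda>h. (0, h))) (at cs)"
      by (intro has_derivative_Pair has_derivative_const has_derivative_ident)
    from dir_deriv_eq[OF has_derivative_compose[OF this smooth_on_has_derivative[OF sm\<Phi> UNIV_I]]]
    have "dir_deriv w (\<lambda>c. \<Phi> (0, c)) cs = 0" using w by simp
    moreover have "dir_deriv w (\<lambda>c. \<Phi> (0, c)) cs = dir_deriv w (\<lambda>c. (P (1, 0, 0) c, P (0, 1, 0) c, P (0, 0, 1) c)) cs"
      by (rule dir_deriv_cong_open[of "ball cs \<epsilon>"]) (use \<epsilon> in \<open>auto simp: \<Phi>_def EP dist_commute\<close>)
    moreover have dP: "(P v has_derivative (\<lambda>h. (5 * snd (snd h) + 20 * (c1 * fst (snd h) + fst h * c2) + 30 * (fst h * c1\<^sup>2)) * B 0 v cs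
      + (4 * fst (snd h) + 12 * (fst h * c1)) * B 1 v cs + (3 * fst h) * B 2 v cs)) (at cs)" for v
    proof -
      have dB: "B i v differentiable (at cs)" for i
      proof -
        have "smooth (B i v)" unfolding B_def[abs_def]
          by (cases "i = 0"; cases "i = 1"; simp only: if_True if_False simp_thms; intro smooth_UNIV_intros)
        then show ?thesis by (rule smooth_differentiable)
      qed
      have h: "((\<lambda>c :: R3. 5 * snd (snd c) + 20 * fst c * fst (snd c) + 10 * fst c ^ 3 + \<alpha> 0 0) has_derivative
          (\<lambda>h. 5 * snd (snd h) + 20 * (c1 * fst (snd h) + fst h * c2) + 30 * (fst h * c1\<^sup>2))) (at cs)"
        "((\<lambda>c :: R3. 4 * fst (snd c) + 6 * (fst c)\<^sup>2 + \<alpha> 1 0) has_derivative (\<lambda>h. 4 * fst (snd h) + 12 * (fst h * c1))) (at cs)"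
        "((\<lambda>c :: R3. 3 * fst c + \<alpha> 2 0) has_derivative (\<lambda>h. 3 * fst h)) (at cs)"
        by (auto intro!: derivative_eq_intros simp: cs_def algebra_simps power2_eq_square)
      have z: "5 * snd (snd cs) + 20 * fst cs * fst (snd cs) + 10 * fst cs ^ 3 + \<alpha> 0 0 = 0"
        "4 * fst (snd cs) + 6 * (fst cs)\<^sup>2 + \<alpha> 1 0 = 0" "3 * fst cs + \<alpha> 2 0 = 0"
        using t0 by (simp_all add: cs_def)
      show ?thesis unfolding P_def[abs_def]
        by (rule has_derivative_add[OF has_derivative_add[OF has_derivative_mult_zero[OF h(1) dB z(1)]
              has_derivative_mult_zero[OF h(2) dB z(2)]] has_derivative_mult_zero[OF h(3) dB z(3)]])
    qed
    ultimately have z: "dir_deriv w (\<lambda>c. (P (1, 0, 0) c, P (0, 1, 0) c, P (0, 0, 1) c)) cs = 0" by simp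
    have z': "(5 * snd (snd w) + 20 * (c1 * fst (snd w) + fst w * c2) + 30 * (fst w * c1\<^sup>2)) * B 0 v cs
      + (4 * fst (snd w) + 12 * (fst w * c1)) * B 1 v cs + (3 * fst w) * B 2 v cs = 0"
      if "v \<in> {(1, 0, 0), (0, 1, 0), (0, 0, 1)}" for v
      using z that unfolding dir_deriv_eq[OF has_derivative_Pair[OF dP has_derivative_Pair[OF dP dP]]] zero_prod_def by auto
    obtain w1 w2 w3 where w: "w = (w1, w2, w3)" by (cases w)
    have w1: "w1 = 0" using z'[of "(1, 0, 0)"] by (simp add: B_def w)
    have w2: "w2 = 0" using z'[of "(0, 1, 0)"] by (simp add: B_def w w1)
    have "w3 = 0" using z'[of "(0, 0, 1)"] by (simp add: B_def w w1 w2)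
    then show ?thesis using w w1 w2 by (simp add: zero_prod_def)
  qed
  obtain \<phi> \<epsilon>' where \<phi>: "smooth \<phi>" "\<epsilon>' > 0" "\<phi> 0 = cs" "\<And>l. dist l 0 < \<epsilon>' \<Longrightarrow> \<Phi> (l, \<phi> l) = 0"
    using implicit_function_global[OF sm\<Phi> \<Phi>0 inj] by blast
  define b' where "b' i l = b i (\<phi> l, l)" for i l
  define e' where "e' l = e (\<phi> l, l)" for l
  have smb: "smooth (b' i)" for i
    unfolding b'_def by (rule smooth_on_compose_UNIV[OF open_UNIV b]) (intro smooth_UNIV_intros \<phi>(1))
  have sme: "smooth e'"
    unfolding e'_def by (rule smooth_on_compose_UNIV[OF open_UNIV e]) (intro smooth_UNIV_intros \<phi>(1))
  have e'0: "e' 0 = 0" using zero(1)[of cs] \<epsilon> \<phi>(3) by (simp add: e'_def)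
  have b'0: "b' i 0 = 0" if "i < 3" for i using zero(2)[of cs i] \<epsilon> \<phi>(3) that by (simp add: b'_def)
  \<comment> \<open>Although c varies with l through \<phi>, b vanishes at l = 0 for all c near the
    base value; its derivative in c is thus 0, and the derivative in l is all that remains.\<close>
  have dbi: "dir_deriv v (b' i) 0 = dir_deriv (0, v) (b i) (cs, 0)" if i: "i < 3" for i v
  proof -
    have "((\<lambda>l. (\<phi> l, l)) has_derivative (\<lambda>h. (dir_deriv h \<phi> 0, h))) (at 0)"
      by (intro has_derivative_Pair has_derivative_ident smooth_on_has_derivative[OF \<phi>(1) UNIV_I])
    from dir_deriv_eq[OF has_derivative_compose[OF this smooth_on_has_derivative[OF b UNIV_I]]]
    have 1: "dir_deriv v (b' i) 0 = dir_deriv (dir_deriv v \<phi> 0, v) (b i) (cs, 0)"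
      by (simp add: b'_def[abs_def] \<phi>(3))
    have 2: "dir_deriv (w, 0) (b i) (cs, 0) = 0" for w
    proof -
      have "((\<lambda>c. (c, 0 :: R3)) has_derivative (\<lambda>h. (h, 0))) (at cs)"
        by (intro has_derivative_Pair has_derivative_ident has_derivative_const)
      from dir_deriv_eq[OF has_derivative_compose[OF this smooth_on_has_derivative[OF b UNIV_I]]]
      have "dir_deriv (w, 0) (b i) (cs, 0) = dir_deriv w (\<lambda>c. b i (c, 0)) cs" by simp
      also have "\<dots> = dir_deriv w (\<lambda>c. 0) cs"
        by (rule dir_deriv_cong_open[of "ball cs \<epsilon>"]) (use \<epsilon> zero(2)[OF _ i] in \<open>auto simp: dist_commute\<close>)
      also have "\<dots> = 0" by (rule dir_deriv_eq) (rule has_derivative_const)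
      finally show ?thesis .
    qed
    have "dir_deriv (u, v) (b i) (cs, 0) = dir_deriv (u, 0) (b i) (cs, 0) + dir_deriv (0, v) (b i) (cs, 0)" for u
      using linear_add[OF dir_deriv_linear[OF smooth_differentiable[OF b]], of "(u, 0)" "(0, v)"] by simp
    then show ?thesis using 1 2 by simp
  qed
  have dbv: "dir_deriv v (b' 0) 0 = B 0 v cs" "dir_deriv v (b' 1) 0 = B 1 v cs" "dir_deriv v (b' 2) 0 = B 2 v cs" for v
    using dbi[of 0 v] dbi[of 1 v] dbi[of 2 v] db[of cs v] \<epsilon> by simp_all
  \<comment> \<open>The sizes of X, e', l and the distance of \<phi> l to the base value will each
    be below \<eta>. The distances to be controlled are sums of at most three of them.\<close>
  define \<eta> where "\<eta> = min \<epsilon> d / 4"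
  have \<eta>: "\<eta> > 0" "4 * \<eta> \<le> \<epsilon>" "4 * \<eta> \<le> d" using \<epsilon> d by (auto simp: \<eta>_def)
  obtain d1 where d1: "d1 > 0" "\<And>l. norm l < d1 \<Longrightarrow> \<bar>e' l\<bar> < \<eta>"
    using isCont_dist_less[OF smooth_on_isCont[OF sme UNIV_I] \<eta>(1)] by (auto simp: e'0)
  obtain d2 where d2: "d2 > 0" "\<And>l. norm l < d2 \<Longrightarrow> dist (\<phi> l) cs < \<eta>"
    using isCont_dist_less[OF smooth_on_isCont[OF \<phi>(1) UNIV_I] \<eta>(1)] unfolding \<phi>(3) by blast
  define D where "D = min (min \<epsilon>' \<eta>) (min d1 d2)"
  have D: "D > 0" "D \<le> \<epsilon>'" "D \<le> \<eta>" "D \<le> d1" "D \<le> d2" using \<phi>(2) \<eta> d1 d2 by (auto simp: D_def)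
  have row3: "(\<Sum>i<3. b' i l * r i 3 (e' l, \<phi> l, l)) = K 3 (e' l, l)" if l: "norm l < D" for l
  proof -
    have c: "dist (\<phi> l) cs < \<epsilon>" using d2(2)[of l] l D \<eta> by linarith
    have "\<Phi> (l, \<phi> l) = 0" by (rule \<phi>(4)) (use l D in simp)
    then have "E v (\<phi> l, l) = 0" if "v \<in> Basis" for v
      using that unfolding Basis_R3 by (auto simp: \<Phi>_def zero_prod_def)
    then have "G (\<phi> l, l) = 0" unfolding E(2) by simp
    moreover have "g (\<phi> l, 0) = 0" using zero[OF c] by (simp add: g_def)
    ultimately have "g (\<phi> l, l) = 0" by (simp add: G_def)
    then show ?thesis by (simp add: g_def b'_def e'_def K_def power2_eq_square)
  qed
  \<comment> \<open>Both substitutions in turn: X - e' is the translated variable and the factor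
    \<rho> divides it by \<omega>. The fifth power of \<rho> in \<open>qq\<close> reverses the
    multiplication of the frame by \<omega>^5.\<close>
  define T where "T w = (fst w - e' (snd w)) * \<rho> (fst w - e' (snd w), \<phi> (snd w))" for w
  define qq where "qq w = \<rho> (fst w - e' (snd w), \<phi> (snd w)) ^ 5 *
    (1 + (\<Sum>i<3. b' i (snd w) * q i (fst w - e' (snd w), e' (snd w), \<phi> (snd w), snd w)))" for w
  have smx: "smooth (\<lambda>w :: real \<times> R3. fst w - e' (snd w))"
    by (intro smooth_UNIV_intros smooth_on_compose_UNIV[OF open_UNIV sme])
  have sm\<phi>: "smooth (\<lambda>w :: real \<times> R3. \<phi> (snd w))"
    by (intro smooth_UNIV_intros smooth_on_compose_UNIV[OF open_UNIV \<phi>(1)])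
  have sm\<rho>: "smooth (\<lambda>w. \<rho> (fst w - e' (snd w), \<phi> (snd w)))"
    by (intro smooth_on_compose_UNIV[OF open_UNIV \<rho>] smooth_on_Pair[OF open_UNIV] smx sm\<phi>)
  have smT: "smooth T" unfolding T_def[abs_def] by (intro smooth_on_mult[OF open_UNIV] smx sm\<rho>)
  have smq: "smooth qq"
  proof -
    have "smooth (\<lambda>w. q i (fst w - e' (snd w), e' (snd w), \<phi> (snd w), snd w))" for i
      by (rule smooth_on_compose_UNIV[OF open_UNIV q])
        (intro smooth_on_Pair[OF open_UNIV] smx sm\<phi> smooth_on_compose_UNIV[OF open_UNIV sme] smooth_UNIV_intros)
    moreover have "smooth (\<lambda>w. b' i (snd w))" for i
      by (rule smooth_on_compose_UNIV[OF open_UNIV smb]) (intro smooth_UNIV_intros)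
    ultimately show ?thesis unfolding qq_def[abs_def]
      by (intro smooth_on_add[OF open_UNIV] smooth_on_sum[OF open_UNIV] smooth_on_mult[OF open_UNIV]
          smooth_on_power[OF open_UNIV] sm\<rho> smooth_on_const)
  qed
  have main: "T (X, l) ^ 5 + (\<Sum>i<3. b' i l * frame \<alpha> i (T (X, l))) = qq (X, l) * butterfly_poly l X"
    if X: "\<bar>X\<bar> < D" and l: "norm l < D" for X l
  proof -
    let ?s = "e' l" and ?c = "\<phi> l"
    let ?x = "X - ?s"
    let ?r = "\<rho> (?x, ?c)"
    have s: "\<bar>?s\<bar> < \<eta>" using d1(2)[of l] l D by simp
    have c: "dist ?c cs < \<eta>" using d2(2)[of l] l D by simp
    have x: "\<bar>?x\<bar> < 2 * \<eta>" using X s D by linarith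
    have l0: "dist l 0 < \<eta>" using l D by simp
    have dist2: "dist (?c, l) (cs, 0) < 2 * \<eta>" using dist_Pair_le[of ?c l cs 0] c l0 by linarith
    have dist1: "dist (?s, ?c, l) (0, cs, 0) < \<epsilon>"
      using dist_Pair_le[of ?s "(?c, l)" 0 "(cs, 0)"] dist2 s \<eta> by (simp add: dist_real_def)
    have dist3: "dist (?x, ?c) (0, cs) < d"
      using dist_Pair_le[of ?x ?c 0 cs] c x \<eta> by (simp add: dist_real_def)
    have x': "\<bar>?x\<bar> < \<epsilon>" using x \<eta> by linarith
    have dist2': "dist (?c, l) (cs, 0) < \<epsilon>" using dist2 \<eta> by linarith
    have P: "butterfly_poly l X = ?x ^ 5 + (\<Sum>j<5. K j (?s, l) * ?x ^ j)" unfolding KQ by simp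
    have "?x ^ 5 + (\<Sum>i<3. b' i l * f i (?x, ?c)) = (1 + (\<Sum>i<3. b' i l * q i (?x, ?s, ?c, l))) * butterfly_poly l X"
    proof (rule remainder_vanishes[where q = "\<lambda>i. q i (?x, ?s, ?c, l)" and r = "\<lambda>i j. r i j (?s, ?c, l)", OF _ P])
      show "f i (?x, ?c) = q i (?x, ?s, ?c, l) * butterfly_poly l X + (\<Sum>j<5. r i j (?s, ?c, l) * ?x ^ j)" if "i < 3" for i
        using div[OF that x' dist1] unfolding P .
      fix j :: nat assume j: "j < 5"
      consider "j = 0" | "j = 1" | "j = 2" | "j = 3" | "j = 4" using j by linarith
      then show "(\<Sum>i<3. b' i l * r i j (?s, ?c, l)) = K j (?s, l)"
      proof cases
        case 1 then show ?thesis using rows[OF dist2', of 0] unfolding rt row by (simp add: b'_def e'_def)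
      next
        case 2 then show ?thesis using rows[OF dist2', of 1] unfolding rt row by (simp add: b'_def e'_def)
      next
        case 3 then show ?thesis using rows[OF dist2', of 2] unfolding rt row by (simp add: b'_def e'_def)
      next
        case 4 then show ?thesis using row3[OF l] by simp
      next
        case 5 then show ?thesis using rows[OF dist2', of 3] unfolding rt row by (simp add: b'_def e'_def)
      qed
    qed
    then have "?r ^ 5 * (?x ^ 5 + (\<Sum>i<3. b' i l * f i (?x, ?c))) = qq (X, l) * butterfly_poly l X"
      by (simp add: qq_def)
    moreover have "?r ^ 5 * (\<Sum>i<3. b' i l * f i (?x, ?c)) = (\<Sum>i<3. b' i l * frame \<alpha> i (T (X, l)))"
      unfolding sum_distrib_left
    proof (rule sum.cong[OF refl])
      fix i :: nat assume "i \<in> {..<3}"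
      then have "?r ^ 5 * f i (?x, ?c) = frame \<alpha> i (T (X, l))"
        using twisted_frame_eq[where \<rho> = \<rho> and \<alpha> = \<alpha> and i = i, OF \<rho>1[OF dist3]] by (simp add: f_def T_def)
      then show "?r ^ 5 * (b' i l * f i (?x, ?c)) = b' i l * frame \<alpha> i (T (X, l))" by (simp add: mult.left_commute)
    qed
    moreover have "?r ^ 5 * ?x ^ 5 = T (X, l) ^ 5" by (simp add: T_def power_mult_distrib)
    ultimately show ?thesis by (simp add: distrib_left)
  qed
  have \<rho>0: "\<rho> (0, cs) = 1" using \<rho>1[of 0 cs] d by (simp add: omega_def)
  have dT: "dir_deriv (1, 0) T (0, 0) = 1"
  proof -
    have "((\<lambda>w :: real \<times> R3. snd w) has_derivative (\<lambda>h. snd h)) (at (0, 0))"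
      by (intro has_derivative_snd has_derivative_ident)
    from has_derivative_compose[OF this smooth_on_has_derivative[OF sme UNIV_I]]
    have "((\<lambda>w :: real \<times> R3. fst w - e' (snd w)) has_derivative (\<lambda>h. fst h - dir_deriv (snd h) e' 0)) (at (0, 0))"
      by (intro has_derivative_diff has_derivative_fst has_derivative_ident) simp
    from dir_deriv_eq[OF has_derivative_mult_zero[OF this smooth_differentiable[OF sm\<rho>]], of "(1, 0)"]
    have "dir_deriv (1, 0) T (0, 0) = 1 - dir_deriv 0 e' 0" unfolding T_def[abs_def] by (simp add: e'0 \<phi>(3) \<rho>0)
    moreover have "dir_deriv 0 e' 0 = 0"
      using linear_0[OF dir_deriv_linear[OF smooth_differentiable[OF sme]]] .
    ultimately show ?thesis by simp
  qed
  have injb: "v = 0" if "\<forall>i<3. dir_deriv v (b' i) 0 = 0" for v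
  proof -
    have z: "B 0 v cs = 0" "B 1 v cs = 0" "B 2 v cs = 0" using that dbv[of v] by auto
    obtain v1 v2 v3 where v: "v = (v1, v2, v3)" by (cases v)
    have 3: "v3 = 0" using z(1) by (simp add: B_def v)
    have 2: "v2 = 0" using z(2) by (simp add: B_def v 3)
    have "v1 = 0" using z(3) by (simp add: B_def v 2 3)
    then show ?thesis using v 2 3 by (simp add: zero_prod_def)
  qed
  have L: "dir_deriv (1, 0, 0) (b' 0) 0 = 0" "dir_deriv (1, 0, 0) (b' 1) 0 = 0" "dir_deriv (1, 0, 0) (b' 2) 0 \<noteq> 0"
    unfolding dbv by (simp_all add: B_def)
  have T0: "T (0, 0) = 0" by (simp add: T_def e'0)
  show ?thesis
    unfolding normal_form_def
    by (rule exI[of _ b'], rule exI[of _ T], rule exI[of _ qq], rule exI[of _ D])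
      (intro conjI allI impI smb smT smq D(1) b'0 L T0 main, simp_all add: injb dT)
qed

section \<open>Maps given by a generating family\<close>

lemma smooth_deriv:
  fixes f :: "real \<Rightarrow> real"
  assumes "smooth f"
  shows "(f has_real_derivative deriv f x) (at x)"
  using smooth_differentiable[OF assms] by (simp add: DERIV_deriv_iff_real_differentiable)

lemma isCont_eventually_nhds:
  assumes "isCont f a" "open S" "f a \<in> S"
  shows "\<forall>\<^sub>F x in nhds a. f x \<in> S"
proof -
  have "(f \<longlongrightarrow> f a) (nhds a)"
    using assms(1) tendsto_at_iff_tendsto_nhds[of f a] by (simp add: continuous_at)
  then show ?thesis using assms(2,3) by (rule topological_tendstoD)
qed

text \<open>The triples \<open>(s, Y, Z)\<close> for which the family \<open>\<xi> x + s \<mu> x + x Y - Z\<close> has a double zero at \<open>x\<close>;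
  \<open>F1\<close> is of this form.\<close>

definition rmap :: "(real \<Rightarrow> real) \<Rightarrow> (real \<Rightarrow> real) \<Rightarrow> real \<times> real \<Rightarrow> R3"
  where "rmap \<xi> \<mu> = (\<lambda>(s, x). (s, - (deriv \<xi> x + s * deriv \<mu> x), \<xi> x + s * \<mu> x - x * (deriv \<xi> x + s * deriv \<mu> x)))"

text \<open>Multiplication by k = 1/\<kappa> normalizes the leading term to \<open>x^n\<close>. The
  functions k, x k and x^2 m k that then multiply -Z, Y and s are triangular modulo
  \<open>x^3\<close>, so a constant linear change of (s, Y, Z) turns them into a frame; k0, k1, k2
  are the Taylor coefficients of k, and M0 = m(0) k0.\<close>

lemma generating_family_frame:
  assumes \<kappa>: "smooth \<kappa>" "\<kappa> 0 \<noteq> 0" and m: "smooth m" "m 0 \<noteq> 0"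
  shows "\<exists>k \<alpha> k0 k1 k2 M0 \<delta>. smooth k \<and> (\<forall>i. smooth (\<alpha> i)) \<and> k0 \<noteq> 0 \<and> M0 \<noteq> 0 \<and> \<delta> > 0 \<and>
    (\<forall>x :: real. \<bar>x\<bar> < \<delta> \<longrightarrow> k x \<noteq> (0 :: real)) \<and>
    (\<forall>x s Y Z. \<bar>x\<bar> < \<delta> \<longrightarrow> k x * (x ^ n * \<kappa> x + s * (x\<^sup>2 * m x) + x * Y - Z) =
       x ^ n + (- k0 * Z * frame \<alpha> 0 x + (k0 * Y - k1 * Z) * frame \<alpha> 1 x + (M0 * s + k1 * Y - k2 * Z) * frame \<alpha> 2 x))"
proof -
  define S where "S = {x. \<kappa> x \<noteq> 0}"
  have "open S" unfolding S_def
    by (intro open_Collect_neq smooth_on_continuous_on[OF \<kappa>(1)] continuous_on_const)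
  moreover have "0 \<in> S" using \<kappa> by (simp add: S_def)
  moreover have "smooth_on S (\<lambda>x. inverse (\<kappa> x))"
    by (rule smooth_on_inverse[OF \<open>open S\<close> smooth_on_subset[OF \<kappa>(1)]]) (auto simp: S_def)
  ultimately obtain k \<delta> where k: "smooth k" and \<delta>: "\<delta> > 0" and kS: "\<And>x. dist x 0 < \<delta> \<Longrightarrow> x \<in> S \<and> k x = inverse (\<kappa> x)"
    using smooth_extension[of S 0] by blast
  have k1: "k x * \<kappa> x = 1" if "\<bar>x\<bar> < \<delta>" for x using kS[of x] that by (simp add: S_def dist_real_def)
  have div: "\<exists>g. smooth g \<and> (\<forall>x. f x = f 0 + x * g x)" if "smooth f" for f :: "real \<Rightarrow> real"
    by (rule smooth_divide_id[OF that]) blast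
  obtain g1 where g1: "smooth g1" "\<And>x. k x = k 0 + x * g1 x" using div[OF k] by blast
  obtain g2 where g2: "smooth g2" "\<And>x. g1 x = g1 0 + x * g2 x" using div[OF g1(1)] by blast
  obtain g3 where g3: "smooth g3" "\<And>x. g2 x = g2 0 + x * g3 x" using div[OF g2(1)] by blast
  define M0 where "M0 = m 0 * k 0"
  have k0: "k 0 \<noteq> 0" using k1[of 0] \<delta> by auto
  have M0: "M0 \<noteq> 0" using k0 m by (simp add: M0_def)
  have "smooth (\<lambda>x. m x * k x / M0)"
    unfolding divide_inverse by (intro smooth_on_mult[OF open_UNIV] smooth_on_const m k)
  from div[OF this] obtain a2 where a2: "smooth a2" "\<And>x. m x * k x / M0 = 1 + x * a2 x" using M0 by (auto simp: M0_def)
  \<comment> \<open>Back substitution: the terms of order 3 of x k and of k that remain after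
    subtracting the multiples of the frame functions of higher index.\<close>
  define a1 where "a1 x = (g2 x - g1 0 * a2 x) * inverse (k 0)" for x
  define a0 where "a0 x = (g3 x - g1 0 * a1 x - g2 0 * a2 x) * inverse (k 0)" for x
  have a1: "smooth a1" unfolding a1_def[abs_def]
    by (intro smooth_on_mult[OF open_UNIV] smooth_on_diff[OF open_UNIV] smooth_on_const g2 a2)
  have a0: "smooth a0" unfolding a0_def[abs_def]
    by (intro smooth_on_mult[OF open_UNIV] smooth_on_diff[OF open_UNIV] smooth_on_const g3 a2 a1)
  define \<alpha> where "\<alpha> i = (if i = 0 then a0 else if i = 1 then a1 else a2)" for i :: nat
  have sm: "smooth (\<alpha> i)" for i using a0 a1 a2 by (simp add: \<alpha>_def)
  have eq: "k x * (x ^ n * \<kappa> x + s * (x\<^sup>2 * m x) + x * Y - Z) =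
       x ^ n + (- k 0 * Z * frame \<alpha> 0 x + (k 0 * Y - g1 0 * Z) * frame \<alpha> 1 x + (M0 * s + g1 0 * Y - g2 0 * Z) * frame \<alpha> 2 x)"
    if x: "\<bar>x\<bar> < \<delta>" for x s Y Z
  proof -
    have m': "m x * k x = M0 * (1 + x * a2 x)" using a2(2)[of x] M0 by (simp add: field_simps)
    have F2: "frame \<alpha> 2 x = x\<^sup>2 * (1 + x * a2 x)" by (simp add: frame_def \<alpha>_def power2_eq_square power3_eq_cube algebra_simps)
    have A1: "k 0 * a1 x = g2 x - g1 0 * a2 x" and A0: "k 0 * a0 x = g3 x - g1 0 * a1 x - g2 0 * a2 x"
      using k0 by (simp_all add: a1_def a0_def)
    have "k 0 * frame \<alpha> 1 x = k 0 * x + x ^ 3 * (k 0 * a1 x)" by (simp add: frame_def \<alpha>_def algebra_simps)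
    also have "\<dots> = x * (k 0 + x * (g1 0 + x * g2 x)) - g1 0 * frame \<alpha> 2 x"
      unfolding A1 F2 by (simp add: power2_eq_square power3_eq_cube algebra_simps)
    finally have F1: "k 0 * frame \<alpha> 1 x = x * k x - g1 0 * frame \<alpha> 2 x" using g1(2)[of x] g2(2)[of x] by simp
    have "k 0 * frame \<alpha> 0 x = k 0 + x ^ 3 * (k 0 * a0 x)" by (simp add: frame_def \<alpha>_def algebra_simps)
    also have "\<dots> = k 0 + x * (g1 0 + x * (g2 0 + x * g3 x)) - g1 0 * frame \<alpha> 1 x - g2 0 * frame \<alpha> 2 x"
      unfolding A0 by (simp add: frame_def \<alpha>_def power2_eq_square power3_eq_cube algebra_simps)
    finally have F0: "k 0 * frame \<alpha> 0 x = k x - g1 0 * frame \<alpha> 1 x - g2 0 * frame \<alpha> 2 x"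
      using g1(2)[of x] g2(2)[of x] g3(2)[of x] by simp
    have "k x * (x ^ n * \<kappa> x + s * (x\<^sup>2 * m x) + x * Y - Z) =
      x ^ n * (k x * \<kappa> x) + s * x\<^sup>2 * (m x * k x) + Y * (x * k x) - Z * k x" by (simp add: algebra_simps)
    also have "\<dots> = x ^ n + s * M0 * frame \<alpha> 2 x + Y * (k 0 * frame \<alpha> 1 x + g1 0 * frame \<alpha> 2 x)
      - Z * (k 0 * frame \<alpha> 0 x + g1 0 * frame \<alpha> 1 x + g2 0 * frame \<alpha> 2 x)"
      unfolding k1[OF x] m' F1 F0 F2 by simp
    also have "\<dots> = x ^ n + (- k 0 * Z * frame \<alpha> 0 x + (k 0 * Y - g1 0 * Z) * frame \<alpha> 1 x + (M0 * s + g1 0 * Y - g2 0 * Z) * frame \<alpha> 2 x)"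
      by (simp add: algebra_simps)
    finally show ?thesis .
  qed
  have "k x \<noteq> 0" if "\<bar>x\<bar> < \<delta>" for x using k1[OF that] by auto
  then show ?thesis using k sm k0 M0 \<delta> eq
    by (intro exI[of _ k] exI[of _ \<alpha>] exI[of _ "k 0"] exI[of _ "g1 0"] exI[of _ "g2 0"] exI[of _ M0] exI[of _ \<delta>]) blast
qed

text \<open>Each map runs through the parameters at which its family has a double zero. A double
  zero of Q at v gives, through the normal form, a double zero of the generating family at
  \<open>T (v, l)\<close>, since k and the derivative of T in its first variable do not vanish. A
  double zero at x determines Y and Z from s and x, so \<open>\<Psi> \<circ> M\<close> equals
  \<open>rmap\<close> after \<phi>.\<close>

lemma rmap_equivalent:
  fixes M :: "real \<times> real \<Rightarrow> R3" and Q :: "R3 \<Rightarrow> real \<Rightarrow> real"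
  assumes \<kappa>: "smooth \<kappa>" "\<kappa> 0 \<noteq> 0" and m: "smooth m" "m 0 \<noteq> 0"
    and nf: "\<And>\<alpha>. (\<And>i. smooth (\<alpha> i)) \<Longrightarrow> normal_form n (frame \<alpha>) Q"
    and M: "smooth M" "M 0 = 0" "\<And>u v. dir_deriv (u, v) M 0 = (u, 0, 0)"
    and root: "\<And>w. Q (M w) (snd w) = 0" "\<And>w. (Q (M w) has_real_derivative 0) (at (snd w))"
  shows "right_left_equivalent (rmap (\<lambda>x. x ^ n * \<kappa> x) (\<lambda>x. x\<^sup>2 * m x)) 0 M 0"
proof -
  define \<xi> where "\<xi> x = x ^ n * \<kappa> x" for x
  define \<mu> where "\<mu> x = x\<^sup>2 * m x" for x
  have \<xi>: "smooth \<xi>" unfolding \<xi>_def[abs_def] by (intro smooth_UNIV_intros \<kappa>)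
  have \<mu>: "smooth \<mu>" unfolding \<mu>_def[abs_def] by (intro smooth_UNIV_intros m)
  obtain k \<alpha> k0 k1 k2 M0 \<delta> where k: "smooth k" and \<alpha>: "\<And>i. smooth (\<alpha> i)" and k0: "k0 \<noteq> 0" and M0: "M0 \<noteq> 0"
    and \<delta>: "\<delta> > 0" and kx: "\<And>x. \<bar>x\<bar> < \<delta> \<Longrightarrow> k x \<noteq> 0"
    and fam: "\<And>x s Y Z. \<bar>x\<bar> < \<delta> \<Longrightarrow> k x * (\<xi> x + s * \<mu> x + x * Y - Z) =
       x ^ n + (- k0 * Z * frame \<alpha> 0 x + (k0 * Y - k1 * Z) * frame \<alpha> 1 x + (M0 * s + k1 * Y - k2 * Z) * frame \<alpha> 2 x)"
    using generating_family_frame[OF \<kappa> m, of n] unfolding \<xi>_def \<mu>_def by blast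
  obtain b T q \<epsilon> where b: "\<And>i. smooth (b i)" and T: "smooth T" and q: "smooth q" and \<epsilon>: "\<epsilon> > 0"
    and b0: "\<And>i. i < 3 \<Longrightarrow> b i 0 = 0" and binj: "\<And>v. (\<forall>i<3. dir_deriv v (b i) 0 = 0) \<Longrightarrow> v = 0"
    and bL: "dir_deriv (1, 0, 0) (b 0) 0 = 0" "dir_deriv (1, 0, 0) (b 1) 0 = 0" "dir_deriv (1, 0, 0) (b 2) 0 \<noteq> 0"
    and T0: "T (0, 0) = 0" "dir_deriv (1, 0) T (0, 0) \<noteq> 0"
    and nfe: "\<And>X l. \<bar>X\<bar> < \<epsilon> \<Longrightarrow> norm l < \<epsilon> \<Longrightarrow>
      T (X, l) ^ n + (\<Sum>i<3. b i l * frame \<alpha> i (T (X, l))) = q (X, l) * Q l X"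
    using nf[of \<alpha>, OF \<alpha>] unfolding normal_form_def by blast
  \<comment> \<open>Inverts the triangular relations of \<open>generating_family_frame\<close>: (s,
    Y, Z) is chosen so that the coefficients of the frame become b 0, b 1, b 2.\<close>
  define Z where "Z l = - b 0 l * inverse k0" for l
  define Y where "Y l = (b 1 l + k1 * Z l) * inverse k0" for l
  define s where "s l = (b 2 l - k1 * Y l + k2 * Z l) * inverse M0" for l
  define \<Psi> where "\<Psi> l = (s l, Y l, Z l)" for l
  have Z: "smooth Z" unfolding Z_def[abs_def] by (intro smooth_UNIV_intros b)
  have Y: "smooth Y" unfolding Y_def[abs_def] by (intro smooth_UNIV_intros b Z)
  have s: "smooth s" unfolding s_def[abs_def] by (intro smooth_UNIV_intros b Z Y)
  have \<Psi>: "smooth \<Psi>" unfolding \<Psi>_def[abs_def] by (intro smooth_UNIV_intros s Y Z)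
  have inv: "- k0 * Z l = b 0 l" "k0 * Y l - k1 * Z l = b 1 l" "M0 * s l + k1 * Y l - k2 * Z l = b 2 l" for l
  proof -
    show "- k0 * Z l = b 0 l" using k0 by (simp add: Z_def)
    have "k0 * Y l = b 1 l + k1 * Z l" using k0 unfolding Y_def by (simp add: field_simps)
    then show "k0 * Y l - k1 * Z l = b 1 l" by simp
    have "M0 * s l = b 2 l - k1 * Y l + k2 * Z l" using M0 unfolding s_def by (simp add: field_simps)
    then show "M0 * s l + k1 * Y l - k2 * Z l = b 2 l" by simp
  qed
  have bd: "((b i) has_derivative (\<lambda>v. dir_deriv v (b i) 0)) (at 0)" for i by (rule smooth_on_has_derivative[OF b UNIV_I])
  have dZ: "dir_deriv v Z 0 = - dir_deriv v (b 0) 0 * inverse k0" for v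
    unfolding Z_def[abs_def] by (rule dir_deriv_eq) (auto intro!: derivative_eq_intros bd)
  have dY: "dir_deriv v Y 0 = (dir_deriv v (b 1) 0 + k1 * dir_deriv v Z 0) * inverse k0" for v
    unfolding Y_def[abs_def] by (rule dir_deriv_eq) (auto intro!: derivative_eq_intros bd smooth_on_has_derivative[OF Z])
  have ds: "dir_deriv v s 0 = (dir_deriv v (b 2) 0 - k1 * dir_deriv v Y 0 + k2 * dir_deriv v Z 0) * inverse M0" for v
    unfolding s_def[abs_def]
    by (rule dir_deriv_eq) (auto intro!: derivative_eq_intros bd smooth_on_has_derivative[OF Z] smooth_on_has_derivative[OF Y])
  have d\<Psi>: "dir_deriv v \<Psi> 0 = (dir_deriv v s 0, dir_deriv v Y 0, dir_deriv v Z 0)" for v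
    unfolding \<Psi>_def[abs_def]
    by (rule dir_deriv_eq) (intro has_derivative_Pair smooth_on_has_derivative[OF Z UNIV_I]
        smooth_on_has_derivative[OF Y UNIV_I] smooth_on_has_derivative[OF s UNIV_I])
  have \<Psi>0: "\<Psi> 0 = 0" using b0 by (simp add: \<Psi>_def s_def Y_def Z_def zero_prod_def)
  have \<Psi>germ: "diffeo_germ \<Psi> 0 0"
  proof (rule diffeo_germI[OF open_UNIV UNIV_I \<Psi> _ \<Psi>0])
    fix v assume "dir_deriv v \<Psi> 0 = 0"
    then have z: "dir_deriv v s 0 = 0" "dir_deriv v Y 0 = 0" "dir_deriv v Z 0 = 0" unfolding d\<Psi> by (auto simp: zero_prod_def)
    have "dir_deriv v (b i) 0 = 0" if "i < 3" for i
    proof -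
      consider "i = 0" | "i = 1" | "i = 2" using \<open>i < 3\<close> by linarith
      then show ?thesis using dZ[of v] dY[of v] ds[of v] k0 M0 unfolding z by cases simp_all
    qed
    then show "v = 0" using binj by blast
  qed
  define \<phi> where "\<phi> w = (s (M w), T (snd w, M w))" for w
  have sm\<phi>: "smooth \<phi>"
    unfolding \<phi>_def[abs_def]
    by (intro smooth_on_Pair[OF open_UNIV] smooth_on_compose_UNIV[OF open_UNIV s] smooth_on_compose_UNIV[OF open_UNIV T]
        smooth_on_snd[OF open_UNIV] smooth_on_id[OF open_UNIV] M(1))
  have \<phi>0: "\<phi> 0 = 0" using b0 T0(1) M(2) by (simp add: \<phi>_def s_def Y_def Z_def zero_prod_def)
  have \<phi>germ: "diffeo_germ \<phi> 0 0"
  proof (rule diffeo_germI[OF open_UNIV UNIV_I sm\<phi> _ \<phi>0])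
    fix w assume w: "dir_deriv w \<phi> 0 = 0"
    obtain u v where uv: "w = (u, v)" by (cases w)
    have "(M has_derivative (\<lambda>w. dir_deriv w M 0)) (at 0)" by (rule smooth_on_has_derivative[OF M(1) UNIV_I])
    then have dM: "(M has_derivative (\<lambda>w. (fst w, 0, 0))) (at 0)"
      by (rule has_derivative_eq_rhs) (use M(3) in \<open>auto simp: fun_eq_iff\<close>)
    have ds': "((\<lambda>w. s (M w)) has_derivative (\<lambda>w. dir_deriv (fst w, 0, 0) s 0)) (at 0)"
      using has_derivative_compose[OF dM smooth_on_has_derivative[OF s UNIV_I]] by (simp add: M(2))
    have "((\<lambda>w. (snd w, M w)) has_derivative (\<lambda>w. (snd w, (fst w, 0, 0)))) (at 0)"
      by (intro has_derivative_Pair has_derivative_snd has_derivative_ident dM)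
    from has_derivative_compose[OF this smooth_on_has_derivative[OF T UNIV_I]]
    have dT: "((\<lambda>w. T (snd w, M w)) has_derivative (\<lambda>w. dir_deriv (snd w, fst w, 0, 0) T (0, 0))) (at 0)"
      by (simp add: M(2))
    have z: "dir_deriv (u, 0, 0) s 0 = 0" "dir_deriv (v, u, 0, 0) T (0, 0) = 0"
      using w unfolding \<phi>_def[abs_def] dir_deriv_eq[OF has_derivative_Pair[OF ds' dT]] by (auto simp: uv zero_prod_def)
    have "dir_deriv (u, 0, 0) s 0 = u * dir_deriv (1, 0, 0) s 0"
      using dir_deriv_scaleR[OF s, of u "(1, 0, 0)" 0] by simp
    \<comment> \<open>By the normalization in \<open>normal_form\<close>, b 0 and b 1 are stationary
      along the first coordinate, hence so are Z and Y, and s moves with b 2.\<close>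
    moreover have "dir_deriv (1, 0, 0) s 0 \<noteq> 0"
      unfolding ds dY dZ bL using bL(3) M0 by simp
    ultimately have u: "u = 0" using z(1) by simp
    have "dir_deriv (v, 0, 0, 0) T (0, 0) = v * dir_deriv (1, 0) T (0, 0)"
      using dir_deriv_scaleR[OF T, of v "(1, 0)" "(0, 0)"] by (simp add: zero_prod_def)
    then have "v = 0" using z(2) T0(2) u by simp
    then show "w = 0" using u uv by (simp add: zero_prod_def)
  qed
  have smT: "smooth (\<lambda>w. T (snd w, M w))" "smooth (\<lambda>w. dir_deriv (1, 0) T (snd w, M w))"
    by (intro smooth_on_compose_UNIV[OF open_UNIV T] smooth_on_compose_UNIV[OF open_UNIV smooth_on_dir_deriv[OF T]]
        smooth_on_Pair[OF open_UNIV] smooth_on_snd[OF open_UNIV] smooth_on_id[OF open_UNIV] M(1))+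
  have ev: "\<forall>\<^sub>F w in nhds 0. T (snd w, M w) \<in> {- \<delta><..<\<delta>}" "\<forall>\<^sub>F w in nhds 0. dir_deriv (1, 0) T (snd w, M w) \<in> - {0}"
    "\<forall>\<^sub>F w in nhds 0. M w \<in> ball 0 \<epsilon>" "\<forall>\<^sub>F w in nhds (0 :: real \<times> real). snd w \<in> {- \<epsilon><..<\<epsilon>}"
    by (intro isCont_eventually_nhds smooth_on_isCont[OF smT(1)] smooth_on_isCont[OF smT(2)] smooth_on_isCont[OF M(1)]
        continuous_intros UNIV_I; use \<delta> \<epsilon> T0 in \<open>simp add: M(2) open_Compl\<close>)+
  have "\<forall>\<^sub>F w in nhds 0. \<Psi> (M w) = rmap \<xi> \<mu> (\<phi> w)"
    using ev
  proof eventually_elim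
    case (elim w)
    define l where "l = M w"
    define v where "v = snd w"
    define x where "x = T (v, l)"
    have x: "\<bar>x\<bar> < \<delta>" and t: "dir_deriv (1, 0) T (v, l) \<noteq> 0" and l: "norm l < \<epsilon>" and v: "\<bar>v\<bar> < \<epsilon>"
      using elim by (auto simp: x_def l_def v_def)
    define H where "H y = \<xi> y + s l * \<mu> y + y * Y l - Z l" for y
    have L: "k y * H y = y ^ n + (\<Sum>i<3. b i l * frame \<alpha> i y)" if "\<bar>y\<bar> < \<delta>" for y
      unfolding H_def fam[OF that] inv sum_lessThan_3 ..
    have L': "k (T (X, l)) * H (T (X, l)) = q (X, l) * Q l X" if "\<bar>X\<bar> < \<epsilon>" "\<bar>T (X, l)\<bar> < \<delta>" for X
      unfolding L[OF that(2)] by (rule nfe[OF that(1) l])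
    have "k x * H x = 0" unfolding x_def using L'[OF v] x root(1)[of w] by (simp add: x_def l_def v_def)
    then have H0: "H x = 0" using kx[OF x] by simp
    have "((\<lambda>X. (X, l)) has_derivative (\<lambda>h. (h, 0))) (at v)"
      by (intro has_derivative_Pair has_derivative_ident has_derivative_const)
    from has_derivative_compose[OF this smooth_on_has_derivative[OF T UNIV_I]]
    have 1: "((\<lambda>X. T (X, l)) has_derivative (\<lambda>h. dir_deriv (h, 0) T (v, l))) (at v)" by simp
    have "dir_deriv (h, 0) T (v, l) = dir_deriv (1, 0) T (v, l) * h" for h
      using dir_deriv_scaleR[OF T, of h "(1, 0)" "(v, l)"] by simp
    then have 2: "(\<lambda>h. dir_deriv (h, 0) T (v, l)) = (*) (dir_deriv (1, 0) T (v, l))" by (rule ext)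
    have dT: "((\<lambda>X. T (X, l)) has_real_derivative dir_deriv (1, 0) T (v, l)) (at v)"
      using 1 unfolding has_field_derivative_def 2 .
    define H' where "H' = deriv \<xi> x + s l * deriv \<mu> x + Y l"
    have dH: "(H has_real_derivative H') (at x)"
      unfolding H_def[abs_def] H'_def by (auto intro!: derivative_eq_intros smooth_deriv[OF \<xi>] smooth_deriv[OF \<mu>])
    \<comment> \<open>The term with the derivative of k drops out because H vanishes at x. On the
      model side the term with the derivative of q drops out in the same way.\<close>
    have "((\<lambda>y. k y * H y) has_real_derivative k x * H') (at x)"
      using DERIV_mult[OF smooth_deriv[OF k] dH] by (simp add: H0 mult.commute)
    from DERIV_chain2[OF this[unfolded x_def] dT]
    have d1: "((\<lambda>X. k (T (X, l)) * H (T (X, l))) has_real_derivative k x * H' * dir_deriv (1, 0) T (v, l)) (at v)"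
      unfolding x_def .
    have smq: "smooth (\<lambda>X. q (X, l))" by (rule smooth_on_compose_UNIV[OF open_UNIV q]) (intro smooth_UNIV_intros)
    have d2: "((\<lambda>X. q (X, l) * Q l X) has_real_derivative 0) (at v)"
      using DERIV_mult[OF smooth_deriv[OF smq, of v] root(2)[of w, folded l_def v_def]] root(1)[of w] by (simp add: l_def v_def)
    define S where "S = {X. \<bar>X\<bar> < \<epsilon>} \<inter> {X. \<bar>T (X, l)\<bar> < \<delta>}"
    have "continuous_on UNIV (\<lambda>X. T (X, l))"
      by (rule smooth_on_continuous_on, rule smooth_on_compose_UNIV[OF open_UNIV T]) (intro smooth_UNIV_intros)
    then have "open S" unfolding S_def by (intro open_Int open_Collect_less continuous_intros)
    moreover have "v \<in> S" using v x by (simp add: S_def x_def)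
    ultimately have "((\<lambda>X. k (T (X, l)) * H (T (X, l))) has_real_derivative 0) (at v)"
      by (rule has_field_derivative_transform_within_open[OF d2]) (use L' in \<open>auto simp: S_def\<close>)
    from DERIV_unique[OF d1 this] have "H' = 0" using kx[OF x] t by simp
    then have Yl: "Y l = - (deriv \<xi> x + s l * deriv \<mu> x)" by (simp add: H'_def)
    have "Z l = \<xi> x + s l * \<mu> x + x * Y l" using H0 by (simp add: H_def)
    then have Zl: "Z l = \<xi> x + s l * \<mu> x - x * (deriv \<xi> x + s l * deriv \<mu> x)" unfolding Yl by (simp only: mult_minus_right diff_conv_add_uminus)
    have "\<Psi> l = (s l, Y l, Z l)" by (simp only: \<Psi>_def)
    also have "\<dots> = rmap \<xi> \<mu> (s l, x)" unfolding rmap_def prod.case Yl Zl ..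
    also have "(s l, x) = \<phi> w" by (simp only: \<phi>_def l_def v_def x_def)
    finally show ?case by (simp only: l_def)
  qed
  moreover have "diffeo_germ \<Psi> (M 0) (rmap \<xi> \<mu> 0)"
  proof -
    have "\<Psi> (M 0) = rmap \<xi> \<mu> (\<phi> 0)" by (rule eventually_nhds_x_imp_x) (rule calculation)
    then show ?thesis using \<Psi>germ by (simp add: \<phi>0 M(2) \<Psi>0)
  qed
  ultimately have "right_left_equivalent M 0 (rmap \<xi> \<mu>) 0"
    unfolding right_left_equivalent_def using \<phi>germ by blast
  then have "right_left_equivalent (rmap \<xi> \<mu>) 0 M 0"
    by (rule right_left_equivalent_sym) (rule smooth_on_isCont[OF M(1) UNIV_I])
  then show ?thesis unfolding \<xi>_def[abs_def] \<mu>_def[abs_def] .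
qed

lemma rmap_cuspidal_edge:
  assumes "smooth \<kappa>" "\<kappa> 0 \<noteq> 0" "smooth m" "m 0 \<noteq> 0"
  shows "is_cuspidal_edge (rmap (\<lambda>x. x ^ 3 * \<kappa> x) (\<lambda>x. x\<^sup>2 * m x)) 0"
proof -
  let ?M = "\<lambda>w :: real \<times> real. (fst w, (snd w)\<^sup>2, snd w ^ 3)"
  have sm: "smooth ?M" by (intro smooth_UNIV_intros)
  have "right_left_equivalent (rmap (\<lambda>x. x ^ 3 * \<kappa> x) (\<lambda>x. x\<^sup>2 * m x)) 0 ?M 0"
  proof (rule rmap_equivalent[OF assms normal_form_cusp sm])
    have "(?M has_derivative (\<lambda>h. (fst h, 0, 0))) (at 0)" by (auto intro!: derivative_eq_intros)
    from dir_deriv_eq[OF this] show "dir_deriv (u, v) ?M 0 = (u, 0, 0)" for u v by simp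
    show "cusp_poly (?M w) (snd w) = 0" for w
      by (simp add: cusp_poly_def power2_eq_square power3_eq_cube)
    show "(cusp_poly (?M w) has_real_derivative 0) (at (snd w))" for w
      unfolding cusp_poly_def[abs_def] by (auto intro!: derivative_eq_intros)
  qed (simp_all add: zero_prod_def)
  then show ?thesis by (simp add: is_cuspidal_edge_def split_def zero_prod_def)
qed

lemma rmap_swallowtail:
  assumes "smooth \<kappa>" "\<kappa> 0 \<noteq> 0" "smooth m" "m 0 \<noteq> 0"
  shows "is_swallowtail (rmap (\<lambda>x. x ^ 4 * \<kappa> x) (\<lambda>x. x\<^sup>2 * m x)) 0"
proof -
  let ?M = "\<lambda>w :: real \<times> real. (fst w, 3 * snd w ^ 4 + fst w * (snd w)\<^sup>2, 4 * snd w ^ 3 + 2 * fst w * snd w)"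
  have sm: "smooth ?M" by (intro smooth_UNIV_intros)
  have "right_left_equivalent (rmap (\<lambda>x. x ^ 4 * \<kappa> x) (\<lambda>x. x\<^sup>2 * m x)) 0 ?M 0"
  proof (rule rmap_equivalent[OF assms normal_form_swallowtail sm])
    have "(?M has_derivative (\<lambda>h. (fst h, 0, 0))) (at 0)" by (auto intro!: derivative_eq_intros)
    from dir_deriv_eq[OF this] show "dir_deriv (u, v) ?M 0 = (u, 0, 0)" for u v by simp
    show "swallowtail_poly (?M w) (snd w) = 0" for w
      by (simp add: swallowtail_poly_def eval_nat_numeral algebra_simps)
    show "(swallowtail_poly (?M w) has_real_derivative 0) (at (snd w))" for w
      unfolding swallowtail_poly_def[abs_def] by (auto intro!: derivative_eq_intros simp: eval_nat_numeral algebra_simps)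
  qed (simp_all add: zero_prod_def)
  then show ?thesis by (simp add: is_swallowtail_def split_def zero_prod_def)
qed

lemma rmap_butterfly:
  assumes "smooth \<kappa>" "\<kappa> 0 \<noteq> 0" "smooth m" "m 0 \<noteq> 0"
  shows "is_butterfly (rmap (\<lambda>x. x ^ 5 * \<kappa> x) (\<lambda>x. x\<^sup>2 * m x)) 0"
proof -
  let ?M = "\<lambda>w :: real \<times> real. (fst w, 5 * snd w ^ 4 + 2 * fst w * snd w, fst w * (snd w)\<^sup>2 + 4 * snd w ^ 5)"
  have sm: "smooth ?M" by (intro smooth_UNIV_intros)
  have "right_left_equivalent (rmap (\<lambda>x. x ^ 5 * \<kappa> x) (\<lambda>x. x\<^sup>2 * m x)) 0 ?M 0"
  proof (rule rmap_equivalent[OF assms normal_form_butterfly sm])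
    have "(?M has_derivative (\<lambda>h. (fst h, 0, 0))) (at 0)" by (auto intro!: derivative_eq_intros)
    from dir_deriv_eq[OF this] show "dir_deriv (u, v) ?M 0 = (u, 0, 0)" for u v by simp
    show "butterfly_poly (?M w) (snd w) = 0" for w
      by (simp add: butterfly_poly_def eval_nat_numeral algebra_simps)
    show "(butterfly_poly (?M w) has_real_derivative 0) (at (snd w))" for w
      unfolding butterfly_poly_def[abs_def] by (auto intro!: derivative_eq_intros simp: eval_nat_numeral algebra_simps)
  qed (simp_all add: zero_prod_def)
  then show ?thesis by (simp add: is_butterfly_def split_def zero_prod_def)
qed

section \<open>Orders of vanishing, change of base point and classification\<close>

lemma smooth_deriv_smooth:
  fixes f :: "real \<Rightarrow> real"
  assumes "smooth f"
  shows "smooth (deriv f)"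
proof -
  have "dir_deriv 1 f = deriv f"
    by (rule ext, rule dir_deriv_eq[THEN trans, OF smooth_deriv[OF assms, unfolded has_field_derivative_def]]) simp
  then show ?thesis using smooth_on_dir_deriv[OF assms, of 1] by simp
qed

lemma deriv_power_mult:
  fixes g :: "real \<Rightarrow> real"
  assumes "smooth g"
  shows "deriv (\<lambda>x. x ^ Suc n * g x) = (\<lambda>x. x ^ n * (real (Suc n) * g x + x * deriv g x))"
proof (rule ext, rule DERIV_imp_deriv)
  fix x
  have "((\<lambda>x. x ^ Suc n) has_real_derivative real (Suc n) * x ^ n) (at x)" using DERIV_pow[of "Suc n" x] by simp
  from DERIV_mult[OF this smooth_deriv[OF assms]]
  show "((\<lambda>x. x ^ Suc n * g x) has_real_derivative x ^ n * (real (Suc n) * g x + x * deriv g x)) (at x)"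
    by (simp add: algebra_simps)
qed

lemma funpow_deriv_power_mult:
  fixes g :: "real \<Rightarrow> real"
  assumes "smooth g"
  shows "(deriv ^^ n) (\<lambda>x. x ^ n * g x) 0 = fact n * g 0"
  using assms
proof (induction n arbitrary: g)
  case (Suc n)
  have "smooth (\<lambda>x. real (Suc n) * g x + x * deriv g x)"
    by (intro smooth_UNIV_intros Suc.prems smooth_deriv_smooth)
  from Suc.IH[OF this] show ?case
    unfolding funpow_Suc_right comp_def deriv_power_mult[OF Suc.prems] by (simp add: algebra_simps)
qed simp

text \<open>After n factors x have been split off, the n-th derivative at 0 is n! times the value of
  the cofactor; when it vanishes, Hadamard's lemma permits one more division.\<close>

lemma smooth_divide_power:
  fixes f :: "real \<Rightarrow> real"
  assumes "smooth f" "\<And>j. j < n \<Longrightarrow> (deriv ^^ j) f 0 = 0"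
  shows "\<exists>g. smooth g \<and> (\<forall>x. f x = x ^ n * g x) \<and> (deriv ^^ n) f 0 = fact n * g 0"
  using assms(2)
proof (induction n)
  case 0
  show ?case using assms(1) by (intro exI[of _ f]) simp
next
  case (Suc n)
  then obtain g where g: "smooth g" "\<And>x. f x = x ^ n * g x" "(deriv ^^ n) f 0 = fact n * g 0" by auto
  have "g 0 = 0" using g(3) Suc.prems[of n] by simp
  have "\<exists>h. smooth h \<and> (\<forall>x. g x = g 0 + x * h x)" by (rule smooth_divide_id[OF g(1)]) blast
  then obtain h where h: "smooth h" "\<And>x. g x = x * h x" using \<open>g 0 = 0\<close> by auto
  have eq: "f = (\<lambda>x. x ^ Suc n * h x)" using g(2) h(2) by (simp add: fun_eq_iff)
  show ?case using h(1) funpow_deriv_power_mult[OF h(1), of "Suc n"] unfolding eq by blast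
qed

text \<open>On the line s = 0 the components are built from \<xi>' and \<xi> - x \<xi>', both O(x^(n
  + 1)). With n = 4 this excludes all three germs when \<xi> vanishes to order 6.\<close>

lemma not_lojasiewicz_rmap:
  assumes "smooth \<kappa>"
  shows "\<not> lojasiewicz n (rmap (\<lambda>x. x ^ (n + 2) * \<kappa> x) \<mu>) 0"
proof -
  define \<xi> where "\<xi> x = x ^ Suc (Suc n) * \<kappa> x" for x
  define g where "g x = real (Suc (Suc n)) * \<kappa> x + x * deriv \<kappa> x" for x
  have d: "deriv \<xi> = (\<lambda>x. x ^ Suc n * g x)"
    unfolding \<xi>_def[abs_def] g_def by (rule deriv_power_mult[OF assms])
  have smg: "smooth g" unfolding g_def[abs_def] by (intro smooth_UNIV_intros assms smooth_deriv_smooth)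
  obtain A where A: "\<And>x. norm x \<le> 1 \<Longrightarrow> norm (\<kappa> x) \<le> A" using smooth_bounded[OF assms] by metis
  obtain B where B: "\<And>x. norm x \<le> 1 \<Longrightarrow> norm (g x) \<le> B" using smooth_bounded[OF smg] by metis
  have "\<not> lojasiewicz n (rmap \<xi> \<mu>) (0, 0)"
  proof (rule not_lojasiewicz[of 1 _ _ _ "A + B + B"])
    fix v :: real assume v: "0 < v" "v < 1"
    have 1: "\<bar>deriv \<xi> v\<bar> \<le> B * v ^ Suc n"
      using mult_right_mono[OF B[of v], of "v ^ Suc n"] v unfolding d by (simp add: abs_mult mult_ac)
    have 2: "\<bar>\<xi> v\<bar> \<le> A * v ^ Suc n"
    proof -
      have "\<bar>\<xi> v\<bar> = v * (\<bar>\<kappa> v\<bar> * v ^ Suc n)" using v by (simp add: \<xi>_def abs_mult mult_ac)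
      also have "\<dots> \<le> 1 * (\<bar>\<kappa> v\<bar> * v ^ Suc n)" using v by (intro mult_right_mono) auto
      also have "\<dots> \<le> A * v ^ Suc n" using mult_right_mono[OF A[of v], of "v ^ Suc n"] v by simp
      finally show ?thesis .
    qed
    have 3: "\<bar>v * deriv \<xi> v\<bar> \<le> \<bar>deriv \<xi> v\<bar>" using v by (simp add: abs_mult mult_left_le_one_le)
    have "rmap \<xi> \<mu> (0, 0 + v) - rmap \<xi> \<mu> (0, 0) = (0, - deriv \<xi> v, \<xi> v - v * deriv \<xi> v)"
      by (simp add: rmap_def d) (simp add: \<xi>_def)
    then have "norm (rmap \<xi> \<mu> (0, 0 + v) - rmap \<xi> \<mu> (0, 0)) \<le> \<bar>deriv \<xi> v\<bar> + \<bar>\<xi> v - v * deriv \<xi> v\<bar>"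
      using norm_triple_le[of 0 "- deriv \<xi> v" "\<xi> v - v * deriv \<xi> v"] by simp
    also have "\<dots> \<le> B * v ^ Suc n + (A * v ^ Suc n + B * v ^ Suc n)" using 1 2 3 by linarith
    finally show "norm (rmap \<xi> \<mu> (0, 0 + v) - rmap \<xi> \<mu> (0, 0)) \<le> (A + B + B) * v ^ Suc n"
      by (simp add: algebra_simps)
  qed simp
  then show ?thesis by (simp add: \<xi>_def[abs_def] zero_prod_def)
qed

lemma smooth_rmap:
  assumes "smooth \<xi>" "smooth \<mu>"
  shows "smooth (rmap \<xi> \<mu>)"
  unfolding rmap_def split_def
  by (intro smooth_on_Pair[OF open_UNIV] smooth_on_minus[OF open_UNIV] smooth_on_add[OF open_UNIV] smooth_on_diff[OF open_UNIV]
      smooth_on_mult[OF open_UNIV] smooth_on_compose_UNIV[OF open_UNIV assms(1)] smooth_on_compose_UNIV[OF open_UNIV assms(2)]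
      smooth_on_compose_UNIV[OF open_UNIV smooth_deriv_smooth[OF assms(1)]]
      smooth_on_compose_UNIV[OF open_UNIV smooth_deriv_smooth[OF assms(2)]]
      smooth_on_fst[OF open_UNIV] smooth_on_snd[OF open_UNIV] smooth_on_id[OF open_UNIV])

lemma DERIV_translate:
  fixes f :: "real \<Rightarrow> real"
  assumes "smooth f"
  shows "((\<lambda>x. f (t0 + x)) has_real_derivative deriv f (t0 + x)) (at x)"
proof -
  have "((\<lambda>x. t0 + x) has_real_derivative 1) (at x)" by (auto intro!: derivative_eq_intros)
  from DERIV_chain2[where f = f and g = "\<lambda>x. t0 + x", OF smooth_deriv[OF assms] this] show ?thesis by simp
qed

lemma smooth_translate:
  fixes f :: "real \<Rightarrow> real"
  assumes "smooth f"
  shows "smooth (\<lambda>x. f (t0 + x))"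
  by (rule smooth_on_compose_UNIV[OF open_UNIV assms]) (intro smooth_UNIV_intros)

text \<open>Affine functions of x added to \<xi> and \<mu> change Y and Z by affine functions of s,
  and moving the origin of x to t0 shears Z by t0 Y. All of this is an affine isomorphism of the
  target, so the base point can be moved to 0 and the 1-jets removed.\<close>

lemma rmap_shift:
  assumes \<xi>: "smooth \<xi>" and \<mu>: "smooth \<mu>"
    and ev: "\<forall>\<^sub>F w in nhds (s0, t0). f w = rmap \<xi> \<mu> w"
  shows "right_left_equivalent f (s0, t0)
    (rmap (\<lambda>x. \<xi> (t0 + x) + s0 * \<mu> (t0 + x) - a - b * x) (\<lambda>x. \<mu> (t0 + x) - a' - b' * x)) 0"
proof -
  let ?\<xi> = "\<lambda>x. \<xi> (t0 + x) + s0 * \<mu> (t0 + x) - a - b * x"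
  let ?\<mu> = "\<lambda>x. \<mu> (t0 + x) - a' - b' * x"
  define A :: "R3 \<Rightarrow> R3" where "A w = (fst w - s0, fst (snd w) + b + (fst w - s0) * b',
    snd (snd w) - t0 * fst (snd w) - a - (fst w - s0) * a')" for w
  define \<phi> where "\<phi> w = (fst w - s0, snd w - t0)" for w :: "real \<times> real"
  have d\<xi>: "deriv ?\<xi> x = deriv \<xi> (t0 + x) + s0 * deriv \<mu> (t0 + x) - b" for x
    by (rule DERIV_imp_deriv) (auto intro!: derivative_eq_intros DERIV_translate \<xi> \<mu>)
  have d\<mu>: "deriv ?\<mu> x = deriv \<mu> (t0 + x) - b'" for x
    by (rule DERIV_imp_deriv) (auto intro!: derivative_eq_intros DERIV_translate \<mu>)
  have eq: "A (rmap \<xi> \<mu> w) = rmap ?\<xi> ?\<mu> (\<phi> w)" for w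
    unfolding A_def \<phi>_def rmap_def split_def d\<xi> d\<mu> by (simp add: algebra_simps)
  have f0: "f (s0, t0) = rmap \<xi> \<mu> (s0, t0)" using ev by (rule eventually_nhds_x_imp_x)
  have \<phi>0: "\<phi> (s0, t0) = 0" by (simp add: \<phi>_def zero_prod_def)
  have \<phi>: "diffeo_germ \<phi> (s0, t0) 0"
  proof (rule diffeo_germI[OF open_UNIV UNIV_I])
    show "\<phi> (s0, t0) = 0" by (rule \<phi>0)
    show "smooth \<phi>" unfolding \<phi>_def[abs_def] by (intro smooth_UNIV_intros)
    have "(\<phi> has_derivative (\<lambda>h. (fst h, snd h))) (at (s0, t0))"
      unfolding \<phi>_def[abs_def] by (auto intro!: derivative_eq_intros)
    then show "v = 0" if "dir_deriv v \<phi> (s0, t0) = 0" for v using that by (simp add: dir_deriv_eq)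
  qed
  have A: "diffeo_germ A (f (s0, t0)) (rmap ?\<xi> ?\<mu> 0)"
  proof (rule diffeo_germI[OF open_UNIV UNIV_I])
    show "smooth A" unfolding A_def[abs_def] by (intro smooth_UNIV_intros)
    show "A (f (s0, t0)) = rmap ?\<xi> ?\<mu> 0" unfolding f0 eq \<phi>0 ..
    have "(A has_derivative (\<lambda>h. (fst h, fst (snd h) + fst h * b', snd (snd h) - t0 * fst (snd h) - fst h * a'))) (at (f (s0, t0)))"
      unfolding A_def[abs_def] by (auto intro!: derivative_eq_intros)
    then show "v = 0" if "dir_deriv v A (f (s0, t0)) = 0" for v
      using that by (auto simp: dir_deriv_eq prod_eq_iff)
  qed
  have "\<forall>\<^sub>F w in nhds (s0, t0). A (f w) = rmap ?\<xi> ?\<mu> (\<phi> w)"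
    using ev by eventually_elim (simp only: eq)
  then show ?thesis unfolding right_left_equivalent_def using \<phi> A by blast
qed

lemma funpow_deriv_translate_add:
  fixes f g :: "real \<Rightarrow> real"
  assumes "smooth f" "smooth g"
  shows "(deriv ^^ k) (\<lambda>x. f (t0 + x) + c * g (t0 + x)) = (\<lambda>x. (deriv ^^ k) f (t0 + x) + c * (deriv ^^ k) g (t0 + x))"
  using assms
proof (induction k arbitrary: f g)
  case (Suc k)
  have "deriv (\<lambda>x. f (t0 + x) + c * g (t0 + x)) = (\<lambda>x. deriv f (t0 + x) + c * deriv g (t0 + x))"
    by (rule ext, rule DERIV_imp_deriv) (auto intro!: derivative_eq_intros DERIV_translate Suc.prems)
  then show ?case
    unfolding funpow_Suc_right comp_def using Suc.IH[OF smooth_deriv_smooth smooth_deriv_smooth, OF Suc.prems] by simp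
qed simp

lemma funpow_deriv_translate:
  fixes f g :: "real \<Rightarrow> real"
  assumes "smooth f" "smooth g"
  shows "(deriv ^^ k) (\<lambda>x. f (t0 + x) + c * g (t0 + x) - a - b * x) 0 =
    (if k = 0 then f t0 + c * g t0 - a else if k = 1 then deriv f t0 + c * deriv g t0 - b
     else (deriv ^^ k) f t0 + c * (deriv ^^ k) g t0)"
proof -
  have d1: "deriv (\<lambda>x. f (t0 + x) + c * g (t0 + x) - a - b * x) = (\<lambda>x. deriv f (t0 + x) + c * deriv g (t0 + x) - b)"
    by (rule ext, rule DERIV_imp_deriv) (auto intro!: derivative_eq_intros DERIV_translate assms)
  have d2: "deriv (\<lambda>x. deriv f (t0 + x) + c * deriv g (t0 + x) - b) = (\<lambda>x. deriv (deriv f) (t0 + x) + c * deriv (deriv g) (t0 + x))"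
    by (rule ext, rule DERIV_imp_deriv) (auto intro!: derivative_eq_intros DERIV_translate smooth_deriv_smooth assms)
  consider "k = 0" | "k = 1" | j where "k = Suc (Suc j)" by (cases k; cases "k - 1") auto
  then show ?thesis
  proof cases
    case 3
    then show ?thesis
      unfolding 3 funpow_Suc_right comp_def d1 d2 funpow_deriv_translate_add[OF smooth_deriv_smooth[OF smooth_deriv_smooth] smooth_deriv_smooth[OF smooth_deriv_smooth], OF assms]
      by simp
  qed (simp_all add: d1)
qed

text \<open>After the shift, \<mu> starts with x^2 and \<xi> with x^n, n being the first index with
  h n \<noteq> 0. The orders 3, 4, 5 yield their germs; the converses follow because the germs
  exclude one another and none occurs for larger order.\<close>

lemma rmap_classification:
  assumes \<xi>: "smooth \<xi>" and \<mu>: "smooth \<mu>"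
    and ev: "\<forall>\<^sub>F w in nhds (s0, t0). f w = rmap \<xi> \<mu> w"
    and h_def: "\<And>k. h k = (deriv ^^ k) \<xi> t0 + s0 * (deriv ^^ k) \<mu> t0"
    and h2: "h 2 = 0" and \<mu>2: "(deriv ^^ 2) \<mu> t0 \<noteq> 0"
  shows "(is_cuspidal_edge f (s0, t0) \<longleftrightarrow> h 3 \<noteq> 0) \<and> (is_swallowtail f (s0, t0) \<longleftrightarrow> h 3 = 0 \<and> h 4 \<noteq> 0) \<and>
    (is_butterfly f (s0, t0) \<longleftrightarrow> h 3 = 0 \<and> h 4 = 0 \<and> h 5 \<noteq> 0)"
proof -
  define \<xi>' where "\<xi>' x = \<xi> (t0 + x) + s0 * \<mu> (t0 + x) - h 0 - h 1 * x" for x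
  define \<mu>' where "\<mu>' x = \<mu> (t0 + x) - \<mu> t0 - deriv \<mu> t0 * x" for x
  have sm\<xi>: "smooth \<xi>'" unfolding \<xi>'_def[abs_def] by (intro smooth_UNIV_intros smooth_translate \<xi> \<mu>)
  have sm\<mu>: "smooth \<mu>'" unfolding \<mu>'_def[abs_def] by (intro smooth_UNIV_intros smooth_translate \<mu>)
  have d\<xi>: "(deriv ^^ k) \<xi>' 0 = (if k < 2 then 0 else h k)" for k
    unfolding \<xi>'_def[abs_def] funpow_deriv_translate[OF \<xi> \<mu>] by (auto simp: h_def)
  have d\<mu>: "(deriv ^^ k) \<mu>' 0 = (if k < 2 then 0 else (deriv ^^ k) \<mu> t0)" for k
    using funpow_deriv_translate[OF \<mu> \<mu>, of k t0 0 "\<mu> t0" "deriv \<mu> t0"] unfolding \<mu>'_def[abs_def] by auto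
  have eqv: "right_left_equivalent f (s0, t0) (rmap \<xi>' \<mu>') 0"
    unfolding \<xi>'_def[abs_def] \<mu>'_def[abs_def] by (rule rmap_shift[OF \<xi> \<mu> ev])
  have cont: "isCont f (s0, t0)"
    using smooth_on_isCont[OF smooth_rmap[OF \<xi> \<mu>] UNIV_I] isCont_cong[OF ev] by blast
  have "(deriv ^^ j) \<mu>' 0 = 0" if "j < 2" for j using that by (simp add: d\<mu>)
  from smooth_divide_power[OF sm\<mu> this]
  obtain m where m: "smooth m" "\<And>x. \<mu>' x = x\<^sup>2 * m x" "(deriv ^^ 2) \<mu>' 0 = fact 2 * m 0" by blast
  have m0: "m 0 \<noteq> 0" using m(3) \<mu>2 by (auto simp: d\<mu>)
  have \<mu>': "\<mu>' = (\<lambda>x. x\<^sup>2 * m x)" using m(2) by blast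
  have ex: "\<exists>\<kappa>. smooth \<kappa> \<and> \<xi>' = (\<lambda>x. x ^ n * \<kappa> x) \<and> h n = fact n * \<kappa> 0" if "n \<ge> 2" "\<And>j. 2 \<le> j \<Longrightarrow> j < n \<Longrightarrow> h j = 0" for n
  proof -
    have "(deriv ^^ j) \<xi>' 0 = 0" if "j < n" for j using that \<open>\<And>j. 2 \<le> j \<Longrightarrow> j < n \<Longrightarrow> h j = 0\<close> by (simp add: d\<xi>)
    from smooth_divide_power[OF sm\<xi> this]
    obtain \<kappa> where \<kappa>: "smooth \<kappa>" "\<And>x. \<xi>' x = x ^ n * \<kappa> x" "(deriv ^^ n) \<xi>' 0 = fact n * \<kappa> 0" by blast
    have "h n = fact n * \<kappa> 0" using \<kappa>(3) that(1) by (simp add: d\<xi>)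
    moreover have "\<xi>' = (\<lambda>x. x ^ n * \<kappa> x)" using \<kappa>(2) by blast
    ultimately show ?thesis using \<kappa>(1) by blast
  qed
  have h23: "h j = 0" if "2 \<le> j" "j < 3" for j
  proof -
    have "j = 2" using that by simp
    then show ?thesis using h2 by simp
  qed
  let ?c = "is_cuspidal_edge f (s0, t0)" and ?s = "is_swallowtail f (s0, t0)" and ?b = "is_butterfly f (s0, t0)"
  have c_loj: "lojasiewicz 2 f (s0, t0)" if ?c
    using lojasiewicz_right_left_equivalent[OF that[unfolded is_cuspidal_edge_def] cont lojasiewicz_cuspidal_edge] .
  have s_loj: "lojasiewicz 3 f (s0, t0)" if ?s
    using lojasiewicz_right_left_equivalent[OF that[unfolded is_swallowtail_def] cont lojasiewicz_swallowtail] .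
  have b_loj: "lojasiewicz 4 f (s0, t0)" if ?b
    using lojasiewicz_right_left_equivalent[OF that[unfolded is_butterfly_def] cont lojasiewicz_butterfly] .
  have s_not: "\<not> lojasiewicz 2 f (s0, t0)" if ?s
  proof
    assume l: "lojasiewicz 2 f (s0, t0)"
    have e: "right_left_equivalent (\<lambda>(u, v). (u, 3 * v^4 + u * v^2, 4 * v^3 + 2 * u * v)) (0, 0) f (s0, t0)"
      by (rule right_left_equivalent_sym[OF that[unfolded is_swallowtail_def] cont])
    have "isCont (\<lambda>(u, v). (u, 3 * v^4 + u * v^2, 4 * v^3 + 2 * u * v) :: R3) (0 :: real, 0 :: real)"
      unfolding split_def by (intro continuous_intros)
    from lojasiewicz_right_left_equivalent[OF e this l] show False using not_lojasiewicz_swallowtail by blast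
  qed
  have b_not: "\<not> lojasiewicz 3 f (s0, t0)" if ?b
  proof
    assume l: "lojasiewicz 3 f (s0, t0)"
    have e: "right_left_equivalent (\<lambda>(u, v). (u, 5 * v^4 + 2 * u * v, u * v^2 + 4 * v^5)) (0, 0) f (s0, t0)"
      by (rule right_left_equivalent_sym[OF that[unfolded is_butterfly_def] cont])
    have "isCont (\<lambda>(u, v). (u, 5 * v^4 + 2 * u * v, u * v^2 + 4 * v^5) :: R3) (0 :: real, 0 :: real)"
      unfolding split_def by (intro continuous_intros)
    from lojasiewicz_right_left_equivalent[OF e this l] show False using not_lojasiewicz_butterfly by blast
  qed
  \<comment> \<open>The swallowtail violates the inequality with exponent 2, which the cuspidal edge
    satisfies; the butterfly violates it with exponent 3, which the other two satisfy.\<close>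
  have cs: "\<not> (?c \<and> ?s)" using c_loj s_not by blast
  have cb: "\<not> (?c \<and> ?b)" using lojasiewicz_mono[OF c_loj, of 3] b_not by auto
  have sb: "\<not> (?s \<and> ?b)" using s_loj b_not by blast
  consider "h 3 \<noteq> 0" | "h 3 = 0" "h 4 \<noteq> 0" | "h 3 = 0" "h 4 = 0" "h 5 \<noteq> 0" | "h 3 = 0" "h 4 = 0" "h 5 = 0" by blast
  then show ?thesis
  proof cases
    case 1
    obtain \<kappa> where \<kappa>: "smooth \<kappa>" "\<xi>' = (\<lambda>x. x ^ 3 * \<kappa> x)" "h 3 = fact 3 * \<kappa> 0" using ex[of 3] h23 by auto
    have "\<kappa> 0 \<noteq> 0" using \<kappa>(3) 1 by auto
    from rmap_cuspidal_edge[OF \<kappa>(1) this m(1) m0]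
    have ?c using right_left_equivalent_trans[OF eqv] unfolding is_cuspidal_edge_def \<kappa>(2)[symmetric] \<mu>'[symmetric] by blast
    then show ?thesis using 1 cs cb by blast
  next
    case 2
    have "h j = 0" if "2 \<le> j" "j < 4" for j
    proof -
      have "j = 2 \<or> j = 3" using that by auto
      then show ?thesis using h2 2 by auto
    qed
    then obtain \<kappa> where \<kappa>: "smooth \<kappa>" "\<xi>' = (\<lambda>x. x ^ 4 * \<kappa> x)" "h 4 = fact 4 * \<kappa> 0" using ex[of 4] by auto
    have "\<kappa> 0 \<noteq> 0" using \<kappa>(3) 2 by auto
    from rmap_swallowtail[OF \<kappa>(1) this m(1) m0]
    have ?s using right_left_equivalent_trans[OF eqv] unfolding is_swallowtail_def \<kappa>(2)[symmetric] \<mu>'[symmetric] by blast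
    then show ?thesis using 2 cs sb by blast
  next
    case 3
    have "h j = 0" if "2 \<le> j" "j < 5" for j
    proof -
      have "j = 2 \<or> j = 3 \<or> j = 4" using that by auto
      then show ?thesis using h2 3 by auto
    qed
    then obtain \<kappa> where \<kappa>: "smooth \<kappa>" "\<xi>' = (\<lambda>x. x ^ 5 * \<kappa> x)" "h 5 = fact 5 * \<kappa> 0" using ex[of 5] by auto
    have "\<kappa> 0 \<noteq> 0" using \<kappa>(3) 3 by auto
    from rmap_butterfly[OF \<kappa>(1) this m(1) m0]
    have ?b using right_left_equivalent_trans[OF eqv] unfolding is_butterfly_def \<kappa>(2)[symmetric] \<mu>'[symmetric] by blast
    then show ?thesis using 3 cb sb by blast
  next
    case 4
    have "h j = 0" if "2 \<le> j" "j < 6" for j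
    proof -
      have "j = 2 \<or> j = 3 \<or> j = 4 \<or> j = 5" using that by auto
      then show ?thesis using h2 4 by auto
    qed
    then obtain \<kappa> where \<kappa>: "smooth \<kappa>" "\<xi>' = (\<lambda>x. x ^ 6 * \<kappa> x)" using ex[of 6] by auto
    have n: "\<not> lojasiewicz 4 (rmap \<xi>' \<mu>') 0" using not_lojasiewicz_rmap[OF \<kappa>(1), of 4 \<mu>'] unfolding \<kappa>(2) by simp
    have "\<not> lojasiewicz 4 f (s0, t0)"
    proof
      assume l: "lojasiewicz 4 f (s0, t0)"
      show False
        using n lojasiewicz_right_left_equivalent[OF right_left_equivalent_sym[OF eqv cont] smooth_on_isCont[OF smooth_rmap[OF sm\<xi> sm\<mu>] UNIV_I] l] by blast
    qed
    then have "\<not> ?c" "\<not> ?s" "\<not> ?b" using lojasiewicz_mono[OF c_loj, of 4] lojasiewicz_mono[OF s_loj, of 4] b_loj by auto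
    then show ?thesis using 4 by blast
  qed
qed

section \<open>Integral manifolds\<close>

lemma funpow_deriv_add:
  fixes f g :: "real \<Rightarrow> real"
  assumes "smooth f" "smooth g"
  shows "(deriv ^^ k) (\<lambda>x. f x + c * g x) = (\<lambda>x. (deriv ^^ k) f x + c * (deriv ^^ k) g x)"
  using funpow_deriv_translate_add[OF assms, of k 0 c] by simp

text \<open>In the Leibniz formula every term with fewer than k derivatives on g vanishes at
  a.\<close>

lemma funpow_deriv_mult:
  fixes f g :: "real \<Rightarrow> real"
  assumes "smooth f" "smooth g" "\<And>j. j < k \<Longrightarrow> (deriv ^^ j) g a = 0"
  shows "(deriv ^^ k) (\<lambda>x. f x * g x) a = f a * (deriv ^^ k) g a"
  using assms
proof (induction k arbitrary: f g)
  case (Suc k)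
  have sm: "smooth (\<lambda>x. f x * g' x)" if "smooth f" "smooth g'" for f g' :: "real \<Rightarrow> real"
    using that by (intro smooth_UNIV_intros)
  have "deriv (\<lambda>x. f x * g x) = (\<lambda>x. deriv f x * g x + 1 * (f x * deriv g x))"
    by (rule ext, rule DERIV_imp_deriv) (auto intro!: derivative_eq_intros smooth_deriv Suc.prems)
  then have "(deriv ^^ Suc k) (\<lambda>x. f x * g x) a =
      (deriv ^^ k) (\<lambda>x. deriv f x * g x) a + 1 * (deriv ^^ k) (\<lambda>x. f x * deriv g x) a"
    unfolding funpow_Suc_right comp_def
    using funpow_deriv_add[OF sm[OF smooth_deriv_smooth[OF Suc.prems(1)] Suc.prems(2)]
        sm[OF Suc.prems(1) smooth_deriv_smooth[OF Suc.prems(2)]], of k 1] by simp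
  also have "(deriv ^^ k) (\<lambda>x. deriv f x * g x) a = deriv f a * (deriv ^^ k) g a"
    by (rule Suc.IH[OF smooth_deriv_smooth[OF Suc.prems(1)] Suc.prems(2)]) (simp add: Suc.prems(3))
  also have "(deriv ^^ k) g a = 0" by (simp add: Suc.prems(3))
  also have "(deriv ^^ k) (\<lambda>x. f x * deriv g x) a = f a * (deriv ^^ k) (deriv g) a"
  proof (rule Suc.IH[OF Suc.prems(1) smooth_deriv_smooth[OF Suc.prems(2)]])
    show "(deriv ^^ j) (deriv g) a = 0" if "j < k" for j
      using Suc.prems(3)[of "Suc j"] that unfolding funpow_Suc_right comp_def by simp
  qed
  finally show ?case unfolding funpow_Suc_right comp_def by simp
qed simp

lemma funpow_deriv_cong:
  assumes "open S" "\<And>x. x \<in> S \<Longrightarrow> f x = g x" "x \<in> S"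
  shows "(deriv ^^ k) f x = (deriv ^^ k) g x"
  using assms(3)
proof (induction k arbitrary: x)
  case (Suc k)
  have "\<forall>\<^sub>F y in nhds x. y \<in> S" using assms(1) Suc.prems by (rule eventually_nhds_in_open)
  then have "\<forall>\<^sub>F y in nhds x. (deriv ^^ k) f y = (deriv ^^ k) g y" by eventually_elim (rule Suc.IH)
  then show ?case using deriv_cong_ev[OF _ refl] by simp
qed (use assms(2) in simp)

lemma funpow_dir_deriv_cong:
  assumes "open S" "\<And>x. x \<in> S \<Longrightarrow> f x = g x" "x \<in> S"
  shows "(dir_deriv v ^^ k) f x = (dir_deriv v ^^ k) g x"
  using assms(3)
proof (induction k arbitrary: x)
  case (Suc k)
  have "dir_deriv v ((dir_deriv v ^^ k) f) x = dir_deriv v ((dir_deriv v ^^ k) g) x"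
    by (rule dir_deriv_cong_open[OF assms(1) Suc.prems Suc.IH])
  then show ?case by simp
qed (use assms(2) in simp)

lemma funpow_D_t:
  assumes "smooth P"
  shows "(D_t ^^ k) P (s, t) = (deriv ^^ k) (\<lambda>t. P (s, t)) t"
  using assms
proof (induction k arbitrary: P)
  case (Suc k)
  have "deriv (\<lambda>t. P (s, t)) = (\<lambda>t. D_t P (s, t))"
  proof (rule ext, rule DERIV_imp_deriv)
    fix t :: real
    have "((\<lambda>t. (s, t)) has_derivative (\<lambda>h. (0, h))) (at t)"
      by (intro has_derivative_Pair has_derivative_const has_derivative_ident)
    from has_derivative_compose[OF this smooth_on_has_derivative[OF Suc.prems UNIV_I]]
    have 1: "((\<lambda>t. P (s, t)) has_derivative (\<lambda>h. dir_deriv (0, h) P (s, t))) (at t)" .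
    have "dir_deriv (0, h) P (s, t) = D_t P (s, t) * h" for h
      using dir_deriv_scaleR[OF Suc.prems, of h "(0, 1)" "(s, t)"] by simp
    then have 2: "(\<lambda>h. dir_deriv (0, h) P (s, t)) = (*) (D_t P (s, t))" by (rule ext)
    show "((\<lambda>t. P (s, t)) has_real_derivative D_t P (s, t)) (at t)"
      using 1 unfolding has_field_derivative_def 2 .
  qed
  then show ?case
    unfolding funpow_Suc_right comp_def using Suc.IH[OF smooth_on_dir_deriv[OF Suc.prems]] by simp
qed simp

section \<open>The integral manifold in coordinates and the function G\<close>

lemma dir_deriv_R5:
  fixes \<alpha> :: "R5 \<Rightarrow> real"
  assumes "\<alpha> differentiable (at w)"
  shows "dir_deriv (a, b, c, d, e) \<alpha> w = a * D_x \<alpha> w + b * D_y \<alpha> w + c * D_z \<alpha> w + d * D_p \<alpha> w + e * D_q \<alpha> w"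
proof -
  note lin = dir_deriv_linear[OF assms]
  have "(a, b, c, d, e) = a *\<^sub>R (1, 0, 0, 0, 0) + (b *\<^sub>R (0, 1, 0, 0, 0) + (c *\<^sub>R (0, 0, 1, 0, 0)
    + (d *\<^sub>R (0, 0, 0, 1, 0) + e *\<^sub>R (0, 0, 0, 0, 1))))" by simp
  then have "dir_deriv (a, b, c, d, e) \<alpha> w = dir_deriv (a *\<^sub>R (1, 0, 0, 0, 0) + (b *\<^sub>R (0, 1, 0, 0, 0) + (c *\<^sub>R (0, 0, 1, 0, 0)
    + (d *\<^sub>R (0, 0, 0, 1, 0) + e *\<^sub>R (0, 0, 0, 0, 1))))) \<alpha> w" by (rule arg_cong[where f = "\<lambda>v. dir_deriv v \<alpha> w"])
  then show ?thesis unfolding linear_add[OF lin] linear_cmul[OF lin] by simp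
qed

lemma DERIV_compose_R5:
  fixes \<alpha> :: "R5 \<Rightarrow> real"
  assumes "\<alpha> differentiable (at (x t, y t, z t, p t, q t))" and
    "(x has_real_derivative x') (at t)" "(y has_real_derivative y') (at t)" "(z has_real_derivative z') (at t)"
    "(p has_real_derivative p') (at t)" "(q has_real_derivative q') (at t)"
  shows "((\<lambda>t. \<alpha> (x t, y t, z t, p t, q t)) has_real_derivative
    (let w = (x t, y t, z t, p t, q t) in x' * D_x \<alpha> w + y' * D_y \<alpha> w + z' * D_z \<alpha> w + p' * D_p \<alpha> w + q' * D_q \<alpha> w)) (at t)"
proof -
  let ?w = "(x t, y t, z t, p t, q t)"
  let ?d = "x' * D_x \<alpha> ?w + y' * D_y \<alpha> ?w + z' * D_z \<alpha> ?w + p' * D_p \<alpha> ?w + q' * D_q \<alpha> ?w"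
  let ?g = "\<lambda>t. (x t, y t, z t, p t, q t)" and ?g' = "\<lambda>h. (x' * h, y' * h, z' * h, p' * h, q' * h)"
  note d = assms(2-)[unfolded has_field_derivative_def]
  have g: "(?g has_derivative ?g') (at t)"
    by (rule has_derivative_Pair[OF d(1) has_derivative_Pair[OF d(2) has_derivative_Pair[OF d(3) has_derivative_Pair[OF d(4) d(5)]]]])
  have 1: "((\<lambda>t. \<alpha> (?g t)) has_derivative (\<lambda>h. dir_deriv (?g' h) \<alpha> ?w)) (at t)"
    by (rule has_derivative_compose[where g = \<alpha> and f = ?g, OF g has_derivative_dir_deriv[OF assms(1)]])
  have 2: "(\<lambda>h. dir_deriv (?g' h) \<alpha> ?w) = (*) ?d"
    by (rule ext, rule trans[OF dir_deriv_R5[OF assms(1)]]) (simp add: algebra_simps)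
  show ?thesis using 1 unfolding has_field_derivative_def Let_def 2 .
qed

lemma Phi1_eqD:
  assumes "Phi1 \<alpha> w = (s, c1, c2, c3, c4)"
  shows "w = (s, c1 - \<alpha> w * s, c2 + c3 * s + c4 * (c1 - \<alpha> w * s), c3, c4)"
  using assms by (cases w) (auto simp: Phi1_def)

text \<open>The involutive condition makes \<open>\<alpha>\<close> constant along the \<open>x\<^sub>0\<close>-curves: its derivative \<open>a'\<close> satisfies
  \<open>a' (1 + x (\<alpha>\<^sub>y + q \<alpha>\<^sub>z)) = 0\<close>.\<close>

lemma alpha_Psi_constant:
  assumes D: "open D" "smooth_on D \<alpha>" "involutive_type D \<alpha>" "generic_type D \<alpha>"
    and K: "open K" "is_interval K" and U: "open U1" and W: "W \<subseteq> D" "diffeo_inverse W (K \<times> U1) (Phi1 \<alpha>) \<Psi>"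
    and c: "(c1, c2, c3, c4) \<in> U1" and x: "x \<in> K" "x' \<in> K"
  shows "\<alpha> (\<Psi> (x, c1, c2, c3, c4)) = \<alpha> (\<Psi> (x', c1, c2, c3, c4))"
proof -
  define w where "w t = \<Psi> (t, c1, c2, c3, c4)" for t
  define a where "a t = \<alpha> (w t)" for t
  have inv: "w t \<in> D" "Phi1 \<alpha> (w t) = (t, c1, c2, c3, c4)" if "t \<in> K" for t
  proof -
    have "(t, c1, c2, c3, c4) \<in> K \<times> U1" using that c by simp
    then show "w t \<in> D" "Phi1 \<alpha> (w t) = (t, c1, c2, c3, c4)"
      using W unfolding diffeo_inverse_def w_def by blast+
  qed
  have w: "w t = (t, c1 - a t * t, c2 + c3 * t + c4 * (c1 - a t * t), c3, c4)" if "t \<in> K" for t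
    using Phi1_eqD[OF inv(2)[OF that]] by (simp add: a_def)
  have aw: "\<alpha> (t, c1 - a t * t, c2 + c3 * t + c4 * (c1 - a t * t), c3, c4) = a t" if "t \<in> K" for t
    unfolding w[OF that, symmetric] by (simp only: a_def)
  have "(a has_real_derivative 0) (at t)" if t: "t \<in> K" for t
  proof -
    have smK: "smooth_on K w"
    proof -
      have "smooth_on K (\<lambda>t. (t, c1, c2, c3, c4))"
        by (intro smooth_on_Pair[OF K(1)] smooth_on_id[OF K(1)] smooth_on_const)
      moreover have "smooth_on (K \<times> U1) \<Psi>" using W(2) unfolding diffeo_inverse_def by blast
      moreover have "(t, c1, c2, c3, c4) \<in> K \<times> U1" if "t \<in> K" for t using that c by blast
      ultimately have "smooth_on K (\<lambda>t. \<Psi> (t, c1, c2, c3, c4))"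
        using smooth_on_compose[where g = \<Psi> and f = "\<lambda>t. (t, c1, c2, c3, c4)", OF K(1) open_Times[OF K(1) U]] by blast
      then show ?thesis by (simp only: w_def[abs_def])
    qed
    have "smooth_on K (\<lambda>t. \<alpha> (w t))"
      by (rule smooth_on_compose[where g = \<alpha> and f = w, OF K(1) D(1) image_subsetI[OF inv(1)] D(2) smK])
    then have "smooth_on K a" by (simp only: a_def[abs_def])
    then have "a differentiable (at t)" using t by (rule smooth_on_differentiable)
    then obtain a' where a': "(a has_real_derivative a') (at t)" using real_differentiable_def by blast
    have diff: "\<alpha> differentiable (at (t, c1 - a t * t, c2 + c3 * t + c4 * (c1 - a t * t), c3, c4))"
      unfolding w[OF t, symmetric] by (rule smooth_on_differentiable[OF D(2) inv(1)[OF t]])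
    \<comment> \<open>With this derivative of y, that of z is c3 + c4 y': the curve is tangent to
      the contact distribution, as p = c3 and q = c4 are constant along it.\<close>
    define y' where "y' = - (a' * t + a t)"
    have dy: "((\<lambda>t. c1 - a t * t) has_real_derivative y') (at t)"
      unfolding y'_def by (auto intro!: derivative_eq_intros a')
    have dz: "((\<lambda>t. c2 + c3 * t + c4 * (c1 - a t * t)) has_real_derivative c3 + c4 * y') (at t)"
      using DERIV_add[OF DERIV_add[OF DERIV_const DERIV_cmult[OF DERIV_ident]] DERIV_cmult[OF dy], of c2 c3 c4] by simp
    have "((\<lambda>t. \<alpha> (t, c1 - a t * t, c2 + c3 * t + c4 * (c1 - a t * t), c3, c4)) has_real_derivative
       1 * D_x \<alpha> (w t) + y' * D_y \<alpha> (w t) + (c3 + c4 * y') * D_z \<alpha> (w t) + 0 * D_p \<alpha> (w t) + 0 * D_q \<alpha> (w t)) (at t)"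
      using DERIV_compose_R5[where x = "\<lambda>t. t" and p = "\<lambda>_. c3" and q = "\<lambda>_. c4", OF diff DERIV_ident dy dz DERIV_const DERIV_const]
      unfolding Let_def w[OF t] .
    then have "(a has_real_derivative
       1 * D_x \<alpha> (w t) + y' * D_y \<alpha> (w t) + (c3 + c4 * y') * D_z \<alpha> (w t) + 0 * D_p \<alpha> (w t) + 0 * D_q \<alpha> (w t)) (at t)"
      by (rule has_field_derivative_transform_within_open[OF _ K(1) t]) (rule aw)
    from DERIV_unique[OF a' this]
    have 1: "a' = D_x \<alpha> (w t) + c3 * D_z \<alpha> (w t) + y' * (D_y \<alpha> (w t) + c4 * D_z \<alpha> (w t))" by (simp add: algebra_simps)
    have 2: "D_x \<alpha> (w t) + c3 * D_z \<alpha> (w t) - a t * (D_y \<alpha> (w t) + c4 * D_z \<alpha> (w t)) = 0"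
      using D(3) inv(1)[OF t] unfolding involutive_type_def Let_def a_def
      by (auto simp: w[OF t] dest!: bspec)
    have 3: "1 + t * (D_y \<alpha> (w t) + c4 * D_z \<alpha> (w t)) \<noteq> 0"
      using D(4) inv(1)[OF t] unfolding generic_type_def Let_def by (auto simp: w[OF t] dest!: bspec)
    define B where "B = D_y \<alpha> (w t) + c4 * D_z \<alpha> (w t)"
    have "a' = a t * B + y' * B" using 1 2 unfolding B_def[symmetric] by linarith
    then have "a' * (1 + t * B) = 0" unfolding y'_def by (simp add: algebra_simps)
    then have "a' = 0" using 3 unfolding B_def by simp
    then show ?thesis using a' by simp
  qed
  then have "\<forall>t\<in>K. (a has_real_derivative 0) (at t within K)" by (blast intro: has_field_derivative_at_within)
  then obtain C where "\<forall>t\<in>K. a t = C"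
    using has_field_derivative_zero_constant[of K a] K(2) by (auto simp: is_interval_convex)
  then show ?thesis using x by (simp add: a_def w_def)
qed

lemma has_derivative_compose_snd:
  fixes f :: "real \<Rightarrow> real"
  assumes "smooth f"
  shows "((\<lambda>w :: real \<times> real. f (snd w)) has_derivative (\<lambda>h. deriv f t0 * snd h)) (at (s0, t0))"
proof -
  have 1: "((\<lambda>w :: real \<times> real. snd w) has_derivative snd) (at (s0, t0))" by (intro has_derivative_snd has_derivative_ident)
  have "(f has_derivative (*) (deriv f t0)) (at (snd (s0, t0)))"
    using smooth_deriv[OF assms, of t0] by (simp add: has_field_derivative_def)
  from has_derivative_compose[OF 1 this] show ?thesis .
qed

text \<open>The first component is s, and the second has derivative -(\<xi>'' + s \<mu>'') in x. If
  this is nonzero, the first two components already have an injective differential.\<close>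

lemma rmap_singular:
  assumes \<xi>: "smooth \<xi>" and \<mu>: "smooth \<mu>" and ev: "\<forall>\<^sub>F w in nhds (s0, t0). f w = rmap \<xi> \<mu> w"
    and sing: "dim (range (frechet_derivative f (at (s0, t0)))) < 2"
  shows "(deriv ^^ 2) \<xi> t0 + s0 * (deriv ^^ 2) \<mu> t0 = 0"
proof (rule ccontr)
  assume h2: "\<not> ?thesis"
  obtain S where S: "open S" "(s0, t0) \<in> S" "\<And>w. w \<in> S \<Longrightarrow> f w = rmap \<xi> \<mu> w" using ev unfolding eventually_nhds by blast
  define D where "D v = dir_deriv v (rmap \<xi> \<mu>) (s0, t0)" for v
  have fD: "frechet_derivative f (at (s0, t0)) = D"
    by (rule ext) (use dir_deriv_cong_open[OF S] in \<open>simp add: D_def dir_deriv_def\<close>)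
  have der: "(rmap \<xi> \<mu> has_derivative D) (at (s0, t0))"
    unfolding D_def by (rule smooth_on_has_derivative[OF smooth_rmap[OF \<xi> \<mu>] UNIV_I])
  have lin: "linear D" using der by (rule has_derivative_linear)
  have 1: "((\<lambda>w. fst (rmap \<xi> \<mu> w)) has_derivative fst) (at (s0, t0))"
    unfolding rmap_def split_def fst_conv by (intro has_derivative_fst has_derivative_ident)
  have 2: "((\<lambda>w. fst (snd (rmap \<xi> \<mu> w))) has_derivative
    (\<lambda>h. - (deriv (deriv \<xi>) t0 * snd h + (s0 * (deriv (deriv \<mu>) t0 * snd h) + fst h * deriv \<mu> t0)))) (at (s0, t0))"
    unfolding rmap_def split_def fst_conv snd_conv
    by (auto intro!: derivative_eq_intros has_derivative_compose_snd smooth_deriv_smooth \<xi> \<mu>)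
  have D1: "fst (D v) = fst v" for v
    using has_derivative_unique[OF has_derivative_fst[OF der] 1] by (rule fun_cong)
  have D2: "fst (snd (D v)) = - (deriv (deriv \<xi>) t0 * snd v + (s0 * (deriv (deriv \<mu>) t0 * snd v) + fst v * deriv \<mu> t0))" for v
    using has_derivative_unique[OF has_derivative_fst[OF has_derivative_snd[OF der]] 2] by (rule fun_cong)
  have "v = 0" if "D v = 0" for v
  proof -
    have f: "fst v = 0" using D1[of v] that by simp
    have "snd v * (deriv (deriv \<xi>) t0 + s0 * deriv (deriv \<mu>) t0) = 0"
      using D2[of v] that f by (simp add: algebra_simps)
    then show ?thesis using h2 f by (simp add: numeral_2_eq_2 prod_eq_iff)
  qed
  then have "inj D" using linear_injective_0[OF lin] by blast
  then have "dim (range D) = dim (UNIV :: (real \<times> real) set)"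
    by (intro dim_image_eq[OF lin]) (simp add: inj_on_subset)
  then show False using sing unfolding fD by (simp add: dim_UNIV)
qed

text \<open>G + \<xi>'' is the product of E and \<xi>'' + s \<mu>''. The second factor vanishes at
  the base point, so the s-derivative meets only its own s-derivative \<mu>''. As long as its lower
  t-derivatives vanish too, Leibniz leaves E times the next one.\<close>

lemma product_derivative_conditions:
  assumes \<xi>: "smooth \<xi>" and \<mu>: "smooth \<mu>" and E: "smooth E" and E0: "E (s0, t0) \<noteq> 0"
    and h_def: "\<And>k. h k = (deriv ^^ k) \<xi> t0 + s0 * (deriv ^^ k) \<mu> t0" and h2: "h 2 = 0"
    and S: "open S" "(s0, t0) \<in> S" and G: "\<And>s t. (s, t) \<in> S \<Longrightarrow>
      G (s, t) = E (s, t) * ((deriv ^^ 2) \<xi> t + s * (deriv ^^ 2) \<mu> t) - (deriv ^^ 2) \<xi> t"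
  shows "D_s G (s0, t0) = E (s0, t0) * (deriv ^^ 2) \<mu> t0"
    and "(\<And>j. j < k \<Longrightarrow> h (j + 2) = 0) \<Longrightarrow> (deriv ^^ (k + 2)) \<xi> t0 + (D_t ^^ k) G (s0, t0) = E (s0, t0) * h (k + 2)"
proof -
  define x2 where "x2 = (deriv ^^ 2) \<xi>"
  define m2 where "m2 = (deriv ^^ 2) \<mu>"
  have x2: "smooth x2" and m2: "smooth m2"
    unfolding x2_def m2_def numeral_2_eq_2 by (simp_all add: smooth_deriv_smooth \<xi> \<mu>)
  have k2: "(deriv ^^ k) x2 = (deriv ^^ (k + 2)) \<xi>" "(deriv ^^ k) m2 = (deriv ^^ (k + 2)) \<mu>" for k
    unfolding x2_def m2_def by (simp_all only: funpow_add comp_def)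
  define P where "P w = E w * (x2 (snd w) + fst w * m2 (snd w)) - x2 (snd w)" for w
  have smx: "smooth (\<lambda>w :: real \<times> real. x2 (snd w))" and smm: "smooth (\<lambda>w :: real \<times> real. m2 (snd w))"
    by (intro smooth_on_compose_UNIV[OF open_UNIV x2] smooth_on_compose_UNIV[OF open_UNIV m2] smooth_on_snd[OF open_UNIV] smooth_on_id[OF open_UNIV])+
  have smg: "smooth (\<lambda>w :: real \<times> real. x2 (snd w) + fst w * m2 (snd w))"
    by (intro smooth_on_add[OF open_UNIV] smooth_on_mult[OF open_UNIV] smx smm smooth_on_fst[OF open_UNIV] smooth_on_id[OF open_UNIV])
  have smP: "smooth P" unfolding P_def[abs_def]
    by (intro smooth_on_diff[OF open_UNIV] smooth_on_mult[OF open_UNIV] E smg smx)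
  have GP: "G w = P w" if "w \<in> S" for w
    using G[of "fst w" "snd w"] that by (simp add: P_def x2_def m2_def)
  have z: "x2 t0 + s0 * m2 t0 = 0" using h2 by (simp add: h_def x2_def m2_def)
  have dg: "((\<lambda>w. x2 (snd w) + fst w * m2 (snd w)) has_derivative
    (\<lambda>h. deriv x2 t0 * snd h + (s0 * (deriv m2 t0 * snd h) + fst h * m2 t0))) (at (s0, t0))"
    by (auto intro!: derivative_eq_intros has_derivative_compose_snd x2 m2)
  have "((\<lambda>w. (x2 (snd w) + fst w * m2 (snd w)) * E w - x2 (snd w)) has_derivative
    (\<lambda>h. (deriv x2 t0 * snd h + (s0 * (deriv m2 t0 * snd h) + fst h * m2 t0)) * E (s0, t0) - deriv x2 t0 * snd h)) (at (s0, t0))"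
    by (rule has_derivative_diff[OF has_derivative_mult_zero[OF dg smooth_differentiable[OF E]] has_derivative_compose_snd[OF x2]]) (simp add: z)
  from dir_deriv_eq[OF this, of "(1, 0)"] have "D_s P (s0, t0) = m2 t0 * E (s0, t0)"
    unfolding P_def[abs_def] by (simp add: mult.commute)
  then show "D_s G (s0, t0) = E (s0, t0) * (deriv ^^ 2) \<mu> t0"
    using dir_deriv_cong_open[OF S GP] by (simp add: m2_def)
  assume hz: "\<And>j. j < k \<Longrightarrow> h (j + 2) = 0"
  define e where "e t = E (s0, t)" for t
  define g where "g t = x2 t + s0 * m2 t" for t
  have sme: "smooth e" unfolding e_def[abs_def] by (rule smooth_on_compose_UNIV[OF open_UNIV E]) (intro smooth_UNIV_intros)
  have smg': "smooth g" unfolding g_def[abs_def] by (intro smooth_UNIV_intros x2 m2)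
  have g: "(deriv ^^ j) g t0 = h (j + 2)" for j
    unfolding g_def[abs_def] funpow_deriv_add[OF x2 m2] k2 h_def ..
  have "(D_t ^^ k) G (s0, t0) = (D_t ^^ k) P (s0, t0)" by (rule funpow_dir_deriv_cong[OF S(1) GP S(2)])
  also have "\<dots> = (deriv ^^ k) (\<lambda>t. P (s0, t)) t0" by (rule funpow_D_t[OF smP])
  also have "(\<lambda>t. P (s0, t)) = (\<lambda>t. e t * g t + (-1) * x2 t)" by (simp add: P_def e_def g_def)
  also have "(deriv ^^ k) \<dots> t0 = (deriv ^^ k) (\<lambda>t. e t * g t) t0 + (-1) * (deriv ^^ k) x2 t0"
    by (rule fun_cong[OF funpow_deriv_add]) (intro smooth_UNIV_intros sme smg' x2)+
  also have "(deriv ^^ k) (\<lambda>t. e t * g t) t0 = e t0 * (deriv ^^ k) g t0"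
    by (rule funpow_deriv_mult[OF sme smg']) (simp only: g hz)
  finally show "(deriv ^^ (k + 2)) \<xi> t0 + (D_t ^^ k) G (s0, t0) = E (s0, t0) * h (k + 2)"
    unfolding g k2 by (simp add: e_def)
qed

theorem theorem6p25:
  fixes \<alpha> :: "R5 \<Rightarrow> real" and D W :: "R5 set" and \<Psi> :: "R5 \<Rightarrow> R5"
    and K I1 J1 :: "real set" and U1 :: "R4 set"
    and \<xi> \<mu> :: "real \<Rightarrow> real" and G :: "real \<times> real \<Rightarrow> real" and s0 t0 :: real
  assumes "open D" and "smooth_on D \<alpha>"
    and "involutive_type D \<alpha>" and "generic_type D \<alpha>"
    and "open K" and "is_interval K" and "open U1"
    and "W \<subseteq> D" and "diffeo_inverse W (K \<times> U1) (Phi1 \<alpha>) \<Psi>"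
    and "open I1" and "is_interval I1" and "open J1" and "is_interval J1"
    and "smooth_on J1 \<xi>" and "smooth_on J1 \<mu>"
    and "\<forall>s\<in>I1. \<forall>t\<in>J1. (s, - deriv \<xi> t, \<xi> t, \<mu> t, t) \<in> K \<times> U1"
    and "\<forall>t\<in>J1. (\<mu> has_real_derivative alpha_bar \<alpha> \<Psi> K (- deriv \<xi> t, \<xi> t, \<mu> t, t)) (at t)"
    and "G = (\<lambda>(x, y, z, p, q). let w = (x, y, z, p, q) in x * (D_q \<alpha> w + \<alpha> w * D_p \<alpha> w))
             \<circ> Theta1 \<Psi> \<xi> \<mu>"
    and "(s0, t0) \<in> singular_points (I1 \<times> J1) (F1 \<Psi> \<xi> \<mu>)"
    and "D_s G (s0, t0) \<noteq> 0"
  shows "(is_cuspidal_edge (F1 \<Psi> \<xi> \<mu>) (s0, t0) \<longleftrightarrow>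
           (deriv ^^ 3) \<xi> t0 + D_t G (s0, t0) \<noteq> 0) \<and>
         (is_swallowtail (F1 \<Psi> \<xi> \<mu>) (s0, t0) \<longleftrightarrow>
           (deriv ^^ 3) \<xi> t0 + D_t G (s0, t0) = 0 \<and>
           (deriv ^^ 4) \<xi> t0 + (D_t ^^ 2) G (s0, t0) \<noteq> 0) \<and>
         (is_butterfly (F1 \<Psi> \<xi> \<mu>) (s0, t0) \<longleftrightarrow>
           (deriv ^^ 3) \<xi> t0 + D_t G (s0, t0) = 0 \<and>
           (deriv ^^ 4) \<xi> t0 + (D_t ^^ 2) G (s0, t0) = 0 \<and>
           (deriv ^^ 5) \<xi> t0 + (D_t ^^ 3) G (s0, t0) \<noteq> 0)"
proof -
  note \<alpha> = assms(1-4) and K = assms(5,6) and U = assms(7) and W = assms(8,9) and I1 = assms(10) and J1 = assms(12)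
    and \<xi>J = assms(14) and \<mu>J = assms(15) and sing = assms(19) and Gs = assms(20)
  have V: "(s, - deriv \<xi> t, \<xi> t, \<mu> t, t) \<in> K \<times> U1" if "s \<in> I1" "t \<in> J1" for s t
    using assms(16) that by blast
  have st0: "s0 \<in> I1" "t0 \<in> J1" and dim: "dim (range (frechet_derivative (F1 \<Psi> \<xi> \<mu>) (at (s0, t0)))) < 2"
    using sing by (auto simp: singular_points_def)
  define \<Theta> where "\<Theta> s t = \<Psi> (s, - deriv \<xi> t, \<xi> t, \<mu> t, t)" for s t
  have \<Theta>D: "\<Theta> s t \<in> D" and \<Theta>P: "Phi1 \<alpha> (\<Theta> s t) = (s, - deriv \<xi> t, \<xi> t, \<mu> t, t)" if "s \<in> I1" "t \<in> J1" for s t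
    using V[OF that] W unfolding diffeo_inverse_def \<Theta>_def by blast+
  have \<alpha>\<Theta>: "\<alpha> (\<Theta> s t) = deriv \<mu> t" if st: "s \<in> I1" "t \<in> J1" for s t
  proof -
    have s: "s \<in> K" and u: "(- deriv \<xi> t, \<xi> t, \<mu> t, t) \<in> U1" using V[OF st] by auto
    have "\<alpha> (\<Psi> (x, - deriv \<xi> t, \<xi> t, \<mu> t, t)) = \<alpha> (\<Theta> s t)" if "x \<in> K" for x
      unfolding \<Theta>_def by (rule alpha_Psi_constant[OF \<alpha> K U W u that s])
    \<comment> \<open>Independence of the first coordinate shows that this common value exists; s
      \<in> K shows that it is unique.\<close>
    then have "alpha_bar \<alpha> \<Psi> K (- deriv \<xi> t, \<xi> t, \<mu> t, t) = \<alpha> (\<Theta> s t)"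
      unfolding alpha_bar_def prod.case using s by (intro the_equality) auto
    then show ?thesis using assms(17) st(2) DERIV_imp_deriv by metis
  qed
  have \<Theta>: "\<Theta> s t = (s, - (deriv \<xi> t + s * deriv \<mu> t), \<xi> t + s * \<mu> t - t * (deriv \<xi> t + s * deriv \<mu> t), \<mu> t, t)"
    if "s \<in> I1" "t \<in> J1" for s t
    using Phi1_eqD[OF \<Theta>P[OF that]] unfolding \<alpha>\<Theta>[OF that] by (simp add: algebra_simps)
  \<comment> \<open>All quantities in the claim depend on germs at the base point, so \<xi> and
    \<mu> are replaced by globally smooth functions equal to them near t0.\<close>
  obtain \<Xi> e1 where \<Xi>: "smooth \<Xi>" "e1 > 0" "\<And>t. dist t t0 < e1 \<Longrightarrow> t \<in> J1 \<and> \<Xi> t = \<xi> t"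
    using smooth_extension[OF J1 st0(2) \<xi>J] by blast
  obtain M e2 where M: "smooth M" "e2 > 0" "\<And>t. dist t t0 < e2 \<Longrightarrow> t \<in> J1 \<and> M t = \<mu> t"
    using smooth_extension[OF J1 st0(2) \<mu>J] by blast
  define N where "N = ball t0 (min e1 e2)"
  have N: "open N" "t0 \<in> N" "N \<subseteq> J1" using \<Xi>(2,3) M(2,3) by (auto simp: N_def dist_commute)
  have dN: "(deriv ^^ k) \<xi> t = (deriv ^^ k) \<Xi> t" "(deriv ^^ k) \<mu> t = (deriv ^^ k) M t" if "t \<in> N" for t k
    by (rule funpow_deriv_cong[OF N(1) _ that]; use \<Xi>(3) M(3) in \<open>simp add: N_def dist_commute\<close>)+
  have N0: "\<xi> t = \<Xi> t" "\<mu> t = M t" "deriv \<xi> t = deriv \<Xi> t" "deriv \<mu> t = deriv M t" if "t \<in> N" for t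
    using dN[OF that, of 0] dN[OF that, of 1] by simp_all
  define S where "S = I1 \<times> N"
  have S: "open S" "(s0, t0) \<in> S" using I1 N st0 by (auto simp: S_def intro: open_Times)
  \<comment> \<open>The parametrization of the integral manifold written through h = \<xi> + s
    \<mu>: (x, y, z, p, q) = (s, -h_t, h - t h_t, \<mu>, t).\<close>
  define T where "T w = (fst w, - (deriv \<Xi> (snd w) + fst w * deriv M (snd w)),
    \<Xi> (snd w) + fst w * M (snd w) - snd w * (deriv \<Xi> (snd w) + fst w * deriv M (snd w)), M (snd w), snd w)" for w :: "real \<times> real"
  have \<Theta>T: "\<Theta> s t = T (s, t)" and TD: "T (s, t) \<in> D" and \<alpha>T: "\<alpha> (T (s, t)) = deriv M t" if "(s, t) \<in> S" for s t
  proof -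
    have st: "s \<in> I1" "t \<in> J1" and t: "t \<in> N" using that N by (auto simp: S_def)
    show *: "\<Theta> s t = T (s, t)" unfolding \<Theta>[OF st] T_def fst_conv snd_conv N0[OF t] ..
    show "T (s, t) \<in> D" using \<Theta>D[OF st] unfolding * .
    show "\<alpha> (T (s, t)) = deriv M t" using \<alpha>\<Theta>[OF st] unfolding * N0[OF t] .
  qed
  have ev: "\<forall>\<^sub>F w in nhds (s0, t0). F1 \<Psi> \<xi> \<mu> w = rmap \<Xi> M w"
  proof -
    have "F1 \<Psi> \<xi> \<mu> (s, t) = rmap \<Xi> M (s, t)" if "(s, t) \<in> S" for s t
      using \<Theta>T[OF that] unfolding \<Theta>_def by (simp add: F1_def rmap_def T_def Let_def)
    then show ?thesis unfolding eventually_nhds using S by (intro exI[of _ S]) auto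
  qed
  define h where "h k = (deriv ^^ k) \<Xi> t0 + s0 * (deriv ^^ k) M t0" for k
  have h2: "h 2 = 0" unfolding h_def by (rule rmap_singular[OF \<Xi>(1) M(1) ev dim])
  have smT: "smooth T"
    unfolding T_def[abs_def]
    by (intro smooth_on_Pair[OF open_UNIV] smooth_on_minus[OF open_UNIV] smooth_on_add[OF open_UNIV] smooth_on_diff[OF open_UNIV]
      smooth_on_mult[OF open_UNIV] smooth_on_compose_UNIV[OF open_UNIV \<Xi>(1)] smooth_on_compose_UNIV[OF open_UNIV M(1)]
      smooth_on_compose_UNIV[OF open_UNIV smooth_deriv_smooth[OF \<Xi>(1)]]
      smooth_on_compose_UNIV[OF open_UNIV smooth_deriv_smooth[OF M(1)]]
      smooth_on_fst[OF open_UNIV] smooth_on_snd[OF open_UNIV] smooth_on_id[OF open_UNIV])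
  define E where "E w = 1 + fst w * (D_y \<alpha> (T w) + snd w * D_z \<alpha> (T w))" for w
  have "smooth_on S (\<lambda>w. dir_deriv v \<alpha> (T w))" for v
    by (rule smooth_on_compose[OF S(1) \<alpha>(1) _ smooth_on_dir_deriv[OF \<alpha>(2)] smooth_on_subset[OF smT]]) (use TD in auto)
  then have smE: "smooth_on S E"
    unfolding E_def[abs_def]
    by (intro smooth_on_add[OF S(1)] smooth_on_mult[OF S(1)] smooth_on_const smooth_on_fst[OF S(1)] smooth_on_snd[OF S(1)] smooth_on_id[OF S(1)])
  obtain E' e where E': "smooth E'" "e > 0" "\<And>w. dist w (s0, t0) < e \<Longrightarrow> w \<in> S \<and> E' w = E w"
    using smooth_extension[OF S smE] by blast
  have E0: "E' (s0, t0) \<noteq> 0"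
  proof -
    have "E (s0, t0) \<noteq> 0"
      using \<alpha>(4) TD[OF S(2)] unfolding generic_type_def E_def Let_def by (auto simp: T_def dest!: bspec)
    then show ?thesis using E'(2,3) by simp
  qed
  have GE: "G (s, t) = E (s, t) * ((deriv ^^ 2) \<Xi> t + s * (deriv ^^ 2) M t) - (deriv ^^ 2) \<Xi> t" if st: "(s, t) \<in> S" for s t
  proof -
    define y where "y t = - (deriv \<Xi> t + s * deriv M t)" for t
    define z where "z t = \<Xi> t + s * M t + t * y t" for t
    have T: "T (s, t) = (s, y t, z t, M t, t)" for t unfolding T_def y_def z_def by (simp add: algebra_simps)
    define y' where "y' = - (deriv (deriv \<Xi>) t + s * deriv (deriv M) t)"
    note d = smooth_deriv[OF \<Xi>(1)] smooth_deriv[OF M(1)] smooth_deriv[OF smooth_deriv_smooth[OF \<Xi>(1)]]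
      smooth_deriv[OF smooth_deriv_smooth[OF M(1)]]
    have dy: "(y has_real_derivative y') (at t)"
      unfolding y_def[abs_def] y'_def by (auto intro!: derivative_eq_intros d)
    have dz: "(z has_real_derivative t * y') (at t)"
      unfolding z_def[abs_def]
      using DERIV_add[OF DERIV_add[OF d(1) DERIV_cmult[OF d(2)]] DERIV_mult[OF DERIV_ident dy], of s]
      by (simp add: y_def mult.commute)
    have diff: "\<alpha> differentiable (at (s, y t, z t, M t, t))"
      using smooth_on_differentiable[OF \<alpha>(2) TD[OF st]] unfolding T .
    have 1: "((\<lambda>t. \<alpha> (T (s, t))) has_real_derivative 0 * D_x \<alpha> (T (s, t)) + y' * D_y \<alpha> (T (s, t)) + (t * y') * D_z \<alpha> (T (s, t))
       + deriv M t * D_p \<alpha> (T (s, t)) + 1 * D_q \<alpha> (T (s, t))) (at t)"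
      using DERIV_compose_R5[where x = "\<lambda>_. s" and q = "\<lambda>t. t", OF diff DERIV_const dy dz d(2) DERIV_ident]
      unfolding Let_def T .
    have "t \<in> N" using st by (simp add: S_def)
    \<comment> \<open>Differentiates \<alpha> (T (s, t)) = M'(t) in t. Since z_t = t y_t and q = t,
      the derivative y_t multiplies \<alpha>_y + q \<alpha>_z, and M' multiplies \<alpha>_p in the
      role of \<alpha>.\<close>
    have "(deriv M has_real_derivative 0 * D_x \<alpha> (T (s, t)) + y' * D_y \<alpha> (T (s, t)) + (t * y') * D_z \<alpha> (T (s, t))
       + deriv M t * D_p \<alpha> (T (s, t)) + 1 * D_q \<alpha> (T (s, t))) (at t)"
      by (rule has_field_derivative_transform_within_open[OF 1 N(1) \<open>t \<in> N\<close>]) (rule \<alpha>T, use st in \<open>simp add: S_def\<close>)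
    from DERIV_unique[OF d(4) this]
    have 2: "D_q \<alpha> (T (s, t)) + deriv M t * D_p \<alpha> (T (s, t)) = deriv (deriv M) t - y' * (D_y \<alpha> (T (s, t)) + t * D_z \<alpha> (T (s, t)))"
      by (simp add: algebra_simps)
    have "G (s, t) = s * (D_q \<alpha> (T (s, t)) + \<alpha> (T (s, t)) * D_p \<alpha> (T (s, t)))"
    proof -
      have "Theta1 \<Psi> \<xi> \<mu> (s, t) = T (s, t)" using \<Theta>T[OF st] by (simp add: Theta1_def \<Theta>_def)
      then show ?thesis unfolding assms(18) comp_def by (simp add: T Let_def)
    qed
    also have "\<dots> = s * (deriv (deriv M) t - y' * (D_y \<alpha> (T (s, t)) + t * D_z \<alpha> (T (s, t))))"
      unfolding \<alpha>T[OF st] 2 ..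
    also have "\<dots> = E (s, t) * (- y') - deriv (deriv \<Xi>) t" by (simp add: E_def y'_def algebra_simps)
    finally show ?thesis by (simp add: y'_def numeral_2_eq_2)
  qed
  define S' where "S' = ball (s0, t0) e"
  have S': "open S'" "(s0, t0) \<in> S'" using E'(2) by (auto simp: S'_def)
  have GE': "G (s, t) = E' (s, t) * ((deriv ^^ 2) \<Xi> t + s * (deriv ^^ 2) M t) - (deriv ^^ 2) \<Xi> t" if "(s, t) \<in> S'" for s t
    using GE[of s t] E'(3)[of "(s, t)"] that by (simp add: S'_def dist_commute)
  note pdc = product_derivative_conditions[where G = G, OF \<Xi>(1) M(1) E'(1) E0 h_def h2 S']
  have "D_s G (s0, t0) = E' (s0, t0) * (deriv ^^ 2) M t0" by (rule pdc(1)) (erule GE')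
  then have "(deriv ^^ 2) M t0 \<noteq> 0" using Gs by auto
  from rmap_classification[OF \<Xi>(1) M(1) ev h_def h2 this]
  have cl: "(is_cuspidal_edge (F1 \<Psi> \<xi> \<mu>) (s0, t0) \<longleftrightarrow> h 3 \<noteq> 0) \<and>
    (is_swallowtail (F1 \<Psi> \<xi> \<mu>) (s0, t0) \<longleftrightarrow> h 3 = 0 \<and> h 4 \<noteq> 0) \<and>
    (is_butterfly (F1 \<Psi> \<xi> \<mu>) (s0, t0) \<longleftrightarrow> h 3 = 0 \<and> h 4 = 0 \<and> h 5 \<noteq> 0)" .
  have cond: "(deriv ^^ (k + 2)) \<Xi> t0 + (D_t ^^ k) G (s0, t0) = E' (s0, t0) * h (k + 2)"
    if "\<And>j. j < k \<Longrightarrow> h (j + 2) = 0" for k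
    by (rule pdc(2)) (erule GE', erule that)
  have 3: "(deriv ^^ 3) \<xi> t0 + D_t G (s0, t0) = E' (s0, t0) * h 3"
  proof -
    have "h (j + 2) = 0" if "j < 1" for j
    proof -
      have "j + 2 = 2" using that by simp
      then show ?thesis using h2 by (simp only:)
    qed
    from cond[of 1, OF this] show ?thesis unfolding dN[OF N(2)] by (simp add: numeral_3_eq_3)
  qed
  \<comment> \<open>The identity holds under \<open>h 3 = 0\<close>; parts (2) and (3) evaluate it
    only together with their first condition, which by the preceding identity says exactly
    this.\<close>
  have 4: "(deriv ^^ 4) \<xi> t0 + (D_t ^^ 2) G (s0, t0) = E' (s0, t0) * h 4" if "h 3 = 0"
  proof -
    have "h (j + 2) = 0" if "j < 2" for j
    proof -
      have "j + 2 = 2 \<or> j + 2 = 3" using that by auto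
      then show ?thesis using h2 \<open>h 3 = 0\<close> by (elim disjE) (simp_all only:)
    qed
    from cond[of 2, OF this] show ?thesis unfolding dN[OF N(2)] by simp
  qed
  have 5: "(deriv ^^ 5) \<xi> t0 + (D_t ^^ 3) G (s0, t0) = E' (s0, t0) * h 5" if "h 3 = 0" "h 4 = 0"
  proof -
    have "h (j + 2) = 0" if "j < 3" for j
    proof -
      have "j + 2 = 2 \<or> j + 2 = 3 \<or> j + 2 = 4" using that by auto
      then show ?thesis using h2 \<open>h 3 = 0\<close> \<open>h 4 = 0\<close> by (elim disjE) (simp_all only:)
    qed
    from cond[of 3, OF this] show ?thesis unfolding dN[OF N(2)] by simp
  qed
  show ?thesis using cl 3 4 5 E0 by auto
qed

end
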